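(* Fix $n\ge 2$. Let $\psi:M\to\mathbb{S}^{2n-1}\subset\mathbb{C}^n$ be a minimal Legendrian immersion of an $(n-1)$-dimensional manifold $M$, and let $\gamma=r e^{i\phi}:I\to\mathbb{C}^*$ be a smooth regular curve parameterized by arclength $s$, with $\gamma'=e^{i\theta}$, satisfying $$r'(s)=\cos(\theta-\phi),\qquad \theta'(s)-\phi'(s)=\left(\frac r2-\frac nr\right)\sin(\theta-\phi).$$ Let $\Sigma$ be the image of the (Lagrangian, self-shrinking) immersion $\gamma*\psi:I\times M\to\mathbb{C}^n$, $(s,\sigma)\mapsto\gamma(s)\psi(\sigma)$. If $\Sigma$ is closed, then $\Sigma$ is $F$-unstable.
   Context: "$\Sigma$ closed" means that the curve $\gamma$ is closed and $M$ is closed (compact without boundary); $\Sigma$ is regarded as an immersed $n$-dimensional submanifold of $\mathbb{C}^n=\mathbb{R}^{2n}$. On $\mathbb{C}^n$ the metric is $\langle\cdot,\cdot\rangle=\sum(dx_i^2+dy_i^2)$, $J$ is multiplication by $i$, and $\omega(\cdot,\cdot)=\langle J\cdot,\cdot\rangle$. An immersion $\psi$ of an $(n-1)$-manifold into $\mathbb{S}^{2n-1}$ is Legendrian if the 1-form $\alpha(\cdot)=\omega(X^M,\cdot)$, $X^M$ the position vector, vanishes on tangent vectors of $\psi(M)$; minimal means zero mean curvature in $\mathbb{S}^{2n-1}$. $\theta$ is the angle between the tangent of $\gamma$ and the $x$-axis. For $\gamma,\psi$ satisfying the stated equations, $\gamma*\psi$ is a Lagrangian immersion with $H=-\frac12X^\perp$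 (self-shrinker), where $X$ is the position vector and $H$ the mean curvature vector, the trace of $A_{ij}=(\overline\nabla_{e_i}e_j)^\perp$. The quantity $E=r^ne^{-r^2/4}\sin(\theta-\phi)$ is constant along $\gamma$, with $0<E\le E_{max}=(2n/e)^{n/2}$. The functional $F$ is $F(\Sigma,x,t)=(4\pi t)^{-n/2}\int_\Sigma e^{-\frac{|X-x|^2}{4t}}d\mu$ for $x\in\mathbb{R}^{2n}$, $t>0$. A self-shrinker $\Sigma$ (for which $(\Sigma,0,1)$ is a critical point of $F$) is $F$-stable if for every compactly supported smooth normal variation $\Sigma_s$ with $\Sigma_0=\Sigma$ there exist smooth variations $x_s$ of $x_0=0$ and $t_s$ of $t_0=1$ such that $\frac{\partial^2}{\partial s^2}\big|_{s=0}F(\Sigma_s,x_s,t_s)\ge 0$; it is $F$-unstable if it is not $F$-stable. *)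

theory Defs
  imports "HOL-Analysis.Analysis" "HOL-Combinatorics.Permutations"
begin

text \<open>Meant for open \<open>U\<close> only.\<close>

primrec Ck_on ::
  "nat \<Rightarrow> 'e::euclidean_space set \<Rightarrow> ('e \<Rightarrow> 'v::real_normed_vector) \<Rightarrow> bool" where
  "Ck_on 0 U f \<longleftrightarrow> continuous_on U f"
| "Ck_on (Suc k) U f \<longleftrightarrow>
     (\<forall>x\<in>U. f differentiable (at x)) \<and>
     (\<forall>v. Ck_on k U (\<lambda>x. frechet_derivative f (at x) v))"

definition smooth_on :: "'e::euclidean_space set \<Rightarrow> ('e \<Rightarrow> 'v::real_normed_vector) \<Rightarrow> bool" where
  "smooth_on U f \<longleftrightarrow> (\<forall>k. Ck_on k U f)"

text \<open>
  A manifold modelled on \<open>'e\<close> is given by a family of local parametrizations \<open>(V, p)\<close>, where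
  \<open>V\<close> is open in \<open>'e\<close> and \<open>p\<close> is the inverse of a chart.  The underlying space is the union of
  the images \<open>p ` V\<close>, with the subspace topology inherited from the type \<open>'a\<close>.  It is Hausdorff
  and second countable as soon as \<open>'a\<close> is.
\<close>

type_synonym ('a, 'e) atlas = "('e set \<times> ('e \<Rightarrow> 'a)) set"

definition points :: "('a, 'e) atlas \<Rightarrow> 'a set" where
  "points A = (\<Union>(V, p)\<in>A. p ` V)"

definition smooth_atlas :: "('a::topological_space, 'e::euclidean_space) atlas \<Rightarrow> bool" where
  "smooth_atlas A \<longleftrightarrow>
     (\<forall>(V, p)\<in>A. open V \<and> openin (top_of_set (points A)) (p ` V) \<and>
        (\<exists>q. homeomorphism V (p ` V) p q)) \<and>
     (\<forall>(V, p)\<in>A. \<forall>(W, q)\<in>A. smooth_on (V \<inter> p -` (q ` W)) (inv_into W q \<circ> p))"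

definition closed_manifold ::
  "('a::{t2_space,second_countable_topology}, 'e::euclidean_space) atlas \<Rightarrow> bool" where
  "closed_manifold A \<longleftrightarrow> smooth_atlas A \<and> points A \<noteq> {} \<and> compact (points A)"

definition prod_atlas :: "('a, 'e) atlas \<Rightarrow> ('b, 'f) atlas \<Rightarrow> ('a \<times> 'b, 'e \<times> 'f) atlas" where
  "prod_atlas A B = {(V \<times> W, map_prod p q) | V p W q. (V, p) \<in> A \<and> (W, q) \<in> B}"

definition interval_atlas :: "real \<Rightarrow> (real, real) atlas" where
  "interval_atlas \<epsilon> = {({-\<epsilon><..<\<epsilon>}, id)}"

definition circle_atlas :: "(complex, real) atlas" where
  "circle_atlas = {({a<..<a + 2 * pi}, cis) | a. True}"

definition smooth_map ::
  "('a, 'e::euclidean_space) atlas \<Rightarrow> ('a \<Rightarrow> 'v::real_normed_vector) \<Rightarrow> bool" where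
  "smooth_map A f \<longleftrightarrow> (\<forall>(V, p)\<in>A. smooth_on V (f \<circ> p))"

text \<open>
  Below, \<open>u\<close> stands for a locally parametrized immersion, i.e. the composition of an immersion
  with a local parametrization of its domain.
\<close>

abbreviation diff :: "('e::euclidean_space \<Rightarrow> 'v::real_normed_vector) \<Rightarrow> 'e \<Rightarrow> 'e \<Rightarrow> 'v" where
  "diff u y \<equiv> frechet_derivative u (at y)"

definition tangent_space ::
  "('e::euclidean_space \<Rightarrow> 'v::euclidean_space) \<Rightarrow> 'e \<Rightarrow> 'v set" where
  "tangent_space u y = range (diff u y)"

definition immersion ::
  "('a, 'e::euclidean_space) atlas \<Rightarrow> ('a \<Rightarrow> 'v::euclidean_space) \<Rightarrow> bool" where
  "immersion A f \<longleftrightarrow> smooth_map A f \<and> (\<forall>(V, p)\<in>A. \<forall>y\<in>V. inj (diff (f \<circ> p) y))"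

text \<open>The determinant of the matrix \<open>g\<^sub>i\<^sub>j = \<langle>\<partial>\<^sub>i u, \<partial>\<^sub>j u\<rangle>\<close>, by the Leibniz formula.\<close>

definition gram_det ::
  "('e::euclidean_space \<Rightarrow> 'v::euclidean_space) \<Rightarrow> 'e \<Rightarrow> real" where
  "gram_det u y =
     (\<Sum>\<pi> | \<pi> permutes Basis.
        of_int (sign \<pi>) * (\<Prod>b\<in>Basis. diff u y b \<bullet> diff u y (\<pi> b)))"

text \<open>
  The Riemannian measure of the metric induced by \<open>f\<close>, determined by its local expression
  \<open>sqrt (det g) dy\<close>.  It lives on the domain of \<open>f\<close>, so that multiplicities are counted.
\<close>

definition volume_measure ::
  "('a::{t2_space,second_countable_topology}, 'e::euclidean_space) atlas
     \<Rightarrow> ('a \<Rightarrow> 'v::euclidean_space) \<Rightarrow> 'a measure" where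
  "volume_measure A f =
     (THE \<mu>. sets \<mu> = sets (restrict_space borel (points A)) \<and>
        (\<forall>(V, p)\<in>A. \<forall>B\<in>sets borel. B \<subseteq> V \<longrightarrow>
           emeasure \<mu> (p ` B) = (\<integral>\<^sup>+y\<in>B. ennreal (sqrt (gram_det (f \<circ> p) y)) \<partial>lborel)))"

definition normal_part :: "'v::euclidean_space set \<Rightarrow> 'v \<Rightarrow> 'v" where
  "normal_part T v = (THE w. w \<in> orthogonal_comp T \<and> v - w \<in> T)"

definition second_diff ::
  "('e::euclidean_space \<Rightarrow> 'v::euclidean_space) \<Rightarrow> 'e \<Rightarrow> 'e \<Rightarrow> 'e \<Rightarrow> 'v" where
  "second_diff u y v w = diff (\<lambda>z. diff u z w) y v"

text \<open>The operator \<open>G\<close> with \<open>\<langle>G v, w\<rangle> = g(v, w)\<close>.\<close>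

definition metric_operator ::
  "('e::euclidean_space \<Rightarrow> 'v::euclidean_space) \<Rightarrow> 'e \<Rightarrow> 'e \<Rightarrow> 'e" where
  "metric_operator u y = adjoint (diff u y) \<circ> diff u y"

text \<open>
  For \<open>u\<close> with values in the unit sphere, the second fundamental form in the sphere at \<open>y\<close> is the
  part of \<open>\<partial>\<^sub>i\<partial>\<^sub>j u\<close> that is orthogonal to the tangent space of \<open>u\<close> and tangent to the sphere,
  i.e. orthogonal to \<open>u y\<close>.  The mean curvature vector in the sphere is its trace
  \<open>\<Sum> g\<^sup>i\<^sup>j A\<^sub>i\<^sub>j\<close>, and \<open>G\<^sup>-\<^sup>1 b\<^sub>j = \<Sum> g\<^sup>i\<^sup>j b\<^sub>i\<close>.
\<close>

definition second_fundamental_form_sphere ::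
  "('e::euclidean_space \<Rightarrow> 'v::euclidean_space) \<Rightarrow> 'e \<Rightarrow> 'e \<Rightarrow> 'e \<Rightarrow> 'v" where
  "second_fundamental_form_sphere u y v w =
     normal_part (span (insert (u y) (tangent_space u y))) (second_diff u y v w)"

definition mean_curvature_sphere ::
  "('e::euclidean_space \<Rightarrow> 'v::euclidean_space) \<Rightarrow> 'e \<Rightarrow> 'v" where
  "mean_curvature_sphere u y =
     (\<Sum>b\<in>Basis. second_fundamental_form_sphere u y (inv (metric_operator u y) b) b)"

definition minimal_in_sphere ::
  "('a, 'e::euclidean_space) atlas \<Rightarrow> ('a \<Rightarrow> 'v::euclidean_space) \<Rightarrow> bool" where
  "minimal_in_sphere A f \<longleftrightarrow> (\<forall>(V, p)\<in>A. \<forall>y\<in>V. mean_curvature_sphere (f \<circ> p) y = 0)"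

definition J :: "complex ^ 'n \<Rightarrow> complex ^ 'n" where
  "J x = \<i> *s x"

definition \<omega> :: "complex ^ 'n \<Rightarrow> complex ^ 'n \<Rightarrow> real" where
  "\<omega> x y = J x \<bullet> y"

definition legendrian ::
  "('a, 'e::euclidean_space) atlas \<Rightarrow> ('a \<Rightarrow> complex ^ 'n) \<Rightarrow> bool" where
  "legendrian A f \<longleftrightarrow>
     immersion A f \<and> f ` points A \<subseteq> sphere 0 1 \<and>
     (\<forall>(V, p)\<in>A. \<forall>y\<in>V. \<forall>w\<in>tangent_space (f \<circ> p) y. \<omega> (f (p y)) w = 0)"

definition F_functional ::
  "('a::{t2_space,second_countable_topology}, 'e::euclidean_space) atlas
     \<Rightarrow> ('a \<Rightarrow> 'v::euclidean_space) \<Rightarrow> 'v \<Rightarrow> real \<Rightarrow> real" where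
  "F_functional A f x t =
     (4 * pi * t) powr (- real DIM('e) / 2) *
     (\<integral>p. exp (- (norm (f p - x))\<^sup>2 / (4 * t)) \<partial>volume_measure A f)"

definition normal_variation ::
  "('a::{t2_space,second_countable_topology}, 'e::euclidean_space) atlas
     \<Rightarrow> ('a \<Rightarrow> 'v::euclidean_space) \<Rightarrow> real \<Rightarrow> (real \<Rightarrow> 'a \<Rightarrow> 'v) \<Rightarrow> bool" where
  "normal_variation A f \<epsilon> X \<longleftrightarrow>
     0 < \<epsilon> \<and>
     smooth_map (prod_atlas (interval_atlas \<epsilon>) A) (\<lambda>(s, p). X s p) \<and>
     (\<forall>s\<in>{-\<epsilon><..<\<epsilon>}. immersion A (X s)) \<and>
     (\<forall>p\<in>points A. X 0 p = f p) \<and>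
     (\<exists>K. compact K \<and> K \<subseteq> points A \<and> (\<forall>s\<in>{-\<epsilon><..<\<epsilon>}. \<forall>p\<in>points A - K. X s p = f p)) \<and>
     (\<forall>(V, p)\<in>A. \<forall>y\<in>V.
        vector_derivative (\<lambda>s. X s (p y)) (at 0) \<in> orthogonal_comp (tangent_space (f \<circ> p) y))"

definition F_stable ::
  "('a::{t2_space,second_countable_topology}, 'e::euclidean_space) atlas
     \<Rightarrow> ('a \<Rightarrow> 'v::euclidean_space) \<Rightarrow> bool" where
  "F_stable A f \<longleftrightarrow>
     (\<forall>\<epsilon> X. normal_variation A f \<epsilon> X \<longrightarrow>
        (\<exists>\<delta>>0. \<exists>x t. smooth_on {-\<delta><..<\<delta>} x \<and> x 0 = 0 \<and>
           smooth_on {-\<delta><..<\<delta>} t \<and> t 0 = 1 \<and> (\<forall>s\<in>{-\<delta><..<\<delta>}. 0 < t s) \<and>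
           0 \<le> (deriv ^^ 2) (\<lambda>s. F_functional A (X s) (x s) (t s)) 0))"

definition F_unstable ::
  "('a::{t2_space,second_countable_topology}, 'e::euclidean_space) atlas
     \<Rightarrow> ('a \<Rightarrow> 'v::euclidean_space) \<Rightarrow> bool" where
  "F_unstable A f \<longleftrightarrow> \<not> F_stable A f"

definition closed_curve :: "real \<Rightarrow> (real \<Rightarrow> complex) \<Rightarrow> bool" where
  "closed_curve L \<gamma> \<longleftrightarrow> 0 < L \<and> (\<forall>s. \<gamma> (s + L) = \<gamma> s)"

text \<open>
  An \<open>L\<close>-periodic curve as a map on the unit circle: \<open>on_circle L \<gamma> (cis t) = \<gamma> (L t / 2\<pi>)\<close>
  for all \<open>t\<close>.
\<close>

definition on_circle :: "real \<Rightarrow> (real \<Rightarrow> complex) \<Rightarrow> complex \<Rightarrow> complex" where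
  "on_circle L \<gamma> z = \<gamma> (L * Arg2pi z / (2 * pi))"

definition curve_prod ::
  "('b \<Rightarrow> complex) \<Rightarrow> ('a \<Rightarrow> complex ^ 'n) \<Rightarrow> 'b \<times> 'a \<Rightarrow> complex ^ 'n" where
  "curve_prod \<gamma> \<psi> = (\<lambda>(s, \<sigma>). \<gamma> s *s \<psi> \<sigma>)"

end

theory Submission
  imports Defs
begin

text \<open>
  Deform \<open>\<gamma> * \<psi>\<close> within products, moving \<open>\<gamma>\<close> by \<open>v = u h i \<gamma>'\<close>, where \<open>h = r sin (\<theta> - \<phi>)\<close> is
  up to sign twice the mean curvature and \<open>u = cos (\<phi> - \<beta>) - m\<close>.  As \<open>h\<close> is an eigenfunction of the
  Jacobi operator, the variation \<open>v\<close> alone contributes \<open>\<integral> \<rho> (u'\<^sup>2 - u\<^sup>2)\<close> with \<open>\<rho> = r\<^sup>n\<^sup>-\<^sup>1 exp (- r\<^sup>2 / 4) h\<^sup>2\<close>.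
  The choice of \<open>m\<close> removes the interaction with the dilations.  The one with translations vanishes
  because \<open>\<psi>\<close> integrates to zero, and the translations themselves do not contribute positively because
  \<open>n \<integral> \<langle>a, \<psi>\<rangle>\<^sup>2 \<le> |a|\<^sup>2 vol\<close>; both follow from the minimality of \<open>\<psi>\<close> by the divergence theorem.
  Finally \<open>\<integral> \<rho> (u'\<^sup>2 - u\<^sup>2)\<close> is negative for \<open>\<beta> = 0\<close> or for \<open>\<beta> = \<pi> / 2\<close>: the sum of
  the two values is at most \<open>E (\<integral> \<phi>') (1 - 2 n + \<pi>\<^sup>2 / (2 n))\<close>, where \<open>E = r\<^sup>n exp (- r\<^sup>2 / 4) sin (\<theta> - \<phi>)\<close>
  is constant.
\<close>

section \<open>Smooth maps\<close>

text \<open>\<open>F_stable\<close> leaves x_s and t_s free, so one direction must stay negative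
  against all dilations and translations at once. The function u = 1 is the dilation direction
  itself, hence the subtraction of a weighted mean; the first Fourier modes in the polar angle are
  the next candidates. The second derivatives of x_s and t_s enter linearly, with coefficients that
  integrate to zero. Everything is measured by E times the total angle because h r^(n-1) exp (- r^2
  / 4) = E, so \<rho> = E h, while the equation for \<alpha> = \<theta> - \<phi> reads \<alpha>' = h
  / 2 - n \<phi>'. Hence \<rho> = 2 E (\<alpha>' + n \<phi>'), where \<alpha>' integrates to zero
  and can be integrated by parts against a cosine. As E is not 0, \<alpha> stays between consecutive
  multiples of \<pi>; centring it bounds the Fourier coefficients by \<pi> E times the total angle,
  and the square divided by the integral of \<rho> gives \<pi>^2 / (2 n). A rotation of the angle
  makes the second coefficient vanish; bounding both separately would be too weak for n = 2.\<close>

lemma frechet_derivative_eqI: "(f has_derivative f') (at x) \<Longrightarrow> frechet_derivative f (at x) = f'"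
  using frechet_derivative_at by metis

lemma differentiable_has_frechet:
  "f differentiable at x \<Longrightarrow> (f has_derivative frechet_derivative f (at x)) (at x)"
  using frechet_derivative_works by blast

text \<open>Both notions are built on \<open>has_derivative\<close> at a point, which sees only a
  neighbourhood. Where no derivative exists, the arbitrary value of
  \<open>frechet_derivative\<close> is still the same for both functions.\<close>

lemma frechet_derivative_cong_open:
  assumes "open U" "x \<in> U" "\<And>y. y \<in> U \<Longrightarrow> f y = g y"
  shows "frechet_derivative f (at x) = frechet_derivative g (at x)"
    and "f differentiable at x \<longleftrightarrow> g differentiable at x"
proof -
  have "(f has_derivative D) (at x) \<longleftrightarrow> (g has_derivative D) (at x)" for D
    using has_derivative_transform_within_open[OF _ assms(1,2), of f D UNIV g]
      has_derivative_transform_within_open[OF _ assms(1,2), of g D UNIV f] assms(3) by auto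
  then show "frechet_derivative f (at x) = frechet_derivative g (at x)"
    and "f differentiable at x \<longleftrightarrow> g differentiable at x"
    by (auto simp: frechet_derivative_def differentiable_def)
qed

lemma Ck_on_cong:
  assumes "open U" "\<And>x. x \<in> U \<Longrightarrow> f x = g x"
  shows "Ck_on k U f \<longleftrightarrow> Ck_on k U g"
  using assms(2)
proof (induction k arbitrary: f g)
  case 0
  then show ?case using continuous_on_cong[OF refl, of U f g] by simp
next
  case (Suc k)
  have "Ck_on k U (\<lambda>x. frechet_derivative f (at x) v) \<longleftrightarrow> Ck_on k U (\<lambda>x. frechet_derivative g (at x) v)" for v
    using frechet_derivative_cong_open(1)[OF assms(1), of _ f g] Suc.prems by (intro Suc.IH) simp
  moreover have "f differentiable at x \<longleftrightarrow> g differentiable at x" if "x \<in> U" for x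
    using frechet_derivative_cong_open(2)[OF assms(1) that, of f g] Suc.prems by blast
  ultimately show ?case by simp
qed

lemma Ck_on_Suc_imp: "Ck_on (Suc k) U f \<Longrightarrow> Ck_on k U f"
proof (induction k arbitrary: f)
  case 0
  then show ?case
    by (auto intro!: continuous_at_imp_continuous_on differentiable_imp_continuous_within)
qed auto

text \<open>Replaces the choice inside \<open>frechet_derivative\<close> by a derivative given
  explicitly.\<close>

lemma Ck_on_SucI:
  assumes "open U" "\<And>x. x \<in> U \<Longrightarrow> (f has_derivative f' x) (at x)" "\<And>v. Ck_on k U (\<lambda>x. f' x v)"
  shows "Ck_on (Suc k) U f"
proof -
  have "Ck_on k U (\<lambda>x. frechet_derivative f (at x) v)" for v
    using assms(3)[of v] frechet_derivative_eqI[OF assms(2)]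
    by (subst Ck_on_cong[OF assms(1), of _ "\<lambda>x. f' x v"]) auto
  then show ?thesis
    using assms(2) by (auto simp: differentiable_def)
qed

lemma Ck_on_const: "open U \<Longrightarrow> Ck_on k U (\<lambda>_. c)"
proof (induction k arbitrary: c)
  case (Suc k)
  show ?case
    by (rule Ck_on_SucI[where f' = "\<lambda>_ _. 0"]) (use Suc in auto)
qed simp

lemma Ck_on_bounded_linear:
  assumes "bounded_linear A" "open U"
  shows "Ck_on k U A"
proof (cases k)
  case 0
  then show ?thesis using assms linear_continuous_on by auto
next
  case (Suc j)
  show ?thesis unfolding Suc
    by (rule Ck_on_SucI[where f' = "\<lambda>_. A"])
      (auto intro: assms Ck_on_const bounded_linear_imp_has_derivative)
qed

lemma Ck_on_add: "open U \<Longrightarrow> Ck_on k U f \<Longrightarrow> Ck_on k U g \<Longrightarrow> Ck_on k U (\<lambda>x. f x + g x)"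
proof (induction k arbitrary: f g)
  case (Suc k)
  then show ?case
    by (intro Ck_on_SucI[where f' = "\<lambda>x v. frechet_derivative f (at x) v + frechet_derivative g (at x) v"])
      (auto intro!: has_derivative_add differentiable_has_frechet)
qed (auto intro: continuous_on_add)

lemma Ck_on_sum:
  "open U \<Longrightarrow> (\<And>i. i \<in> I \<Longrightarrow> Ck_on k U (f i)) \<Longrightarrow> Ck_on k U (\<lambda>x. \<Sum>i\<in>I. f i x)"
  by (induction I rule: infinite_finite_induct) (auto intro!: Ck_on_const Ck_on_add)

lemma Ck_on_bilinear:
  assumes "bounded_bilinear B" "open U"
  shows "Ck_on k U f \<Longrightarrow> Ck_on k U g \<Longrightarrow> Ck_on k U (\<lambda>x. B (f x) (g x))"
proof (induction k arbitrary: f g)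
  case 0
  then show ?case by (auto intro: bounded_bilinear.continuous_on[OF assms(1)])
next
  case (Suc k)
  show ?case
  proof (rule Ck_on_SucI[OF assms(2), where f' = "\<lambda>x v. B (f x) (frechet_derivative g (at x) v) + B (frechet_derivative f (at x) v) (g x)"])
    fix v
    show "Ck_on k U (\<lambda>x. B (f x) (frechet_derivative g (at x) v) + B (frechet_derivative f (at x) v) (g x))"
      using Suc.prems by (intro Ck_on_add assms Suc.IH) (auto intro: Ck_on_Suc_imp)
  qed (use Suc.prems in \<open>auto intro!: bounded_bilinear.FDERIV[OF assms(1)] differentiable_has_frechet\<close>)
qed

lemmas Ck_on_mult = Ck_on_bilinear[OF bounded_bilinear_mult]
lemmas Ck_on_scaleR = Ck_on_bilinear[OF bounded_bilinear_scaleR]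
lemmas Ck_on_inner = Ck_on_bilinear[OF bounded_bilinear_inner]

lemma Ck_on_compose:
  assumes "open U" "open W"
  shows "Ck_on k U f \<Longrightarrow> Ck_on k W g \<Longrightarrow> f ` U \<subseteq> W \<Longrightarrow> Ck_on k U (\<lambda>x. g (f x))"
proof (induction k arbitrary: f g)
  case 0
  then show ?case using continuous_on_compose2 by auto
next
  case (Suc k)
  \<comment> \<open>\<open>Ck_on\<close> fixes the direction of differentiation, whereas the chain
    rule differentiates \<open>g\<close> in a direction that moves with the point. Expanding that
    direction in the basis leaves fixed directions, to which the induction hypothesis
    applies.\<close>
  have lin: "frechet_derivative g (at z) w = (\<Sum>b\<in>Basis. (w \<bullet> b) *\<^sub>R frechet_derivative g (at z) b)"
    if "z \<in> W" for z w
  proof -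
    interpret linear "frechet_derivative g (at z)"
      using Suc.prems(2) that by (auto intro!: linear_frechet_derivative)
    show ?thesis
      by (subst (1) euclidean_representation[of w, symmetric]) (simp add: sum scaleR)
  qed
  show ?case
  proof (rule Ck_on_SucI[OF assms(1), where f' = "\<lambda>x v. \<Sum>b\<in>Basis. (frechet_derivative f (at x) v \<bullet> b) *\<^sub>R frechet_derivative g (at (f x)) b"])
    fix x assume x: "x \<in> U"
    then have "((\<lambda>x. g (f x)) has_derivative (\<lambda>v. frechet_derivative g (at (f x)) (frechet_derivative f (at x) v))) (at x)"
      using Suc.prems by (auto intro!: has_derivative_compose[of f _ x UNIV g] differentiable_has_frechet)
    then show "((\<lambda>x. g (f x)) has_derivative (\<lambda>v. \<Sum>b\<in>Basis. (frechet_derivative f (at x) v \<bullet> b) *\<^sub>R frechet_derivative g (at (f x)) b)) (at x)"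
      using x Suc.prems(3) by (subst (asm) lin) auto
  next
    fix v
    have "Ck_on k U (\<lambda>x. frechet_derivative g (at (f x)) b)" for b
      using Suc.prems by (intro Suc.IH) (auto intro: Ck_on_Suc_imp)
    then show "Ck_on k U (\<lambda>x. \<Sum>b\<in>Basis. (frechet_derivative f (at x) v \<bullet> b) *\<^sub>R frechet_derivative g (at (f x)) b)"
      using Suc.prems by (auto intro!: Ck_on_sum Ck_on_scaleR Ck_on_inner Ck_on_const assms)
  qed
qed

text \<open>The derivative contains two copies of \<open>inverse\<close> itself, so the induction
  hypothesis covers it.\<close>

lemma Ck_on_inverse: "Ck_on k (- {0}) (inverse :: real \<Rightarrow> real)"
proof (induction k)
  case 0
  then show ?case by (simp add: continuous_on_inverse)
next
  case (Suc k)
  have "Ck_on k (- {0}) (\<lambda>x::real. (- v) * (inverse x * inverse x))" for v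
    by (intro Ck_on_mult Ck_on_const Suc) auto
  then have "Ck_on k (- {0}) (\<lambda>x::real. - (inverse x * v * inverse x))" for v
    by (simp add: mult_ac)
  moreover have "(inverse has_derivative (\<lambda>v. - (inverse x * v * inverse x))) (at x)" if "x \<in> - {0}" for x :: real
    using that by (intro has_derivative_inverse') simp
  ultimately show ?case
    by (intro Ck_on_SucI[where f' = "\<lambda>x v. - (inverse x * v * inverse x)"]) auto
qed

text \<open>C^1 is what integration by parts against the density \<open>sqrt (gram_det u y)\<close>
  asks for.\<close>

lemma Ck_on_sqrt: "Ck_on (Suc 0) {0<..} sqrt"
proof (rule Ck_on_SucI[where f' = "\<lambda>x v. (inverse (sqrt x) / 2) * v"])
  fix x :: real assume "x \<in> {0<..}"
  then show "(sqrt has_derivative (\<lambda>v. (inverse (sqrt x) / 2) * v)) (at x)"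
    using DERIV_real_sqrt[of x] by (simp only: has_field_derivative_def greaterThan_iff)
next
  fix v :: real
  show "Ck_on 0 {0<..} (\<lambda>x. (inverse (sqrt x) / 2) * v)"
    unfolding Ck_on.simps by (intro continuous_intros) auto
qed simp

lemma Ck_on_prod:
  fixes f :: "'i \<Rightarrow> 'e::euclidean_space \<Rightarrow> real"
  shows "open U \<Longrightarrow> (\<And>i. i \<in> I \<Longrightarrow> Ck_on k U (f i)) \<Longrightarrow> Ck_on k U (\<lambda>x. \<Prod>i\<in>I. f i x)"
  by (induction I rule: infinite_finite_induct) (auto intro!: Ck_on_const Ck_on_mult)

text \<open>Serves functions given by different formulas on different open sets, such as a compactly
  supported function extended by zero.\<close>

lemma Ck_on_locally:
  assumes "\<And>x. x \<in> U \<Longrightarrow> \<exists>V. open V \<and> x \<in> V \<and> Ck_on k V f"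
  shows "Ck_on k U f"
  using assms
proof (induction k arbitrary: f)
  case 0
  then show ?case
    by (auto intro!: continuous_at_imp_continuous_on) (metis continuous_on_eq_continuous_at)
next
  case (Suc k)
  have "Ck_on k U (\<lambda>x. frechet_derivative f (at x) v)" for v
    using Suc.prems by (intro Suc.IH) (metis Ck_on.simps(2))
  moreover have "f differentiable at x" if "x \<in> U" for x
    using Suc.prems[OF that] by auto
  ultimately show ?case by simp
qed

lemma smooth_onD: "smooth_on U f \<Longrightarrow> Ck_on k U f"
  by (simp add: smooth_on_def)

section \<open>Trigonometric functions and closure properties of smooth maps\<close>

lemma smooth_on_cos: "smooth_on UNIV (cos :: real \<Rightarrow> real)"
  and smooth_on_sin: "smooth_on UNIV (sin :: real \<Rightarrow> real)"
proof -
  have "Ck_on k UNIV (cos :: real \<Rightarrow> real) \<and> Ck_on k UNIV (sin :: real \<Rightarrow> real)" for k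
  proof (induction k)
    case 0
    then show ?case by (simp add: continuous_on_cos continuous_on_sin)
  next
    case (Suc k)
    have "Ck_on k UNIV (\<lambda>x::real. (- v) * sin x)" "Ck_on k UNIV (\<lambda>x::real. cos x * v)" for v
      using Suc by (intro Ck_on_mult Ck_on_const; simp)+
    note * = this
    have "Ck_on (Suc k) UNIV (cos :: real \<Rightarrow> real)"
      by (rule Ck_on_SucI[where f' = "\<lambda>x v. (- v) * sin x"])
        (use * in \<open>auto intro!: derivative_eq_intros\<close>)
    moreover have "Ck_on (Suc k) UNIV (sin :: real \<Rightarrow> real)"
      by (rule Ck_on_SucI[where f' = "\<lambda>x v. cos x * v"])
        (use * in \<open>auto intro!: derivative_eq_intros\<close>)
    ultimately show ?case by blast
  qed
  then show "smooth_on UNIV (cos :: real \<Rightarrow> real)" "smooth_on UNIV (sin :: real \<Rightarrow> real)"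
    by (auto simp: smooth_on_def)
qed

lemma smooth_on_const: "open U \<Longrightarrow> smooth_on U (\<lambda>_. c)"
  by (simp add: smooth_on_def Ck_on_const)

lemma smooth_on_bounded_linear: "bounded_linear A \<Longrightarrow> open U \<Longrightarrow> smooth_on U A"
  by (simp add: smooth_on_def Ck_on_bounded_linear)

lemma smooth_on_add: "open U \<Longrightarrow> smooth_on U f \<Longrightarrow> smooth_on U g \<Longrightarrow> smooth_on U (\<lambda>x. f x + g x)"
  by (simp add: smooth_on_def Ck_on_add)

lemma smooth_on_bilinear:
  "bounded_bilinear B \<Longrightarrow> open U \<Longrightarrow> smooth_on U f \<Longrightarrow> smooth_on U g \<Longrightarrow> smooth_on U (\<lambda>x. B (f x) (g x))"
  by (simp add: smooth_on_def Ck_on_bilinear)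

lemma smooth_on_compose:
  "open U \<Longrightarrow> open W \<Longrightarrow> smooth_on U f \<Longrightarrow> smooth_on W g \<Longrightarrow> f ` U \<subseteq> W \<Longrightarrow> smooth_on U (\<lambda>x. g (f x))"
  by (auto simp: smooth_on_def intro: Ck_on_compose)

lemma Ck1_imp:
  assumes "Ck_on (Suc 0) U f"
  shows "x \<in> U \<Longrightarrow> f differentiable at x"
    and "x \<in> U \<Longrightarrow> (f has_derivative frechet_derivative f (at x)) (at x)"
    and "continuous_on U (\<lambda>x. frechet_derivative f (at x) v)"
    and "continuous_on U f"
  using assms Ck_on_Suc_imp[OF assms] by (auto intro: differentiable_has_frechet)

text \<open>Schwarz's theorem: compare the second difference quotient with both mixed derivatives
  by the mean value theorem.\<close>

lemma second_diff_symmetric: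
  fixes f :: "'e::euclidean_space \<Rightarrow> 'v::euclidean_space"
  assumes f: "Ck_on (Suc (Suc 0)) U f" and U: "open U" "x \<in> U"
  shows "second_diff f x v w = second_diff f x w v"
proof (rule euclidean_eqI)
  fix b :: 'v assume "b \<in> Basis"
  obtain e where e: "e > 0" "ball x e \<subseteq> U" using U open_contains_ball by blast
  \<comment> \<open>The summand 1 makes \<open>M\<close> positive even for \<open>v = w = 0\<close>
    and the estimate below strict.\<close>
  define M where "M = norm v + norm w + 1"
  have M: "M > 0" by (simp add: M_def add_nonneg_pos)
  have inU: "x + s *\<^sub>R v + t *\<^sub>R w \<in> U" if "\<bar>s\<bar> < e / M" "\<bar>t\<bar> < e / M" for s t
  proof -
    have "norm (s *\<^sub>R v + t *\<^sub>R w) \<le> \<bar>s\<bar> * norm v + \<bar>t\<bar> * norm w"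
      by (metis norm_scaleR norm_triangle_ineq)
    also have "\<dots> \<le> (e/M) * norm v + (e/M) * norm w"
      using that by (intro add_mono mult_right_mono) auto
    also have "\<dots> = e * ((norm v + norm w) / M)" by (simp add: algebra_simps add_divide_distrib)
    also have "\<dots> < e * 1" using e M by (intro mult_strict_left_mono) (auto simp: M_def)
    finally have "norm (s *\<^sub>R v + t *\<^sub>R w) < e" by simp
    then have "x + (s *\<^sub>R v + t *\<^sub>R w) \<in> ball x e"
      by (metis add_diff_cancel_left' dist_norm dist_commute mem_ball)
    then show ?thesis using e by (auto simp: add.assoc)
  qed
  have d1: "((\<lambda>s. f (p s) \<bullet> b) has_real_derivative (frechet_derivative f (at (p s)) u \<bullet> b)) (at s)"
    if "p s \<in> U" "(p has_vector_derivative u) (at s)" for p u s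
  proof -
    have "(f has_derivative frechet_derivative f (at (p s))) (at (p s))"
      using f that by (auto intro: differentiable_has_frechet)
    from has_derivative_compose[OF that(2)[unfolded has_vector_derivative_def] this]
    have "((\<lambda>s. f (p s)) has_derivative (\<lambda>r. frechet_derivative f (at (p s)) (r *\<^sub>R u))) (at s)" .
    then have "((\<lambda>s. f (p s) \<bullet> b) has_derivative (\<lambda>r. frechet_derivative f (at (p s)) (r *\<^sub>R u) \<bullet> b)) (at s)"
      by (rule has_derivative_inner_left)
    moreover have "linear (frechet_derivative f (at (p s)))"
      using f that by (auto intro: linear_frechet_derivative)
    ultimately show ?thesis
      by (simp add: has_field_derivative_def linear_cmul mult_commute_abs)
  qed
  have d2: "((\<lambda>s. frechet_derivative f (at (p s)) z \<bullet> b) has_real_derivative (second_diff f (p s) u z \<bullet> b)) (at s)"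
    if "p s \<in> U" "(p has_vector_derivative u) (at s)" for p u s z
  proof -
    let ?g = "\<lambda>y. frechet_derivative f (at y) z"
    have g: "?g differentiable at (p s)" using f that by auto
    then have "(?g has_derivative frechet_derivative ?g (at (p s))) (at (p s))"
      by (rule differentiable_has_frechet)
    from has_derivative_compose[OF that(2)[unfolded has_vector_derivative_def] this]
    have "((\<lambda>s. ?g (p s)) has_derivative (\<lambda>r. frechet_derivative ?g (at (p s)) (r *\<^sub>R u))) (at s)" .
    then have "((\<lambda>s. ?g (p s) \<bullet> b) has_derivative (\<lambda>r. frechet_derivative ?g (at (p s)) (r *\<^sub>R u) \<bullet> b)) (at s)"
      by (rule has_derivative_inner_left)
    moreover have "linear (frechet_derivative ?g (at (p s)))"
      using g by (auto intro: linear_frechet_derivative)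
    ultimately show ?thesis
      by (simp add: has_field_derivative_def linear_cmul mult_commute_abs second_diff_def)
  qed
  \<comment> \<open>The mean value theorem is applied first along \<open>v\<close>, to the increment
    of \<open>f\<close> across \<open>h *\<^sub>R w\<close>, and then along \<open>w\<close>. The
    directions are generalised so that the same fact can be used with \<open>v\<close> and
    \<open>w\<close> exchanged.\<close>
  have key: "\<exists>s t. 0 < s \<and> s < h \<and> 0 < t \<and> t < h \<and>
      (f (x + h *\<^sub>R v + h *\<^sub>R w) - f (x + h *\<^sub>R v) - f (x + h *\<^sub>R w) + f x) \<bullet> b
        = h * h * (second_diff f (x + s *\<^sub>R v + t *\<^sub>R w) w v \<bullet> b)"
    if h: "0 < h" "h < e / M" and inU: "\<And>s t. \<bar>s\<bar> < e / M \<Longrightarrow> \<bar>t\<bar> < e / M \<Longrightarrow> x + s *\<^sub>R v + t *\<^sub>R w \<in> U" for h v w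
  proof -
    let ?F = "\<lambda>s. f (x + s *\<^sub>R v + h *\<^sub>R w) \<bullet> b - f (x + s *\<^sub>R v + 0 *\<^sub>R w) \<bullet> b"
    have "\<exists>s>0. s < h \<and> ?F h - ?F 0 = (h - 0) *
      (frechet_derivative f (at (x + s *\<^sub>R v + h *\<^sub>R w)) v \<bullet> b - frechet_derivative f (at (x + s *\<^sub>R v + 0 *\<^sub>R w)) v \<bullet> b)"
      by (rule MVT2[OF h(1)])
        (use h inU[of _ 0] in \<open>auto intro!: derivative_intros d1 inU derivative_eq_intros simp: has_vector_derivative_def\<close>)
    then obtain s where s: "0 < s" "s < h" and 1: "?F h - ?F 0 = (h - 0) *
      (frechet_derivative f (at (x + s *\<^sub>R v + h *\<^sub>R w)) v \<bullet> b - frechet_derivative f (at (x + s *\<^sub>R v + 0 *\<^sub>R w)) v \<bullet> b)"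
      by blast
    let ?G = "\<lambda>t. frechet_derivative f (at (x + s *\<^sub>R v + t *\<^sub>R w)) v \<bullet> b"
    have "\<exists>t>0. t < h \<and> ?G h - ?G 0 = (h - 0) * (second_diff f (x + s *\<^sub>R v + t *\<^sub>R w) w v \<bullet> b)"
      by (rule MVT2[OF h(1)])
        (use h s inU[of _ 0] in \<open>auto intro!: derivative_intros d2 inU derivative_eq_intros simp: has_vector_derivative_def\<close>)
    then obtain t where "0 < t" "t < h" "?G h - ?G 0 = (h - 0) * (second_diff f (x + s *\<^sub>R v + t *\<^sub>R w) w v \<bullet> b)"
      by blast
    with 1 s show ?thesis by (intro exI[of _ s] exI[of _ t]) (simp add: inner_diff_left inner_add_left algebra_simps)
  qed
  have lim: "((\<lambda>k. second_diff f (x + s k *\<^sub>R v + t k *\<^sub>R w) p q \<bullet> b) \<longlonglongrightarrow> second_diff f x p q \<bullet> b)"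
    if "s \<longlonglongrightarrow> 0" "t \<longlonglongrightarrow> 0" for s t p q v w
  proof -
    have "continuous_on U (\<lambda>y. second_diff f y p q)"
      using f by (auto simp: second_diff_def)
    then have "isCont (\<lambda>y. second_diff f y p q) x"
      using U continuous_on_eq_continuous_at by blast
    moreover have "(\<lambda>k. x + s k *\<^sub>R v + t k *\<^sub>R w) \<longlonglongrightarrow> x + 0 *\<^sub>R v + 0 *\<^sub>R w"
      by (intro tendsto_intros that)
    ultimately have "(\<lambda>k. second_diff f (x + s k *\<^sub>R v + t k *\<^sub>R w) p q) \<longlonglongrightarrow> second_diff f x p q"
      using isCont_tendsto_compose[of x "\<lambda>y. second_diff f y p q"] by simp
    then show ?thesis by (intro tendsto_intros)
  qed
  define h where "h k = (e / M) / (real k + 2)" for k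
  have h: "0 < h k" "h k < e / M" for k
    using e M by (auto simp: h_def divide_simps)
  have h0: "h \<longlonglongrightarrow> 0"
    unfolding h_def using LIMSEQ_ignore_initial_segment[OF lim_const_over_n[of "e / M"], of 2] by (simp add: add.commute)
  have inU': "x + s *\<^sub>R w + t *\<^sub>R v \<in> U" if "\<bar>s\<bar> < e / M" "\<bar>t\<bar> < e / M" for s t
    using inU[OF that(2,1)] by (simp add: algebra_simps)
  obtain s t where st: "\<And>k. 0 < s k" "\<And>k. s k < h k" "\<And>k. 0 < t k" "\<And>k. t k < h k"
     "\<And>k. (f (x + h k *\<^sub>R v + h k *\<^sub>R w) - f (x + h k *\<^sub>R v) - f (x + h k *\<^sub>R w) + f x) \<bullet> b
        = h k * h k * (second_diff f (x + s k *\<^sub>R v + t k *\<^sub>R w) w v \<bullet> b)"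
    using key[OF h inU] by metis
  obtain s' t' where st': "\<And>k. 0 < s' k" "\<And>k. s' k < h k" "\<And>k. 0 < t' k" "\<And>k. t' k < h k"
     "\<And>k. (f (x + h k *\<^sub>R w + h k *\<^sub>R v) - f (x + h k *\<^sub>R w) - f (x + h k *\<^sub>R v) + f x) \<bullet> b
        = h k * h k * (second_diff f (x + s' k *\<^sub>R w + t' k *\<^sub>R v) v w \<bullet> b)"
    using key[OF h inU'] by metis
  \<comment> \<open>The second difference itself does not change when \<open>v\<close> and
    \<open>w\<close> are exchanged.\<close>
  have "h k * h k * (second_diff f (x + s k *\<^sub>R v + t k *\<^sub>R w) w v \<bullet> b)
      = h k * h k * (second_diff f (x + s' k *\<^sub>R w + t' k *\<^sub>R v) v w \<bullet> b)" for k
    unfolding st(5)[symmetric] st'(5)[symmetric] by (simp add: algebra_simps)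
  then have eq: "second_diff f (x + s k *\<^sub>R v + t k *\<^sub>R w) w v \<bullet> b
      = second_diff f (x + s' k *\<^sub>R w + t' k *\<^sub>R v) v w \<bullet> b" for k
    using h(1)[of k] by (metis mult_cancel_left mult_eq_0_iff less_irrefl)
  have sq: "g \<longlonglongrightarrow> 0" if "\<And>k. 0 < g k" "\<And>k. g k < h k" for g
    by (rule tendsto_sandwich[OF _ _ tendsto_const h0])
      (use that in \<open>auto intro!: always_eventually less_imp_le\<close>)
  have 1: "(\<lambda>k. second_diff f (x + s k *\<^sub>R v + t k *\<^sub>R w) w v \<bullet> b) \<longlonglongrightarrow> second_diff f x w v \<bullet> b"
    by (intro lim sq[of s] sq[of t] st)
  have 2: "(\<lambda>k. second_diff f (x + s' k *\<^sub>R w + t' k *\<^sub>R v) v w \<bullet> b) \<longlonglongrightarrow> second_diff f x v w \<bullet> b"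
    by (intro lim sq[of s'] sq[of t'] st')
  show "second_diff f x v w \<bullet> b = second_diff f x w v \<bullet> b"
    by (rule LIMSEQ_unique[OF 2 1[unfolded eq]])
qed

section \<open>Gram determinants and their derivatives\<close>

text \<open>\<open>det\<close> and the vectors of \<open>real ^ 'n\<close> are indexed by a type,
  whereas \<open>Basis\<close> is a set; this type turns the basis vectors into indices.\<close>

typedef (overloaded) 'e basis_index = "Basis :: 'e::euclidean_space set"
  morphisms basis_vec Abs_basis_index
  using nonempty_Basis by blast

lemma bij_basis_vec: "bij_betw basis_vec UNIV Basis"
proof -
  have "x \<in> range basis_vec" if "x \<in> Basis" for x :: 'a
    using Abs_basis_index_inverse[OF that] by (metis rangeI)
  then show ?thesis
    using basis_vec by (auto simp: bij_betw_def inj_on_def basis_vec_inject)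
qed

instance basis_index :: (euclidean_space) finite
  using bij_betw_finite[OF bij_basis_vec] by intro_classes simp

text \<open>An arbitrary enumeration, from which the index type inherits the order that the change
  of variables theorem on \<open>real ^ 'n\<close> demands.\<close>

definition basis_index_nat :: "'e::euclidean_space basis_index \<Rightarrow> nat" where
  "basis_index_nat = (SOME f. inj f)"

lemma inj_basis_index_nat: "inj basis_index_nat"
proof -
  have "\<exists>f :: 'a basis_index \<Rightarrow> nat. inj f"
    using finite_imp_inj_to_nat_seg[of "UNIV :: 'a basis_index set"] by auto
  then show ?thesis unfolding basis_index_nat_def by (rule someI_ex)
qed

instantiation basis_index :: (euclidean_space) wellorder
begin

definition "x \<le> y \<longleftrightarrow> basis_index_nat x \<le> basis_index_nat y"
definition "x < y \<longleftrightarrow> basis_index_nat x < basis_index_nat y"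

instance
proof
  fix P :: "'a basis_index \<Rightarrow> bool" and a :: "'a basis_index"
  assume *: "\<And>x. (\<And>y. y < x \<Longrightarrow> P y) \<Longrightarrow> P x"
  show "P a"
    by (induction a rule: measure_induct_rule[of basis_index_nat])
      (auto intro: * simp: less_basis_index_def)
qed (use inj_basis_index_nat in \<open>auto simp: less_eq_basis_index_def less_basis_index_def inj_def\<close>)

end

lemma sum_basis_vec: "(\<Sum>i\<in>UNIV. f (basis_vec i)) = (\<Sum>b\<in>Basis. f b)"
  by (rule sum.reindex_bij_betw[OF bij_basis_vec])

lemma basis_vec_in_Basis [simp]: "basis_vec i \<in> Basis"
  by (rule basis_vec)

lemma inner_basis_vec: "basis_vec i \<bullet> basis_vec j = (if i = j then 1 else 0)"
  by (simp add: inner_Basis basis_vec_inject)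

text \<open>Leibniz's formula from \<open>gram_det\<close> for arbitrary entries, so that Cramer's
  rule and differentiation can alter them.\<close>

definition basis_det :: "('e::euclidean_space \<Rightarrow> 'e \<Rightarrow> real) \<Rightarrow> real" where
  "basis_det m = (\<Sum>\<pi> | \<pi> permutes Basis. of_int (sign \<pi>) * (\<Prod>b\<in>Basis. m b (\<pi> b)))"

lemma gram_det_basis_det: "gram_det u y = basis_det (\<lambda>b c. diff u y b \<bullet> diff u y c)"
  by (simp add: gram_det_def basis_det_def)

text \<open>Transport along the bijection conjugates the permutations, and this preserves their
  signs.\<close>

lemma sum_permutes_reindex:
  assumes f: "bij_betw f A B" "finite A"
  shows "(\<Sum>\<pi> | \<pi> permutes B. of_int (sign \<pi>) * (\<Prod>b\<in>B. m b (\<pi> b)))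
       = (\<Sum>\<pi> | \<pi> permutes A. of_int (sign \<pi>) * (\<Prod>a\<in>A. m (f a) (f (\<pi> a)) :: real))"
proof -
  have inj: "inj_on f A" using f by (auto simp: bij_betw_def)
  define g where "g = inv_into A f"
  have g: "bij_betw g B A" unfolding g_def using f bij_betw_inv_into by blast
  have gf: "g (f x) = x" if "x \<in> A" for x unfolding g_def using that inj by simp
  have fg: "f (g x) = x" if "x \<in> B" for x
    unfolding g_def using that f by (simp add: bij_betw_def f_inv_into_f)
  have "bij_betw (map_permutation A f) {\<pi>. \<pi> permutes A} {\<pi>. \<pi> permutes B}"
    by (rule bij_betw_byWitness[where f' = "map_permutation B g"])
      (auto simp: map_permutation_compose_inv[OF f(1)] map_permutation_compose_inv[OF g] gf fg
        intro!: map_permutation_permutes f g)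
  from sum.reindex_bij_betw[OF this, symmetric]
  have "(\<Sum>\<pi> | \<pi> permutes B. of_int (sign \<pi>) * (\<Prod>b\<in>B. m b (\<pi> b)))
     = (\<Sum>\<pi> | \<pi> permutes A. of_int (sign (map_permutation A f \<pi>)) * (\<Prod>b\<in>B. m b (map_permutation A f \<pi> b)))" .
  also have "\<dots> = (\<Sum>\<pi> | \<pi> permutes A. of_int (sign \<pi>) * (\<Prod>a\<in>A. m (f a) (f (\<pi> a))))"
  proof (intro sum.cong refl, clarsimp)
    fix \<pi> assume p: "\<pi> permutes A"
    have "(\<Prod>b\<in>B. m b (map_permutation A f \<pi> b)) = (\<Prod>a\<in>A. m (f a) (map_permutation A f \<pi> (f a)))"
      by (rule prod.reindex_bij_betw[OF f(1), symmetric])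
    also have "\<dots> = (\<Prod>a\<in>A. m (f a) (f (\<pi> a)))"
      by (intro prod.cong refl) (simp add: map_permutation_apply inj)
    finally show "real_of_int (sign (map_permutation A f \<pi>)) * (\<Prod>b\<in>B. m b (map_permutation A f \<pi> b)) =
         real_of_int (sign \<pi>) * (\<Prod>a\<in>A. m (f a) (f (\<pi> a)))"
      using sign_map_permutation[OF inj p f(2)] by simp
  qed
  finally show ?thesis .
qed

lemma basis_det_eq_det: "basis_det m = det (\<chi> i j. m (basis_vec i) (basis_vec j))"
  unfolding basis_det_def det_def by (subst sum_permutes_reindex[OF bij_basis_vec]) auto

lemma basis_det_cong:
  "(\<And>b c. b \<in> Basis \<Longrightarrow> c \<in> Basis \<Longrightarrow> m b c = k b c) \<Longrightarrow> basis_det m = basis_det k"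
  by (simp add: basis_det_eq_det)

lemma basis_det_one: "basis_det (\<lambda>b c. if b = c then 1 else 0) = 1"
proof -
  have "(\<chi> i j. if basis_vec i = basis_vec j then 1 else 0) = (mat 1 :: real^'a basis_index^'a basis_index)"
    by (simp add: mat_def basis_vec_inject vec_eq_iff)
  then show ?thesis by (simp add: basis_det_eq_det)
qed

lemma basis_det_mult:
  "basis_det (\<lambda>b c. \<Sum>d\<in>Basis. m b d * k d c) = basis_det m * basis_det k"
  unfolding basis_det_eq_det det_mul[symmetric] matrix_matrix_mult_def
  by (simp add: sum_basis_vec[where f = "\<lambda>d. m _ d * k d _"])

lemma basis_det_transpose: "basis_det (\<lambda>b c. m c b) = basis_det m"
  unfolding basis_det_eq_det by (subst det_transpose[symmetric]) (simp add: transpose_def)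

text \<open>All matrices on the segment from the identity to \<open>A\<close> are positive definite,
  hence nonsingular, so \<open>det\<close> keeps the sign that it has at the identity.\<close>

lemma det_pos_if_pos_def:
  fixes A :: "real^'n^'n"
  assumes "\<And>x. x \<noteq> 0 \<Longrightarrow> x \<bullet> (A *v x) > 0"
  shows "det A > 0"
proof (rule ccontr)
  assume neg: "\<not> det A > 0"
  define P where "P t = (1 - t) *\<^sub>R mat 1 + t *\<^sub>R A" for t :: real
  have nz: "det (P t) \<noteq> 0" if t: "0 \<le> t" "t \<le> 1" for t
  proof
    assume "det (P t) = 0"
    then obtain x where x: "x \<noteq> 0" "P t *v x = 0"
      using invertible_det_nz[of "P t"] invertible_left_inverse[of "P t"] matrix_left_invertible_ker[of "P t"] by auto
    have "0 = x \<bullet> (P t *v x)" using x by simp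
    also have "\<dots> = (1 - t) * (x \<bullet> x) + t * (x \<bullet> (A *v x))"
      by (simp add: P_def matrix_vector_mult_add_rdistrib scaleR_matrix_vector_assoc[symmetric] inner_add_right)
    also have "\<dots> > 0"
      using assms[OF x(1)] t x(1) by (cases "t = 0") (auto intro: add_nonneg_pos simp: inner_ge_zero)
    finally show False by simp
  qed
  have "continuous_on {0..1} (\<lambda>t. det (P t))"
    unfolding det_def P_def vector_add_component vector_scaleR_component by (intro continuous_intros)
  moreover have "det (P 1) \<le> 0" "0 \<le> det (P 0)" using neg by (auto simp: P_def)
  ultimately obtain t where "0 \<le> t" "t \<le> 1" "det (P t) = 0"
    using IVT2'[of "\<lambda>t. det (P t)" 1 0 0] by auto
  with nz show False by auto
qed

section \<open>Coordinates with respect to the basis\<close>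

definition coord_iso :: "real ^ 'e basis_index \<Rightarrow> 'e::euclidean_space" where
  "coord_iso x = (\<Sum>i\<in>UNIV. (x $ i) *\<^sub>R basis_vec i)"

definition coord_inv :: "'e::euclidean_space \<Rightarrow> real ^ 'e basis_index" where
  "coord_inv x = (\<chi> i. x \<bullet> basis_vec i)"

lemma coord_inv_iso [simp]: "coord_inv (coord_iso x) = x"
  by (simp add: coord_inv_def coord_iso_def vec_eq_iff inner_sum_left inner_basis_vec if_distrib cong: if_cong)

lemma coord_iso_inv [simp]: "coord_iso (coord_inv x) = x"
  using sum_basis_vec[of "\<lambda>b. (x \<bullet> b) *\<^sub>R b"] by (simp add: coord_inv_def coord_iso_def euclidean_representation)

lemma bounded_linear_coord_iso: "bounded_linear coord_iso"
  unfolding coord_iso_def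
  by (intro bounded_linear_sum bounded_linear_compose[OF bounded_linear_scaleR_left] bounded_linear_vec_nth)

lemma linear_coord_inv: "linear coord_inv"
  by (auto simp: coord_inv_def vec_eq_iff inner_add_left intro!: linearI)

lemma bounded_linear_coord_inv: "bounded_linear coord_inv"
  using linear_conv_bounded_linear linear_coord_inv by blast

lemma coord_iso_axis: "coord_iso (axis i 1) = basis_vec i"
  by (simp add: coord_iso_def axis_def if_distrib[of "\<lambda>c. c *\<^sub>R _"] cong: if_cong)

lemma basis_det_pos:
  assumes "\<And>x. x \<noteq> 0 \<Longrightarrow> (\<Sum>b\<in>Basis. \<Sum>c\<in>Basis. (x \<bullet> b) * (x \<bullet> c) * m b c) > 0"
  shows "basis_det m > 0"
  unfolding basis_det_eq_det
proof (rule det_pos_if_pos_def)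
  fix x :: "real ^ 'a basis_index" assume "x \<noteq> 0"
  then have "coord_iso x \<noteq> 0"
    using coord_inv_iso[of x] linear_0[OF linear_coord_inv] by metis
  from assms[OF this] have "0 < (\<Sum>b\<in>Basis. \<Sum>c\<in>Basis. (coord_iso x \<bullet> b) * (coord_iso x \<bullet> c) * m b c)" .
  also have "\<dots> = (\<Sum>i\<in>UNIV. \<Sum>j\<in>UNIV. (coord_iso x \<bullet> basis_vec i) * (coord_iso x \<bullet> basis_vec j) * m (basis_vec i) (basis_vec j))"
    unfolding sum_basis_vec[where f = "\<lambda>c. (coord_iso x \<bullet> b) * (coord_iso x \<bullet> c) * m b c" for b]
    by (rule sum_basis_vec[symmetric])
  also have "\<dots> = x \<bullet> ((\<chi> i j. m (basis_vec i) (basis_vec j)) *v x)"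
  proof -
    have "coord_iso x \<bullet> basis_vec i = x $ i" for i
      by (metis coord_inv_def coord_inv_iso vec_lambda_beta)
    then show ?thesis
      by (simp add: inner_vec_def matrix_vector_mult_def sum_distrib_left mult_ac)
  qed
  finally show "0 < x \<bullet> ((\<chi> i j. m (basis_vec i) (basis_vec j)) *v x)" .
qed

lemma basis_det_cramer:
  assumes "\<And>b. b \<in> Basis \<Longrightarrow> (\<Sum>c\<in>Basis. m b c * (x \<bullet> c)) = y b" "basis_det m \<noteq> 0" "k \<in> Basis"
  shows "x \<bullet> k = basis_det (\<lambda>b c. if c = k then y b else m b c) / basis_det m"
proof -
  let ?A = "\<chi> i j. m (basis_vec i) (basis_vec j)"
  obtain k' where k: "k = basis_vec k'" using assms(3) Abs_basis_index_inverse by metis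
  have "?A *v coord_inv x = (\<chi> i. y (basis_vec i))"
    using assms(1) sum_basis_vec[where f = "\<lambda>c. m _ c * (x \<bullet> c)"]
    by (simp add: vec_eq_iff matrix_vector_mult_def coord_inv_def)
  then have "coord_inv x = (\<chi> k. det(\<chi> i j. if j=k then (\<chi> i. y (basis_vec i)) $i else ?A$i$j) / det ?A)"
    using cramer[of ?A] assms(2) basis_det_eq_det[of m] by simp
  from arg_cong[OF this, of "\<lambda>z. z $ k'"] show ?thesis
    by (simp add: basis_det_eq_det k coord_inv_def basis_vec_inject cong: if_cong)
qed

lemma Ck_on_basis_det:
  assumes "open U" "\<And>b c. b \<in> Basis \<Longrightarrow> c \<in> Basis \<Longrightarrow> Ck_on k U (\<lambda>x. m x b c)"
  shows "Ck_on k U (\<lambda>x. basis_det (m x))"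
  unfolding basis_det_def
  by (intro Ck_on_sum assms(1) Ck_on_mult Ck_on_const Ck_on_prod assms(2)) (auto simp: permutes_in_image)

text \<open>A permutation other than the identity moves at least two points. Even after one factor
  of its product has been differentiated, an off-diagonal entry of the identity matrix remains, so
  only the identity permutation contributes.\<close>

lemma DERIV_basis_det_one:
  fixes P :: "real \<Rightarrow> 'e::euclidean_space \<Rightarrow> 'e \<Rightarrow> real"
  assumes d: "\<And>b c. b \<in> Basis \<Longrightarrow> c \<in> Basis \<Longrightarrow> ((\<lambda>s. P s b c) has_real_derivative P' b c) (at s)"
    and one: "\<And>b c. b \<in> Basis \<Longrightarrow> c \<in> Basis \<Longrightarrow> P s b c = (if b = c then 1 else 0)"
  shows "((\<lambda>s. basis_det (P s)) has_real_derivative (\<Sum>b\<in>Basis. P' b b)) (at s)"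
proof -
  let ?S = "{\<pi>. \<pi> permutes (Basis :: 'e set)}"
  define D where "D \<pi> = (\<Sum>b\<in>Basis. P' b (\<pi> b) * (\<Prod>c\<in>Basis - {b}. P s c (\<pi> c)))" for \<pi>
  have "((\<lambda>s. \<Prod>b\<in>Basis. P s b (\<pi> b)) has_real_derivative D \<pi>) (at s)" if "\<pi> \<in> ?S" for \<pi>
    unfolding D_def using that by (intro has_field_derivative_prod d) (auto simp: permutes_in_image)
  then have "((\<lambda>s. basis_det (P s)) has_real_derivative (\<Sum>\<pi>\<in>?S. of_int (sign \<pi>) * D \<pi>)) (at s)"
    unfolding basis_det_def by (intro DERIV_sum DERIV_cmult) auto
  moreover have "D \<pi> = 0" if p: "\<pi> \<in> ?S - {id}" for \<pi>
  proof -
    obtain a where a: "\<pi> a \<noteq> a" using p by fastforce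
    have "(\<Prod>c\<in>Basis - {b}. P s c (\<pi> c)) = 0" if b: "b \<in> Basis" for b
    proof -
      have aB: "a \<in> Basis" using p a permutes_not_in by fastforce
      have inj: "inj \<pi>" using p permutes_inj by auto
      obtain c where c: "c \<in> Basis" "c \<noteq> b" "\<pi> c \<noteq> c"
      proof (cases "a = b")
        case True
        have "\<pi> (\<pi> a) \<noteq> \<pi> a" using inj a by (auto simp: inj_def)
        moreover have "\<pi> a \<in> Basis" using p aB by (simp add: permutes_in_image)
        ultimately show ?thesis using that[of "\<pi> a"] True a by auto
      qed (use that a aB in auto)
      moreover have "\<pi> c \<in> Basis" using p c by (simp add: permutes_in_image)
      ultimately have "P s c (\<pi> c) = 0" using one[of c "\<pi> c"] by auto
      then show ?thesis using c by (intro prod_zero) auto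
    qed
    then show ?thesis unfolding D_def by (intro sum.neutral ballI) (simp only: mult_zero_right)
  qed
  then have "(\<Sum>\<pi>\<in>?S. of_int (sign \<pi>) * D \<pi>) = (\<Sum>\<pi>\<in>{id}. of_int (sign \<pi>) * D \<pi>)"
    by (intro sum.mono_neutral_right) (auto simp: finite_permutations permutes_id)
  moreover have "D id = (\<Sum>b\<in>Basis. P' b b)"
    using one by (auto simp: D_def intro!: sum.cong)
  ultimately show ?thesis by simp
qed

text \<open>Jacobi's formula, with the inverse of the matrix \<open>A s\<close> given as \<open>K\<close>.\<close>

lemma DERIV_basis_det:
  assumes d: "\<And>b c. b \<in> Basis \<Longrightarrow> c \<in> Basis \<Longrightarrow> ((\<lambda>s. A s b c) has_real_derivative A' b c) (at s)"
    and one: "\<And>b c. b \<in> Basis \<Longrightarrow> c \<in> Basis \<Longrightarrow> (\<Sum>d\<in>Basis. K b d * A s d c) = (if b = c then 1 else 0)"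
  shows "((\<lambda>s. basis_det (A s)) has_real_derivative basis_det (A s) * (\<Sum>b\<in>Basis. \<Sum>d\<in>Basis. K b d * A' d b)) (at s)"
proof -
  have K: "basis_det K * basis_det (A s) = 1"
    unfolding basis_det_mult[symmetric]
    by (rule trans[OF basis_det_cong basis_det_one]) (rule one)
  \<comment> \<open>Multiplication by the constant matrix \<open>K\<close> turns the matrix at the
    point of differentiation into the identity.\<close>
  have "((\<lambda>s. basis_det (\<lambda>b c. \<Sum>d\<in>Basis. K b d * A s d c)) has_real_derivative (\<Sum>b\<in>Basis. \<Sum>d\<in>Basis. K b d * A' d b)) (at s)"
    by (rule DERIV_basis_det_one[where P' = "\<lambda>b c. \<Sum>d\<in>Basis. K b d * A' d c"])
      (intro DERIV_sum DERIV_cmult d, simp_all only: one)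
  from DERIV_cmult[OF this, of "basis_det (A s)"] show ?thesis
    unfolding basis_det_mult using K by (simp add: mult.assoc[symmetric] mult.commute)
qed

definition linear_det :: "('e::euclidean_space \<Rightarrow> 'e) \<Rightarrow> real" where
  "linear_det T = basis_det (\<lambda>b c. T c \<bullet> b)"

text \<open>The Gram matrix of the composition is that of \<open>u\<close> multiplied on both sides
  by the Jacobian matrix of \<open>f\<close>, whence the square.\<close>

lemma gram_det_compose:
  assumes "u differentiable at (f x)" "f differentiable at x"
  shows "gram_det (\<lambda>x. u (f x)) x = (linear_det (diff f x))\<^sup>2 * gram_det u (f x)"
proof -
  let ?D = "diff u (f x)" and ?T = "diff f x"
  have eq: "diff (\<lambda>x. u (f x)) x v = ?D (?T v)" for v
    using assms by (subst frechet_derivative_eqI[OF has_derivative_compose]) (auto intro: differentiable_has_frechet)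
  interpret linear ?D using assms by (auto intro: linear_frechet_derivative)
  have rep: "?D w = (\<Sum>b\<in>Basis. (w \<bullet> b) *\<^sub>R ?D b)" for w
    by (subst (1) euclidean_representation[of w, symmetric]) (simp add: sum scaleR)
  have "gram_det (\<lambda>x. u (f x)) x = basis_det (\<lambda>b c. \<Sum>d\<in>Basis. (?T b \<bullet> d) * (\<Sum>e\<in>Basis. (?D d \<bullet> ?D e) * (?T c \<bullet> e)))"
    unfolding gram_det_basis_det eq
  proof (rule basis_det_cong)
    fix b c
    have 1: "z \<bullet> ?D (?T c) = (\<Sum>e\<in>Basis. (z \<bullet> ?D e) * (?T c \<bullet> e))" for z
      by (subst rep) (simp add: inner_sum_right mult.commute)
    have 2: "?D (?T b) \<bullet> z = (\<Sum>d\<in>Basis. (?T b \<bullet> d) * (?D d \<bullet> z))" for z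
      by (subst rep) (simp add: inner_sum_left)
    show "?D (?T b) \<bullet> ?D (?T c) = (\<Sum>d\<in>Basis. (?T b \<bullet> d) * (\<Sum>e\<in>Basis. (?D d \<bullet> ?D e) * (?T c \<bullet> e)))"
      by (subst 2) (simp only: 1)
  qed
  also have "\<dots> = basis_det (\<lambda>b d. ?T b \<bullet> d) * (basis_det (\<lambda>d e. ?D d \<bullet> ?D e) * basis_det (\<lambda>e c. ?T c \<bullet> e))"
    unfolding basis_det_mult ..
  also have "basis_det (\<lambda>b d. ?T b \<bullet> d) = basis_det (\<lambda>e c. ?T c \<bullet> e)"
    by (rule basis_det_transpose)
  finally show ?thesis
    by (simp add: gram_det_basis_det linear_det_def power2_eq_square mult_ac)
qed

text \<open>The quadratic form of the Gram matrix is the squared length of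
  \<open>diff u y x\<close>.\<close>

lemma gram_det_pos:
  assumes "u differentiable at y" "inj (diff u y)"
  shows "gram_det u y > 0"
  unfolding gram_det_basis_det
proof (rule basis_det_pos)
  fix x :: 'a assume "x \<noteq> 0"
  interpret linear "diff u y" using assms by (auto intro: linear_frechet_derivative)
  have "diff u y x \<noteq> 0" using assms(2) \<open>x \<noteq> 0\<close> zero injD by metis
  then have "0 < diff u y x \<bullet> diff u y x" by simp
  also have "diff u y x = (\<Sum>b\<in>Basis. (x \<bullet> b) *\<^sub>R diff u y b)"
    by (subst (1) euclidean_representation[of x, symmetric]) (simp add: sum scaleR)
  also have "(\<Sum>b\<in>Basis. (x \<bullet> b) *\<^sub>R diff u y b) \<bullet> (\<Sum>b\<in>Basis. (x \<bullet> b) *\<^sub>R diff u y b)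
     = (\<Sum>b\<in>Basis. \<Sum>c\<in>Basis. (x \<bullet> b) * (x \<bullet> c) * (diff u y b \<bullet> diff u y c))"
    by (simp add: inner_sum_left inner_sum_right sum_distrib_left mult_ac inner_commute)
  finally show "0 < (\<Sum>b\<in>Basis. \<Sum>c\<in>Basis. (x \<bullet> b) * (x \<bullet> c) * (diff u y b \<bullet> diff u y c))" .
qed

text \<open>Expansion along the row of \<open>(1, 0)\<close>, which is zero off the diagonal: only
  permutations that fix \<open>(1, 0)\<close> survive, and they permute the basis of the second
  factor.\<close>

lemma basis_det_prod:
  fixes m :: "(real \<times> 'e::euclidean_space) \<Rightarrow> (real \<times> 'e) \<Rightarrow> real"
  assumes z: "\<And>b. b \<in> Basis \<Longrightarrow> m (1, 0) (0, b) = 0"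
  shows "basis_det m = m (1, 0) (1, 0) * basis_det (\<lambda>b c. m (0, b) (0, c))"
proof -
  let ?o = "(1, 0) :: real \<times> 'e" and ?S = "Pair 0 ` Basis :: (real \<times> 'e) set"
  have B: "Basis = insert ?o ?S" by (auto simp: Basis_prod_def)
  have o: "?o \<notin> ?S" by auto
  let ?f = "\<lambda>\<pi>. of_int (sign \<pi>) * (\<Prod>b\<in>Basis. m b (\<pi> b))"
  have "basis_det m = (\<Sum>\<pi> | \<pi> permutes ?S. ?f \<pi>)"
    unfolding basis_det_def
  proof (rule sum.mono_neutral_right)
    show "\<forall>\<pi>\<in>{\<pi>. \<pi> permutes Basis} - {\<pi>. \<pi> permutes ?S}. ?f \<pi> = 0"
    proof
      fix \<pi> assume p: "\<pi> \<in> {\<pi>. \<pi> permutes (Basis :: (real \<times> 'e) set)} - {\<pi>. \<pi> permutes ?S}"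
      then have "\<pi> ?o \<noteq> ?o" unfolding B by (metis DiffE mem_Collect_eq permutes_superset insert_Diff_single DiffD2 insert_iff singletonD)
      moreover have "\<pi> ?o \<in> Basis" using p permutes_in_image[of \<pi> Basis ?o] by (simp add: B)
      ultimately have "m ?o (\<pi> ?o) = 0" using z unfolding B by auto
      then have "(\<Prod>b\<in>Basis. m b (\<pi> b)) = 0" by (intro prod_zero) (auto simp: B)
      then show "?f \<pi> = 0" by simp
    qed
    show "{\<pi>. \<pi> permutes ?S} \<subseteq> {\<pi>. \<pi> permutes (Basis :: (real \<times> 'e) set)}"
    proof
      fix \<pi> assume "\<pi> \<in> {\<pi>. \<pi> permutes ?S}"
      then have "\<pi> permutes ?S" by (simp only: mem_Collect_eq)
      then have "\<pi> permutes insert ?o ?S" by (rule permutes_subset) blast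
      then show "\<pi> \<in> {\<pi>. \<pi> permutes (Basis :: (real \<times> 'e) set)}"
        by (simp only: B mem_Collect_eq)
    qed
    show "finite {\<pi>. \<pi> permutes (Basis :: (real \<times> 'e) set)}"
      by (rule finite_permutations[OF finite_Basis])
  qed
  also have "\<dots> = m ?o ?o * (\<Sum>\<pi> | \<pi> permutes ?S. of_int (sign \<pi>) * (\<Prod>b\<in>?S. m b (\<pi> b)))"
    unfolding sum_distrib_left
  proof (intro sum.cong refl)
    fix \<pi> assume "\<pi> \<in> {\<pi>. \<pi> permutes ?S}"
    then have "\<pi> ?o = ?o" by (intro permutes_not_in[OF _ o]) (simp only: mem_Collect_eq)
    moreover have "(\<Prod>b\<in>Basis. m b (\<pi> b)) = m ?o (\<pi> ?o) * (\<Prod>b\<in>?S. m b (\<pi> b))"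
      unfolding B by (rule prod.insert[OF finite_imageI[OF finite_Basis] o])
    ultimately show "?f \<pi> = m ?o ?o * (of_int (sign \<pi>) * (\<Prod>b\<in>?S. m b (\<pi> b)))"
      by (simp only: mult_ac)
  qed
  also have "(\<Sum>\<pi> | \<pi> permutes ?S. of_int (sign \<pi>) * (\<Prod>b\<in>?S. m b (\<pi> b)))
     = basis_det (\<lambda>b c. m (0, b) (0, c))"
    unfolding basis_det_def by (rule sum_permutes_reindex[OF _ finite_Basis]) (simp add: bij_betw_def inj_on_def)
  finally show ?thesis .
qed

lemma basis_det_scale:
  fixes m :: "'e::euclidean_space \<Rightarrow> 'e \<Rightarrow> real"
  shows "basis_det (\<lambda>b d. c * m b d) = c ^ DIM('e) * basis_det m"
  by (simp add: basis_det_def prod.distrib sum_distrib_left mult_ac)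

section \<open>Change of variables for immersions\<close>

text \<open>Boxes pull back to boxes with the same side lengths, and the measures of boxes determine
  \<open>lborel\<close>.\<close>

lemma distr_coord_iso: "distr lborel borel coord_iso = (lborel :: 'e::euclidean_space measure)"
proof (rule lborel_eqI[symmetric])
  fix l u :: 'e assume lu: "\<And>b. b \<in> Basis \<Longrightarrow> l \<bullet> b \<le> u \<bullet> b"
  have ci: "coord_iso x \<bullet> basis_vec i = x $ i" for x :: "real ^ 'e basis_index" and i
    by (metis coord_inv_def coord_inv_iso vec_lambda_beta)
  have all: "(\<forall>b\<in>Basis. P b) \<longleftrightarrow> (\<forall>i. P (basis_vec i))" for P :: "'e \<Rightarrow> bool"
    using bij_basis_vec by (metis bij_betw_def rangeE basis_vec_in_Basis rangeI)
  have "coord_iso -` box l u = box (coord_inv l) (coord_inv u)"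
    by (auto simp: box_def mem_box_cart all ci coord_inv_def set_eq_iff Basis_vec_def inner_axis)
  moreover have "(coord_iso :: _ \<Rightarrow> 'e) \<in> borel_measurable borel"
    by (intro borel_measurable_continuous_onI linear_continuous_on bounded_linear_coord_iso)
  ultimately have "emeasure (distr lborel borel coord_iso) (box l u) = emeasure lborel (box (coord_inv l) (coord_inv u))"
    by (simp add: emeasure_distr)
  also have "\<dots> = ennreal (\<Prod>b\<in>Basis. (coord_inv u - coord_inv l) \<bullet> b)"
    by (rule emeasure_lborel_box)
      (use lu in \<open>auto simp: Basis_vec_def inner_axis coord_inv_def\<close>)
  also have "(\<Prod>b\<in>Basis. (coord_inv u - coord_inv l) \<bullet> b)
     = (\<Prod>i\<in>UNIV. (coord_inv u - coord_inv l) \<bullet> axis i 1)"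
    by (rule prod.reindex_bij_betw[symmetric]) (auto simp: bij_betw_def inj_on_def axis_eq_axis Basis_vec_def)
  also have "\<dots> = (\<Prod>i\<in>UNIV. (u - l) \<bullet> basis_vec i)"
    by (simp add: inner_axis coord_inv_def inner_diff_left)
  also have "\<dots> = (\<Prod>b\<in>Basis. (u - l) \<bullet> b)"
    by (rule prod.reindex_bij_betw[OF bij_basis_vec])
  finally show "emeasure (distr lborel borel coord_iso) (box l u) = ennreal (\<Prod>b\<in>Basis. (u - l) \<bullet> b)" .
qed simp

lemma coord_iso_measurable [measurable]: "coord_iso \<in> borel_measurable borel"
  by (intro borel_measurable_continuous_onI linear_continuous_on bounded_linear_coord_iso)

lemma emeasure_lborel_coord_iso:
  "S \<in> sets borel \<Longrightarrow> emeasure lborel S = emeasure lborel (coord_iso -` S)"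
  by (subst distr_coord_iso[symmetric]) (simp add: emeasure_distr)

lemma nn_integral_coord_iso:
  "f \<in> borel_measurable borel \<Longrightarrow> (\<integral>\<^sup>+x. f x \<partial>lborel) = (\<integral>\<^sup>+x. f (coord_iso x) \<partial>lborel)"
  by (subst distr_coord_iso[symmetric]) (simp add: nn_integral_distr)

lemma emeasure_lborel_image_cart:
  fixes g :: "real^'n::{finite,wellorder} \<Rightarrow> real^'n::_"
  assumes S: "S \<in> sets borel" "g ` S \<in> sets borel"
    and d: "\<And>x. x \<in> S \<Longrightarrow> (g has_derivative g' x) (at x)"
    and inj: "inj_on g S"
    and m: "(\<lambda>x. indicator S x * \<bar>det (matrix (g' x))\<bar>) \<in> borel_measurable borel"
  shows "emeasure lborel (g ` S) = (\<integral>\<^sup>+x\<in>S. ennreal \<bar>det (matrix (g' x))\<bar> \<partial>lborel)"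
proof -
  have S': "S \<in> sets lebesgue" using S by simp
  note d' = has_derivative_at_withinI[OF d]
  have em: "emeasure lborel (g ` S) = emeasure lebesgue (g ` S)" using S by simp
  have ind: "(\<integral>\<^sup>+x\<in>S. ennreal \<bar>det (matrix (g' x))\<bar> \<partial>lborel) = (\<integral>\<^sup>+x. ennreal (indicator S x * \<bar>det (matrix (g' x))\<bar>) \<partial>lborel)"
    by (intro nn_integral_cong) (auto split: split_indicator)
  show ?thesis
  proof (cases "(\<lambda>x. \<bar>det (matrix (g' x))\<bar>) integrable_on S")
    case True
    then have lm: "g ` S \<in> lmeasurable"
      using measurable_differentiable_image_eq[OF S' d' inj] by blast
    have "emeasure lebesgue (g ` S) = ennreal (measure lebesgue (g ` S))"
      by (rule emeasure_eq_measure2[OF lm])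
    also have "\<dots> = ennreal (integral S (\<lambda>x. \<bar>det (matrix (g' x))\<bar>))"
      using measure_differentiable_image_eq[OF S' d' inj True] by simp
    also have "\<dots> = (\<integral>\<^sup>+x\<in>S. ennreal \<bar>det (matrix (g' x))\<bar> \<partial>lborel)"
      by (rule nn_integral_has_integral_lebesgue'[symmetric]) (use True in auto)
    finally show ?thesis using em by simp
  next
    \<comment> \<open>Both sides are infinite: the image has no finite measure, and a finite
      integral would make the Jacobian integrable.\<close>
    case False
    then have "g ` S \<notin> lmeasurable"
      using measurable_differentiable_image_eq[OF S' d' inj] by blast
    then have "emeasure lebesgue (g ` S) = \<infinity>"
      using S(2) by (simp add: fmeasurable_def less_top[symmetric])
    moreover have "(\<integral>\<^sup>+x. ennreal (indicator S x * \<bar>det (matrix (g' x))\<bar>) \<partial>lborel) = \<infinity>"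
    proof (rule ccontr)
      assume "(\<integral>\<^sup>+x. ennreal (indicator S x * \<bar>det (matrix (g' x))\<bar>) \<partial>lborel) \<noteq> \<infinity>"
      then have "(\<lambda>x. indicator S x * \<bar>det (matrix (g' x))\<bar>) integrable_on UNIV"
        by (intro nn_integral_integrable_on m) (auto simp: less_top)
      moreover have "(\<lambda>x. indicator S x * \<bar>det (matrix (g' x))\<bar>) = (\<lambda>x. if x \<in> S then \<bar>det (matrix (g' x))\<bar> else 0)"
        by (auto simp: fun_eq_iff)
      ultimately show False using False by (simp add: integrable_restrict_UNIV)
    qed
    ultimately show ?thesis using em ind by simp
  qed
qed

text \<open>The Cartesian case conjugated by the measure preserving
  \<open>coord_iso\<close>.\<close>

lemma emeasure_lborel_image:
  fixes g :: "'e::euclidean_space \<Rightarrow> 'e"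
  assumes S: "S \<in> sets borel" "g ` S \<in> sets borel"
    and d: "\<And>x. x \<in> S \<Longrightarrow> (g has_derivative g' x) (at x)"
    and inj: "inj_on g S"
    and m: "(\<lambda>x. indicator S x * \<bar>linear_det (g' x)\<bar>) \<in> borel_measurable borel"
  shows "emeasure lborel (g ` S) = (\<integral>\<^sup>+x\<in>S. ennreal \<bar>linear_det (g' x)\<bar> \<partial>lborel)"
proof -
  define h where "h x = coord_inv (g (coord_iso x))" for x
  define h' where "h' x v = coord_inv (g' (coord_iso x) (coord_iso v))" for x v
  have dt: "det (matrix (h' x)) = linear_det (g' (coord_iso x))" for x
    by (simp add: linear_det_def basis_det_eq_det matrix_def h'_def coord_iso_axis)
      (simp add: coord_inv_def)
  let ?S = "coord_iso -` S"
  have im: "h ` ?S = coord_iso -` (g ` S)"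
  proof -
    have "coord_iso -` (g ` S) \<subseteq> h ` ?S"
    proof
      fix y assume "y \<in> coord_iso -` (g ` S)"
      then obtain x where "x \<in> S" "coord_iso y = g x" by auto
      then show "y \<in> h ` ?S"
        by (intro image_eqI[of _ _ "coord_inv x"]) (auto simp: h_def, metis coord_inv_iso)
    qed
    then show ?thesis by (auto simp: h_def)
  qed
  have Sb: "?S \<in> sets borel" "coord_iso -` (g ` S) \<in> sets borel"
    using measurable_sets[OF coord_iso_measurable] S by auto
  have "emeasure lborel (g ` S) = emeasure lborel (h ` ?S)"
    unfolding im by (rule emeasure_lborel_coord_iso[OF S(2)])
  also have "\<dots> = (\<integral>\<^sup>+x\<in>?S. ennreal \<bar>det (matrix (h' x))\<bar> \<partial>lborel)"
  proof (rule emeasure_lborel_image_cart)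
    show "inj_on h ?S"
      using inj by (auto simp: inj_on_def h_def) (metis coord_inv_iso coord_iso_inv)
    have "(\<lambda>x. indicator S (coord_iso x) * \<bar>linear_det (g' (coord_iso x))\<bar>) \<in> borel_measurable borel"
      using measurable_compose[OF coord_iso_measurable m] .
    then show "(\<lambda>x. indicator ?S x * \<bar>det (matrix (h' x))\<bar>) \<in> borel_measurable borel"
      by (simp add: dt indicator_vimage)
    fix x assume "x \<in> ?S"
    then have "(g has_derivative g' (coord_iso x)) (at (coord_iso x))" by (intro d) simp
    then have "((\<lambda>x. g (coord_iso x)) has_derivative (\<lambda>v. g' (coord_iso x) (coord_iso v))) (at x)"
      by (rule has_derivative_compose[OF bounded_linear_imp_has_derivative[OF bounded_linear_coord_iso]])
    then show "(h has_derivative h' x) (at x)"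
      unfolding h_def h'_def by (rule bounded_linear.has_derivative[OF bounded_linear_coord_inv])
  qed (use Sb im in auto)
  also have "\<dots> = (\<integral>\<^sup>+x\<in>S. ennreal \<bar>linear_det (g' x)\<bar> \<partial>lborel)"
  proof -
    have eq: "ennreal \<bar>linear_det (g' x)\<bar> * indicator S x = ennreal (indicator S x * \<bar>linear_det (g' x)\<bar>)" for x
      by (auto split: split_indicator)
    have "(\<lambda>x. ennreal \<bar>linear_det (g' x)\<bar> * indicator S x) \<in> borel_measurable borel"
      unfolding eq using m by measurable
    from nn_integral_coord_iso[OF this] show ?thesis
      by (simp add: dt indicator_vimage)
  qed
  finally show ?thesis .
qed

lemma nn_integral_change_of_variables:
  fixes g :: "'e::euclidean_space \<Rightarrow> 'e"
  assumes S: "S \<in> sets borel" "g ` S \<in> sets borel"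
    and d: "\<And>x. x \<in> S \<Longrightarrow> (g has_derivative g' x) (at x)"
    and inj: "inj_on g S"
    and m: "(\<lambda>x. indicator S x * \<bar>linear_det (g' x)\<bar>) \<in> borel_measurable borel"
    and f: "f \<in> borel_measurable borel"
  shows "(\<integral>\<^sup>+x\<in>g ` S. f x \<partial>lborel) = (\<integral>\<^sup>+x\<in>S. ennreal \<bar>linear_det (g' x)\<bar> * f (g x) \<partial>lborel)"
proof -
  \<comment> \<open>A Borel map on the whole space that agrees with \<open>g\<close> on
    \<open>S\<close>; the value 0 elsewhere is never seen, since the density \<open>?w\<close> below
    vanishes there.\<close>
  define h where "h x = (if x \<in> S then g x else 0)" for x
  have "continuous_on S g"
    using d by (auto intro!: continuous_at_imp_continuous_on has_derivative_continuous)
  then have h [measurable]: "h \<in> borel_measurable borel"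
    unfolding h_def by (intro borel_measurable_continuous_on_if S) auto
  let ?w = "\<lambda>x. ennreal (indicator S x * \<bar>linear_det (g' x)\<bar>)"
  have w [measurable]: "?w \<in> borel_measurable borel" using m by measurable
  \<comment> \<open>The formula for general integrands is an identity of measures: \<open>g\<close>
    pushes the Jacobian density on \<open>S\<close> forward to Lebesgue measure on the image. On a
    set \<open>C\<close> it is the preceding lemma for the part of \<open>S\<close> that is mapped
    into \<open>C\<close>.\<close>
  have eq: "density lborel (indicator (g ` S)) = distr (density lborel ?w) borel h"
  proof (rule measure_eqI)
    fix C assume C: "C \<in> sets (density lborel (indicator (g ` S) :: 'e \<Rightarrow> ennreal))"
    let ?T = "S \<inter> h -` C"
    have T: "?T \<in> sets borel" using S measurable_sets[OF h] C by auto
    have gT: "g ` ?T = g ` S \<inter> C" by (auto simp: h_def)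
    have "emeasure (density lborel (indicator (g ` S))) C = emeasure lborel (g ` ?T)"
      using C S gT by (subst emeasure_density) (auto simp flip: indicator_inter_arith)
    also have "\<dots> = (\<integral>\<^sup>+x\<in>?T. ennreal \<bar>linear_det (g' x)\<bar> \<partial>lborel)"
    proof (rule emeasure_lborel_image)
      have "(\<lambda>x. indicator ?T x * (indicator S x * \<bar>linear_det (g' x)\<bar>)) \<in> borel_measurable borel"
        using T m by measurable
      moreover have "(\<lambda>x. indicator ?T x * (indicator S x * \<bar>linear_det (g' x)\<bar>)) = (\<lambda>x. indicator ?T x * \<bar>linear_det (g' x)\<bar>)"
        by (auto simp: fun_eq_iff split: split_indicator)
      ultimately show "(\<lambda>x. indicator ?T x * \<bar>linear_det (g' x)\<bar>) \<in> borel_measurable borel" by simp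
      show "g ` ?T \<in> sets borel" unfolding gT using S C by auto
    qed (use T d inj in \<open>auto intro: inj_on_subset\<close>)
    also have "\<dots> = (\<integral>\<^sup>+x. ?w x * indicator (h -` C) x \<partial>lborel)"
      by (intro nn_integral_cong) (auto split: split_indicator)
    also have "\<dots> = emeasure (distr (density lborel ?w) borel h) C"
      using C measurable_sets[OF h, of C] emeasure_density[OF w[folded measurable_lborel2], of "h -` C"]
      by (simp add: emeasure_distr)
    finally show "emeasure (density lborel (indicator (g ` S))) C = emeasure (distr (density lborel ?w) borel h) C" .
  qed simp
  have "(\<integral>\<^sup>+x\<in>g ` S. f x \<partial>lborel) = (\<integral>\<^sup>+x. f x \<partial>density lborel (indicator (g ` S)))"
    using S f by (subst nn_integral_density) (auto simp: mult.commute)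
  also have "\<dots> = (\<integral>\<^sup>+x. ?w x * f (h x) \<partial>lborel)"
  proof -
    have fh: "(\<lambda>x. f (h x)) \<in> borel_measurable lborel"
      using measurable_compose[OF h f] by simp
    have "?w \<in> borel_measurable lborel" using w by simp
    from nn_integral_density[OF this fh] show ?thesis
      unfolding eq using f h by (simp add: nn_integral_distr)
  qed
  also have "\<dots> = (\<integral>\<^sup>+x\<in>S. ennreal \<bar>linear_det (g' x)\<bar> * f (g x) \<partial>lborel)"
    by (intro nn_integral_cong) (auto split: split_indicator simp: h_def)
  finally show ?thesis .
qed

section \<open>The Riemannian measure\<close>

text \<open>The property by which the definite description \<open>volume_measure\<close> singles out
  its value; existence and uniqueness are shown separately.\<close>

definition is_volume_measure ::
  "('a::{t2_space,second_countable_topology}, 'e::euclidean_space) atlas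
     \<Rightarrow> ('a \<Rightarrow> 'v::euclidean_space) \<Rightarrow> 'a measure \<Rightarrow> bool" where
  "is_volume_measure A f \<mu> \<longleftrightarrow> sets \<mu> = sets (restrict_space borel (points A)) \<and>
     (\<forall>(V, p)\<in>A. \<forall>B\<in>sets borel. B \<subseteq> V \<longrightarrow>
        emeasure \<mu> (p ` B) = (\<integral>\<^sup>+y\<in>B. ennreal (sqrt (gram_det (f \<circ> p) y)) \<partial>lborel))"

text \<open>A set is cut along a finite cover by charts, and in each chart the local formula
  prescribes the measure of the piece. Only the charts of the cover \<open>C\<close> are assumed to
  be well behaved, so that the product atlas can be treated in the same way without being an
  instance of \<open>closed_atlas\<close>.\<close>

lemma is_volume_measure_unique:
  assumes \<mu>: "is_volume_measure A f \<mu>" and \<nu>: "is_volume_measure A f \<nu>"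
    and C: "finite C" "C \<subseteq> A" "points A \<subseteq> (\<Union>(V, p)\<in>C. p ` V)"
    and ch: "\<And>V p. (V, p) \<in> C \<Longrightarrow> V \<in> sets borel \<and> continuous_on V p \<and> p ` V \<in> sets borel"
    and A: "points A \<in> sets borel"
  shows "\<mu> = \<nu>"
proof (rule measure_eqI)
  show sets_eq: "sets \<mu> = sets \<nu>" using \<mu> \<nu> by (simp add: is_volume_measure_def)
  have sets_iff: "X \<in> sets \<mu> \<longleftrightarrow> X \<in> sets borel \<and> X \<subseteq> points A" for X
    using \<mu> A by (auto simp: is_volume_measure_def sets_restrict_space_iff)
  have *: "emeasure \<mu> X = emeasure \<nu> X" if "finite D" "D \<subseteq> C" "X \<in> sets \<mu>" "X \<subseteq> (\<Union>(V, p)\<in>D. p ` V)" for D X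
    using that
  proof (induction D arbitrary: X rule: finite_induct)
    case empty
    then show ?case by simp
  next
    case (insert c D)
    obtain V p where c: "c = (V, p)" by fastforce
    then have Vp: "(V, p) \<in> C" "(V, p) \<in> A" using insert.prems C by auto
    note V = ch[OF Vp(1)]
    let ?Y = "X \<inter> p ` V" and ?B = "V \<inter> p -` X"
    have Xb: "X \<in> sets borel" "X \<subseteq> points A" using insert.prems sets_iff by auto
    have "p \<in> measurable (restrict_space borel V) borel"
      using V by (intro borel_measurable_continuous_on_restrict) auto
    from measurable_sets[OF this Xb(1)] have "?B \<in> sets borel"
      using V by (simp add: sets_restrict_space_iff space_restrict_space Int_commute)
    moreover have Y: "?Y = p ` ?B" by auto
    ultimately have eqY: "emeasure \<mu> ?Y = emeasure \<nu> ?Y"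
      using \<mu> \<nu> Vp unfolding Y is_volume_measure_def by fastforce
    have Ys: "?Y \<in> sets \<mu>" "X - p ` V \<in> sets \<mu>"
      using Xb V by (auto simp: sets_iff)
    have eqX: "emeasure \<mu> (X - p ` V) = emeasure \<nu> (X - p ` V)"
      by (rule insert.IH) (use insert.prems Ys c in auto)
    have "emeasure M X = emeasure M ?Y + emeasure M (X - p ` V)" if "sets M = sets \<mu>" for M
    proof -
      have "?Y \<union> (X - p ` V) = X" "?Y \<inter> (X - p ` V) = {}" by auto
      then show ?thesis using plus_emeasure[of ?Y M "X - p ` V"] Ys that by simp
    qed
    then show ?case using eqY eqX sets_eq by simp
  qed
  fix X assume X: "X \<in> sets \<mu>"
  show "emeasure \<mu> X = emeasure \<nu> X"
    by (rule *[OF C(1) order_refl X]) (use X C(3) sets_iff in auto)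
qed

lemma volume_measure_eqI:
  assumes "is_volume_measure A f \<mu>" "\<And>\<nu>. is_volume_measure A f \<nu> \<Longrightarrow> \<nu> = \<mu>"
  shows "volume_measure A f = \<mu>"
  unfolding volume_measure_def is_volume_measure_def[symmetric]
  by (rule the_equality) (fact assms)+

section \<open>Charts of a closed manifold\<close>

locale closed_atlas =
  fixes A :: "('a::{t2_space,second_countable_topology}, 'e::euclidean_space) atlas"
  assumes closed_mfd: "closed_manifold A"
begin

lemma compact_points: "compact (points A)" and points_nonempty: "points A \<noteq> {}"
  using closed_mfd by (auto simp: closed_manifold_def)

lemma points_borel [measurable]: "points A \<in> sets borel"
  by (intro borel_closed compact_imp_closed compact_points)

lemma chart_open: "(V, p) \<in> A \<Longrightarrow> open V"
  using closed_mfd by (auto simp: closed_manifold_def smooth_atlas_def)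

lemma chart_in_points: "(V, p) \<in> A \<Longrightarrow> y \<in> V \<Longrightarrow> p y \<in> points A"
  by (auto simp: points_def)

lemma chart_homeo: "(V, p) \<in> A \<Longrightarrow> \<exists>q. homeomorphism V (p ` V) p q"
  using closed_mfd by (auto simp: closed_manifold_def smooth_atlas_def)

lemma chart_cont: "(V, p) \<in> A \<Longrightarrow> continuous_on V p"
  using chart_homeo by (auto simp: homeomorphism_def)

lemma chart_inj: "(V, p) \<in> A \<Longrightarrow> inj_on p V"
  using chart_homeo unfolding homeomorphism_def inj_on_def by metis

lemma chart_inv_cont:
  assumes "(V, p) \<in> A"
  shows "continuous_on (p ` V) (inv_into V p)"
proof -
  obtain q where q: "homeomorphism V (p ` V) p q" using chart_homeo[OF assms] by blast
  have "inv_into V p x = q x" if "x \<in> p ` V" for x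
    using that q chart_inj[OF assms] by (auto simp: homeomorphism_def)
  then show ?thesis
    using q unfolding homeomorphism_def by (metis continuous_on_cong)
qed

lemma chart_image_open:
  assumes "(V, p) \<in> A" "open U" "U \<subseteq> V"
  obtains T where "open T" "p ` U = T \<inter> points A"
proof -
  have 1: "openin (top_of_set (points A)) (p ` V)"
    using assms closed_mfd by (auto simp: closed_manifold_def smooth_atlas_def)
  obtain q where q: "homeomorphism V (p ` V) p q" using chart_homeo[OF assms(1)] by blast
  have "openin (top_of_set (p ` V)) (p ` U)"
    by (rule homeomorphism_imp_open_map[OF q]) (use assms in \<open>auto simp: openin_open_eq chart_open\<close>)
  with 1 have "openin (top_of_set (points A)) (p ` U)" using openin_trans by blast
  then show ?thesis using that unfolding openin_open by (metis Int_commute)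
qed

lemma chart_image_borel:
  assumes Vp: "(V, p) \<in> A" and B: "B \<in> sets borel" "B \<subseteq> V"
  shows "p ` B \<in> sets borel"
proof -
  obtain T where "open T" "p ` V = T \<inter> points A"
    using chart_image_open[OF Vp chart_open[OF Vp] order_refl] .
  then have pV: "p ` V \<in> sets borel" by auto
  have "inv_into V p \<in> measurable (restrict_space borel (p ` V)) borel"
    using chart_inv_cont[OF Vp] by (rule borel_measurable_continuous_on_restrict)
  from measurable_sets[OF this B(1)] have "inv_into V p -` B \<inter> p ` V \<in> sets borel"
    using pV by (simp add: sets_restrict_space_iff space_restrict_space)
  moreover have "inv_into V p -` B \<inter> p ` V = p ` B"
    using B(2) chart_inj[OF Vp] by auto
  ultimately show ?thesis by simp
qed

lemma chart_vimage_borel: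
  assumes Vp: "(V, p) \<in> A" and X: "X \<in> sets borel"
  shows "V \<inter> p -` X \<in> sets borel"
proof -
  have "p \<in> measurable (restrict_space borel V) borel"
    using chart_cont[OF Vp] by (intro borel_measurable_continuous_on_restrict)
  from measurable_sets[OF this X] show ?thesis
    using chart_open[OF Vp] by (simp add: sets_restrict_space_iff space_restrict_space Int_commute)
qed

text \<open>The open balls give the cover, while the compact balls around them bound densities and
  carry the supports of cutoff functions.\<close>

lemma finite_ball_cover:
  obtains F where "finite F"
    "\<forall>(V, p, z, \<rho>)\<in>F. (V, p) \<in> A \<and> 0 < \<rho> \<and> cball z \<rho> \<subseteq> V"
    "points A \<subseteq> (\<Union>(V, p, z, \<rho>)\<in>F. p ` ball z \<rho>)"
proof -
  let ?C = "{(V, p, z, \<rho>). (V, p) \<in> A \<and> 0 < \<rho> \<and> cball z \<rho> \<subseteq> V}"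
  define T where "T V p z \<rho> = (SOME T. open T \<and> p ` ball z \<rho> = T \<inter> points A)" for V :: "'e set" and p :: "'e \<Rightarrow> 'a" and z \<rho>
  have T: "open (T V p z \<rho>) \<and> p ` ball z \<rho> = T V p z \<rho> \<inter> points A" if c: "(V, p, z, \<rho>) \<in> ?C" for V p z \<rho>
  proof -
    have "(V, p) \<in> A" "ball z \<rho> \<subseteq> V" using c ball_subset_cball[of z \<rho>] by auto
    from chart_image_open[OF this(1) open_ball this(2)]
    obtain T' where "open T' \<and> p ` ball z \<rho> = T' \<inter> points A" by metis
    then show ?thesis unfolding T_def by (rule someI)
  qed
  have cov: "points A \<subseteq> (\<Union>c\<in>?C. case c of (V, p, z, \<rho>) \<Rightarrow> T V p z \<rho>)"
  proof
    fix x assume "x \<in> points A"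
    then obtain V p z where Vp: "(V, p) \<in> A" "z \<in> V" "x = p z" by (auto simp: points_def)
    then obtain \<rho> where "0 < \<rho>" "cball z \<rho> \<subseteq> V" using chart_open open_contains_cball by metis
    then have c: "(V, p, z, \<rho>) \<in> ?C" using Vp by auto
    moreover have "x \<in> T V p z \<rho>" using T[OF c] Vp \<open>0 < \<rho>\<close> by auto
    ultimately show "x \<in> (\<Union>c\<in>?C. case c of (V, p, z, \<rho>) \<Rightarrow> T V p z \<rho>)" by (intro UN_I[OF c]) auto
  qed
  obtain F where F: "F \<subseteq> ?C" "finite F" "points A \<subseteq> (\<Union>c\<in>F. case c of (V, p, z, \<rho>) \<Rightarrow> T V p z \<rho>)"
  proof (rule compactE_image[OF compact_points _ cov])
    fix c assume c: "c \<in> ?C"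
    obtain V p z \<rho> where "c = (V, p, z, \<rho>)" by (cases c)
    then show "open (case c of (V, p, z, \<rho>) \<Rightarrow> T V p z \<rho>)" using T[of V p z \<rho>] c by simp
  qed
  show ?thesis
  proof
    show "points A \<subseteq> (\<Union>(V, p, z, \<rho>)\<in>F. p ` ball z \<rho>)"
    proof
      fix x assume x: "x \<in> points A"
      then obtain V p z \<rho> where c: "(V, p, z, \<rho>) \<in> F" "x \<in> T V p z \<rho>" using F(3) by fastforce
      then have "x \<in> p ` ball z \<rho>" using T[of V p z \<rho>] F(1) x by auto
      then show "x \<in> (\<Union>(V, p, z, \<rho>)\<in>F. p ` ball z \<rho>)" using c by fastforce
    qed
  qed (use F in auto)
qed

lemma finite_chart_cover:
  obtains C where "finite C" "C \<subseteq> A" "points A \<subseteq> (\<Union>(V, p)\<in>C. p ` V)"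
proof -
  obtain F where F: "finite F"
    "\<forall>(V, p, z, \<rho>)\<in>F. (V, p) \<in> A \<and> 0 < \<rho> \<and> cball z \<rho> \<subseteq> V"
    "points A \<subseteq> (\<Union>(V, p, z, \<rho>)\<in>F. p ` ball z \<rho>)"
    by (rule finite_ball_cover)
  show ?thesis
  proof (rule that[of "(\<lambda>(V, p, z, \<rho>). (V, p)) ` F"])
    show "points A \<subseteq> (\<Union>(V, p)\<in>(\<lambda>(V, p, z, \<rho>). (V, p)) ` F. p ` V)"
    proof
      fix x assume "x \<in> points A"
      then obtain V p z \<rho> where c: "(V, p, z, \<rho>) \<in> F" "x \<in> p ` ball z \<rho>" using F(3) by fastforce
      then have "x \<in> p ` V" using F(2) c(1) ball_subset_cball[of z \<rho>] by blast
      then show "x \<in> (\<Union>(V, p)\<in>(\<lambda>(V, p, z, \<rho>). (V, p)) ` F. p ` V)" using c(1) by force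
    qed
  qed (use F in auto)
qed

lemma transition:
  assumes Vp: "(V, p) \<in> A" and Wq: "(W, q) \<in> A"
  defines "O' \<equiv> W \<inter> q -` (p ` V)" and "\<tau> \<equiv> inv_into V p \<circ> q"
  shows "open O'" "smooth_on O' \<tau>" "inj_on \<tau> O'"
    and "\<And>y. y \<in> O' \<Longrightarrow> \<tau> y \<in> V" "\<And>y. y \<in> O' \<Longrightarrow> p (\<tau> y) = q y"
proof -
  obtain T where T: "open T" "p ` V = T \<inter> points A"
    using chart_image_open[OF Vp chart_open[OF Vp] order_refl] .
  have "O' = W \<inter> q -` T"
    unfolding O'_def T(2) using chart_in_points[OF Wq] by auto
  then show "open O'"
    using continuous_open_preimage[OF chart_cont[OF Wq] chart_open[OF Wq] T(1)] by simp
  show "smooth_on O' \<tau>"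
    using closed_mfd Vp Wq unfolding closed_manifold_def smooth_atlas_def O'_def \<tau>_def by fastforce
  show tV: "\<tau> y \<in> V" if "y \<in> O'" for y
    using that by (auto simp: O'_def \<tau>_def inv_into_into)
  show p\<tau>: "p (\<tau> y) = q y" if "y \<in> O'" for y
    using that by (auto simp: O'_def \<tau>_def f_inv_into_f)
  show "inj_on \<tau> O'"
  proof (rule inj_onI)
    fix x y assume xy: "x \<in> O'" "y \<in> O'" "\<tau> x = \<tau> y"
    then have "q x = q y" using p\<tau> by metis
    then show "x = y" using xy chart_inj[OF Wq] by (auto simp: O'_def inj_on_def)
  qed
qed

end

section \<open>Existence and finiteness of the Riemannian measure\<close>

locale closed_immersion = closed_atlas A
  for A :: "('a::{t2_space,second_countable_topology}, 'e::euclidean_space) atlas" +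
  fixes f :: "'a \<Rightarrow> 'v::euclidean_space"
  assumes immersion: "immersion A f"
begin

lemma chart_smooth: "(V, p) \<in> A \<Longrightarrow> smooth_on V (f \<circ> p)"
  using immersion by (auto simp: immersion_def smooth_map_def)

lemma chart_Ck: "(V, p) \<in> A \<Longrightarrow> Ck_on k V (f \<circ> p)"
  using chart_smooth smooth_onD by blast

lemma chart_differentiable: "(V, p) \<in> A \<Longrightarrow> y \<in> V \<Longrightarrow> (f \<circ> p) differentiable at y"
  using Ck1_imp(1)[OF chart_Ck] by blast

lemma chart_inj_diff: "(V, p) \<in> A \<Longrightarrow> y \<in> V \<Longrightarrow> inj (diff (f \<circ> p) y)"
  using immersion by (auto simp: immersion_def)

lemma chart_gram_pos: "(V, p) \<in> A \<Longrightarrow> y \<in> V \<Longrightarrow> gram_det (f \<circ> p) y > 0"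
  by (intro gram_det_pos chart_differentiable chart_inj_diff)

lemma chart_gram_Ck: "(V, p) \<in> A \<Longrightarrow> Ck_on k V (gram_det (f \<circ> p))"
proof -
  assume Vp: "(V, p) \<in> A"
  have "Ck_on k V (\<lambda>y. diff (f \<circ> p) y b)" for b
    using chart_Ck[OF Vp, of "Suc k"] by simp
  then show ?thesis
    unfolding gram_det_basis_det[abs_def]
    by (intro Ck_on_basis_det chart_open[OF Vp] Ck_on_inner)
qed

lemma chart_density_cont: "(V, p) \<in> A \<Longrightarrow> continuous_on V (\<lambda>y. sqrt (gram_det (f \<circ> p) y))"
  using chart_gram_Ck[of V p 0] by (simp add: continuous_on_real_sqrt)

text \<open>Nothing is known about \<open>gram_det (f \<circ> p)\<close> outside \<open>V\<close>;
  the indicator makes the density Borel on the whole space.\<close>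

lemma chart_density_measurable:
  assumes "(V, p) \<in> A"
  shows "(\<lambda>y. indicator V y * sqrt (gram_det (f \<circ> p) y)) \<in> borel_measurable borel"
  using borel_measurable_continuous_on_indicator[OF _ chart_density_cont[OF assms]] chart_open[OF assms] by auto

text \<open>Under a change of coordinates the square root of the Gram determinant acquires the
  factor \<open>\<bar>linear_det\<bar>\<close>, which the change of variables absorbs. This is why
  the local formulas in different charts are compatible.\<close>

lemma chart_volume_change:
  assumes Vp: "(V, p) \<in> A" and Wq: "(W, q) \<in> A"
    and B: "B \<in> sets borel" "B \<subseteq> W" "q ` B \<subseteq> p ` V"
  shows "(\<integral>\<^sup>+y\<in>V \<inter> p -` (q ` B). ennreal (sqrt (gram_det (f \<circ> p) y)) \<partial>lborel)
       = (\<integral>\<^sup>+y\<in>B. ennreal (sqrt (gram_det (f \<circ> q) y)) \<partial>lborel)"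
proof -
  define O' where "O' = W \<inter> q -` (p ` V)"
  define \<tau> where "\<tau> = inv_into V p \<circ> q"
  note tr = transition[OF Vp Wq, folded O'_def \<tau>_def]
  have BO: "B \<subseteq> O'" using B by (auto simp: O'_def)
  have im: "\<tau> ` B = V \<inter> p -` (q ` B)"
  proof -
    have "y \<in> \<tau> ` B" if y: "y \<in> V" "p y = q x" "x \<in> B" for x y
    proof -
      have "\<tau> x = y" using y chart_inj[OF Vp] by (simp add: \<tau>_def flip: y(2))
      then show ?thesis using y by blast
    qed
    moreover have "\<tau> x \<in> V" "p (\<tau> x) = q x" if "x \<in> B" for x
      using tr(4,5) that BO by auto
    ultimately show ?thesis by (auto simp: image_iff)
  qed
  have C1: "Ck_on (Suc 0) O' \<tau>" using tr(2) by (rule smooth_onD)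
  have ld: "Ck_on 0 O' (\<lambda>x. linear_det (diff \<tau> x))"
    unfolding linear_det_def
    using C1 by (intro Ck_on_basis_det tr(1) Ck_on_inner Ck_on_const) auto
  have "(\<integral>\<^sup>+y\<in>V \<inter> p -` (q ` B). ennreal (sqrt (gram_det (f \<circ> p) y)) \<partial>lborel)
      = (\<integral>\<^sup>+y\<in>\<tau> ` B. ennreal (indicator V y * sqrt (gram_det (f \<circ> p) y)) \<partial>lborel)"
    unfolding im by (intro nn_integral_cong) (auto split: split_indicator)
  also have "\<dots> = (\<integral>\<^sup>+y\<in>B. ennreal \<bar>linear_det (diff \<tau> y)\<bar> * ennreal (indicator V (\<tau> y) * sqrt (gram_det (f \<circ> p) (\<tau> y))) \<partial>lborel)"
  proof (rule nn_integral_change_of_variables)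
    show "\<tau> ` B \<in> sets borel"
      unfolding im by (intro chart_vimage_borel[OF Vp] chart_image_borel[OF Wq] B)
    show "(\<lambda>x. indicator B x * \<bar>linear_det (diff \<tau> x)\<bar>) \<in> borel_measurable borel"
      using borel_measurable_continuous_on_indicator[OF B(1)
        continuous_on_rabs[OF continuous_on_subset[OF ld[unfolded Ck_on.simps] BO]]] by simp
    show "(\<lambda>x. ennreal (indicator V x * sqrt (gram_det (f \<circ> p) x))) \<in> borel_measurable borel"
      using chart_density_measurable[OF Vp] by measurable
  qed (use B BO tr(3) Ck1_imp(2)[OF C1] in \<open>auto intro: inj_on_subset\<close>)
  also have "\<dots> = (\<integral>\<^sup>+y\<in>B. ennreal (sqrt (gram_det (f \<circ> q) y)) \<partial>lborel)"
  proof (intro nn_integral_cong)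
    fix y
    have "\<bar>linear_det (diff \<tau> y)\<bar> * sqrt (gram_det (f \<circ> p) (\<tau> y)) = sqrt (gram_det (f \<circ> q) y)" if "y \<in> B"
    proof -
      have y: "y \<in> O'" using that BO by auto
      have "gram_det (f \<circ> q) y = gram_det (\<lambda>x. (f \<circ> p) (\<tau> x)) y"
        unfolding gram_det_basis_det
        using frechet_derivative_cong_open(1)[OF tr(1) y, of "f \<circ> q" "\<lambda>x. (f \<circ> p) (\<tau> x)"] tr(5) by simp
      also have "\<dots> = (linear_det (diff \<tau> y))\<^sup>2 * gram_det (f \<circ> p) (\<tau> y)"
        using y tr(4) C1 by (intro gram_det_compose chart_differentiable[OF Vp]) auto
      finally show ?thesis by (simp add: real_sqrt_mult)
    qed
    then show "ennreal \<bar>linear_det (diff \<tau> y)\<bar> * ennreal (indicator V (\<tau> y) * sqrt (gram_det (f \<circ> p) (\<tau> y))) * indicator B y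
        = ennreal (sqrt (gram_det (f \<circ> q) y)) * indicator B y"
      using BO tr(4) by (auto split: split_indicator simp flip: ennreal_mult')
  qed
  finally show ?thesis .
qed

text \<open>The manifold is cut into disjoint Borel pieces \<open>D k\<close>, one for each chart of
  a finite cover, and the chart measures of the pieces are added up. In any other chart,
  \<open>chart_volume_change\<close> identifies each summand, and the pieces add up to the whole
  set.\<close>

lemma ex_volume_measure: "\<exists>\<mu>. is_volume_measure A f \<mu>"
proof -
  obtain C where C: "finite C" "C \<subseteq> A" "points A \<subseteq> (\<Union>(V, p)\<in>C. p ` V)"
    by (rule finite_chart_cover)
  obtain c :: "nat \<Rightarrow> _" and N where c: "C = c ` {..<N}"
    using finite_imp_nat_seg_image_inj_on[OF C(1)] by (metis lessThan_def)
  define V p where "V k = fst (c k)" and "p k = snd (c k)" for k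
  have Vp: "(V k, p k) \<in> A" if "k < N" for k
    using that C(2) unfolding c V_def p_def by auto
  define D where "D k = p k ` V k - (\<Union>j<k. p j ` V j)" for k
  have Db: "D k \<in> sets borel" if "k < N" for k
    unfolding D_def using that
    by (intro sets.Diff sets.finite_UN chart_image_borel[OF Vp] borel_open chart_open[OF Vp]) auto
  have Ddisj: "D j \<inter> D k = {}" if "j \<noteq> k" for j k
    using that by (cases rule: linorder_cases[of j k]) (auto simp: D_def)
  have Dcov: "\<exists>k<N. x \<in> D k" if x: "x \<in> points A" for x
  proof -
    have "points A \<subseteq> (\<Union>k<N. p k ` V k)"
      using C(3) unfolding c V_def p_def by (simp add: case_prod_beta)
    then obtain k where k: "k < N" "x \<in> p k ` V k" using x by blast
    define l where "l = (LEAST k. x \<in> p k ` V k)"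
    have "x \<in> p l ` V l" "l \<le> k" unfolding l_def using k(2) by (auto intro: LeastI Least_le)
    moreover have "x \<notin> p j ` V j" if "j < l" for j using that not_less_Least unfolding l_def by blast
    ultimately show ?thesis using k by (auto simp: D_def intro!: exI[of _ l])
  qed
  define w where "w k y = ennreal (indicator (V k) y * sqrt (gram_det (f \<circ> p k) y))" for k y
  have w: "w k \<in> borel_measurable lborel" if "k < N" for k
    unfolding w_def using chart_density_measurable[OF Vp[OF that]] by measurable
  define X' where "X' k X = V k \<inter> p k -` (X \<inter> D k)" for k X
  have X': "X' k X \<in> sets lborel" if "k < N" "X \<in> sets borel" for k X
    unfolding X'_def using chart_vimage_borel[OF Vp[OF that(1)] sets.Int[OF that(2) Db[OF that(1)]]] by simp
  define m where "m X = (\<Sum>k<N. emeasure (density lborel (w k)) (X' k X))" for X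
  define \<mu> where "\<mu> = measure_of (points A) (sets (restrict_space borel (points A))) m"
  have sp: "space (restrict_space borel (points A)) = points A" by (simp add: space_restrict_space)
  have sets_\<mu>: "sets \<mu> = sets (restrict_space borel (points A))"
    unfolding \<mu>_def using sets.space_closed[of "restrict_space borel (points A)"] sets.sigma_sets_eq[of "restrict_space borel (points A)"]
    by (simp add: sp)
  have em: "emeasure \<mu> X = m X" if X: "X \<in> sets (restrict_space borel (points A))" for X
  proof (rule emeasure_measure_of[OF \<mu>_def])
    show "countably_additive (sets \<mu>) m"
    proof (rule countably_additiveI)
      fix Y :: "nat \<Rightarrow> 'a set"
      assume Y: "range Y \<subseteq> sets \<mu>" "disjoint_family Y"
      have Yb: "Y i \<in> sets borel" for i
        using subsetD[OF Y(1) rangeI, of i] points_borel by (simp add: sets_\<mu> sets_restrict_space_iff)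
      have "(\<Sum>i. emeasure (density lborel (w k)) (X' k (Y i))) = emeasure (density lborel (w k)) (X' k (\<Union> (range Y)))" if "k < N" for k
      proof -
        have "(\<Sum>i. emeasure (density lborel (w k)) (X' k (Y i))) = emeasure (density lborel (w k)) (\<Union>i. X' k (Y i))"
          by (rule suminf_emeasure)
            (use X'[OF that Yb] Y(2) in \<open>auto simp: disjoint_family_on_def X'_def\<close>)
        also have "(\<Union>i. X' k (Y i)) = X' k (\<Union> (range Y))" by (auto simp: X'_def)
        finally show ?thesis .
      qed
      then show "(\<Sum>i. m (Y i)) = m (\<Union> (range Y))"
        unfolding m_def by (subst suminf_sum) auto
    qed
  qed (use X sets_\<mu> sets.space_closed[of "restrict_space borel (points A)"] in \<open>auto simp: positive_def m_def X'_def sp\<close>)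
  have chart: "emeasure \<mu> (q ` B) = (\<integral>\<^sup>+y\<in>B. ennreal (sqrt (gram_det (f \<circ> q) y)) \<partial>lborel)"
    if Wq: "(W, q) \<in> A" and B: "B \<in> sets borel" "B \<subseteq> W" for W q B
  proof -
    have qB: "q ` B \<in> sets borel" using chart_image_borel[OF Wq B] .
    have "q ` B \<subseteq> points A" using B(2) chart_in_points[OF Wq] by auto
    with qB have "emeasure \<mu> (q ` B) = m (q ` B)"
      by (intro em) (auto simp: sets_restrict_space_iff)
    also have "\<dots> = (\<Sum>k<N. \<integral>\<^sup>+y\<in>B \<inter> q -` D k. ennreal (sqrt (gram_det (f \<circ> q) y)) \<partial>lborel)"
      unfolding m_def
    proof (intro sum.cong refl)
      fix k assume "k \<in> {..<N}"
      then have k: "k < N" by simp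
      let ?B = "B \<inter> q -` D k"
      have "B \<inter> (W \<inter> q -` D k) \<in> sets borel"
        using B(1) chart_vimage_borel[OF Wq Db[OF k]] by blast
      moreover have "B \<inter> (W \<inter> q -` D k) = ?B" using B(2) by auto
      ultimately have Bk: "?B \<in> sets borel" by simp
      have eq: "X' k (q ` B) = V k \<inter> p k -` (q ` ?B)"
        by (auto simp: X'_def)
      have "emeasure (density lborel (w k)) (X' k (q ` B)) = (\<integral>\<^sup>+y\<in>X' k (q ` B). w k y \<partial>lborel)"
        by (rule emeasure_density[OF w[OF k] X'[OF k qB]])
      also have "\<dots> = (\<integral>\<^sup>+y\<in>V k \<inter> p k -` (q ` ?B). ennreal (sqrt (gram_det (f \<circ> p k) y)) \<partial>lborel)"
        unfolding eq by (intro nn_integral_cong) (auto simp: w_def split: split_indicator)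
      also have "\<dots> = (\<integral>\<^sup>+y\<in>?B. ennreal (sqrt (gram_det (f \<circ> q) y)) \<partial>lborel)"
        using B(2) by (intro chart_volume_change[OF Vp[OF k] Wq Bk]) (auto simp: D_def)
      finally show "emeasure (density lborel (w k)) (X' k (q ` B)) = (\<integral>\<^sup>+y\<in>?B. ennreal (sqrt (gram_det (f \<circ> q) y)) \<partial>lborel)" .
    qed
    also have "\<dots> = (\<integral>\<^sup>+y. (\<Sum>k<N. ennreal (sqrt (gram_det (f \<circ> q) y)) * indicator (B \<inter> q -` D k) y) \<partial>lborel)"
    proof (rule nn_integral_sum[symmetric])
      fix k assume "k \<in> {..<N}"
      then have k: "k < N" by simp
      have "B \<inter> (W \<inter> q -` D k) \<in> sets borel"
        using B(1) chart_vimage_borel[OF Wq Db[OF k]] by blast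
      then have "(\<lambda>y. ennreal (indicator W y * sqrt (gram_det (f \<circ> q) y)) * indicator (B \<inter> (W \<inter> q -` D k)) y) \<in> borel_measurable lborel"
        using chart_density_measurable[OF Wq] by measurable
      moreover have "(\<lambda>y. ennreal (indicator W y * sqrt (gram_det (f \<circ> q) y)) * indicator (B \<inter> (W \<inter> q -` D k)) y)
         = (\<lambda>y. ennreal (sqrt (gram_det (f \<circ> q) y)) * indicator (B \<inter> q -` D k) y)"
        using B(2) by (auto simp: fun_eq_iff split: split_indicator)
      ultimately show "(\<lambda>y. ennreal (sqrt (gram_det (f \<circ> q) y)) * indicator (B \<inter> q -` D k) y) \<in> borel_measurable lborel"
        by simp
    qed
    also have "\<dots> = (\<integral>\<^sup>+y\<in>B. ennreal (sqrt (gram_det (f \<circ> q) y)) \<partial>lborel)"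
    proof (intro nn_integral_cong)
      fix y
      show "(\<Sum>k<N. ennreal (sqrt (gram_det (f \<circ> q) y)) * indicator (B \<inter> q -` D k) y)
         = ennreal (sqrt (gram_det (f \<circ> q) y)) * indicator B y"
      proof (cases "y \<in> B")
        case True
        then have "q y \<in> points A" using B chart_in_points[OF Wq] by auto
        then obtain k where k: "k < N" "q y \<in> D k" using Dcov by blast
        have "{j. j < N \<and> q y \<in> D j} = {k}" using k Ddisj by blast
        then show ?thesis using True by simp
      qed auto
    qed
    finally show "emeasure \<mu> (q ` B) = (\<integral>\<^sup>+y\<in>B. ennreal (sqrt (gram_det (f \<circ> q) y)) \<partial>lborel)" .
  qed
  have "is_volume_measure A f \<mu>"
    unfolding is_volume_measure_def using sets_\<mu> chart by blast
  then show ?thesis by blast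
qed

abbreviation vol :: "'a measure" where "vol \<equiv> volume_measure A f"

lemma is_volume_measure_vol: "is_volume_measure A f vol"
proof -
  obtain \<mu> where \<mu>: "is_volume_measure A f \<mu>" using ex_volume_measure by blast
  obtain C where C: "finite C" "C \<subseteq> A" "points A \<subseteq> (\<Union>(V, p)\<in>C. p ` V)"
    by (rule finite_chart_cover)
  have "\<nu> = \<mu>" if "is_volume_measure A f \<nu>" for \<nu>
  proof (rule is_volume_measure_unique[OF that \<mu> C _ points_borel])
    fix V p assume "(V, p) \<in> C"
    then have Vp: "(V, p) \<in> A" using C(2) by auto
    from borel_open[OF chart_open[OF Vp]] have "V \<in> sets borel" .
    then show "V \<in> sets borel \<and> continuous_on V p \<and> p ` V \<in> sets borel"
      using chart_cont[OF Vp] chart_image_borel[OF Vp] by blast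
  qed
  from volume_measure_eqI[OF \<mu> this] \<mu> show ?thesis by simp
qed

lemma sets_vol: "sets vol = sets (restrict_space borel (points A))"
  using is_volume_measure_vol by (simp add: is_volume_measure_def)

lemma space_vol: "space vol = points A"
  using sets_eq_imp_space_eq[OF sets_vol] by (simp add: space_restrict_space)

lemma in_sets_vol_iff: "X \<in> sets vol \<longleftrightarrow> X \<in> sets borel \<and> X \<subseteq> points A"
  by (auto simp: sets_vol sets_restrict_space_iff)

lemma emeasure_vol:
  "(V, p) \<in> A \<Longrightarrow> B \<in> sets borel \<Longrightarrow> B \<subseteq> V \<Longrightarrow>
     emeasure vol (p ` B) = (\<integral>\<^sup>+y\<in>B. ennreal (sqrt (gram_det (f \<circ> p) y)) \<partial>lborel)"
  using is_volume_measure_vol by (auto simp: is_volume_measure_def)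

text \<open>The density is bounded on each of finitely many compact balls that cover the
  manifold.\<close>

lemma finite_measure_vol: "finite_measure vol"
proof
  obtain F where F: "finite F"
    "\<forall>(V, p, z, \<rho>)\<in>F. (V, p) \<in> A \<and> 0 < \<rho> \<and> cball z \<rho> \<subseteq> V"
    "points A \<subseteq> (\<Union>(V, p, z, \<rho>)\<in>F. p ` ball z \<rho>)"
    by (rule finite_ball_cover)
  let ?c = "\<lambda>(V, p, z, \<rho>). p ` cball z \<rho>"
  have sub: "space vol \<subseteq> (\<Union>c\<in>F. ?c c)"
    unfolding space_vol by (rule order_trans[OF F(3)], rule UN_mono) auto
  have s: "?c c \<in> sets vol" if "c \<in> F" for c
  proof -
    obtain V p z \<rho> where c: "c = (V, p, z, \<rho>)" by (cases c)
    with that F(2) have "(V, p) \<in> A" "cball z \<rho> \<subseteq> V" by auto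
    then show ?thesis unfolding c in_sets_vol_iff
      using chart_image_borel[of V p "cball z \<rho>"] chart_in_points[of V p] by auto
  qed
  have fin: "emeasure vol (?c c) < \<infinity>" if "c \<in> F" for c
  proof -
    obtain V p z \<rho> where c: "c = (V, p, z, \<rho>)" by (cases c)
    with that F(2) have Vp: "(V, p) \<in> A" and sub: "cball z \<rho> \<subseteq> V" by auto
    have "compact ((\<lambda>y. sqrt (gram_det (f \<circ> p) y)) ` cball z \<rho>)"
      by (intro compact_continuous_image continuous_on_subset[OF chart_density_cont[OF Vp] sub]) auto
    then have "bounded ((\<lambda>y. sqrt (gram_det (f \<circ> p) y)) ` cball z \<rho>)"
      by (rule compact_imp_bounded)
    then obtain b where b: "\<forall>y\<in>cball z \<rho>. \<bar>sqrt (gram_det (f \<circ> p) y)\<bar> \<le> b"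
      unfolding bounded_iff by auto
    have "emeasure vol (p ` cball z \<rho>) = (\<integral>\<^sup>+y\<in>cball z \<rho>. ennreal (sqrt (gram_det (f \<circ> p) y)) \<partial>lborel)"
      by (rule emeasure_vol[OF Vp _ sub]) simp
    also have "\<dots> \<le> (\<integral>\<^sup>+y. ennreal b * indicator (cball z \<rho>) y \<partial>lborel)"
      using b by (intro nn_integral_mono) (auto split: split_indicator intro!: ennreal_leI dest: abs_le_D1)
    also have "\<dots> = ennreal b * emeasure lborel (cball z \<rho>)"
      by (rule nn_integral_cmult_indicator) simp
    also have "\<dots> < \<infinity>"
      using emeasure_lborel_cball_finite[of z \<rho>] by (auto simp: ennreal_mult_less_top)
    finally show ?thesis by (simp add: c)
  qed
  have "emeasure vol (space vol) \<le> emeasure vol (\<Union>c\<in>F. ?c c)"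
    using sub s by (intro emeasure_mono sets.finite_UN F(1)) auto
  also have "\<dots> \<le> (\<Sum>c\<in>F. emeasure vol (?c c))"
    by (rule emeasure_subadditive_finite[OF F(1)]) (use s in auto)
  also have "\<dots> < \<infinity>"
    using fin F(1) by simp
  finally show "emeasure vol (space vol) \<noteq> \<infinity>" by simp
qed

end

section \<open>Differentiation under the integral\<close>

lemma DERIV_integral_param:
  fixes k k' :: "real \<Rightarrow> 'b \<Rightarrow> real"
  assumes I: "s0 \<in> {a<..<b}"
    and int: "\<And>s. s \<in> {a<..<b} \<Longrightarrow> integrable M (k s)"
    and d: "\<And>s x. s \<in> {a<..<b} \<Longrightarrow> x \<in> space M \<Longrightarrow> ((\<lambda>s. k s x) has_real_derivative k' s x) (at s)"
    and bd: "\<And>s x. s \<in> {a<..<b} \<Longrightarrow> x \<in> space M \<Longrightarrow> \<bar>k' s x\<bar> \<le> w x"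
    and w: "integrable M w"
    and m: "k' s0 \<in> borel_measurable M"
  shows "((\<lambda>s. \<integral>x. k s x \<partial>M) has_real_derivative (\<integral>x. k' s0 x \<partial>M)) (at s0)"
  unfolding has_field_derivative_iff tendsto_at_iff_sequentially
proof (intro allI impI)
  fix X :: "nat \<Rightarrow> real" assume X: "\<forall>i. X i \<in> UNIV - {s0}" "X \<longlonglongrightarrow> s0"
  \<comment> \<open>Difference quotients along the sequence. The value \<open>k' s0\<close> for the
    finitely many terms outside the interval keeps every \<open>q i\<close> measurable and dominated
    by \<open>w\<close>.\<close>
  define q where "q i x = (if X i \<in> {a<..<b} then (k (X i) x - k s0 x) / (X i - s0) else k' s0 x)" for i x
  have ev: "\<forall>\<^sub>F i in sequentially. X i \<in> {a<..<b}"
    using topological_tendstoD[OF X(2) open_greaterThanLessThan I] .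
  have km: "k s \<in> borel_measurable M" if "s \<in> {a<..<b}" for s
    using int[OF that] by (rule borel_measurable_integrable)
  have "(\<lambda>i. \<integral>x. q i x \<partial>M) \<longlonglongrightarrow> (\<integral>x. k' s0 x \<partial>M)"
  proof (rule integral_dominated_convergence[where w = w])
    show "q i \<in> borel_measurable M" for i
      unfolding q_def using km[of "X i"] km[OF I] m by (cases "X i \<in> {a<..<b}") auto
    show "AE x in M. (\<lambda>i. q i x) \<longlonglongrightarrow> k' s0 x"
    proof (rule AE_I2)
      fix x assume x: "x \<in> space M"
      have "(\<lambda>i. (k (X i) x - k s0 x) / (X i - s0)) \<longlonglongrightarrow> k' s0 x"
        using d[OF I x] X unfolding has_field_derivative_iff tendsto_at_iff_sequentially by (auto simp: o_def)
      moreover have "\<forall>\<^sub>F i in sequentially. (k (X i) x - k s0 x) / (X i - s0) = q i x"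
        using ev by eventually_elim (simp add: q_def)
      ultimately show "(\<lambda>i. q i x) \<longlonglongrightarrow> k' s0 x" by (rule Lim_transform_eventually)
    qed
    show "AE x in M. norm (q i x) \<le> w x" for i
    proof (rule AE_I2)
      fix x assume x: "x \<in> space M"
      show "norm (q i x) \<le> w x"
      proof (cases "X i \<in> {a<..<b}")
        case True
        have ne: "X i \<noteq> s0" using X by auto
        have "norm (k (X i) x - k s0 x) \<le> w x * norm (X i - s0)"
          by (rule field_differentiable_bound[of "{a<..<b}" "\<lambda>s. k s x" "\<lambda>s. k' s x"])
            (use True I d[OF _ x] bd[OF _ x] in \<open>auto intro: has_field_derivative_at_within\<close>)
        then show ?thesis using True ne by (simp add: q_def divide_le_eq)
      next
        case False
        then have "q i x = k' s0 x" unfolding q_def by (rule if_not_P)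
        then show ?thesis using bd[OF I x] by simp
      qed
    qed
  qed (use w m in auto)
  moreover have "\<forall>\<^sub>F i in sequentially. (\<integral>x. q i x \<partial>M) = ((\<integral>x. k (X i) x \<partial>M) - (\<integral>x. k s0 x \<partial>M)) / (X i - s0)"
    using ev
  proof eventually_elim
    case (elim i)
    then have "(\<integral>x. q i x \<partial>M) = (\<integral>x. (k (X i) x - k s0 x) / (X i - s0) \<partial>M)"
      by (simp add: q_def)
    also have "\<dots> = ((\<integral>x. k (X i) x \<partial>M) - (\<integral>x. k s0 x \<partial>M)) / (X i - s0)"
      using int[OF elim] int[OF I] by simp
    finally show ?case .
  qed
  ultimately show "((\<lambda>y. ((\<integral>x. k y x \<partial>M) - (\<integral>x. k s0 x \<partial>M)) / (y - s0)) \<circ> X) \<longlonglongrightarrow> (\<integral>x. k' s0 x \<partial>M)"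
    unfolding o_def by (rule Lim_transform_eventually)
qed

lemma integrable_compact_support:
  fixes h :: "'e::euclidean_space \<Rightarrow> real"
  assumes "continuous_on UNIV h" "\<And>x. x \<notin> cball z \<rho> \<Longrightarrow> h x = 0"
  shows "integrable lborel h"
proof -
  have "integrable lborel (\<lambda>x. indicator (cball z \<rho>) x *\<^sub>R h x)"
    by (rule borel_integrable_compact[OF compact_cball continuous_on_subset[OF assms(1)]]) auto
  moreover have "(\<lambda>x. indicator (cball z \<rho>) x *\<^sub>R h x) = h"
    using assms(2) by (auto simp: fun_eq_iff split: split_indicator)
  ultimately show ?thesis by simp
qed

text \<open>Differentiate \<open>t \<mapsto> \<integral> Z (x + t b) dx\<close>, which is constant by translation invariance.\<close>

lemma integral_partial_derivative_zero:
  fixes Z :: "'e::euclidean_space \<Rightarrow> real"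
  assumes Z: "Ck_on (Suc 0) UNIV Z" and supp: "\<And>x. x \<notin> cball z \<rho> \<Longrightarrow> Z x = 0"
  shows "integrable lborel (\<lambda>x. diff Z x b)" "(\<integral>x. diff Z x b \<partial>lborel) = 0"
proof -
  note C = Ck1_imp[OF Z]
  have supp': "diff Z x b = 0" if "x \<notin> cball z \<rho>" for x
  proof -
    have "diff Z x = diff (\<lambda>_. 0) x"
      by (rule frechet_derivative_cong_open(1)[of "- cball z \<rho>"]) (use that supp in auto)
    then show ?thesis by simp
  qed
  show "integrable lborel (\<lambda>x. diff Z x b)"
    by (rule integrable_compact_support[OF C(3) supp'])
  have "bounded ((\<lambda>x. diff Z x b) ` cball z \<rho>)"
    by (intro compact_imp_bounded compact_continuous_image continuous_on_subset[OF C(3)]) auto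
  then obtain c where c: "\<forall>x\<in>cball z \<rho>. \<bar>diff Z x b\<bar> \<le> c" unfolding bounded_iff by auto
  have c0: "\<bar>diff Z x b\<bar> \<le> max c 0" for x using c supp'[of x] by (cases "x \<in> cball z \<rho>") force+
  \<comment> \<open>For \<open>\<bar>s\<bar> < 1\<close> the translated support lies in the ball
    enlarged by \<open>norm b\<close>. The bound \<open>max c 0\<close> is nonnegative even if
    \<open>cball z \<rho>\<close> is empty.\<close>
  let ?w = "\<lambda>x. max c 0 * indicator (cball z (\<rho> + norm b)) x :: real"
  have "((\<lambda>t. \<integral>x. Z (x + t *\<^sub>R b) \<partial>lborel) has_real_derivative (\<integral>x. diff Z (x + 0 *\<^sub>R b) b \<partial>lborel)) (at 0)"
  proof (rule DERIV_integral_param[where a = "-1" and b = 1 and w = ?w])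
    show "integrable lborel (\<lambda>x. Z (x + s *\<^sub>R b))" for s
    proof (rule integrable_compact_support[where z = "z - s *\<^sub>R b"])
      show "continuous_on UNIV (\<lambda>x. Z (x + s *\<^sub>R b))"
        by (rule continuous_on_compose2[OF C(4)]) (auto intro: continuous_on_add continuous_on_id continuous_on_const)
      show "Z (x + s *\<^sub>R b) = 0" if "x \<notin> cball (z - s *\<^sub>R b) \<rho>" for x
        using that by (intro supp) (simp add: dist_norm algebra_simps)
    qed
    show "((\<lambda>s. Z (x + s *\<^sub>R b)) has_real_derivative diff Z (x + s *\<^sub>R b) b) (at s)" for s x
    proof -
      have "((\<lambda>s. x + s *\<^sub>R b) has_derivative (\<lambda>t. t *\<^sub>R b)) (at s)"
        by (auto intro!: derivative_eq_intros)
      from has_derivative_compose[OF this C(2)[of "x + s *\<^sub>R b"]]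
      have "((\<lambda>s. Z (x + s *\<^sub>R b)) has_derivative (\<lambda>t. diff Z (x + s *\<^sub>R b) (t *\<^sub>R b))) (at s)" by simp
      moreover have "linear (diff Z (x + s *\<^sub>R b))" using C(1) by (auto intro: linear_frechet_derivative)
      ultimately show ?thesis by (simp add: has_field_derivative_def linear_cmul mult_commute_abs)
    qed
    show "\<bar>diff Z (x + s *\<^sub>R b) b\<bar> \<le> ?w x" if "s \<in> {- 1<..<1}" for s x
    proof (cases "x + s *\<^sub>R b \<in> cball z \<rho>")
      case True
      have "dist z x \<le> dist z (x + s *\<^sub>R b) + norm (s *\<^sub>R b)"
        by (metis add_diff_cancel_left' dist_commute dist_norm dist_triangle)
      also have "\<dots> \<le> \<rho> + norm b"
        using True that by (intro add_mono) (auto intro: mult_left_le_one_le)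
      finally show ?thesis using c0 by simp
    qed (use supp' in auto)
    show "integrable lborel ?w"
      using emeasure_lborel_cball_finite[of z "\<rho> + norm b"]
      by (intro integrable_mult_right integrable_real_indicator) auto
    show "(\<lambda>x. diff Z (x + 0 *\<^sub>R b) b) \<in> borel_measurable lborel"
      using borel_measurable_continuous_onI[OF C(3)] by simp
  qed simp
  moreover have "(\<integral>x. Z (x + t *\<^sub>R b) \<partial>lborel) = (\<integral>x. Z x \<partial>lborel)" for t
  proof -
    have "(\<integral>x. Z x \<partial>lborel) = (\<integral>x. Z x \<partial>distr lborel borel ((+) (t *\<^sub>R b)))"
      by (simp add: lborel_distr_plus)
    also have "\<dots> = (\<integral>x. Z (t *\<^sub>R b + x) \<partial>lborel)"
      using borel_measurable_continuous_onI[OF C(4)] by (simp add: integral_distr)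
    finally show ?thesis by (simp add: add.commute)
  qed
  ultimately have "((\<lambda>t. \<integral>x. Z x \<partial>lborel) has_real_derivative (\<integral>x. diff Z x b \<partial>lborel)) (at 0)"
    by simp
  then show "(\<integral>x. diff Z x b \<partial>lborel) = 0"
    using DERIV_const DERIV_unique by blast
qed

lemma (in closed_immersion) integral_chart:
  fixes k :: "'a \<Rightarrow> real"
  assumes Vp: "(V, p) \<in> A" and k: "k \<in> borel_measurable vol"
    and supp: "\<And>x. x \<in> points A \<Longrightarrow> x \<notin> p ` V \<Longrightarrow> k x = 0"
  shows "(\<integral>x. k x \<partial>vol) = (\<integral>y. indicator V y * (k (p y) * sqrt (gram_det (f \<circ> p) y)) \<partial>lborel)"
proof -
  obtain x0 where x0: "x0 \<in> points A" using points_nonempty by blast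
  \<comment> \<open>The chart must take values in the space of \<open>vol\<close> everywhere;
    outside \<open>V\<close>, where the density \<open>?w\<close> vanishes, any point will
    do.\<close>
  define p0 where "p0 y = (if y \<in> V then p y else x0)" for y
  let ?w = "\<lambda>y. indicator V y * sqrt (gram_det (f \<circ> p) y)"
  have w: "?w \<in> borel_measurable lborel" using chart_density_measurable[OF Vp] by simp
  have w0: "0 \<le> ?w y" for y using chart_gram_pos[OF Vp, of y] by (auto split: split_indicator)
  have p0b: "p0 \<in> borel_measurable borel"
    unfolding p0_def using chart_open[OF Vp] chart_cont[OF Vp]
    by (intro borel_measurable_continuous_on_if) auto
  have p0: "p0 \<in> measurable (density lborel ?w) vol"
  proof (rule measurableI)
    show "p0 y \<in> space vol" for y
      using x0 chart_in_points[OF Vp] by (auto simp: p0_def space_vol)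
    show "p0 -` X \<inter> space (density lborel ?w) \<in> sets (density lborel ?w)" if "X \<in> sets vol" for X
      using measurable_sets[OF p0b] that by (simp add: in_sets_vol_iff)
  qed
  have pV: "p ` V \<in> sets vol"
    using chart_image_borel[OF Vp borel_open[OF chart_open[OF Vp]] order_refl] chart_in_points[OF Vp]
    by (auto simp: in_sets_vol_iff)
  have eq: "distr (density lborel ?w) vol p0 = density vol (indicator (p ` V))"
  proof (rule measure_eqI)
    fix X assume "X \<in> sets (distr (density lborel ?w) vol p0)"
    then have X: "X \<in> sets vol" by simp
    then have Xb: "X \<in> sets borel" by (simp add: in_sets_vol_iff)
    have p0X: "p0 -` X \<in> sets borel" using measurable_sets[OF p0b Xb] by simp
    have "emeasure (distr (density lborel ?w) vol p0) X = emeasure (density lborel ?w) (p0 -` X)"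
      using X p0 by (simp add: emeasure_distr)
    also have "\<dots> = (\<integral>\<^sup>+y. ennreal (?w y) * indicator (p0 -` X) y \<partial>lborel)"
      using p0X w by (intro emeasure_density) auto
    also have "\<dots> = (\<integral>\<^sup>+y\<in>V \<inter> p -` X. ennreal (sqrt (gram_det (f \<circ> p) y)) \<partial>lborel)"
      by (intro nn_integral_cong) (auto simp: p0_def split: split_indicator)
    also have "\<dots> = emeasure vol (p ` (V \<inter> p -` X))"
      by (rule emeasure_vol[OF Vp chart_vimage_borel[OF Vp Xb], symmetric]) auto
    also have "p ` (V \<inter> p -` X) = p ` V \<inter> X" by auto
    also have "emeasure vol (p ` V \<inter> X) = emeasure (density vol (indicator (p ` V))) X"
      using X pV by (subst emeasure_density) (auto simp flip: indicator_inter_arith)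
    finally show "emeasure (distr (density lborel ?w) vol p0) X = emeasure (density vol (indicator (p ` V))) X" .
  qed simp
  have "(\<integral>x. k x \<partial>vol) = (\<integral>x. indicator (p ` V) x *\<^sub>R k x \<partial>vol)"
    using supp by (intro Bochner_Integration.integral_cong refl) (auto simp: space_vol split: split_indicator)
  also have "\<dots> = (\<integral>x. k x \<partial>density vol (\<lambda>x. ennreal (indicator (p ` V) x)))"
    using k pV by (intro integral_density[symmetric]) auto
  also have "density vol (\<lambda>x. ennreal (indicator (p ` V) x)) = distr (density lborel ?w) vol p0"
    unfolding eq by (simp add: ennreal_indicator)
  also have "(\<integral>x. k x \<partial>distr (density lborel ?w) vol p0) = (\<integral>y. k (p0 y) \<partial>density lborel ?w)"
    by (rule integral_distr[OF p0 k])
  also have "\<dots> = (\<integral>y. ?w y *\<^sub>R k (p0 y) \<partial>lborel)"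
    using w w0 measurable_compose[OF p0 k] by (intro integral_density) auto
  also have "\<dots> = (\<integral>y. indicator V y * (k (p y) * sqrt (gram_det (f \<circ> p) y)) \<partial>lborel)"
    by (intro Bochner_Integration.integral_cong refl) (auto simp: p0_def split: split_indicator)
  finally show ?thesis .
qed

section \<open>The divergence of a tangential constant field\<close>

text \<open>The coordinates of the tangential part of \<open>a\<close>, by Cramer's rule.\<close>

definition tangent_coord :: "('e::euclidean_space \<Rightarrow> 'v::euclidean_space) \<Rightarrow> 'v \<Rightarrow> 'e \<Rightarrow> 'e" where
  "tangent_coord u a y =
     (\<Sum>k\<in>Basis. (basis_det (\<lambda>b c. if c = k then diff u y b \<bullet> a else diff u y b \<bullet> diff u y c) / gram_det u y) *\<^sub>R k)"

lemma linear_sum_Basis: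
  assumes "linear f"
  shows "f x = (\<Sum>b\<in>Basis. (x \<bullet> b) *\<^sub>R f b)"
proof -
  interpret linear f by fact
  show ?thesis by (subst (1) euclidean_representation[of x, symmetric]) (simp add: sum scaleR)
qed

context
  fixes u :: "'e::euclidean_space \<Rightarrow> 'v::euclidean_space" and y :: 'e
  assumes du: "u differentiable at y" and inj: "inj (diff u y)"
begin

lemma linear_diff_u: "linear (diff u y)"
  using du by (rule linear_frechet_derivative)

lemma metric_operator_inner: "metric_operator u y v \<bullet> w = diff u y v \<bullet> diff u y w"
  using adjoint_works[OF linear_diff_u, of w "diff u y v"] by (simp add: metric_operator_def inner_commute)

lemma surj_metric_operator: "surj (metric_operator u y)"
proof (rule linear_inj_imp_surj)
  show lin: "linear (metric_operator u y)"
    unfolding metric_operator_def by (intro linear_compose linear_diff_u adjoint_linear)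
  show "inj (metric_operator u y)"
  proof (rule linear_injective_0[OF lin, THEN iffD2], intro allI impI)
    fix v assume "metric_operator u y v = 0"
    then have "diff u y v = 0" using metric_operator_inner[of v v] by simp
    then show "v = 0" using linear_injective_0[OF linear_diff_u] inj by blast
  qed
qed

text \<open>The vectors \<open>diff u y (inv (metric_operator u y) b)\<close> are the dual basis,
  within the tangent space, of the coordinate vectors; traces with respect to the metric, as in
  \<open>mean_curvature_sphere\<close>, are sums over both.\<close>

lemma dual_basis: "diff u y (inv (metric_operator u y) b) \<bullet> diff u y w = b \<bullet> w"
  using metric_operator_inner[of "inv (metric_operator u y) b" w] surj_f_inv_f[OF surj_metric_operator] by simp

lemma tangent_coord_unique:
  assumes "\<And>v. diff u y v \<bullet> diff u y \<xi> = diff u y v \<bullet> a"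
  shows "\<xi> = tangent_coord u a y"
proof -
  have "\<xi> \<bullet> k = basis_det (\<lambda>b c. if c = k then diff u y b \<bullet> a else diff u y b \<bullet> diff u y c) / gram_det u y"
    if "k \<in> Basis" for k
    unfolding gram_det_basis_det
  proof (rule basis_det_cramer[OF _ _ that])
    fix b :: 'e
    show "(\<Sum>c\<in>Basis. (diff u y b \<bullet> diff u y c) * (\<xi> \<bullet> c)) = diff u y b \<bullet> a"
      unfolding assms[of b, symmetric]
      by (subst (2) linear_sum_Basis[OF linear_diff_u]) (simp add: inner_sum_right mult.commute)
  next
    show "basis_det (\<lambda>b c. diff u y b \<bullet> diff u y c) \<noteq> 0"
      using gram_det_pos[OF du inj] by (simp add: gram_det_basis_det)
  qed
  then show ?thesis
    unfolding tangent_coord_def by (subst euclidean_representation[of \<xi>, symmetric]) (simp cong: sum.cong)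
qed

text \<open>A vector with this property exists because \<open>metric_operator\<close> is onto, and
  Cramer's rule identifies it with \<open>tangent_coord\<close>. The explicit formula is what gives
  smooth dependence on \<open>y\<close>.\<close>

lemma tangent_coord: "diff u y v \<bullet> diff u y (tangent_coord u a y) = diff u y v \<bullet> a"
proof -
  obtain \<xi> where \<xi>: "metric_operator u y \<xi> = adjoint (diff u y) a"
    using surj_metric_operator by (metis surjD)
  have *: "diff u y w \<bullet> diff u y \<xi> = diff u y w \<bullet> a" for w
    using metric_operator_inner[of \<xi> w] adjoint_works[OF linear_diff_u, of w a] \<xi> by (simp add: inner_commute)
  from tangent_coord_unique[OF this] show ?thesis using * by simp
qed

text \<open>With \<open>q b\<close> the derivative of the coordinate vector
  \<open>diff u y b\<close>, the left side is the trace of the inverse metric times the derivative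
  of the metric. Its two halves agree since the inverse metric is symmetric.\<close>

lemma sum_diff_dual_basis:
  "(\<Sum>b\<in>Basis. \<Sum>c\<in>Basis. (inv (metric_operator u y) b \<bullet> c) * (q b \<bullet> diff u y c + q c \<bullet> diff u y b))
     = 2 * (\<Sum>b\<in>Basis. diff u y (inv (metric_operator u y) b) \<bullet> q b)"
proof -
  let ?d = "inv (metric_operator u y)"
  have sym: "?d b \<bullet> c = ?d c \<bullet> b" for b c
  proof -
    have "?d b \<bullet> c = diff u y (?d c) \<bullet> diff u y (?d b)" unfolding dual_basis by (simp add: inner_commute)
    also have "\<dots> = ?d c \<bullet> b" by (simp add: inner_commute dual_basis)
    finally show ?thesis .
  qed
  have 1: "(\<Sum>c\<in>Basis. (?d b \<bullet> c) * (q b \<bullet> diff u y c)) = diff u y (?d b) \<bullet> q b" for b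
    by (subst (2) linear_sum_Basis[OF linear_diff_u]) (simp add: inner_sum_right inner_sum_left inner_commute)
  have "(\<Sum>b\<in>Basis. \<Sum>c\<in>Basis. (?d b \<bullet> c) * (q c \<bullet> diff u y b))
      = (\<Sum>c\<in>Basis. \<Sum>b\<in>Basis. (?d c \<bullet> b) * (q c \<bullet> diff u y b))"
    by (subst sum.swap) (simp add: sym)
  then show ?thesis
    by (simp add: distrib_left sum.distrib 1)
qed

end

text \<open>Orthogonal decomposition along a subspace is unique, so the definite description in
  \<open>normal_part\<close> is meaningful.\<close>

lemma normal_part_properties:
  "normal_part (span S) v \<in> orthogonal_comp (span S)" "v - normal_part (span S) v \<in> span S"
proof -
  obtain t w where tw: "t \<in> span S" "\<And>z. z \<in> span S \<Longrightarrow> orthogonal w z" "v = t + w"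
    using orthogonal_subspace_decomp_exists[of S v] by metis
  have "\<exists>!w. w \<in> orthogonal_comp (span S) \<and> v - w \<in> span S"
  proof (rule ex1I[of _ w])
    show "w \<in> orthogonal_comp (span S) \<and> v - w \<in> span S"
      using tw by (auto simp: orthogonal_comp_def orthogonal_commute)
    fix w' assume w': "w' \<in> orthogonal_comp (span S) \<and> v - w' \<in> span S"
    have "v - w \<in> span S" using tw by simp
    from span_diff[OF conjunct2[OF w'] this] have s: "w - w' \<in> span S" by simp
    have "orthogonal (w - w') w'"
      using w' s by (auto simp: orthogonal_comp_def)
    moreover have "orthogonal (w - w') w"
      using tw(2)[OF s] by (simp only: orthogonal_commute)
    ultimately have "(w - w') \<bullet> (w - w') = 0" by (simp add: orthogonal_def inner_diff_right)
    then show "w' = w" by simp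
  qed
  from theI'[OF this] show "normal_part (span S) v \<in> orthogonal_comp (span S)" "v - normal_part (span S) v \<in> span S"
    by (auto simp: normal_part_def)
qed

lemma inner_normal_part:
  assumes "\<And>s. s \<in> S \<Longrightarrow> s \<bullet> z = 0"
  shows "normal_part (span S) v \<bullet> z = v \<bullet> z"
proof -
  have "x \<bullet> z = 0" if "x \<in> span S" for x
    using that by (induction rule: span_induct) (auto simp: assms inner_add_left intro!: subspaceI)
  from this[OF normal_part_properties(2)] show ?thesis by (simp add: inner_diff_left)
qed

section \<open>Divergence in one chart of a minimal immersion into the sphere\<close>

locale sphere_chart =
  fixes u :: "'e::euclidean_space \<Rightarrow> 'v::euclidean_space" and V :: "'e set"
  assumes V: "open V" and smooth: "smooth_on V u"
    and inj_u: "\<And>y. y \<in> V \<Longrightarrow> inj (diff u y)"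
    and norm_u: "\<And>y. y \<in> V \<Longrightarrow> norm (u y) = 1"
    and minimal: "\<And>y. y \<in> V \<Longrightarrow> mean_curvature_sphere u y = 0"
begin

lemma diff_u: "y \<in> V \<Longrightarrow> u differentiable at y"
  using Ck1_imp(1)[OF smooth_onD[OF smooth]] by blast

lemma Ck_u: "Ck_on k V u"
  using smooth by (rule smooth_onD)

lemma Ck_diff: "Ck_on k V (\<lambda>y. diff u y b)"
  using Ck_u[of "Suc k"] by simp

lemma gram_pos: "y \<in> V \<Longrightarrow> gram_det u y > 0"
  by (intro gram_det_pos diff_u inj_u)

lemma Ck_gram: "Ck_on k V (gram_det u)"
  unfolding gram_det_basis_det[abs_def] by (intro Ck_on_basis_det V Ck_on_inner Ck_diff)

lemma Ck_tangent_coord: "Ck_on k V (tangent_coord u a)"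
proof -
  have "Ck_on k V (\<lambda>y. basis_det (\<lambda>b c. if c = d then diff u y b \<bullet> a else diff u y b \<bullet> diff u y c) * inverse (gram_det u y))" for d
  proof (rule Ck_on_mult[OF V])
    show "Ck_on k V (\<lambda>y. basis_det (\<lambda>b c. if c = d then diff u y b \<bullet> a else diff u y b \<bullet> diff u y c))"
    proof (rule Ck_on_basis_det[OF V])
      show "Ck_on k V (\<lambda>y. if c = d then diff u y b \<bullet> a else diff u y b \<bullet> diff u y c)" for b c
        using Ck_on_inner[OF V Ck_diff Ck_on_const[OF V, of _ a]] Ck_on_inner[OF V Ck_diff Ck_diff] by (cases "c = d") auto
    qed
    show "Ck_on k V (\<lambda>y. inverse (gram_det u y))"
      by (rule Ck_on_compose[OF V _ Ck_gram Ck_on_inverse]) (use gram_pos in force)+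
  qed
  then show ?thesis
    unfolding tangent_coord_def[abs_def] divide_inverse
    by (intro Ck_on_sum V Ck_on_scaleR Ck_on_const)
qed

text \<open>\<open>second_diff\<close> is linear in the outer direction as a derivative; the inner
  direction sits inside the differentiated function, so linearity there has to be carried through
  the derivative.\<close>

lemma second_diff_sum: 
  assumes y: "y \<in> V"
  shows "second_diff u y v w = (\<Sum>c\<in>Basis. (w \<bullet> c) *\<^sub>R second_diff u y v c)"
proof -
  have "second_diff u y v w = diff (\<lambda>z. \<Sum>c\<in>Basis. (w \<bullet> c) *\<^sub>R diff u z c) y v"
    unfolding second_diff_def
    by (intro fun_cong[OF frechet_derivative_cong_open(1)[OF V y]] linear_sum_Basis linear_frechet_derivative diff_u)
  also have "diff (\<lambda>z. \<Sum>c\<in>Basis. (w \<bullet> c) *\<^sub>R diff u z c) y = (\<lambda>v. \<Sum>c\<in>Basis. (w \<bullet> c) *\<^sub>R diff (\<lambda>z. diff u z c) y v)"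
    using y Ck1_imp(2)[OF Ck_diff]
    by (intro frechet_derivative_eqI has_derivative_sum has_derivative_scaleR_right)
  finally show ?thesis by (simp add: second_diff_def)
qed

lemma second_diff_sym: "y \<in> V \<Longrightarrow> second_diff u y v w = second_diff u y w v"
  by (rule second_diff_symmetric[OF Ck_u V])

lemma inner_u_diff:
  assumes y: "y \<in> V"
  shows "u y \<bullet> diff u y v = 0"
proof -
  have "((\<lambda>z. u z \<bullet> u z) has_derivative (\<lambda>v. u y \<bullet> diff u y v + diff u y v \<bullet> u y)) (at y)"
    by (intro has_derivative_inner Ck1_imp(2)[OF Ck_u y])
  then have 1: "diff (\<lambda>z. u z \<bullet> u z) y = (\<lambda>v. u y \<bullet> diff u y v + diff u y v \<bullet> u y)"
    by (rule frechet_derivative_eqI)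
  have "diff (\<lambda>z. u z \<bullet> u z) y = diff (\<lambda>_. 1 :: real) y"
    by (rule frechet_derivative_cong_open(1)[OF V y]) (use norm_u in \<open>simp add: dot_square_norm\<close>)
  then have "diff (\<lambda>z. u z \<bullet> u z) y v = 0" by simp
  then show ?thesis unfolding 1 by (simp add: inner_commute)
qed

text \<open>Jacobi's formula along the line through \<open>y\<close> in the direction of the
  argument: the logarithmic derivative of the volume density is half the trace of the inverse metric
  times the derivative of the metric.\<close>

lemma diff_sqrt_gram:
  assumes y: "y \<in> V"
  shows "((\<lambda>y. sqrt (gram_det u y)) has_derivative
     (\<lambda>v. sqrt (gram_det u y) * (\<Sum>b\<in>Basis. diff u y (inv (metric_operator u y) b) \<bullet> second_diff u y v b))) (at y)"
proof -
  let ?d = "inv (metric_operator u y)"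
  have g: "(gram_det u has_derivative diff (gram_det u) y) (at y)"
    by (rule Ck1_imp(2)[OF Ck_gram y])
  have dg: "diff (gram_det u) y v = gram_det u y * (2 * (\<Sum>b\<in>Basis. diff u y (?d b) \<bullet> second_diff u y v b))" for v
  proof -
    let ?l = "\<lambda>s. y + s *\<^sub>R v"
    have l: "(?l has_derivative (\<lambda>s. s *\<^sub>R v)) (at 0)"
      by (auto intro!: derivative_eq_intros)
    have "((\<lambda>s. gram_det u (?l s)) has_derivative (\<lambda>s. diff (gram_det u) y (s *\<^sub>R v))) (at 0)"
      using has_derivative_compose[OF l, of "gram_det u"] g by simp
    moreover have "linear (diff (gram_det u) y)" using Ck1_imp(1)[OF Ck_gram y] by (rule linear_frechet_derivative)
    ultimately have 1: "((\<lambda>s. gram_det u (?l s)) has_real_derivative diff (gram_det u) y v) (at 0)"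
      by (simp add: has_field_derivative_def linear_cmul mult_commute_abs)
    have e: "((\<lambda>s. diff u (?l s) b) has_derivative (\<lambda>s. s *\<^sub>R second_diff u y v b)) (at 0)" for b
    proof -
      have "((\<lambda>s. diff u (?l s) b) has_derivative (\<lambda>s. diff (\<lambda>z. diff u z b) y (s *\<^sub>R v))) (at 0)"
        using has_derivative_compose[OF l, of "\<lambda>z. diff u z b"] Ck1_imp(2)[OF Ck_diff y] by simp
      moreover have "linear (diff (\<lambda>z. diff u z b) y)" using Ck1_imp(1)[OF Ck_diff y] by (rule linear_frechet_derivative)
      ultimately show ?thesis by (simp add: linear_cmul second_diff_def)
    qed
    have "((\<lambda>s. basis_det (\<lambda>b c. diff u (?l s) b \<bullet> diff u (?l s) c)) has_real_derivative
       basis_det (\<lambda>b c. diff u (?l 0) b \<bullet> diff u (?l 0) c) * (\<Sum>b\<in>Basis. \<Sum>c\<in>Basis. (?d b \<bullet> c) *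
         (second_diff u y v b \<bullet> diff u y c + second_diff u y v c \<bullet> diff u y b))) (at 0)"
    proof (rule DERIV_basis_det)
      fix b c :: 'e
      have "((\<lambda>s. diff u (?l s) b \<bullet> diff u (?l s) c) has_derivative
          (\<lambda>s. diff u (?l 0) b \<bullet> (s *\<^sub>R second_diff u y v c) + (s *\<^sub>R second_diff u y v b) \<bullet> diff u (?l 0) c)) (at 0)"
        by (intro has_derivative_inner e)
      then show "((\<lambda>s. diff u (?l s) b \<bullet> diff u (?l s) c) has_real_derivative
          (second_diff u y v c \<bullet> diff u y b + second_diff u y v b \<bullet> diff u y c)) (at 0)"
        unfolding has_field_derivative_def by (rule has_derivative_eq_rhs) (auto simp: algebra_simps inner_commute)
    next
      fix b c :: 'e assume bc: "b \<in> Basis" "c \<in> Basis"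
      have "(\<Sum>d\<in>Basis. (?d b \<bullet> d) * (diff u y d \<bullet> diff u y c)) = diff u y (?d b) \<bullet> diff u y c"
        by (subst linear_sum_Basis[OF linear_frechet_derivative[OF diff_u[OF y]], of "?d b"]) (simp add: inner_sum_left)
      also have "\<dots> = (if b = c then 1 else 0)"
        using bc dual_basis[OF diff_u[OF y] inj_u[OF y]] by (simp add: inner_Basis)
      finally show "(\<Sum>d\<in>Basis. (?d b \<bullet> d) * (diff u (?l 0) d \<bullet> diff u (?l 0) c)) = (if b = c then 1 else 0)" by simp
    qed
    then have "((\<lambda>s. gram_det u (?l s)) has_real_derivative gram_det u y * (2 * (\<Sum>b\<in>Basis. diff u y (?d b) \<bullet> second_diff u y v b))) (at 0)"
      unfolding gram_det_basis_det using sum_diff_dual_basis[OF diff_u[OF y] inj_u[OF y], of "second_diff u y v"] by simp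
    from DERIV_unique[OF 1 this] show ?thesis .
  qed
  have "((\<lambda>y. sqrt (gram_det u y)) has_derivative (\<lambda>v. (inverse (sqrt (gram_det u y)) / 2) * diff (gram_det u) y v)) (at y)"
    using has_derivative_compose[OF g DERIV_real_sqrt[OF gram_pos[OF y], unfolded has_field_derivative_def]] .
  moreover have "(inverse (sqrt (gram_det u y)) / 2) * (gram_det u y * (2 * S)) = sqrt (gram_det u y) * S" for S
  proof -
    define r where "r = sqrt (gram_det u y)"
    then have r: "r = sqrt (gram_det u y)" "r > 0" "gram_det u y = r * r"
      using gram_pos[OF y] by auto
    show ?thesis unfolding r(1)[symmetric] r(3) using r(2) by (simp add: field_simps)
  qed
  ultimately show ?thesis unfolding dg by (simp only:)
qed

text \<open>This is \<open>div a\<^sup>T = - (n - 1) \<langle>a, u\<rangle>\<close>: the divergence of the constant field \<open>a\<close> vanishes, and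
  its component normal to \<open>u\<close> in the sphere does not contribute by minimality.\<close>

lemma divergence_tangent:
  fixes a :: 'v
  assumes y: "y \<in> V"
  defines "\<xi> \<equiv> tangent_coord u a" and "d \<equiv> inv (metric_operator u y)"
  shows "(\<Sum>b\<in>Basis. diff \<xi> y b \<bullet> b) + (\<Sum>b\<in>Basis. diff u y (d b) \<bullet> second_diff u y (\<xi> y) b)
     = - real DIM('e) * (a \<bullet> u y)"
proof -
  note lin = linear_frechet_derivative[OF diff_u[OF y]] and dual = dual_basis[OF diff_u[OF y] inj_u[OF y], folded d_def]
  have C\<xi>: "Ck_on (Suc 0) V \<xi>" unfolding \<xi>_def by (rule Ck_tangent_coord)
  \<comment> \<open>The tangential part of \<open>a\<close>, written with fixed directions so that
    the product rule applies.\<close>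
  define P where "P z = (\<Sum>c\<in>Basis. (\<xi> z \<bullet> c) *\<^sub>R diff u z c)" for z
  have P: "P z = diff u z (\<xi> z)" if "z \<in> V" for z
    unfolding P_def by (rule linear_sum_Basis[OF linear_frechet_derivative[OF diff_u[OF that]], symmetric])
  define dP where "dP b = diff u y (diff \<xi> y b) + second_diff u y b (\<xi> y)" for b
  have dP: "(P has_derivative dP) (at y)"
  proof -
    have "(P has_derivative (\<lambda>b. \<Sum>c\<in>Basis. (\<xi> y \<bullet> c) *\<^sub>R diff (\<lambda>z. diff u z c) y b + (diff \<xi> y b \<bullet> c) *\<^sub>R diff u y c)) (at y)"
      unfolding P_def[abs_def]
      by (intro has_derivative_sum has_derivative_scaleR has_derivative_inner_left Ck1_imp(2)[OF C\<xi> y] Ck1_imp(2)[OF Ck_diff y])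
    moreover have "(\<lambda>b. \<Sum>c\<in>Basis. (\<xi> y \<bullet> c) *\<^sub>R diff (\<lambda>z. diff u z c) y b + (diff \<xi> y b \<bullet> c) *\<^sub>R diff u y c) = dP"
    proof
      fix b
      have "diff u y (diff \<xi> y b) = (\<Sum>c\<in>Basis. (diff \<xi> y b \<bullet> c) *\<^sub>R diff u y c)"
        by (rule linear_sum_Basis[OF lin])
      moreover have "second_diff u y b (\<xi> y) = (\<Sum>c\<in>Basis. (\<xi> y \<bullet> c) *\<^sub>R diff (\<lambda>z. diff u z c) y b)"
        using second_diff_sum[OF y, of b "\<xi> y"] by (simp only: second_diff_def)
      ultimately show "(\<Sum>c\<in>Basis. (\<xi> y \<bullet> c) *\<^sub>R diff (\<lambda>z. diff u z c) y b + (diff \<xi> y b \<bullet> c) *\<^sub>R diff u y c) = dP b"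
        by (simp add: dP_def sum.distrib)
    qed
    ultimately show ?thesis by simp
  qed
  \<comment> \<open>The part of \<open>a\<close> that is normal to the immersion and tangent to the
    sphere.\<close>
  define N where "N z = a - P z - (a \<bullet> u z) *\<^sub>R u z" for z
  define dN where "dN b = - dP b - ((a \<bullet> u y) *\<^sub>R diff u y b + (a \<bullet> diff u y b) *\<^sub>R u y)" for b
  have dN: "(N has_derivative dN) (at y)"
  proof -
    have "(N has_derivative (\<lambda>b. 0 - dP b - ((a \<bullet> u y) *\<^sub>R diff u y b + (a \<bullet> diff u y b) *\<^sub>R u y))) (at y)"
      unfolding N_def[abs_def]
      by (intro has_derivative_diff has_derivative_scaleR has_derivative_inner_right has_derivative_const dP Ck1_imp(2)[OF Ck_u y])
    then show ?thesis by (simp add: dN_def[abs_def])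
  qed
  have N_tan: "diff u z v \<bullet> N z = 0" if z: "z \<in> V" for z v
    using tangent_coord[OF diff_u[OF z] inj_u[OF z], of v a] inner_u_diff[OF z, of v]
    by (simp add: N_def P[OF z] \<xi>_def inner_diff_right inner_commute)
  have N_u: "u z \<bullet> N z = 0" if z: "z \<in> V" for z
    using inner_u_diff[OF z] norm_u[OF z] by (simp add: N_def P[OF z] inner_diff_right dot_square_norm inner_commute)
  \<comment> \<open>Differentiating the orthogonality \<open>N_tan\<close> trades the derivative of
    \<open>N\<close> for second derivatives of \<open>u\<close>.\<close>
  have key: "second_diff u y b v \<bullet> N y + diff u y v \<bullet> dN b = 0" for b v
  proof -
    have "((\<lambda>z. diff u z v \<bullet> N z) has_derivative (\<lambda>b. diff u y v \<bullet> dN b + diff (\<lambda>z. diff u z v) y b \<bullet> N y)) (at y)"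
      by (intro has_derivative_inner dN Ck1_imp(2)[OF Ck_diff y])
    then have 1: "diff (\<lambda>z. diff u z v \<bullet> N z) y = (\<lambda>b. diff u y v \<bullet> dN b + diff (\<lambda>z. diff u z v) y b \<bullet> N y)"
      by (rule frechet_derivative_eqI)
    have "diff (\<lambda>z. diff u z v \<bullet> N z) y = diff (\<lambda>_. 0 :: real) y"
      by (rule frechet_derivative_cong_open(1)[OF V y]) (rule N_tan)
    then have "diff (\<lambda>z. diff u z v \<bullet> N z) y b = 0" by simp
    then show ?thesis unfolding 1 second_diff_def by simp
  qed
  \<comment> \<open>\<open>N y\<close> is orthogonal to \<open>u y\<close> and to the tangent space,
    so it does not see the projection in \<open>second_fundamental_form_sphere\<close>; minimality
    then makes the trace vanish.\<close>
  have mc: "(\<Sum>b\<in>Basis. second_diff u y b (d b) \<bullet> N y) = 0"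
  proof -
    have "normal_part (span (insert (u y) (tangent_space u y))) v \<bullet> N y = v \<bullet> N y" for v
      by (rule inner_normal_part) (use N_tan[OF y] N_u[OF y] in \<open>auto simp: tangent_space_def\<close>)
    then have "(\<Sum>b\<in>Basis. second_diff u y (d b) b \<bullet> N y) = mean_curvature_sphere u y \<bullet> N y"
      by (simp add: mean_curvature_sphere_def second_fundamental_form_sphere_def inner_sum_left d_def)
    then show ?thesis using minimal[OF y] second_diff_sym[OF y] by simp
  qed
  have *: "diff u y (d b) \<bullet> dP b = second_diff u y b (d b) \<bullet> N y - (a \<bullet> u y)" if b: "b \<in> Basis" for b
  proof -
    have "diff u y (d b) \<bullet> diff u y b = 1" using dual b by simp
    moreover have "diff u y (d b) \<bullet> u y = 0" using inner_u_diff[OF y] by (simp add: inner_commute)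
    ultimately have "diff u y (d b) \<bullet> dN b = - (diff u y (d b) \<bullet> dP b) - (a \<bullet> u y)"
      by (simp add: dN_def inner_diff_right inner_add_right)
    then show ?thesis using key[of b "d b"] by simp
  qed
  have "(\<Sum>b\<in>Basis. diff u y (d b) \<bullet> dP b) = - real DIM('e) * (a \<bullet> u y)"
    using mc by (simp add: * sum_subtractf)
  moreover have "diff u y (d b) \<bullet> dP b = diff \<xi> y b \<bullet> b + diff u y (d b) \<bullet> second_diff u y (\<xi> y) b" for b
    using dual[of b "diff \<xi> y b"] second_diff_sym[OF y, of b "\<xi> y"]
    by (simp add: dP_def inner_add_right inner_commute[of b])
  ultimately show ?thesis by (simp add: sum.distrib)
qed

text \<open>The field \<eta> \<xi>, multiplied by the volume density, has compact support in the
  chart, so the sum of its partial derivatives integrates to zero. The product rule evaluates that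
  sum, the terms with \<eta> undifferentiated being \<open>divergence_tangent\<close>.\<close>

lemma weak_divergence_tangent:
  fixes a :: 'v
  assumes \<eta>: "Ck_on (Suc 0) V \<eta>" and supp: "cball z \<rho> \<subseteq> V" "\<And>y. y \<in> V \<Longrightarrow> y \<notin> cball z \<rho> \<Longrightarrow> \<eta> y = 0"
  shows "(\<integral>y. indicator V y * (diff \<eta> y (tangent_coord u a y) * sqrt (gram_det u y)) \<partial>lborel)
       = real DIM('e) * (\<integral>y. indicator V y * (\<eta> y * (a \<bullet> u y) * sqrt (gram_det u y)) \<partial>lborel)"
proof -
  let ?\<xi> = "tangent_coord u a" and ?g = "\<lambda>y. sqrt (gram_det u y)"
  \<comment> \<open>The component along \<open>b\<close> of the density times \<eta> \<xi>, extended
    by zero to the whole space; it is C^1 because \<eta> vanishes outside a compact ball in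
    \<open>V\<close>.\<close>
  define Z where "Z b y = (if y \<in> V then \<eta> y * (?g y * (?\<xi> y \<bullet> b)) else 0)" for b y
  have Cg: "Ck_on (Suc 0) V ?g"
    by (rule Ck_on_compose[OF V _ Ck_gram Ck_on_sqrt]) (use gram_pos in auto)
  have CZ: "Ck_on (Suc 0) UNIV (Z b)" for b
  proof (rule Ck_on_locally)
    fix x
    show "\<exists>W. open W \<and> x \<in> W \<and> Ck_on (Suc 0) W (Z b)"
    proof (cases "x \<in> V")
      case True
      have "Ck_on (Suc 0) V (\<lambda>y. \<eta> y * (?g y * (?\<xi> y \<bullet> b)))"
        by (intro Ck_on_mult Ck_on_inner V \<eta> Cg Ck_tangent_coord Ck_on_const)
      then have "Ck_on (Suc 0) V (Z b)"
        by (subst Ck_on_cong[OF V]) (auto simp: Z_def)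
      then show ?thesis using True V by blast
    next
      case False
      have "Ck_on (Suc 0) (- cball z \<rho>) (Z b)"
        by (subst Ck_on_cong[where g = "\<lambda>_. 0"]) (use supp in \<open>auto simp: Z_def simp del: Ck_on.simps mem_cball intro!: Ck_on_const\<close>)
      moreover have "x \<in> - cball z \<rho>" using False supp by auto
      moreover have "open (- cball z \<rho>)" by (simp add: open_Compl)
      ultimately show ?thesis by blast
    qed
  qed
  have Z0: "Z b x = 0" if "x \<notin> cball z \<rho>" for b x
    using supp that by (auto simp: Z_def)
  note int = integral_partial_derivative_zero[OF CZ Z0]
  have "0 = (\<Sum>b\<in>Basis. \<integral>y. diff (Z b) y b \<partial>lborel)" using int(2) by simp
  also have "\<dots> = (\<integral>y. (\<Sum>b\<in>Basis. diff (Z b) y b) \<partial>lborel)"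
    using int(1) by (intro Bochner_Integration.integral_sum[symmetric])
  also have "\<dots> = (\<integral>y. indicator V y * (diff \<eta> y (?\<xi> y) * ?g y) - real DIM('e) * (indicator V y * (\<eta> y * (a \<bullet> u y) * ?g y)) \<partial>lborel)"
  proof (intro Bochner_Integration.integral_cong refl)
    fix y
    show "(\<Sum>b\<in>Basis. diff (Z b) y b) = indicator V y * (diff \<eta> y (?\<xi> y) * ?g y) - real DIM('e) * (indicator V y * (\<eta> y * (a \<bullet> u y) * ?g y))"
    proof (cases "y \<in> V")
      case True
      note y = True
      let ?S = "\<lambda>v. \<Sum>c\<in>Basis. diff u y (inv (metric_operator u y) c) \<bullet> second_diff u y v c"
      have "diff (Z b) y = diff (\<lambda>y. \<eta> y * (?g y * (?\<xi> y \<bullet> b))) y" for b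
        by (rule frechet_derivative_cong_open(1)[OF V y]) (simp add: Z_def)
      also have "diff (\<lambda>y. \<eta> y * (?g y * (?\<xi> y \<bullet> b))) y
         = (\<lambda>v. \<eta> y * (?g y * (diff ?\<xi> y v \<bullet> b) + (?g y * ?S v) * (?\<xi> y \<bullet> b)) + diff \<eta> y v * (?g y * (?\<xi> y \<bullet> b)))" for b
        by (intro frechet_derivative_eqI has_derivative_mult has_derivative_inner_left diff_sqrt_gram y
            Ck1_imp(2)[OF \<eta>] Ck1_imp(2)[OF Ck_tangent_coord])
      finally have "(\<Sum>b\<in>Basis. diff (Z b) y b)
         = (\<Sum>b\<in>Basis. \<eta> y * ?g y * (diff ?\<xi> y b \<bullet> b) + \<eta> y * ?g y * ((?\<xi> y \<bullet> b) * ?S b) + ?g y * ((?\<xi> y \<bullet> b) * diff \<eta> y b))"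
        by (simp add: algebra_simps)
      also have "\<dots> = \<eta> y * ?g y * (\<Sum>b\<in>Basis. diff ?\<xi> y b \<bullet> b) + \<eta> y * ?g y * (\<Sum>b\<in>Basis. (?\<xi> y \<bullet> b) * ?S b)
          + ?g y * (\<Sum>b\<in>Basis. (?\<xi> y \<bullet> b) * diff \<eta> y b)"
        by (simp add: sum.distrib sum_distrib_left)
      also have "(\<Sum>b\<in>Basis. (?\<xi> y \<bullet> b) * diff \<eta> y b) = diff \<eta> y (?\<xi> y)"
        using linear_sum_Basis[OF linear_frechet_derivative[OF Ck1_imp(1)[OF \<eta> y]], of "?\<xi> y"] by simp
      also have "(\<Sum>b\<in>Basis. (?\<xi> y \<bullet> b) * ?S b) = ?S (?\<xi> y)"
      proof -
        have "second_diff u y (?\<xi> y) c = (\<Sum>b\<in>Basis. (?\<xi> y \<bullet> b) *\<^sub>R second_diff u y b c)" for c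
          using second_diff_sum[OF y, of c "?\<xi> y"] second_diff_sym[OF y] by simp
        then have "?S (?\<xi> y) = (\<Sum>c\<in>Basis. \<Sum>b\<in>Basis. (?\<xi> y \<bullet> b) * (diff u y (inv (metric_operator u y) c) \<bullet> second_diff u y b c))"
          by (simp add: inner_sum_right)
        also have "\<dots> = (\<Sum>b\<in>Basis. (?\<xi> y \<bullet> b) * ?S b)"
          by (subst sum.swap) (simp add: sum_distrib_left)
        finally show ?thesis ..
      qed
      finally have "(\<Sum>b\<in>Basis. diff (Z b) y b) = \<eta> y * ?g y * ((\<Sum>b\<in>Basis. diff ?\<xi> y b \<bullet> b) + ?S (?\<xi> y)) + ?g y * diff \<eta> y (?\<xi> y)"
        by (simp add: algebra_simps)
      then show ?thesis
        unfolding divergence_tangent[OF y] using y by (simp add: algebra_simps)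
    next
      case False
      then have "y \<in> - cball z \<rho>" using supp by auto
      then have "diff (Z b) y = diff (\<lambda>_. 0) y" for b
        by (intro frechet_derivative_cong_open(1)[of "- cball z \<rho>"]) (use Z0 in auto)
      then show ?thesis using False by simp
    qed
  qed
  also have "\<dots> = (\<integral>y. indicator V y * (diff \<eta> y (?\<xi> y) * ?g y) \<partial>lborel) - real DIM('e) * (\<integral>y. indicator V y * (\<eta> y * (a \<bullet> u y) * ?g y) \<partial>lborel)"
  proof -
    have ind: "integrable lborel (\<lambda>y. indicator V y * h y)"
      if h: "continuous_on V h" "\<And>y. y \<in> V \<Longrightarrow> y \<notin> cball z \<rho> \<Longrightarrow> h y = 0" for h :: "'e \<Rightarrow> real"
    proof -
      have "integrable lborel (\<lambda>y. indicator (cball z \<rho>) y *\<^sub>R h y)"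
        by (rule borel_integrable_compact[OF compact_cball continuous_on_subset[OF h(1) supp(1)]])
      moreover have "(\<lambda>y. indicator (cball z \<rho>) y *\<^sub>R h y) = (\<lambda>y. indicator V y * h y)"
        using h(2) supp(1) by (auto simp: fun_eq_iff simp del: mem_cball split: split_indicator)
      ultimately show ?thesis by simp
    qed
    have d\<eta>0: "diff \<eta> y v = 0" if "y \<in> V" "y \<notin> cball z \<rho>" for y v
    proof -
      have "diff \<eta> y = diff (\<lambda>_. 0) y"
        by (rule frechet_derivative_cong_open(1)[of "V - cball z \<rho>"]) (use that supp V in \<open>auto simp: open_Diff simp del: mem_cball\<close>)
      then show ?thesis by simp
    qed
    have cd: "continuous_on V (\<lambda>y. diff \<eta> y (?\<xi> y))"
    proof -
      have "continuous_on V (\<lambda>y. \<Sum>b\<in>Basis. (?\<xi> y \<bullet> b) *\<^sub>R diff \<eta> y b)"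
        by (intro continuous_on_sum continuous_on_scaleR continuous_on_inner continuous_on_const Ck1_imp(3)[OF \<eta>]
            Ck1_imp(4)[OF Ck_tangent_coord])
      then show ?thesis
        by (rule continuous_on_eq) (rule linear_sum_Basis[OF linear_frechet_derivative[OF Ck1_imp(1)[OF \<eta>]], symmetric])
    qed
    show ?thesis
      by (subst Bochner_Integration.integral_diff)
        (auto intro!: ind integrable_mult_right continuous_on_mult cd Ck1_imp(4)[OF Cg] Ck1_imp(4)[OF \<eta>]
          continuous_on_inner continuous_on_const Ck1_imp(4)[OF Ck_u] simp: d\<eta>0 supp simp del: mem_cball)
  qed
  finally show ?thesis by simp
qed

end

section \<open>Integral identities for minimal immersions into the sphere\<close>

definition C1_map :: "('a, 'e::euclidean_space) atlas \<Rightarrow> ('a \<Rightarrow> real) \<Rightarrow> bool" where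
  "C1_map A \<eta> \<longleftrightarrow> (\<forall>(V, p)\<in>A. Ck_on (Suc 0) V (\<lambda>y. \<eta> (p y)))"

lemma C1_mapD: "C1_map A \<eta> \<Longrightarrow> (V, p) \<in> A \<Longrightarrow> Ck_on (Suc 0) V (\<lambda>y. \<eta> (p y))"
  by (auto simp: C1_map_def)

section \<open>Cutoff functions\<close>

lemma Ck_on_max_square: "Ck_on (Suc 0) UNIV (\<lambda>t::real. (max 0 t)\<^sup>2)"
proof (rule Ck_on_SucI[where f' = "\<lambda>t v. (2 * max 0 t) * v"])
  fix t :: real
  have "((\<lambda>t::real. (max 0 t)\<^sup>2) has_real_derivative 2 * max 0 t) (at t)"
  proof (cases "t = 0")
    case True
    have "((\<lambda>h. (max 0 h)\<^sup>2 / h) \<longlongrightarrow> 0) (at (0::real))"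
    proof (rule Lim_null_comparison[OF always_eventually])
      show "\<forall>h::real. norm ((max 0 h)\<^sup>2 / h) \<le> \<bar>h\<bar>"
        by (auto simp: max_def power2_eq_square)
    qed (auto intro: tendsto_rabs_zero tendsto_ident_at)
    then show ?thesis using True by (simp add: has_field_derivative_iff)
  next
    case False
    define U where "U = (if t > 0 then {0<..} else {..<0::real})"
    have "((\<lambda>s. if t > 0 then s\<^sup>2 else 0) has_real_derivative 2 * max 0 t) (at t)"
      using False by (cases "t > 0") (auto intro!: derivative_eq_intros)
    then show ?thesis
      by (rule has_field_derivative_transform_within_open[where S = U])
        (use False in \<open>auto simp: U_def max_def split: if_splits\<close>)
  qed
  then show "((\<lambda>t::real. (max 0 t)\<^sup>2) has_derivative (\<lambda>v. 2 * max 0 t * v)) (at t)"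
    by (simp add: has_field_derivative_def)
next
  fix v :: real
  show "Ck_on 0 UNIV (\<lambda>t. 2 * max 0 t * v)"
    unfolding Ck_on.simps by (intro continuous_intros)
qed simp

text \<open>Test functions need only be C^1, so the squared positive part of a quadratic polynomial
  serves as a cutoff.\<close>

definition ball_bump :: "'e::euclidean_space \<Rightarrow> real \<Rightarrow> 'e \<Rightarrow> real" where
  "ball_bump z \<rho> y = (max 0 (\<rho>\<^sup>2 - (y - z) \<bullet> (y - z)))\<^sup>2"

lemma Ck_on_ball_bump: "Ck_on (Suc 0) UNIV (ball_bump z \<rho>)"
proof -
  have 1: "Ck_on (Suc 0) UNIV (\<lambda>y. y + (- z))"
    by (intro Ck_on_add Ck_on_const Ck_on_bounded_linear bounded_linear_ident open_UNIV)
  have "Ck_on (Suc 0) UNIV (\<lambda>y. \<rho>\<^sup>2 + (- 1) * ((y + (- z)) \<bullet> (y + (- z))))"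
    by (intro Ck_on_add Ck_on_mult Ck_on_inner Ck_on_const 1 open_UNIV)
  from Ck_on_compose[OF open_UNIV open_UNIV this Ck_on_max_square] show ?thesis
    by (simp add: ball_bump_def[abs_def] del: Ck_on.simps)
qed

lemma ball_bump_nonneg: "0 \<le> ball_bump z \<rho> y"
  by (simp add: ball_bump_def)

lemma ball_bump_pos: "y \<in> ball z \<rho> \<Longrightarrow> 0 < ball_bump z \<rho> y"
proof -
  assume "y \<in> ball z \<rho>"
  then have "norm (y - z) < \<rho>" by (simp add: dist_norm norm_minus_commute)
  then have "(norm (y - z))\<^sup>2 < \<rho>\<^sup>2" by (intro power_strict_mono) auto
  then show ?thesis by (simp add: ball_bump_def power2_norm_eq_inner)
qed

lemma ball_bump_zero: "0 < \<rho> \<Longrightarrow> y \<notin> cball z \<rho> \<Longrightarrow> ball_bump z \<rho> y = 0"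
proof -
  assume "0 < \<rho>" "y \<notin> cball z \<rho>"
  then have "\<rho> < norm (y - z)" by (simp add: dist_norm norm_minus_commute)
  then have "\<rho>\<^sup>2 < (norm (y - z))\<^sup>2" using \<open>0 < \<rho>\<close> by (intro power_strict_mono) auto
  then show ?thesis by (simp add: ball_bump_def power2_norm_eq_inner)
qed

context closed_atlas
begin

lemma C1_map_mult: "C1_map A \<alpha> \<Longrightarrow> C1_map A \<beta> \<Longrightarrow> C1_map A (\<lambda>x. \<alpha> x * \<beta> x)"
  unfolding C1_map_def using chart_open Ck_on_mult by blast

lemma C1_map_sum:
  assumes "\<And>i. i \<in> I \<Longrightarrow> C1_map A (\<alpha> i)"
  shows "C1_map A (\<lambda>x. \<Sum>i\<in>I. \<alpha> i x)"
  unfolding C1_map_def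
proof clarify
  fix V p assume Vp: "(V, p) \<in> A"
  show "Ck_on (Suc 0) V (\<lambda>y. \<Sum>i\<in>I. \<alpha> i (p y))"
    by (intro Ck_on_sum chart_open[OF Vp] C1_mapD[OF assms Vp])
qed

lemma C1_map_inverse:
  assumes "C1_map A \<alpha>" "\<And>x. x \<in> points A \<Longrightarrow> \<alpha> x \<noteq> 0"
  shows "C1_map A (\<lambda>x. inverse (\<alpha> x))"
  unfolding C1_map_def
proof clarify
  fix V p assume Vp: "(V, p) \<in> A"
  show "Ck_on (Suc 0) V (\<lambda>y. inverse (\<alpha> (p y)))"
    by (rule Ck_on_compose[OF chart_open[OF Vp] _ C1_mapD[OF assms(1) Vp] Ck_on_inverse])
      (use assms(2) chart_in_points[OF Vp] in auto)
qed

lemma continuous_on_points: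
  assumes "\<And>V p. (V, p) \<in> A \<Longrightarrow> continuous_on V (\<lambda>y. k (p y))"
  shows "continuous_on (points A) k"
proof (rule continuous_on_eq_continuous_within[THEN iffD2], rule ballI)
  fix x assume x: "x \<in> points A"
  then obtain V p where Vp: "(V, p) \<in> A" "x \<in> p ` V" by (auto simp: points_def)
  obtain T where T: "open T" "p ` V = T \<inter> points A"
    using chart_image_open[OF Vp(1) chart_open[OF Vp(1)] order_refl] .
  have "continuous_on (p ` V) (\<lambda>x. k (p (inv_into V p x)))"
    by (rule continuous_on_compose2[OF assms[OF Vp(1)] chart_inv_cont[OF Vp(1)]]) (auto intro: inv_into_into)
  then have "continuous_on (p ` V) k"
    by (rule continuous_on_eq) (simp add: f_inv_into_f)
  then have "continuous (at x within T \<inter> points A) k"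
    using Vp(2) unfolding T(2) continuous_on_eq_continuous_within by blast
  moreover have "at x within T \<inter> points A = at x within points A"
    by (rule at_within_nhd[of x T]) (use T Vp(2) in auto)
  ultimately show "continuous (at x within points A) k" by (simp add: continuous_within)
qed

text \<open>The argument is a tuple so that the cutoffs can be summed over the index set of
  \<open>finite_ball_cover\<close>.\<close>

definition chart_bump :: "('e set \<times> ('e \<Rightarrow> 'a) \<times> 'e \<times> real) \<Rightarrow> 'a \<Rightarrow> real" where
  "chart_bump = (\<lambda>(V, p, z, \<rho>) x. if x \<in> p ` V then ball_bump z \<rho> (inv_into V p x) else 0)"

lemma C1_map_chart_bump:
  assumes Vp: "(V, p) \<in> A" and \<rho>: "0 < \<rho>" "cball z \<rho> \<subseteq> V"
  shows "C1_map A (chart_bump (V, p, z, \<rho>))"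
  unfolding C1_map_def
proof clarify
  fix W q assume Wq: "(W, q) \<in> A"
  define O' where "O' = W \<inter> q -` (p ` V)"
  define \<tau> where "\<tau> = inv_into V p \<circ> q"
  note tr = transition[OF Vp Wq, folded O'_def \<tau>_def]
  let ?K = "p ` cball z \<rho>"
  have "compact ?K"
    by (intro compact_continuous_image continuous_on_subset[OF chart_cont[OF Vp] \<rho>(2)]) auto
  then have K: "open (- ?K)" by (simp add: compact_imp_closed open_Compl)
  show "Ck_on (Suc 0) W (\<lambda>y. chart_bump (V, p, z, \<rho>) (q y))"
  proof (rule Ck_on_locally)
    fix y assume y: "y \<in> W"
    show "\<exists>U. open U \<and> y \<in> U \<and> Ck_on (Suc 0) U (\<lambda>y. chart_bump (V, p, z, \<rho>) (q y))"
    proof (cases "y \<in> O'")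
      case True
      have "Ck_on (Suc 0) O' (\<lambda>y. ball_bump z \<rho> (\<tau> y))"
        by (rule Ck_on_compose[OF tr(1) open_UNIV smooth_onD[OF tr(2)] Ck_on_ball_bump]) simp
      then have "Ck_on (Suc 0) O' (\<lambda>y. chart_bump (V, p, z, \<rho>) (q y))"
        by (subst Ck_on_cong[OF tr(1), where g = "\<lambda>y. ball_bump z \<rho> (\<tau> y)"])
          (auto simp: chart_bump_def O'_def \<tau>_def)
      then show ?thesis using True tr(1) by blast
    next
      case False
      \<comment> \<open>A point of \<open>W\<close> outside \<open>O'\<close> is mapped off the
        compact, hence closed, image of the ball, and so are its neighbours; the cutoff vanishes
        there.\<close>
      let ?U = "W \<inter> q -` (- ?K)"
      have U: "open ?U" by (rule continuous_open_preimage[OF chart_cont[OF Wq] chart_open[OF Wq] K])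
      have "chart_bump (V, p, z, \<rho>) (q x) = 0" if x: "x \<in> ?U" for x
      proof (cases "q x \<in> p ` V")
        case True
        then have "inv_into V p (q x) \<notin> cball z \<rho>"
          using x by (metis ComplD IntD2 f_inv_into_f imageI vimageD)
        then show ?thesis using True ball_bump_zero[OF \<rho>(1)] by (simp add: chart_bump_def)
      qed (simp add: chart_bump_def)
      then have "Ck_on (Suc 0) ?U (\<lambda>y. chart_bump (V, p, z, \<rho>) (q y))"
        by (subst Ck_on_cong[OF U, where g = "\<lambda>_. 0"]) (auto intro: Ck_on_const[OF U] simp del: Ck_on.simps)
      moreover have "y \<in> ?U" using y False \<rho>(2) by (auto simp: O'_def)
      ultimately show ?thesis using U by blast
    qed
  qed
qed

end

section \<open>Integration by parts on the whole manifold\<close>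

locale minimal_sphere_immersion = closed_immersion A f
  for A :: "('a::{t2_space,second_countable_topology}, 'e::euclidean_space) atlas"
    and f :: "'a \<Rightarrow> 'v::euclidean_space" +
  assumes sphere: "f ` points A \<subseteq> sphere 0 1" and minimal: "minimal_in_sphere A f"
begin

lemma sphere_chart: "(V, p) \<in> A \<Longrightarrow> sphere_chart (f \<circ> p) V"
proof
  assume Vp: "(V, p) \<in> A"
  show "norm ((f \<circ> p) y) = 1" if "y \<in> V" for y
    using sphere chart_in_points[OF Vp that] by auto
  show "mean_curvature_sphere (f \<circ> p) y = 0" if "y \<in> V" for y
    using minimal Vp that by (auto simp: minimal_in_sphere_def)
qed (use chart_open chart_smooth chart_inj_diff in auto)

text \<open>The derivative of \<open>\<eta>\<close> in the direction of the tangential part of the constant vector \<open>a\<close>.\<close>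

definition tangent_deriv :: "'v \<Rightarrow> ('a \<Rightarrow> real) \<Rightarrow> 'a \<Rightarrow> real" where
  "tangent_deriv a \<eta> x = (THE r. \<forall>(V, p)\<in>A. \<forall>y\<in>V. p y = x \<longrightarrow>
     r = diff (\<lambda>y. \<eta> (p y)) y (tangent_coord (f \<circ> p) a y))"

text \<open>The tangential part of \<open>a\<close> depends on the tangent space alone. Its
  coordinates in the two charts are matched by the derivative of the transition map, because the
  latter is onto and the equations of \<open>tangent_coord_unique\<close> have one solution.\<close>

lemma tangent_deriv_well_defined:
  assumes \<eta>: "C1_map A \<eta>" and Vp: "(V, p) \<in> A" "y \<in> V" and Wq: "(W, q) \<in> A" "w \<in> W" and eq: "p y = q w"
  shows "diff (\<lambda>y. \<eta> (q y)) w (tangent_coord (f \<circ> q) a w) = diff (\<lambda>y. \<eta> (p y)) y (tangent_coord (f \<circ> p) a y)"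
proof -
  define O' where "O' = W \<inter> q -` (p ` V)"
  define \<tau> where "\<tau> = inv_into V p \<circ> q"
  note tr = transition[OF Vp(1) Wq(1), folded O'_def \<tau>_def]
  have w: "w \<in> O'" using Vp Wq eq by (auto simp: O'_def) (metis imageI)
  have \<tau>w: "\<tau> w = y" using Vp chart_inj[OF Vp(1)] by (simp add: \<tau>_def flip: eq)
  have d\<tau>: "(\<tau> has_derivative diff \<tau> w) (at w)" by (rule Ck1_imp(2)[OF smooth_onD[OF tr(2)] w])
  have chain: "diff (\<lambda>y. g (q y)) w v = diff (\<lambda>y. g (p y)) y (diff \<tau> w v)"
    if g: "(\<lambda>y. g (p y)) differentiable (at y)" for g :: "'a \<Rightarrow> 'c::real_normed_vector" and v
  proof -
    have "diff (\<lambda>y. g (q y)) w = diff (\<lambda>y. g (p (\<tau> y))) w"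
      by (rule frechet_derivative_cong_open(1)[OF tr(1) w]) (simp add: tr(5))
    also have "\<dots> = (\<lambda>v. diff (\<lambda>y. g (p y)) y (diff \<tau> w v))"
      using has_derivative_compose[OF d\<tau>, of "\<lambda>y. g (p y)"] differentiable_has_frechet[OF g] \<tau>w
      by (intro frechet_derivative_eqI) auto
    finally show ?thesis by simp
  qed
  have cf: "diff (f \<circ> q) w v = diff (f \<circ> p) y (diff \<tau> w v)" for v
    using chain[of f v] chart_differentiable[OF Vp] by (simp add: o_def)
  have lin: "linear (diff \<tau> w)" using d\<tau> by (rule has_derivative_linear)
  have "inj (diff \<tau> w)"
  proof (rule injI)
    fix v v' assume "diff \<tau> w v = diff \<tau> w v'"
    then have "diff (f \<circ> q) w v = diff (f \<circ> q) w v'" by (simp add: cf)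
    then show "v = v'" using chart_inj_diff[OF Wq] by (simp add: inj_eq)
  qed
  then have "surj (diff \<tau> w)" using linear_inj_imp_surj[OF lin] by blast
  note T = tangent_coord[OF chart_differentiable[OF Wq] chart_inj_diff[OF Wq], of _ a]
  have "diff \<tau> w (tangent_coord (f \<circ> q) a w) = tangent_coord (f \<circ> p) a y"
  proof (rule tangent_coord_unique[OF chart_differentiable[OF Vp] chart_inj_diff[OF Vp]])
    fix v
    obtain v' where "v = diff \<tau> w v'" using \<open>surj (diff \<tau> w)\<close> by (metis surjD)
    then show "diff (f \<circ> p) y v \<bullet> diff (f \<circ> p) y (diff \<tau> w (tangent_coord (f \<circ> q) a w)) = diff (f \<circ> p) y v \<bullet> a"
      using T[of v'] by (simp add: cf)
  qed
  then show ?thesis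
    using chain[of \<eta>] Ck1_imp(1)[OF C1_mapD[OF \<eta> Vp(1)] Vp(2)] by simp
qed

lemma tangent_deriv_chart:
  assumes "C1_map A \<eta>" "(V, p) \<in> A" "y \<in> V"
  shows "tangent_deriv a \<eta> (p y) = diff (\<lambda>y. \<eta> (p y)) y (tangent_coord (f \<circ> p) a y)"
  unfolding tangent_deriv_def
proof (rule the_equality)
  show "\<forall>(W, q)\<in>A. \<forall>w\<in>W. q w = p y \<longrightarrow>
      diff (\<lambda>y. \<eta> (p y)) y (tangent_coord (f \<circ> p) a y) = diff (\<lambda>y. \<eta> (q y)) w (tangent_coord (f \<circ> q) a w)"
  proof clarify
    fix W q w assume "(W, q) \<in> A" "w \<in> W" "q w = p y"
    then show "diff (\<lambda>y. \<eta> (p y)) y (tangent_coord (f \<circ> p) a y) = diff (\<lambda>y. \<eta> (q y)) w (tangent_coord (f \<circ> q) a w)"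
      by (intro tangent_deriv_well_defined[OF assms, symmetric]) simp_all
  qed
  fix r
  assume "\<forall>(W, q)\<in>A. \<forall>w\<in>W. q w = p y \<longrightarrow> r = diff (\<lambda>y. \<eta> (q y)) w (tangent_coord (f \<circ> q) a w)"
  from bspec[OF this assms(2)] show "r = diff (\<lambda>y. \<eta> (p y)) y (tangent_coord (f \<circ> p) a y)"
    using assms(3) by simp
qed

lemma tangent_deriv_sum:
  assumes "\<And>i. i \<in> I \<Longrightarrow> C1_map A (\<alpha> i)" "x \<in> points A"
  shows "tangent_deriv a (\<lambda>x. \<Sum>i\<in>I. \<alpha> i x) x = (\<Sum>i\<in>I. tangent_deriv a (\<alpha> i) x)"
proof -
  obtain V p y where Vp: "(V, p) \<in> A" "y \<in> V" "x = p y" using assms(2) by (auto simp: points_def)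
  have "((\<lambda>y. \<Sum>i\<in>I. \<alpha> i (p y)) has_derivative (\<lambda>v. \<Sum>i\<in>I. diff (\<lambda>y. \<alpha> i (p y)) y v)) (at y)"
    by (intro has_derivative_sum Ck1_imp(2)[OF C1_mapD[OF assms(1) Vp(1)] Vp(2)])
  then have "diff (\<lambda>y. \<Sum>i\<in>I. \<alpha> i (p y)) y = (\<lambda>v. \<Sum>i\<in>I. diff (\<lambda>y. \<alpha> i (p y)) y v)"
    by (rule frechet_derivative_eqI)
  then show ?thesis
    unfolding Vp(3) using tangent_deriv_chart[OF _ Vp(1,2)] C1_map_sum[of I \<alpha>] assms(1) by simp
qed

lemma tangent_deriv_cong:
  assumes "C1_map A \<alpha>" "\<And>x. x \<in> points A \<Longrightarrow> \<alpha> x = \<beta> x" "x \<in> points A"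
  shows "tangent_deriv a \<alpha> x = tangent_deriv a \<beta> x"
proof -
  have \<beta>: "C1_map A \<beta>"
    unfolding C1_map_def
  proof clarify
    fix V p assume Vp: "(V, p) \<in> A"
    show "Ck_on (Suc 0) V (\<lambda>y. \<beta> (p y))"
      using C1_mapD[OF assms(1) Vp] Ck_on_cong[OF chart_open[OF Vp], of "\<lambda>y. \<alpha> (p y)" "\<lambda>y. \<beta> (p y)"]
        assms(2) chart_in_points[OF Vp] by blast
  qed
  obtain V p y where Vp: "(V, p) \<in> A" "y \<in> V" "x = p y" using assms(3) by (auto simp: points_def)
  have "diff (\<lambda>y. \<alpha> (p y)) y = diff (\<lambda>y. \<beta> (p y)) y"
    by (rule frechet_derivative_cong_open(1)[OF chart_open[OF Vp(1)] Vp(2)]) (use assms(2) chart_in_points[OF Vp(1)] in auto)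
  then show ?thesis unfolding Vp(3) using tangent_deriv_chart[OF _ Vp(1,2)] assms(1) \<beta> by simp
qed

lemma continuous_on_tangent_deriv:
  assumes \<eta>: "C1_map A \<eta>"
  shows "continuous_on (points A) (tangent_deriv a \<eta>)"
proof (rule continuous_on_points)
  fix V p assume Vp: "(V, p) \<in> A"
  interpret sphere_chart "f \<circ> p" V by (rule sphere_chart[OF Vp])
  note C = C1_mapD[OF \<eta> Vp]
  have "continuous_on V (\<lambda>y. \<Sum>b\<in>Basis. (tangent_coord (f \<circ> p) a y \<bullet> b) *\<^sub>R diff (\<lambda>y. \<eta> (p y)) y b)"
    by (intro continuous_on_sum continuous_on_scaleR continuous_on_inner continuous_on_const Ck1_imp(3)[OF C]
        Ck1_imp(4)[OF Ck_tangent_coord])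
  then show "continuous_on V (\<lambda>y. tangent_deriv a \<eta> (p y))"
  proof (rule continuous_on_eq)
    fix y assume y: "y \<in> V"
    show "(\<Sum>b\<in>Basis. (tangent_coord (f \<circ> p) a y \<bullet> b) *\<^sub>R diff (\<lambda>y. \<eta> (p y)) y b) = tangent_deriv a \<eta> (p y)"
      unfolding tangent_deriv_chart[OF \<eta> Vp y]
      by (rule linear_sum_Basis[OF linear_frechet_derivative[OF Ck1_imp(1)[OF C y]], symmetric])
  qed
qed

lemma integrable_vol:
  fixes k :: "'a \<Rightarrow> real"
  assumes "continuous_on (points A) k"
  shows "integrable vol k"
proof -
  interpret finite_measure vol by (rule finite_measure_vol)
  have "compact (k ` points A)" by (rule compact_continuous_image[OF assms compact_points])
  then have "bounded (k ` points A)" by (rule compact_imp_bounded)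
  then obtain B where B: "\<forall>x\<in>points A. norm (k x) \<le> B" unfolding bounded_iff by auto
  have "k \<in> borel_measurable (restrict_space borel (points A))"
    by (rule borel_measurable_continuous_on_restrict[OF assms])
  then have "k \<in> borel_measurable vol" using measurable_cong_sets[OF sets_vol refl] by blast
  then show ?thesis
    by (intro integrable_const_bound[of _ B] AE_I2) (use B in \<open>auto simp: space_vol\<close>)
qed

lemma continuous_on_f: "continuous_on (points A) f"
proof (rule continuous_on_eq_continuous_within[THEN iffD2], rule ballI)
  fix x assume x: "x \<in> points A"
  have "continuous_on (points A) (\<lambda>x. f x \<bullet> b)" for b
  proof (rule continuous_on_points)
    fix V p assume "(V, p) \<in> A"
    from Ck1_imp(4)[OF chart_Ck[OF this]] show "continuous_on V (\<lambda>y. f (p y) \<bullet> b)"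
      by (intro continuous_on_inner continuous_on_const) (simp add: o_def)
  qed
  then have "continuous_on (points A) f" by (rule continuous_on_componentwise[THEN iffD2, rule_format])
  then show "continuous (at x within points A) f" using x by (simp add: continuous_on_eq_continuous_within)
qed

lemma C1_map_continuous: "C1_map A \<eta> \<Longrightarrow> continuous_on (points A) \<eta>"
  by (rule continuous_on_points) (use Ck1_imp(4) C1_mapD in blast)

lemma integral_tangent_deriv_local:
  assumes \<eta>: "C1_map A \<eta>" and Vp: "(V, p) \<in> A" and \<rho>: "cball z \<rho> \<subseteq> V"
    and supp: "\<And>x. x \<in> points A \<Longrightarrow> x \<notin> p ` cball z \<rho> \<Longrightarrow> \<eta> x = 0"
  shows "(\<integral>x. tangent_deriv a \<eta> x \<partial>vol) = real DIM('e) * (\<integral>x. \<eta> x * (a \<bullet> f x) \<partial>vol)"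
proof -
  interpret sphere_chart "f \<circ> p" V by (rule sphere_chart[OF Vp])
  note C = C1_mapD[OF \<eta> Vp]
  have K: "compact (p ` cball z \<rho>)"
    by (intro compact_continuous_image continuous_on_subset[OF chart_cont[OF Vp] \<rho>]) auto
  \<comment> \<open>The support of \<eta> is contained in the closed set \<open>p\<close> cball z
    \<rho>\<open>, so \<eta> vanishes near a point outside\<close>p \<open>V\<close>.\<close>
  have td0: "tangent_deriv a \<eta> x = 0" if x: "x \<in> points A" "x \<notin> p ` V" for x
  proof -
    obtain W q w where Wq: "(W, q) \<in> A" "w \<in> W" "x = q w" using x(1) by (auto simp: points_def)
    let ?U = "W \<inter> q -` (- (p ` cball z \<rho>))"
    have U: "open ?U"
      by (rule continuous_open_preimage[OF chart_cont[OF Wq(1)] chart_open[OF Wq(1)]])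
        (use K in \<open>simp add: compact_imp_closed open_Compl\<close>)
    have "diff (\<lambda>y. \<eta> (q y)) w = diff (\<lambda>_. 0) w"
      by (rule frechet_derivative_cong_open(1)[OF U]) (use x Wq \<rho> supp chart_in_points[OF Wq(1)] in auto)
    then show ?thesis unfolding Wq(3) tangent_deriv_chart[OF \<eta> Wq(1,2)] by simp
  qed
  have "(\<integral>x. tangent_deriv a \<eta> x \<partial>vol)
     = (\<integral>y. indicator V y * (tangent_deriv a \<eta> (p y) * sqrt (gram_det (f \<circ> p) y)) \<partial>lborel)"
    by (rule integral_chart[OF Vp borel_measurable_integrable[OF integrable_vol[OF continuous_on_tangent_deriv[OF \<eta>]]] td0])
  also have "\<dots> = (\<integral>y. indicator V y * (diff (\<lambda>y. \<eta> (p y)) y (tangent_coord (f \<circ> p) a y) * sqrt (gram_det (f \<circ> p) y)) \<partial>lborel)"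
    by (intro Bochner_Integration.integral_cong refl) (auto simp: tangent_deriv_chart[OF \<eta> Vp] split: split_indicator)
  also have "\<dots> = real DIM('e) * (\<integral>y. indicator V y * (\<eta> (p y) * (a \<bullet> (f \<circ> p) y) * sqrt (gram_det (f \<circ> p) y)) \<partial>lborel)"
  proof (rule weak_divergence_tangent[OF C \<rho>])
    fix y assume y: "y \<in> V" "y \<notin> cball z \<rho>"
    then have "p y \<notin> p ` cball z \<rho>" using chart_inj[OF Vp] \<rho> by (auto simp: inj_on_def subset_iff simp del: mem_cball)
    then show "\<eta> (p y) = 0" using supp chart_in_points[OF Vp y(1)] by blast
  qed
  also have "(\<integral>y. indicator V y * (\<eta> (p y) * (a \<bullet> (f \<circ> p) y) * sqrt (gram_det (f \<circ> p) y)) \<partial>lborel)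
     = (\<integral>x. \<eta> x * (a \<bullet> f x) \<partial>vol)"
  proof (subst integral_chart[OF Vp])
    show "(\<lambda>x. \<eta> x * (a \<bullet> f x)) \<in> borel_measurable vol"
      by (intro borel_measurable_integrable integrable_vol continuous_on_mult C1_map_continuous[OF \<eta>]
          continuous_on_inner continuous_on_const continuous_on_f)
    show "\<eta> x * (a \<bullet> f x) = 0" if "x \<in> points A" "x \<notin> p ` V" for x
      using supp[OF that(1)] that(2) \<rho> by auto
  qed (simp add: o_def)
  finally show ?thesis .
qed

text \<open>A partition of unity reduces this to one chart. It is the weak form of the fact that the
  coordinate functions of a minimal immersion into the unit sphere are eigenfunctions of the
  Laplacian, the eigenvalue being the dimension.\<close>

lemma integral_tangent_deriv:
  assumes \<eta>: "C1_map A \<eta>"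
  shows "(\<integral>x. tangent_deriv a \<eta> x \<partial>vol) = real DIM('e) * (\<integral>x. \<eta> x * (a \<bullet> f x) \<partial>vol)"
proof -
  obtain F where F: "finite F"
    "\<forall>(V, p, z, \<rho>)\<in>F. (V, p) \<in> A \<and> 0 < \<rho> \<and> cball z \<rho> \<subseteq> V"
    "points A \<subseteq> (\<Union>(V, p, z, \<rho>)\<in>F. p ` ball z \<rho>)"
    by (rule finite_ball_cover)
  let ?\<beta> = chart_bump
  define S where "S x = (\<Sum>c\<in>F. ?\<beta> c x)" for x
  have C\<beta>: "C1_map A (?\<beta> c)" if c: "c \<in> F" for c
  proof -
    obtain V p z \<rho> where "c = (V, p, z, \<rho>)" by (cases c)
    then show ?thesis using C1_map_chart_bump[of V p \<rho> z] F(2) c by auto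
  qed
  have \<beta>0: "0 \<le> ?\<beta> c x" for c x by (cases c) (simp add: chart_bump_def ball_bump_nonneg)
  have Spos: "S x > 0" if x: "x \<in> points A" for x
  proof -
    obtain V p z \<rho> where c: "(V, p, z, \<rho>) \<in> F" "x \<in> p ` ball z \<rho>" using x F(3) by fastforce
    then obtain y where y: "y \<in> ball z \<rho>" "x = p y" by blast
    have "(V, p) \<in> A" "cball z \<rho> \<subseteq> V" using F(2) c(1) by auto
    then have V: "(V, p) \<in> A" "y \<in> V" using y(1) by (auto simp: subset_iff)
    then have "?\<beta> (V, p, z, \<rho>) x > 0"
      using ball_bump_pos[OF y(1)] chart_inj[OF V(1)] by (simp add: chart_bump_def y(2))
    then show ?thesis unfolding S_def by (intro sum_pos2[OF F(1) c(1)] \<beta>0)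
  qed
  \<comment> \<open>Dividing by the sum of the cutoffs, which is positive on the manifold, makes the
    products with the single cutoffs add up to \<eta>.\<close>
  define \<eta>' where "\<eta>' x = \<eta> x * inverse (S x)" for x
  have C\<eta>': "C1_map A \<eta>'"
    unfolding \<eta>'_def[abs_def] S_def[abs_def] using Spos unfolding S_def
    by (intro C1_map_mult \<eta> C1_map_inverse C1_map_sum C\<beta>) force+
  have C: "C1_map A (\<lambda>x. ?\<beta> c x * \<eta>' x)" if "c \<in> F" for c
    by (intro C1_map_mult C\<beta> C\<eta>' that)
  have eq: "\<eta> x = (\<Sum>c\<in>F. ?\<beta> c x * \<eta>' x)" if "x \<in> points A" for x
    using Spos[OF that] by (simp add: sum_distrib_right[symmetric] \<eta>'_def S_def[symmetric])
  have loc: "(\<integral>x. tangent_deriv a (\<lambda>x. ?\<beta> c x * \<eta>' x) x \<partial>vol) = real DIM('e) * (\<integral>x. ?\<beta> c x * \<eta>' x * (a \<bullet> f x) \<partial>vol)" if c: "c \<in> F" for c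
  proof -
    obtain V p z \<rho> where c': "c = (V, p, z, \<rho>)" by (cases c)
    then have Vp: "(V, p) \<in> A" "0 < \<rho>" "cball z \<rho> \<subseteq> V" using F(2) c by auto
    show ?thesis
    proof (rule integral_tangent_deriv_local[OF C[OF c] Vp(1,3)])
      fix x assume x: "x \<notin> p ` cball z \<rho>"
      have "inv_into V p x \<notin> cball z \<rho>" if "x \<in> p ` V" using x that by (metis f_inv_into_f imageI)
      then have "?\<beta> c x = 0"
        using ball_bump_zero[OF Vp(2), of "inv_into V p x" z] by (auto simp: c' chart_bump_def simp del: mem_cball)
      then show "?\<beta> c x * \<eta>' x = 0" by simp
    qed
  qed
  have "(\<integral>x. tangent_deriv a \<eta> x \<partial>vol) = (\<integral>x. (\<Sum>c\<in>F. tangent_deriv a (\<lambda>x. ?\<beta> c x * \<eta>' x) x) \<partial>vol)"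
    by (intro Bochner_Integration.integral_cong refl)
      (simp add: space_vol tangent_deriv_cong[OF \<eta> eq] tangent_deriv_sum[OF C])
  also have "\<dots> = (\<Sum>c\<in>F. \<integral>x. tangent_deriv a (\<lambda>x. ?\<beta> c x * \<eta>' x) x \<partial>vol)"
    by (intro Bochner_Integration.integral_sum integrable_vol continuous_on_tangent_deriv C)
  also have "\<dots> = (\<Sum>c\<in>F. real DIM('e) * (\<integral>x. ?\<beta> c x * \<eta>' x * (a \<bullet> f x) \<partial>vol))"
    by (intro sum.cong refl loc)
  also have "\<dots> = real DIM('e) * (\<integral>x. (\<Sum>c\<in>F. ?\<beta> c x * \<eta>' x * (a \<bullet> f x)) \<partial>vol)"
    unfolding sum_distrib_left[symmetric]
    by (subst Bochner_Integration.integral_sum)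
      (auto intro!: integrable_vol continuous_on_mult[OF C1_map_continuous[OF C]] continuous_on_inner continuous_on_const continuous_on_f)
  also have "(\<integral>x. (\<Sum>c\<in>F. ?\<beta> c x * \<eta>' x * (a \<bullet> f x)) \<partial>vol) = (\<integral>x. \<eta> x * (a \<bullet> f x) \<partial>vol)"
    by (intro Bochner_Integration.integral_cong refl) (simp add: space_vol eq sum_distrib_right)
  finally show ?thesis .
qed

text \<open>The test function 1 has vanishing tangential derivative.\<close>

lemma integral_linear_zero:
  shows "(\<integral>x. a \<bullet> f x \<partial>vol) = 0"
proof -
  have C: "C1_map A (\<lambda>_. 1)" using chart_open Ck_on_const unfolding C1_map_def by blast
  have "tangent_deriv a (\<lambda>_. 1) x = 0" if x: "x \<in> points A" for x
  proof -
    obtain V p y where Vp: "(V, p) \<in> A" "y \<in> V" "x = p y" using x by (auto simp: points_def)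
    show ?thesis unfolding Vp(3) tangent_deriv_chart[OF C Vp(1,2)] by simp
  qed
  then have "(\<integral>x. tangent_deriv a (\<lambda>_. 1) x \<partial>vol) = (\<integral>x. 0 \<partial>vol)"
    by (intro Bochner_Integration.integral_cong refl) (simp add: space_vol)
  then show ?thesis using integral_tangent_deriv[OF C, of a] by simp
qed

text \<open>For the test function <a, f> the tangential derivative is the squared length of the
  tangential part of \<open>a\<close>. Since that part is orthogonal to \<open>f\<close>, and
  \<open>f\<close> has length 1, the squared length is at most |a|^2 - <a, f>^2; moving the last
  term to the left gives the summand 1.\<close>

lemma integral_quadratic_le:
  shows "(real DIM('e) + 1) * (\<integral>x. (a \<bullet> f x)\<^sup>2 \<partial>vol) \<le> (a \<bullet> a) * measure vol (points A)"
proof -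
  interpret finite_measure vol by (rule finite_measure_vol)
  have Cu: "Ck_on k V (\<lambda>y. a \<bullet> f (p y))" if "(V, p) \<in> A" for k V p
    using Ck_on_inner[OF chart_open[OF that] Ck_on_const[OF chart_open[OF that]] chart_Ck[OF that]] by (simp add: o_def)
  have C: "C1_map A (\<lambda>x. a \<bullet> f x)" unfolding C1_map_def using Cu by blast
  have td: "tangent_deriv a (\<lambda>x. a \<bullet> f x) x \<le> a \<bullet> a - (a \<bullet> f x)\<^sup>2" if x: "x \<in> points A" for x
  proof -
    obtain V p y where Vp: "(V, p) \<in> A" "y \<in> V" "x = p y" using x by (auto simp: points_def)
    interpret sphere_chart "f \<circ> p" V by (rule sphere_chart[OF Vp(1)])
    let ?P = "diff (f \<circ> p) y (tangent_coord (f \<circ> p) a y)"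
    have "((\<lambda>y. a \<bullet> (f \<circ> p) y) has_derivative (\<lambda>v. a \<bullet> diff (f \<circ> p) y v)) (at y)"
      by (intro has_derivative_inner_right Ck1_imp(2)[OF Ck_u Vp(2)])
    then have "diff (\<lambda>y. a \<bullet> (f \<circ> p) y) y = (\<lambda>v. a \<bullet> diff (f \<circ> p) y v)" by (rule frechet_derivative_eqI)
    then have 1: "tangent_deriv a (\<lambda>x. a \<bullet> f x) x = a \<bullet> ?P"
      unfolding Vp(3) tangent_deriv_chart[OF C Vp(1,2)] by (simp add: o_def)
    have 2: "?P \<bullet> ?P = a \<bullet> ?P"
      using tangent_coord[OF diff_u[OF Vp(2)] inj_u[OF Vp(2)], of "tangent_coord (f \<circ> p) a y" a] by (simp add: inner_commute)
    have 3: "f x \<bullet> ?P = 0" using inner_u_diff[OF Vp(2)] Vp(3) by simp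
    have 4: "f x \<bullet> f x = 1" using norm_u[OF Vp(2)] Vp(3) by (simp add: dot_square_norm)
    \<comment> \<open>The squared length of the component of \<open>a\<close> normal to the
      immersion in the sphere.\<close>
    have "0 \<le> (a - ?P - (a \<bullet> f x) *\<^sub>R f x) \<bullet> (a - ?P - (a \<bullet> f x) *\<^sub>R f x)" by simp
    also have "\<dots> = a \<bullet> a - a \<bullet> ?P - (a \<bullet> f x)\<^sup>2"
      using 2 3 4 by (simp add: inner_diff_left inner_diff_right inner_commute power2_eq_square algebra_simps)
    finally show ?thesis using 1 by simp
  qed
  have cq: "continuous_on (points A) (\<lambda>x. (a \<bullet> f x)\<^sup>2)"
    by (intro continuous_on_power continuous_on_inner continuous_on_const continuous_on_f)
  have "real DIM('e) * (\<integral>x. (a \<bullet> f x)\<^sup>2 \<partial>vol) = (\<integral>x. tangent_deriv a (\<lambda>x. a \<bullet> f x) x \<partial>vol)"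
    unfolding integral_tangent_deriv[OF C] by (simp add: power2_eq_square)
  also have "\<dots> \<le> (\<integral>x. a \<bullet> a - (a \<bullet> f x)\<^sup>2 \<partial>vol)"
    by (intro integral_mono integrable_vol continuous_on_tangent_deriv[OF C] continuous_on_diff continuous_on_const cq)
      (simp add: space_vol td)
  also have "\<dots> = (a \<bullet> a) * measure vol (points A) - (\<integral>x. (a \<bullet> f x)\<^sup>2 \<partial>vol)"
    by (subst Bochner_Integration.integral_diff) (auto intro!: integrable_vol cq simp: space_vol)
  finally show ?thesis by (simp add: algebra_simps)
qed

text \<open>The density is positive on a nonempty open chart domain. The strict sign of the second
  variation, which carries this volume as a factor, depends on it.\<close>

lemma measure_vol_pos: "measure vol (points A) > 0"
proof -
  interpret finite_measure vol by (rule finite_measure_vol)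
  obtain V p y where Vp: "(V, p) \<in> A" "y \<in> V" using points_nonempty by (auto simp: points_def)
  have oV: "open V" by (rule chart_open[OF Vp(1)])
  have "emeasure vol (p ` V) \<noteq> 0"
  proof
    assume "emeasure vol (p ` V) = 0"
    then have "(\<integral>\<^sup>+y. ennreal (indicator V y * sqrt (gram_det (f \<circ> p) y)) \<partial>lborel) = 0"
      unfolding emeasure_vol[OF Vp(1) borel_open[OF oV] order_refl]
      by (rule trans[rotated]) (auto intro!: nn_integral_cong split: split_indicator)
    then have "AE y in lborel. ennreal (indicator V y * sqrt (gram_det (f \<circ> p) y)) = 0"
      using chart_density_measurable[OF Vp(1)] by (subst (asm) nn_integral_0_iff_AE) auto
    then have "AE y in lborel. y \<notin> V"
      by eventually_elim (use chart_gram_pos[OF Vp(1)] in \<open>force simp: indicator_def split: if_splits\<close>)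
    then have "emeasure lborel V = 0"
      using oV by (subst (asm) AE_iff_measurable[where N = V]) auto
    then show False using Vp(2) oV open_not_negligible[of V] by (auto simp: negligible_iff_null_sets null_sets_def)
  qed
  moreover have "p ` V \<subseteq> points A" using chart_in_points[OF Vp(1)] by auto
  ultimately have "emeasure vol (points A) \<noteq> 0"
    using emeasure_mono[of "p ` V" "points A" vol] by (auto simp: in_sets_vol_iff)
  then show ?thesis by (simp add: emeasure_eq_measure zero_less_measure_iff measure_nonneg less_le)
qed

end

section \<open>The induced measure on the product of a curve and a Legendrian immersion\<close>

text \<open>The real inner product and \<omega> are, up to sign, the real and imaginary parts of the
  Hermitian form, and this is its sesquilinearity. Vectors on which both vanish therefore stay
  orthogonal under all complex scalings.\<close>

lemma inner_vector_scalar_mult: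
  fixes x y :: "complex ^ 'n"
  shows "(c *s x) \<bullet> (d *s y) = Re (c * cnj d) * (x \<bullet> y) + Im (c * cnj d) * \<omega> x y"
  by (simp add: inner_vec_def \<omega>_def J_def inner_complex_def sum_distrib_left sum.distrib[symmetric] algebra_simps
      sum_subtractf[symmetric])

lemma norm_vector_scalar_mult: "norm (c *s (x :: complex ^ 'n)) = norm c * norm x"
proof -
  have "(c *s x) \<bullet> (c *s x) = (norm c)\<^sup>2 * (norm x)\<^sup>2"
    unfolding inner_vector_scalar_mult by (simp add: complex_mult_cnj cmod_power2 power2_norm_eq_inner)
  then have "(norm (c *s x))\<^sup>2 = (norm c * norm x)\<^sup>2"
    by (simp add: power2_norm_eq_inner[of "c *s x"] power_mult_distrib)
  then show ?thesis by (simp add: power2_eq_iff_nonneg)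
qed

lemma bounded_bilinear_vector_scalar_mult:
  "bounded_bilinear (\<lambda>(c::complex) (x :: complex ^ 'n). c *s x)"
proof
  show "\<exists>K. \<forall>c (x :: complex ^ 'n). norm (c *s x) \<le> norm c * norm x * K"
    by (intro exI[of _ 1]) (simp add: norm_vector_scalar_mult)
qed (auto simp: vec_eq_iff algebra_simps)

section \<open>Periodic functions and angles on the circle\<close>

lemma periodic_int:
  fixes f :: "real \<Rightarrow> 'b"
  assumes "\<And>t. f (t + P) = f t"
  shows "f (t + of_int k * P) = f t"
proof -
  have nat: "f (t + real m * P) = f t" for m t
  proof (induction m)
    case (Suc m)
    have "f (t + real (Suc m) * P) = f ((t + real m * P) + P)" by (simp add: algebra_simps)
    then show ?case using assms[of "t + real m * P"] Suc by simp
  qed simp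
  show ?thesis
  proof (cases "k \<ge> 0")
    case True
    then show ?thesis using nat[of t "nat k"] by simp
  next
    case False
    then show ?thesis using nat[of "t + of_int k * P" "nat (- k)"] by simp
  qed
qed

text \<open>A translation by a multiple of \<open>P\<close> moves the left end into the first
  period; the part beyond \<open>P\<close> is then shifted back by one period. End points are null
  sets, which allows the open interval that is the domain of a chart of the circle.\<close>

lemma nn_integral_periodic:
  fixes f :: "real \<Rightarrow> ennreal"
  assumes f: "f \<in> borel_measurable borel" and P: "0 < P" and per: "\<And>t. f (t + P) = f t"
  shows "(\<integral>\<^sup>+t\<in>{0..P}. f t \<partial>lborel) = (\<integral>\<^sup>+t\<in>{a<..<a + P}. f t \<partial>lborel)"
proof -
  have shift: "(\<integral>\<^sup>+t. f t * indicator S t \<partial>lborel) = (\<integral>\<^sup>+t. f t * indicator ((\<lambda>t. of_int k * P + t) -` S) t \<partial>lborel)"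
    if "S \<in> sets borel" for S k
  proof -
    have "(\<integral>\<^sup>+t. f t * indicator S t \<partial>lborel)
       = (\<integral>\<^sup>+t. f (of_int k * P + 1 * t) * indicator S (of_int k * P + 1 * t) \<partial>lborel)"
      using that f by (subst nn_integral_real_affine[of _ 1 "of_int k * P"]) auto
    also have "\<dots> = (\<integral>\<^sup>+t. f t * indicator ((\<lambda>t. of_int k * P + t) -` S) t \<partial>lborel)"
      using periodic_int[of f P, OF per] by (intro nn_integral_cong) (auto simp: add.commute split: split_indicator)
    finally show ?thesis .
  qed
  have add: "(\<integral>\<^sup>+t. f t * indicator {x..<z} t \<partial>lborel)
     = (\<integral>\<^sup>+t. f t * indicator {x..<y} t \<partial>lborel) + (\<integral>\<^sup>+t. f t * indicator {y..<z} t \<partial>lborel)" if "x \<le> y" "y \<le> z" for x y z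
    using that f by (subst nn_integral_add[symmetric]) (auto intro!: nn_integral_cong split: split_indicator)
  define k where "k = \<lfloor>a / P\<rfloor>"
  define b where "b = a - of_int k * P"
  have "of_int k \<le> a / P" "a / P < of_int k + 1" unfolding k_def by linarith+
  then have b: "0 \<le> b" "b < P" using P by (auto simp: b_def field_simps)
  have ae: "(\<integral>\<^sup>+t. f t * indicator S t \<partial>lborel) = (\<integral>\<^sup>+t. f t * indicator S' t \<partial>lborel)"
    if "\<And>t. t \<noteq> c \<Longrightarrow> t \<in> S \<longleftrightarrow> t \<in> S'" for S S' and c :: real
  proof (rule nn_integral_cong_AE)
    show "AE t in lborel. f t * indicator S t = f t * indicator S' t"
      using AE_lborel_singleton[of c] by eventually_elim (use that in \<open>auto split: split_indicator\<close>)
  qed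
  have "(\<integral>\<^sup>+t. f t * indicator {a<..<a + P} t \<partial>lborel) = (\<integral>\<^sup>+t. f t * indicator {a..<a + P} t \<partial>lborel)"
    by (rule ae[of a]) auto
  also have "\<dots> = (\<integral>\<^sup>+t. f t * indicator {b..<b + P} t \<partial>lborel)"
    by (subst shift[of _ k]) (auto simp: b_def intro!: nn_integral_cong split: split_indicator)
  also have "\<dots> = (\<integral>\<^sup>+t. f t * indicator {b..<P} t \<partial>lborel) + (\<integral>\<^sup>+t. f t * indicator {P..<b + P} t \<partial>lborel)"
    using b by (intro add) auto
  also have "(\<integral>\<^sup>+t. f t * indicator {P..<b + P} t \<partial>lborel) = (\<integral>\<^sup>+t. f t * indicator {0..<b} t \<partial>lborel)"
    by (subst shift[of _ 1]) (auto intro!: nn_integral_cong split: split_indicator)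
  also have "(\<integral>\<^sup>+t. f t * indicator {b..<P} t \<partial>lborel) + (\<integral>\<^sup>+t. f t * indicator {0..<b} t \<partial>lborel)
     = (\<integral>\<^sup>+t. f t * indicator {0..<P} t \<partial>lborel)"
    using b by (subst add[of 0 b P]) (auto simp: add.commute)
  also have "\<dots> = (\<integral>\<^sup>+t. f t * indicator {0..P} t \<partial>lborel)"
    by (rule ae[of P]) auto
  finally show ?thesis ..
qed

lemma Arg2pi_cis: "0 \<le> t \<Longrightarrow> t < 2 * pi \<Longrightarrow> Arg2pi (cis t) = t"
  by (rule Arg2pi_unique[of 1]) (auto simp: cis_conv_exp mult.commute)

lemma cis_2pi_int: "cis (t + of_int k * (2 * pi)) = cis t"
  by (rule periodic_int) (simp add: cis_mult[symmetric])

lemma on_circle_cis: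
  assumes "closed_curve L C"
  shows "on_circle L C (cis t) = C (L / (2 * pi) * t)"
proof -
  define k where "k = \<lfloor>t / (2 * pi)\<rfloor>"
  define b where "b = t - of_int k * (2 * pi)"
  have "of_int k \<le> t / (2 * pi)" "t / (2 * pi) < of_int k + 1" unfolding k_def by linarith+
  then have b: "0 \<le> b" "b < 2 * pi" by (auto simp: b_def field_simps)
  have t: "t = b + of_int k * (2 * pi)" by (simp add: b_def)
  have "on_circle L C (cis t) = C (L * b / (2 * pi))"
    unfolding t cis_2pi_int on_circle_def Arg2pi_cis[OF b] ..
  also have "\<dots> = C (L * b / (2 * pi) + of_int k * L)"
    using assms by (intro periodic_int[symmetric]) (simp add: closed_curve_def)
  also have "L * b / (2 * pi) + of_int k * L = L / (2 * pi) * t"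
    unfolding t by (simp add: field_simps)
  finally show ?thesis .
qed

lemma cis_inj_on: "inj_on cis {a<..<a + 2 * pi}"
proof (rule inj_onI)
  fix x y assume xy: "x \<in> {a<..<a + 2 * pi}" "y \<in> {a<..<a + 2 * pi}" "cis x = cis y"
  have "cis (x - a) = cis (y - a)" using xy(3) by (metis cis_divide)
  moreover have "Arg2pi (cis (x - a)) = x - a" using xy by (intro Arg2pi_cis) auto
  moreover have "Arg2pi (cis (y - a)) = y - a" using xy by (intro Arg2pi_cis) auto
  ultimately have "x - a = y - a" by metis
  then show "x = y" by simp
qed

lemma cis_image: "cis ` {a<..<a + 2 * pi} = sphere 0 1 - {cis a}"
proof (intro equalityI subsetI)
  fix z assume "z \<in> cis ` {a<..<a + 2 * pi}"
  then obtain t where t: "t \<in> {a<..<a + 2 * pi}" "z = cis t" by blast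
  have "Arg2pi (cis (t - a)) = t - a" using t by (intro Arg2pi_cis) auto
  moreover have "Arg2pi (cis (a - a)) = 0" using Arg2pi_cis[of 0] by simp
  ultimately have "cis (t - a) \<noteq> cis (a - a)" using t by (metis greaterThanLessThan_iff less_irrefl diff_gt_0_iff_gt)
  then have "cis t \<noteq> cis a" by (metis cis_divide)
  then show "z \<in> sphere 0 1 - {cis a}" using t by (simp add: dist_norm)
next
  fix z assume z: "z \<in> sphere 0 1 - {cis a}"
  define s where "s = Arg2pi (z / cis a)"
  have n: "norm (z / cis a) = 1" using z by (simp add: norm_divide)
  have s: "0 \<le> s" "s < 2 * pi" "z / cis a = cis s"
    using Arg2pi[of "z / cis a"] n by (auto simp: s_def is_Arg_def) (simp add: cis_conv_exp)
  have "s \<noteq> 0" using s(3) z by auto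
  moreover have "z = cis (a + s)" using s(3) by (simp add: cis_mult[symmetric] field_simps)
  ultimately show "z \<in> cis ` {a<..<a + 2 * pi}" using s by (intro image_eqI[of _ _ "a + s"]) auto
qed

text \<open>The branch of the argument with its cut at the angle \<open>a\<close>, extended by 0; it
  serves to write images under the chart as preimages.\<close>

lemma cis_inverse_measurable:
  obtains g where "g \<in> borel_measurable (borel :: complex measure)" "\<forall>t\<in>{a<..<a + 2 * pi}. g (cis t) = t"
proof
  let ?S = "sphere 0 1 - {cis a} :: complex set"
  define g where "g z = (if z \<in> ?S then a + Arg2pi (z / cis a) else 0)" for z
  have S: "?S \<in> sets borel" by (intro sets.Diff borel_closed) auto
  show "g \<in> borel_measurable borel"
    unfolding g_def
  proof (rule borel_measurable_continuous_on_if[OF S])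
    have cA: "continuous_on (- \<real>\<^sub>\<ge>\<^sub>0) Arg2pi"
      using continuous_at_Arg2pi by (intro continuous_at_imp_continuous_on) auto
    have nr: "z / cis a \<in> - \<real>\<^sub>\<ge>\<^sub>0" if "z \<in> ?S" for z
    proof
      assume "z / cis a \<in> \<real>\<^sub>\<ge>\<^sub>0"
      then obtain x where x: "z / cis a = of_real x" "0 \<le> x" by (auto simp: nonneg_Reals_def)
      have "norm (z / cis a) = 1" using that by (simp add: norm_divide)
      then have "x = 1" using x by simp
      then show False using x that by simp
    qed
    have "continuous_on ?S (\<lambda>z. z / cis a)" by (intro continuous_on_divide continuous_on_id continuous_on_const) simp
    from continuous_on_compose2[OF cA this] nr have "continuous_on ?S (\<lambda>z. Arg2pi (z / cis a))" by blast
    then show "continuous_on ?S (\<lambda>z. a + Arg2pi (z / cis a))" by (intro continuous_intros)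
  qed auto
  show "\<forall>t\<in>{a<..<a + 2 * pi}. g (cis t) = t"
  proof
    fix t assume t: "t \<in> {a<..<a + 2 * pi}"
    then have "cis t \<in> ?S" using cis_image[of a] by blast
    moreover have "Arg2pi (cis t / cis a) = t - a" unfolding cis_divide using t by (intro Arg2pi_cis) auto
    ultimately show "g (cis t) = t" by (simp add: g_def)
  qed
qed

lemma points_circle_atlas: "points circle_atlas = sphere 0 1"
proof -
  have "points circle_atlas = (\<Union>a. sphere 0 1 - {cis a})"
    by (auto simp: points_def circle_atlas_def cis_image[symmetric])
  moreover have "(\<Union>a. sphere 0 1 - {cis a}) = sphere 0 1"
  proof (intro equalityI subsetI)
    fix x :: complex assume x: "x \<in> sphere 0 1"
    have "cis 0 \<noteq> cis pi" by simp
    then have "x \<noteq> cis 0 \<or> x \<noteq> cis pi" by metis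
    then show "x \<in> (\<Union>a. sphere 0 1 - {cis a})" using x by blast
  qed blast
  ultimately show ?thesis by simp
qed

lemma points_prod_atlas: "points (prod_atlas A B) = points A \<times> points B"
proof (intro equalityI subsetI)
  fix x assume "x \<in> points (prod_atlas A B)"
  then obtain V p W q where "(V, p) \<in> A" "(W, q) \<in> B" "x \<in> map_prod p q ` (V \<times> W)"
    unfolding points_def prod_atlas_def by blast
  then show "x \<in> points A \<times> points B" by (auto simp: points_def)
next
  fix x assume x: "x \<in> points A \<times> points B"
  obtain V p y where 1: "(V, p) \<in> A" "y \<in> V" "fst x = p y" using x by (auto simp: points_def)
  obtain W q z where 2: "(W, q) \<in> B" "z \<in> W" "snd x = q z" using x by (auto simp: points_def)
  have "(V \<times> W, map_prod p q) \<in> prod_atlas A B" using 1(1) 2(1) unfolding prod_atlas_def by blast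
  moreover have "x \<in> map_prod p q ` (V \<times> W)"
    using 1 2 by (intro image_eqI[of _ _ "(y, z)"]) (auto simp: prod_eq_iff)
  ultimately show "x \<in> points (prod_atlas A B)" unfolding points_def by blast
qed

section \<open>Charts, metric and measure of the product\<close>

locale legendrian_cone = minimal_sphere_immersion M \<psi>
  for M :: "('a::{t2_space,second_countable_topology}, 'e::euclidean_space) atlas"
    and \<psi> :: "'a \<Rightarrow> complex ^ 'n" +
  fixes L :: real
  assumes leg: "legendrian M \<psi>" and L: "0 < L"
begin

text \<open>The rate of the curve parameter with respect to the angle: the charts of the circle use
  an angle \<open>t\<close>, and the curve is evaluated at \<open>\<kappa> * t\<close>.\<close>

definition \<kappa> :: real where "\<kappa> = L / (2 * pi)"

lemma \<kappa>: "\<kappa> > 0" using L by (simp add: \<kappa>_def)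

definition cone :: "(real \<Rightarrow> complex) \<Rightarrow> complex \<times> 'a \<Rightarrow> complex ^ 'n" where
  "cone C = curve_prod (on_circle L C) \<psi>"

abbreviation PA where "PA \<equiv> prod_atlas circle_atlas M"

lemma PA_cases:
  assumes "(U, p) \<in> PA"
  obtains a W q where "(W, q) \<in> M" "U = {a<..<a + 2 * pi} \<times> W" "p = map_prod cis q"
  using assms by (auto simp: prod_atlas_def circle_atlas_def)

lemma PA_I: "(W, q) \<in> M \<Longrightarrow> ({a<..<a + 2 * pi} \<times> W, map_prod cis q) \<in> PA"
  by (auto simp: prod_atlas_def circle_atlas_def)

lemma points_PA: "points PA = sphere 0 1 \<times> points M"
  by (simp add: points_prod_atlas points_circle_atlas)

lemma compact_points_PA: "compact (points PA)"
  unfolding points_PA by (intro compact_Times compact_points) simp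

lemma cone_chart:
  assumes "closed_curve L C"
  shows "cone C \<circ> map_prod cis q = (\<lambda>(t, y). C (\<kappa> * t) *s (\<psi> \<circ> q) y)"
  using on_circle_cis[OF assms] by (auto simp: cone_def curve_prod_def \<kappa>_def fun_eq_iff)

text \<open>The position vector is orthogonal to tangent vectors because it has constant length, and
  its rotation by \<open>J\<close> is orthogonal to them because \<psi> is Legendrian. Hence
  arbitrary complex multiples are orthogonal as well, and the metric of the product splits.\<close>

lemma hermitian_zero:
  assumes "(W, q) \<in> M" "y \<in> W"
  shows "(c *s (\<psi> \<circ> q) y) \<bullet> (d *s diff (\<psi> \<circ> q) y v) = 0"
proof -
  interpret sphere_chart "\<psi> \<circ> q" W by (rule sphere_chart[OF assms(1)])
  have "\<omega> ((\<psi> \<circ> q) y) (diff (\<psi> \<circ> q) y v) = 0"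
    using leg assms by (auto simp: legendrian_def tangent_space_def)
  then show ?thesis
    unfolding inner_vector_scalar_mult using inner_u_diff[OF assms(2)] by simp
qed

lemma cone_chart_derivative:
  assumes Wq: "(W, q) \<in> M" "y \<in> W" and C: "closed_curve L C"
    and d: "(C has_vector_derivative C') (at (\<kappa> * t))"
  shows "(cone C \<circ> map_prod cis q has_derivative
     (\<lambda>(\<tau>, v). (of_real (\<kappa> * \<tau>) * C') *s (\<psi> \<circ> q) y + C (\<kappa> * t) *s diff (\<psi> \<circ> q) y v)) (at (t, y))"
proof -
  have 1: "((\<lambda>x. \<kappa> * fst x) has_derivative (\<lambda>x. \<kappa> * fst x)) (at (t, y))"
    by (auto intro!: derivative_eq_intros)
  have "((\<lambda>x. C (\<kappa> * fst x)) has_derivative (\<lambda>x. (\<kappa> * fst x) *\<^sub>R C')) (at (t, y))"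
    using has_derivative_compose[OF 1, of C "\<lambda>r. r *\<^sub>R C'"] d by (simp add: has_vector_derivative_def)
  moreover have "((\<lambda>x. (\<psi> \<circ> q) (snd x)) has_derivative (\<lambda>x. diff (\<psi> \<circ> q) y (snd x))) (at (t, y))"
  proof -
    have "(snd has_derivative snd) (at (t, y))" by (rule has_derivative_snd[OF has_derivative_ident])
    from has_derivative_compose[OF this, of "\<psi> \<circ> q"] differentiable_has_frechet[OF chart_differentiable[OF Wq]]
    show ?thesis by simp
  qed
  ultimately have "((\<lambda>x. C (\<kappa> * fst x) *s (\<psi> \<circ> q) (snd x)) has_derivative
      (\<lambda>x. C (\<kappa> * t) *s diff (\<psi> \<circ> q) y (snd x) + ((\<kappa> * fst x) *\<^sub>R C') *s (\<psi> \<circ> q) y)) (at (t, y))"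
    using bounded_bilinear.FDERIV[OF bounded_bilinear_vector_scalar_mult] by fastforce
  then show ?thesis
    unfolding cone_chart[OF C] by (simp add: case_prod_beta' scaleR_conv_of_real add.commute)
qed

lemma cone_chart_diff:
  assumes "(W, q) \<in> M" "y \<in> W" "closed_curve L C" "(C has_vector_derivative C') (at (\<kappa> * t))"
  shows "diff (cone C \<circ> map_prod cis q) (t, y) (\<tau>, v)
     = (of_real (\<kappa> * \<tau>) * C') *s (\<psi> \<circ> q) y + C (\<kappa> * t) *s diff (\<psi> \<circ> q) y v"
  using frechet_derivative_eqI[OF cone_chart_derivative[OF assms]] by simp

text \<open>The metric is a warped product: the direction of the curve has squared length
  \<open>(\<kappa> * norm C')\<^sup>2\<close> and is orthogonal to the directions of
  \<open>M\<close>, whose metric is scaled by the squared distance of the curve from the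
  origin.\<close>

lemma gram_det_cone:
  assumes Wq: "(W, q) \<in> M" "y \<in> W" and C: "closed_curve L C"
    and d: "(C has_vector_derivative C') (at (\<kappa> * t))"
  shows "sqrt (gram_det (cone C \<circ> map_prod cis q) (t, y))
     = \<kappa> * norm C' * norm (C (\<kappa> * t)) ^ DIM('e) * sqrt (gram_det (\<psi> \<circ> q) y)"
proof -
  interpret sphere_chart "\<psi> \<circ> q" W by (rule sphere_chart[OF Wq(1)])
  let ?D = "diff (cone C \<circ> map_prod cis q) (t, y)"
  note D = cone_chart_diff[OF assms]
  have lin: "linear (diff (\<psi> \<circ> q) y)" by (rule linear_frechet_derivative[OF diff_u[OF Wq(2)]])
  have D0: "?D (0, v) = C (\<kappa> * t) *s diff (\<psi> \<circ> q) y v" for v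
    by (simp add: D)
  have D1: "?D (1, 0) = (of_real \<kappa> * C') *s (\<psi> \<circ> q) y"
    by (simp add: D linear_0[OF lin])
  have "gram_det (cone C \<circ> map_prod cis q) (t, y) = (?D (1, 0) \<bullet> ?D (1, 0)) * basis_det (\<lambda>b c. ?D (0, b) \<bullet> ?D (0, c))"
    unfolding gram_det_basis_det
    by (rule basis_det_prod) (unfold D0 D1, rule hermitian_zero[OF Wq])
  also have "?D (1, 0) \<bullet> ?D (1, 0) = (\<kappa> * norm C')\<^sup>2"
    using \<kappa> norm_u[OF Wq(2)] unfolding D1 by (simp add: power2_norm_eq_inner[symmetric] norm_vector_scalar_mult norm_mult)
  also have "basis_det (\<lambda>b c. ?D (0, b) \<bullet> ?D (0, c)) = ((norm (C (\<kappa> * t)))\<^sup>2) ^ DIM('e) * gram_det (\<psi> \<circ> q) y"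
    unfolding D0 inner_vector_scalar_mult gram_det_basis_det basis_det_scale[symmetric]
    by (simp add: complex_mult_cnj cmod_power2)
  finally have "sqrt (gram_det (cone C \<circ> map_prod cis q) (t, y))
     = sqrt ((\<kappa> * norm C')\<^sup>2) * (sqrt ((norm (C (\<kappa> * t)) ^ DIM('e))\<^sup>2) * sqrt (gram_det (\<psi> \<circ> q) y))"
    by (simp only: real_sqrt_mult power_mult[symmetric] mult.commute[of 2])
  then show ?thesis using \<kappa> by simp
qed

text \<open>By orthogonality the two components of a vector in the kernel vanish separately.\<close>

lemma inj_cone_chart:
  assumes Wq: "(W, q) \<in> M" "y \<in> W" and C: "closed_curve L C"
    and d: "(C has_vector_derivative C') (at (\<kappa> * t))" and nz: "C (\<kappa> * t) \<noteq> 0" "C' \<noteq> 0"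
  shows "inj (diff (cone C \<circ> map_prod cis q) (t, y))"
proof -
  interpret sphere_chart "\<psi> \<circ> q" W by (rule sphere_chart[OF Wq(1)])
  note der = cone_chart_derivative[OF Wq C d]
  have lin: "linear (diff (cone C \<circ> map_prod cis q) (t, y))"
    using der by (intro linear_frechet_derivative) (auto simp: differentiable_def)
  show ?thesis
  proof (rule linear_injective_0[OF lin, THEN iffD2], intro allI impI)
    fix x assume "diff (cone C \<circ> map_prod cis q) (t, y) x = 0"
    then obtain \<tau> v where x: "x = (\<tau>, v)" and 0: "diff (cone C \<circ> map_prod cis q) (t, y) (\<tau>, v) = 0"
      by (cases x) auto
    let ?a = "(of_real (\<kappa> * \<tau>) * C') *s (\<psi> \<circ> q) y" and ?b = "C (\<kappa> * t) *s diff (\<psi> \<circ> q) y v"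
    have ab: "?a + ?b = 0" using 0 cone_chart_diff[OF Wq C d] by simp
    have h: "?a \<bullet> ?b = 0" by (rule hermitian_zero[OF Wq])
    have "?a \<bullet> (?a + ?b) = 0" unfolding ab by simp
    then have a: "?a = 0" using h by (simp add: inner_add_right)
    have b: "?b = 0" using ab unfolding a by simp
    have "norm ?a = 0" using a by simp
    moreover have "norm ((\<psi> \<circ> q) y) \<noteq> 0" using norm_u[OF Wq(2)] by simp
    ultimately have "\<tau> = 0" using \<kappa> nz(2) by (simp add: norm_vector_scalar_mult norm_mult)
    moreover have "norm ?b = 0" using b by simp
    then have "diff (\<psi> \<circ> q) y v = 0" using nz by (simp add: norm_vector_scalar_mult)
    then have "v = 0"
      using inj_u[OF Wq(2)] linear_injective_0[OF linear_frechet_derivative[OF diff_u[OF Wq(2)]]] by blast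
    ultimately show "x = 0" by (simp add: x zero_prod_def)
  qed
qed

text \<open>The same measure for all curves: the dependence on the curve is left to
  \<open>cone_density\<close>, so that variations can be differentiated under the integral. Both end
  points of the angle give the same point of the circle, but they form a null set.\<close>

definition base_measure :: "(real \<times> 'a) measure" where
  "base_measure = restrict_space lborel {0..2 * pi} \<Otimes>\<^sub>M vol"

definition cone_density :: "(real \<Rightarrow> complex) \<Rightarrow> (real \<Rightarrow> complex) \<Rightarrow> real \<times> 'a \<Rightarrow> real" where
  "cone_density C C' = (\<lambda>(t, \<sigma>). \<kappa> * norm (C' (\<kappa> * t)) * norm (C (\<kappa> * t)) ^ DIM('e))"

definition cone_measure :: "(real \<Rightarrow> complex) \<Rightarrow> (real \<Rightarrow> complex) \<Rightarrow> (complex \<times> 'a) measure" where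
  "cone_measure C C' = distr (density base_measure (cone_density C C')) (restrict_space borel (points PA)) (map_prod cis id)"

lemma finite_measure_interval: "finite_measure (restrict_space lborel {0..2 * pi :: real})"
  by standard (simp add: space_restrict_space emeasure_restrict_space)

lemma finite_measure_base: "finite_measure base_measure"
proof -
  interpret T: finite_measure "restrict_space lborel {0..2 * pi :: real}" by (rule finite_measure_interval)
  interpret V: finite_measure vol by (rule finite_measure_vol)
  show ?thesis unfolding base_measure_def by (rule finite_measure_pair_measure) unfold_locales
qed

lemma space_base: "space base_measure = {0..2 * pi} \<times> points M"
  by (simp add: base_measure_def space_pair_measure space_restrict_space space_vol)

lemma points_PA_borel: "points PA \<in> sets borel"
  by (intro borel_closed compact_imp_closed compact_points_PA)

lemma map_cis_measurable: "map_prod cis id \<in> measurable base_measure (restrict_space borel (points PA))"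
proof (rule measurable_restrict_space2)
  show "map_prod cis id \<in> space base_measure \<rightarrow> points PA"
    by (auto simp: space_base points_PA)
  have 1: "(\<lambda>x. cis (fst x)) \<in> borel_measurable base_measure"
  proof -
    have "cis \<in> borel_measurable (restrict_space lborel {0..2 * pi})"
      by (intro measurable_restrict_space1) (simp add: borel_measurable_continuous_onI continuous_on_cis)
    then show ?thesis unfolding base_measure_def by (rule measurable_compose[OF measurable_fst])
  qed
  have 2: "(\<lambda>x. snd x) \<in> measurable base_measure borel"
  proof -
    have "(\<lambda>x. x) \<in> measurable vol borel"
      using points_borel by (intro measurableI) (auto simp: in_sets_vol_iff space_vol)
    then show ?thesis unfolding base_measure_def by (rule measurable_compose[OF measurable_snd])
  qed
  have "(\<lambda>x. (cis (fst x), snd x)) \<in> measurable base_measure (borel \<Otimes>\<^sub>M borel)"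
    by (rule measurable_Pair[OF 1 2])
  then show "map_prod cis id \<in> borel_measurable base_measure"
    by (simp add: borel_prod map_prod_def case_prod_beta')
qed

text \<open>A chart of the product has a Borel inverse on its Borel image, so the image of a Borel
  set is the preimage under that inverse.\<close>

lemma PA_image_borel:
  assumes Up: "(U, p) \<in> PA" and B: "B \<in> sets borel" "B \<subseteq> U"
  shows "p ` B \<in> sets borel"
proof -
  obtain a W q where Wq: "(W, q) \<in> M" and U: "U = {a<..<a + 2 * pi} \<times> W" and p: "p = map_prod cis q"
    using Up by (rule PA_cases)
  obtain g where g: "g \<in> borel_measurable (borel :: complex measure)" "\<forall>t\<in>{a<..<a + 2 * pi}. g (cis t) = t"
    by (rule cis_inverse_measurable[of a])
  have qW: "q ` W \<in> sets borel" using chart_image_borel[OF Wq borel_open[OF chart_open[OF Wq]] order_refl] .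
  define q' where "q' x = (if x \<in> q ` W then inv_into W q x else 0)" for x
  have q': "q' \<in> borel_measurable borel"
    unfolding q'_def by (intro borel_measurable_continuous_on_if qW chart_inv_cont[OF Wq]) auto
  have "(\<lambda>x. (g (fst x), q' (snd x))) \<in> measurable (borel \<Otimes>\<^sub>M borel) (borel \<Otimes>\<^sub>M borel)"
    by (intro measurable_Pair measurable_compose[OF measurable_fst g(1)] measurable_compose[OF measurable_snd q'])
  then have m: "(\<lambda>x. (g (fst x), q' (snd x))) \<in> measurable borel borel" by (simp add: borel_prod)
  have S: "(sphere 0 1 - {cis a}) \<times> q ` W \<in> sets borel"
    unfolding borel_prod[symmetric] by (intro pair_measureI sets.Diff borel_closed qW) auto
  have "p ` B = (\<lambda>x. (g (fst x), q' (snd x))) -` B \<inter> ((sphere 0 1 - {cis a}) \<times> q ` W)"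
  proof (intro equalityI subsetI)
    fix x assume "x \<in> p ` B"
    then obtain t y where ty: "(t, y) \<in> B" "x = (cis t, q y)" by (auto simp: p)
    then have "t \<in> {a<..<a + 2 * pi}" "y \<in> W" using B(2) by (auto simp: U)
    then show "x \<in> (\<lambda>x. (g (fst x), q' (snd x))) -` B \<inter> ((sphere 0 1 - {cis a}) \<times> q ` W)"
      using ty g(2) chart_inj[OF Wq] by (auto simp: q'_def cis_image[symmetric])
  next
    fix x assume x: "x \<in> (\<lambda>x. (g (fst x), q' (snd x))) -` B \<inter> ((sphere 0 1 - {cis a}) \<times> q ` W)"
    then obtain t y where ty: "t \<in> {a<..<a + 2 * pi}" "y \<in> W" "x = (cis t, q y)"
      unfolding cis_image[symmetric] by auto
    then have "(t, y) \<in> B" using x g(2) chart_inj[OF Wq] by (auto simp: q'_def)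
    then show "x \<in> p ` B" using ty by (force simp: p)
  qed
  then show ?thesis using measurable_sets[OF m B(1)] S by simp
qed

lemma pB_in_pair:
  assumes "X \<in> sets borel" "X \<subseteq> points PA"
  shows "X \<in> sets (borel \<Otimes>\<^sub>M vol)"
proof -
  have "(\<lambda>x. x) \<in> measurable vol borel"
    using points_borel by (intro measurableI) (auto simp: in_sets_vol_iff space_vol)
  then have "(\<lambda>x. (fst x, snd x)) \<in> measurable (borel \<Otimes>\<^sub>M vol) (borel \<Otimes>\<^sub>M borel)"
    by (intro measurable_Pair measurable_fst measurable_compose[OF measurable_snd])
  moreover have "X \<in> sets (borel \<Otimes>\<^sub>M borel)" using assms(1) unfolding borel_prod .
  ultimately have "(\<lambda>x. (fst x, snd x)) -` X \<inter> space (borel \<Otimes>\<^sub>M vol) \<in> sets (borel \<Otimes>\<^sub>M vol)"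
    by (rule measurable_sets)
  then have "X \<inter> space (borel \<Otimes>\<^sub>M vol) \<in> sets (borel \<Otimes>\<^sub>M vol)" by simp
  moreover have "X \<inter> space (borel \<Otimes>\<^sub>M vol) = X"
    using assms(2) by (auto simp: space_pair_measure space_vol points_PA)
  ultimately show ?thesis by simp
qed

text \<open>In a product chart both sides are iterated integrals over the angle and a chart of
  \<open>M\<close>, with the density of \<open>gram_det_cone\<close>. The chart uses an interval of
  length 2 \<pi> with arbitrary left end and \<open>cone_measure\<close> the interval from 0 to 2
  \<pi>; periodicity reconciles them.\<close>

lemma is_volume_measure_cone:
  assumes C: "closed_curve L C" and d: "\<And>l. (C has_vector_derivative C' l) (at l)"
    and cC': "continuous_on UNIV C'" and per': "\<And>l. C' (l + L) = C' l"
  shows "is_volume_measure PA (cone C) (cone_measure C C')"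
proof -
  interpret V: finite_measure vol by (rule finite_measure_vol)
  have cC: "continuous_on UNIV C" using d by (intro continuous_at_imp_continuous_on ballI) (auto intro: has_vector_derivative_continuous)
  define j where "j t = \<kappa> * norm (C' (\<kappa> * t)) * norm (C (\<kappa> * t)) ^ DIM('e)" for t
  have j0: "0 \<le> j t" for t using \<kappa> by (simp add: j_def)
  have jc: "continuous_on UNIV j"
    unfolding j_def by (intro continuous_intros continuous_on_compose2[OF cC] continuous_on_compose2[OF cC']) auto
  have jm [measurable]: "j \<in> borel_measurable borel" by (rule borel_measurable_continuous_onI[OF jc])
  have jper: "j (t + 2 * pi) = j t" for t
  proof -
    have "\<kappa> * (t + 2 * pi) = \<kappa> * t + L" by (simp add: \<kappa>_def field_simps)
    then show ?thesis using C per' by (simp add: j_def closed_curve_def)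
  qed
  have dens: "cone_density C C' = (\<lambda>x. j (fst x))" by (simp add: cone_density_def j_def case_prod_beta')
  have jb: "(\<lambda>x. ennreal (j (fst x))) \<in> borel_measurable base_measure"
  proof -
    have "(\<lambda>t. ennreal (j t)) \<in> borel_measurable (restrict_space lborel {0..2 * pi})"
      by (intro measurable_restrict_space1) simp
    then show ?thesis unfolding base_measure_def by (rule measurable_compose[OF measurable_fst])
  qed
  have sets: "sets (cone_measure C C') = sets (restrict_space borel (points PA))"
    by (simp add: cone_measure_def)
  have em: "emeasure (cone_measure C C') X = (\<integral>\<^sup>+t\<in>{0..2 * pi}. ennreal (j t) * emeasure vol (Pair (cis t) -` X) \<partial>lborel)"
    if X: "X \<in> sets (restrict_space borel (points PA))" for X
  proof -
    let ?Y = "map_prod cis id -` X \<inter> space base_measure"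
    have Y: "?Y \<in> sets base_measure" by (rule measurable_sets[OF map_cis_measurable X])
    have Xp: "X \<subseteq> points PA" using X points_PA_borel by (simp add: sets_restrict_space_iff)
    have "emeasure (cone_measure C C') X = emeasure (density base_measure (cone_density C C')) ?Y"
      unfolding cone_measure_def using X map_cis_measurable by (subst emeasure_distr) auto
    also have "\<dots> = (\<integral>\<^sup>+x. ennreal (j (fst x)) * indicator ?Y x \<partial>base_measure)"
      unfolding dens by (rule emeasure_density[OF jb Y])
    also have "\<dots> = (\<integral>\<^sup>+t. \<integral>\<^sup>+\<sigma>. ennreal (j t) * indicator ?Y (t, \<sigma>) \<partial>vol \<partial>restrict_space lborel {0..2 * pi})"
      using jb Y unfolding base_measure_def by (subst V.nn_integral_fst[symmetric]) auto
    also have "\<dots> = (\<integral>\<^sup>+t. ennreal (j t) * emeasure vol (Pair (cis t) -` X) \<partial>restrict_space lborel {0..2 * pi})"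
    proof (intro nn_integral_cong)
      fix t assume "t \<in> space (restrict_space lborel {0..2 * pi})"
      then have t: "t \<in> {0..2 * pi}" by (simp add: space_restrict_space)
      have eq: "Pair t -` ?Y = Pair (cis t) -` X"
        using t Xp by (auto simp: space_base points_PA)
      have "Pair t -` ?Y \<in> sets vol" using Y unfolding base_measure_def by (rule sets_Pair1)
      then have "(\<integral>\<^sup>+\<sigma>. ennreal (j t) * indicator (Pair t -` ?Y) \<sigma> \<partial>vol) = ennreal (j t) * emeasure vol (Pair t -` ?Y)"
        by (rule nn_integral_cmult_indicator)
      then show "(\<integral>\<^sup>+\<sigma>. ennreal (j t) * indicator ?Y (t, \<sigma>) \<partial>vol) = ennreal (j t) * emeasure vol (Pair (cis t) -` X)"
        unfolding eq[symmetric] by (simp add: indicator_def)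
    qed
    also have "\<dots> = (\<integral>\<^sup>+t\<in>{0..2 * pi}. ennreal (j t) * emeasure vol (Pair (cis t) -` X) \<partial>lborel)"
      by (rule nn_integral_restrict_space) simp
    finally show ?thesis .
  qed
  have chart: "emeasure (cone_measure C C') (p ` B) = (\<integral>\<^sup>+y\<in>B. ennreal (sqrt (gram_det (cone C \<circ> p) y)) \<partial>lborel)"
    if Up: "(U, p) \<in> PA" and B: "B \<in> sets borel" "B \<subseteq> U" for U p B
  proof -
    obtain a W q where Wq: "(W, q) \<in> M" and U: "U = {a<..<a + 2 * pi} \<times> W" and p: "p = map_prod cis q"
      using Up by (rule PA_cases)
    have pB: "p ` B \<in> sets borel" by (rule PA_image_borel[OF Up B])
    have "p ` B \<subseteq> points PA" using B(2) chart_in_points[OF Wq] by (auto simp: U p points_PA)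
    then have pBr: "p ` B \<in> sets (restrict_space borel (points PA))"
      using pB by (auto simp: sets_restrict_space_iff points_PA_borel)
    let ?h = "\<lambda>t. ennreal (j t) * emeasure vol (Pair (cis t) -` (p ` B))"
    let ?g = "\<lambda>y. ennreal (indicator W y * sqrt (gram_det (\<psi> \<circ> q) y))"
    have gm: "?g \<in> borel_measurable borel" using chart_density_measurable[OF Wq] by measurable
    have hm: "?h \<in> borel_measurable borel"
    proof -
      have "(\<lambda>x. (cis (fst x), snd x)) \<in> measurable (borel \<Otimes>\<^sub>M vol) (borel \<Otimes>\<^sub>M vol)" 
        by (intro measurable_Pair measurable_compose[OF measurable_fst] measurable_snd) (simp add: borel_measurable_continuous_onI continuous_on_cis)
      moreover have "p ` B \<in> sets (borel \<Otimes>\<^sub>M vol)"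
        using pB_in_pair[OF pB \<open>p ` B \<subseteq> points PA\<close>] .
      ultimately have Z: "(\<lambda>x. (cis (fst x), snd x)) -` (p ` B) \<inter> space (borel \<Otimes>\<^sub>M vol) \<in> sets (borel \<Otimes>\<^sub>M vol)"
        by (rule measurable_sets)
      have "Pair t -` ((\<lambda>x. (cis (fst x), snd x)) -` (p ` B) \<inter> space (borel \<Otimes>\<^sub>M vol)) = Pair (cis t) -` (p ` B)" for t
        using \<open>p ` B \<subseteq> points PA\<close> by (auto simp: space_pair_measure space_vol points_PA)
      with V.measurable_emeasure_Pair[OF Z] show ?thesis by simp
    qed
    have "emeasure (cone_measure C C') (p ` B) = (\<integral>\<^sup>+t\<in>{0..2 * pi}. ?h t \<partial>lborel)" by (rule em[OF pBr])
    also have "\<dots> = (\<integral>\<^sup>+t\<in>{a<..<a + 2 * pi}. ?h t \<partial>lborel)"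
    proof (rule nn_integral_periodic[OF hm])
      fix t show "?h (t + 2 * pi) = ?h t" using jper cis_2pi_int[of t 1] by simp
    qed simp
    also have "\<dots> = (\<integral>\<^sup>+t. \<integral>\<^sup>+y. ennreal (j t) * ?g y * indicator B (t, y) \<partial>lborel \<partial>lborel)"
    proof (intro nn_integral_cong)
      fix t
      show "?h t * indicator {a<..<a + 2 * pi} t = (\<integral>\<^sup>+y. ennreal (j t) * ?g y * indicator B (t, y) \<partial>lborel)"
      proof (cases "t \<in> {a<..<a + 2 * pi}")
        case True
        let ?B = "Pair t -` B"
        have "B \<in> sets (borel \<Otimes>\<^sub>M borel)" using B(1) unfolding borel_prod .
        then have Bt: "?B \<in> sets borel" by (rule sets_Pair1)
        have BW: "?B \<subseteq> W" using B(2) by (auto simp: U)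
        have "Pair (cis t) -` (p ` B) = q ` ?B"
        proof (intro equalityI subsetI)
          fix \<sigma> assume "\<sigma> \<in> Pair (cis t) -` (p ` B)"
          then obtain t' y where ty: "(t', y) \<in> B" "cis t = cis t'" "\<sigma> = q y" by (auto simp: p)
          then have "t' = t" using B(2) True inj_onD[OF cis_inj_on[of a] ty(2)[symmetric]] by (auto simp: U)
          then show "\<sigma> \<in> q ` ?B" using ty by auto
        next
          fix \<sigma> assume "\<sigma> \<in> q ` ?B"
          then show "\<sigma> \<in> Pair (cis t) -` (p ` B)" unfolding p by force
        qed
        then have "?h t = ennreal (j t) * (\<integral>\<^sup>+y\<in>?B. ennreal (sqrt (gram_det (\<psi> \<circ> q) y)) \<partial>lborel)"
          using emeasure_vol[OF Wq Bt BW] by simp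
        also have "(\<integral>\<^sup>+y\<in>?B. ennreal (sqrt (gram_det (\<psi> \<circ> q) y)) \<partial>lborel) = (\<integral>\<^sup>+y. ?g y * indicator ?B y \<partial>lborel)"
          using BW by (intro nn_integral_cong) (auto split: split_indicator)
        also have "ennreal (j t) * \<dots> = (\<integral>\<^sup>+y. ennreal (j t) * (?g y * indicator ?B y) \<partial>lborel)"
          using gm Bt by (intro nn_integral_cmult[symmetric]) auto
        finally show ?thesis using True by (simp add: indicator_def mult.assoc)
      next
        case False
        then have "(t, y) \<notin> B" for y using B(2) by (auto simp: U)
        then have "indicator B (t, y) = (0 :: ennreal)" for y by simp
        then show ?thesis using False by simp
      qed
    qed
    also have "\<dots> = (\<integral>\<^sup>+x. ennreal (j (fst x)) * ?g (snd x) * indicator B x \<partial>lborel)"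
    proof -
      have sB: "B \<in> sets (lborel \<Otimes>\<^sub>M lborel)" using B(1) unfolding lborel_prod by simp
      have "(\<lambda>x. ennreal (j (fst x))) \<in> borel_measurable (lborel \<Otimes>\<^sub>M (lborel :: 'e measure))"
        by (rule measurable_compose[OF measurable_fst]) simp
      moreover have "(\<lambda>x. ?g (snd x)) \<in> borel_measurable ((lborel :: real measure) \<Otimes>\<^sub>M lborel)"
        by (rule measurable_compose[OF measurable_snd gm[folded measurable_lborel2]])
      ultimately have "(\<lambda>x. ennreal (j (fst x)) * ?g (snd x) * indicator B x) \<in> borel_measurable (lborel \<Otimes>\<^sub>M lborel)"
        using sB by (intro borel_measurable_times_ennreal borel_measurable_indicator)
      from lborel.nn_integral_fst[OF this] show ?thesis by (simp add: lborel_prod)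
    qed
    also have "\<dots> = (\<integral>\<^sup>+y\<in>B. ennreal (sqrt (gram_det (cone C \<circ> p) y)) \<partial>lborel)"
    proof (intro nn_integral_cong)
      fix x :: "real \<times> 'e"
      show "ennreal (j (fst x)) * ?g (snd x) * indicator B x = ennreal (sqrt (gram_det (cone C \<circ> p) x)) * indicator B x"
      proof (cases "x \<in> B")
        case True
        obtain t y where x: "x = (t, y)" by (cases x)
        have y: "y \<in> W" using True B(2) by (auto simp: U x)
        show ?thesis
          unfolding x p gram_det_cone[OF Wq y C d] using y j0 \<open>x \<in> B\<close> x by (simp add: j_def ennreal_mult'[symmetric])
      qed simp
    qed
    finally show ?thesis .
  qed
  show ?thesis unfolding is_volume_measure_def using sets chart by blast
qed

end

section \<open>The functional and normal variations of the product\<close>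

text \<open>\<open>Arg2pi\<close> is continuous off the nonnegative reals and equal to 0 on
  them.\<close>

lemma Arg2pi_measurable: "Arg2pi \<in> borel_measurable borel"
proof -
  have "(\<lambda>z. if z \<in> - \<real>\<^sub>\<ge>\<^sub>0 then Arg2pi z else 0) \<in> borel_measurable borel"
    using continuous_at_Arg2pi
    by (intro borel_measurable_continuous_on_if continuous_at_imp_continuous_on borel_open)
      (auto intro: continuous_on_const simp: open_Compl closed_nonneg_Reals_complex)
  moreover have "(\<lambda>z. if z \<in> - \<real>\<^sub>\<ge>\<^sub>0 then Arg2pi z else 0) = Arg2pi"
    by (auto simp: fun_eq_iff nonneg_Reals_def Arg2pi_eq_0)
  ultimately show ?thesis by simp
qed

lemma \<omega>_self: "\<omega> x x = 0"
  by (simp add: \<omega>_def J_def inner_vec_def inner_complex_def)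

context legendrian_cone
begin

lemma volume_measure_cone:
  assumes C: "closed_curve L C" and d: "\<And>l. (C has_vector_derivative C' l) (at l)"
    and C': "continuous_on UNIV C'" "\<And>l. C' (l + L) = C' l"
  shows "volume_measure PA (cone C) = cone_measure C C'"
proof (rule volume_measure_eqI)
  show 1: "is_volume_measure PA (cone C) (cone_measure C C')"
    by (rule is_volume_measure_cone[OF assms])
  fix \<nu> assume \<nu>: "is_volume_measure PA (cone C) \<nu>"
  obtain D where D: "finite D" "D \<subseteq> M" "points M \<subseteq> (\<Union>(V, p)\<in>D. p ` V)"
    by (rule finite_chart_cover)
  let ?f = "\<lambda>(a, W, q). ({a<..<a + 2 * pi} \<times> W, map_prod cis q)"
  \<comment> \<open>Two charts of the circle, cut open at the angles 0 and \<pi>, cover it, so the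
    product has a finite cover by charts.\<close>
  let ?D = "?f ` ({0, pi} \<times> D)"
  show "\<nu> = cone_measure C C'"
  proof (rule is_volume_measure_unique[OF \<nu> 1 _ _ _ _ points_PA_borel])
    show "finite ?D" using D(1) by blast
    show "?D \<subseteq> PA" using D(2) PA_I by auto
    show "points PA \<subseteq> (\<Union>(V, p)\<in>?D. p ` V)"
    proof
      fix x assume "x \<in> points PA"
      then obtain z \<sigma> where x: "x = (z, \<sigma>)" "z \<in> sphere 0 1" "\<sigma> \<in> points M" by (auto simp: points_PA)
      obtain W q where Wq: "(W, q) \<in> D" "\<sigma> \<in> q ` W" using D(3) x(3) by auto
      have "cis 0 \<noteq> cis pi" by simp
      then have "z \<noteq> cis 0 \<or> z \<noteq> cis pi" by metis
      then obtain a where a: "a \<in> {0, pi}" "z \<noteq> cis a" by blast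
      have "x \<in> map_prod cis q ` ({a<..<a + 2 * pi} \<times> W)"
        using a(2) x Wq(2) by (simp add: map_prod_image cis_image)
      moreover have "({a<..<a + 2 * pi} \<times> W, map_prod cis q) \<in> ?D"
        using a(1) Wq(1) by (intro image_eqI[of _ _ "(a, W, q)"]) auto
      ultimately show "x \<in> (\<Union>(V, p)\<in>?D. p ` V)" by blast
    qed
    fix V p assume "(V, p) \<in> ?D"
    then obtain a W q where Vp: "V = {a<..<a + 2 * pi} \<times> W" "p = map_prod cis q" and Wq: "(W, q) \<in> M"
      using D(2) by auto
    have oV: "open V" unfolding Vp using chart_open[OF Wq] by (intro open_Times) auto
    have "continuous_on V p"
      unfolding Vp map_prod_def case_prod_beta'
      by (intro continuous_on_Pair continuous_on_cis continuous_on_fst continuous_on_id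
          continuous_on_compose2[OF chart_cont[OF Wq] continuous_on_snd[OF continuous_on_id]]) auto
    moreover have "p ` V \<in> sets borel"
      by (rule PA_image_borel[of V p]) (use oV Vp PA_I[OF Wq] in auto)
    ultimately show "V \<in> sets borel \<and> continuous_on V p \<and> p ` V \<in> sets borel" using borel_open[OF oV] by blast
  qed
qed

lemma psi_measurable: "\<psi> \<in> borel_measurable vol"
  using borel_measurable_continuous_on_restrict[OF continuous_on_f] measurable_cong_sets[OF sets_vol refl] by blast

text \<open>Rewrites the functional over \<open>base_measure\<close>, so that a variation of the
  curve acts on the integrand alone.\<close>

lemma F_functional_cone:
  assumes C: "closed_curve L C" and d: "\<And>l. (C has_vector_derivative C' l) (at l)"
    and C': "continuous_on UNIV C'" "\<And>l. C' (l + L) = C' l"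
  shows "F_functional PA (cone C) x \<tau> = (4 * pi * \<tau>) powr (- (real DIM('e) + 1) / 2) *
     (\<integral>p. cone_density C C' p * exp (- (norm (C (\<kappa> * fst p) *s \<psi> (snd p) - x))\<^sup>2 / (4 * \<tau>)) \<partial>base_measure)"
proof -
  let ?N = "restrict_space borel (points PA)"
  let ?k = "\<lambda>p. exp (- (norm (cone C p - x))\<^sup>2 / (4 * \<tau>))"
  have cC: "continuous_on UNIV C" using d by (intro continuous_at_imp_continuous_on ballI) (auto intro: has_vector_derivative_continuous)
  have oc: "on_circle L C \<in> borel_measurable borel"
    unfolding on_circle_def
    by (intro measurable_compose[OF _ borel_measurable_continuous_onI[OF cC]] borel_measurable_divide
        borel_measurable_times Arg2pi_measurable) auto
  have m1: "(\<lambda>p. on_circle L C (fst p)) \<in> borel_measurable ?N"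
    by (intro measurable_restrict_space1) (simp add: borel_prod[symmetric] measurable_compose[OF measurable_fst oc])
  have m2: "(\<lambda>p. \<psi> (snd p)) \<in> borel_measurable ?N"
  proof -
    have "snd \<in> measurable ?N vol"
    proof (rule measurableI)
      show "snd p \<in> space vol" if "p \<in> space ?N" for p
        using that by (auto simp: space_vol space_restrict_space points_PA)
      fix X assume X: "X \<in> sets vol"
      have "(snd :: complex \<times> 'a \<Rightarrow> 'a) \<in> borel_measurable (borel \<Otimes>\<^sub>M borel)" by (rule measurable_snd)
      then have "(snd :: complex \<times> 'a \<Rightarrow> 'a) \<in> borel_measurable ?N"
        unfolding borel_prod by (rule measurable_restrict_space1)
      then show "snd -` X \<inter> space ?N \<in> sets ?N" using X by (intro measurable_sets) (auto simp: in_sets_vol_iff)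
    qed
    then show ?thesis by (rule measurable_compose[OF _ psi_measurable])
  qed
  have "continuous_on UNIV (\<lambda>x. fst x *s snd x :: complex ^ 'n)"
    by (intro bounded_bilinear.continuous_on[OF bounded_bilinear_vector_scalar_mult] continuous_on_fst continuous_on_snd continuous_on_id)
  from borel_measurable_continuous_Pair[OF m1 m2, of "\<lambda>c v. c *s v", OF this]
  have cm: "cone C \<in> borel_measurable ?N"
    unfolding cone_def curve_prod_def by (simp add: case_prod_beta')
  have km: "?k \<in> borel_measurable ?N" using cm by measurable
  have w: "cone_density C C' \<in> borel_measurable base_measure"
  proof -
    have "(\<lambda>t. \<kappa> * norm (C' (\<kappa> * t)) * norm (C (\<kappa> * t)) ^ DIM('e)) \<in> borel_measurable borel"
      by (intro borel_measurable_continuous_onI continuous_on_mult continuous_on_power continuous_on_norm continuous_on_const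
          continuous_on_compose2[OF cC] continuous_on_compose2[OF C'(1)] continuous_on_id) auto
    then have "(\<lambda>t. \<kappa> * norm (C' (\<kappa> * t)) * norm (C (\<kappa> * t)) ^ DIM('e)) \<in> borel_measurable (restrict_space lborel {0..2 * pi})"
      by (intro measurable_restrict_space1) simp
    then show ?thesis
      unfolding base_measure_def cone_density_def case_prod_beta' by (rule measurable_compose[OF measurable_fst])
  qed
  have w0: "0 \<le> cone_density C C' p" for p using \<kappa> by (simp add: cone_density_def case_prod_beta')
  have "(\<integral>p. ?k p \<partial>volume_measure PA (cone C)) = (\<integral>p. ?k (map_prod cis id p) \<partial>density base_measure (cone_density C C'))"
    unfolding volume_measure_cone[OF assms] cone_measure_def
    by (rule integral_distr[OF _ km]) (use map_cis_measurable in simp)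
  also have "\<dots> = (\<integral>p. cone_density C C' p *\<^sub>R ?k (map_prod cis id p) \<partial>base_measure)"
    using measurable_compose[OF map_cis_measurable km] w w0 by (intro integral_density) auto
  also have "\<dots> = (\<integral>p. cone_density C C' p * exp (- (norm (C (\<kappa> * fst p) *s \<psi> (snd p) - x))\<^sup>2 / (4 * \<tau>)) \<partial>base_measure)"
    by (intro Bochner_Integration.integral_cong refl)
      (simp add: cone_def curve_prod_def case_prod_beta' on_circle_cis[OF C] \<kappa>_def)
  finally show ?thesis unfolding F_functional_def by (simp add: add.commute)
qed

text \<open>The variation field is \<open>v *s \<psi>\<close>. It is orthogonal to the directions of
  \<open>M\<close> by \<open>hermitian_zero\<close>, and to the direction of the curve by
  \<open>orth\<close>, which says that \<open>v\<close> is normal to \<gamma>.\<close>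

lemma normal_variation_cone:
  assumes \<gamma>: "smooth_on UNIV \<gamma>" "closed_curve L \<gamma>" "\<And>l. (\<gamma> has_vector_derivative \<gamma>' l) (at l)"
    and v: "smooth_on UNIV v" "\<And>l. v (l + L) = v l" "\<And>l. (v has_vector_derivative v' l) (at l)"
    and \<epsilon>: "0 < \<epsilon>"
    and nz: "\<And>s l. \<bar>s\<bar> < \<epsilon> \<Longrightarrow> \<gamma> l + s *\<^sub>R v l \<noteq> 0" "\<And>s l. \<bar>s\<bar> < \<epsilon> \<Longrightarrow> \<gamma>' l + s *\<^sub>R v' l \<noteq> 0"
    and orth: "\<And>l. Re (\<gamma>' l * cnj (v l)) = 0"
  shows "normal_variation PA (cone \<gamma>) \<epsilon> (\<lambda>s. cone (\<lambda>l. \<gamma> l + s *\<^sub>R v l))"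
proof -
  let ?c = "\<lambda>s l. \<gamma> l + s *\<^sub>R v l"
  have cl: "closed_curve L (?c s)" for s using \<gamma>(2) v(2) by (simp add: closed_curve_def)
  have dc: "(?c s has_vector_derivative \<gamma>' l + s *\<^sub>R v' l) (at l)" for s l
    by (intro has_vector_derivative_add \<gamma>(3) bounded_linear.has_vector_derivative[OF bounded_linear_scaleR_right v(3)])
  \<comment> \<open>Smoothness is needed in two forms: jointly with the parameter \<open>s\<close>,
    for the variation, and in \<open>sm0\<close> for each fixed \<open>s\<close>, for the
    immersions.\<close>
  have sm: "smooth_on ({- \<epsilon><..<\<epsilon>} \<times> ({a<..<a + 2 * pi} \<times> W)) (\<lambda>(s, t, y). ?c s (\<kappa> * t) *s (\<psi> \<circ> q) y)"
    (is "smooth_on ?U _") if Wq: "(W, q) \<in> M" for a W q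
  proof -
    have U: "open ?U" using chart_open[OF Wq] by (intro open_Times) auto
    have lin: "bounded_linear (\<lambda>x :: real \<times> real \<times> 'e. \<kappa> * fst (snd x))"
      by (intro bounded_linear_const_mult bounded_linear_compose[OF bounded_linear_fst bounded_linear_snd])
    have bl2: "bounded_linear (\<lambda>x :: real \<times> real \<times> 'e. snd (snd x))"
      by (rule bounded_linear_compose[OF bounded_linear_snd bounded_linear_snd])
    have g: "smooth_on ?U (\<lambda>x. g (\<kappa> * fst (snd x)))" if "smooth_on UNIV g" for g :: "real \<Rightarrow> complex"
      by (rule smooth_on_compose[OF U open_UNIV smooth_on_bounded_linear[OF lin U] that]) simp
    have p: "smooth_on ?U (\<lambda>x. (\<psi> \<circ> q) (snd (snd x)))"
      by (rule smooth_on_compose[OF U chart_open[OF Wq] smooth_on_bounded_linear[OF bl2 U] chart_smooth[OF Wq]]) auto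
    have "smooth_on ?U (\<lambda>x. (\<gamma> (\<kappa> * fst (snd x)) + fst x *\<^sub>R v (\<kappa> * fst (snd x))) *s (\<psi> \<circ> q) (snd (snd x)))"
      by (intro smooth_on_bilinear[OF bounded_bilinear_vector_scalar_mult U] smooth_on_add[OF U] p g \<gamma>(1)
          smooth_on_bilinear[OF bounded_bilinear_scaleR U] smooth_on_bounded_linear[OF bounded_linear_fst U] v(1))
    then show ?thesis by (simp add: case_prod_beta')
  qed
  have sm0: "smooth_on ({a<..<a + 2 * pi} \<times> W) (\<lambda>(t, y). ?c s (\<kappa> * t) *s (\<psi> \<circ> q) y)"
    (is "smooth_on ?U _") if Wq: "(W, q) \<in> M" for a W q s
  proof -
    have U: "open ?U" using chart_open[OF Wq] by (intro open_Times) auto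
    have lin: "bounded_linear (\<lambda>x :: real \<times> 'e. \<kappa> * fst x)"
      by (intro bounded_linear_const_mult bounded_linear_fst)
    have g: "smooth_on ?U (\<lambda>x. g (\<kappa> * fst x))" if "smooth_on UNIV g" for g :: "real \<Rightarrow> complex"
      by (rule smooth_on_compose[OF U open_UNIV smooth_on_bounded_linear[OF lin U] that]) simp
    have p: "smooth_on ?U (\<lambda>x. (\<psi> \<circ> q) (snd x))"
      by (rule smooth_on_compose[OF U chart_open[OF Wq] smooth_on_bounded_linear[OF bounded_linear_snd U] chart_smooth[OF Wq]]) auto
    have "smooth_on ?U (\<lambda>x. (\<gamma> (\<kappa> * fst x) + s *\<^sub>R v (\<kappa> * fst x)) *s (\<psi> \<circ> q) (snd x))"
      by (intro smooth_on_bilinear[OF bounded_bilinear_vector_scalar_mult U] smooth_on_add[OF U] p g \<gamma>(1)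
          smooth_on_bilinear[OF bounded_bilinear_scaleR U] smooth_on_const[OF U] v(1))
    then show ?thesis by (simp add: case_prod_beta')
  qed
  show ?thesis
    unfolding normal_variation_def
  proof (intro conjI)
    show "smooth_map (prod_atlas (interval_atlas \<epsilon>) PA) (\<lambda>(s, p). cone (?c s) p)"
      unfolding smooth_map_def
    proof clarify
      fix V P assume "(V, P) \<in> prod_atlas (interval_atlas \<epsilon>) PA"
      then obtain U p where Up: "(U, p) \<in> PA" and V: "V = {- \<epsilon><..<\<epsilon>} \<times> U" "P = map_prod id p"
        unfolding prod_atlas_def[of "interval_atlas \<epsilon>"] by (auto simp: interval_atlas_def)
      obtain a W q where Wq: "(W, q) \<in> M" and U: "U = {a<..<a + 2 * pi} \<times> W" and p: "p = map_prod cis q"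
        using Up by (rule PA_cases)
      have "(\<lambda>(s, p). cone (?c s) p) \<circ> P = (\<lambda>(s, t, y). ?c s (\<kappa> * t) *s (\<psi> \<circ> q) y)"
      proof
        fix x :: "real \<times> real \<times> 'e"
        obtain s t y where x: "x = (s, t, y)" by (cases x)
        show "((\<lambda>(s, p). cone (?c s) p) \<circ> P) x = (\<lambda>(s, t, y). ?c s (\<kappa> * t) *s (\<psi> \<circ> q) y) x"
          using fun_cong[OF cone_chart[OF cl[of s], of q], of "(t, y)"] by (simp add: x V p)
      qed
      then show "smooth_on V ((\<lambda>(s, p). cone (?c s) p) \<circ> P)" using sm[OF Wq] by (simp add: V U)
    qed
    show "\<forall>s\<in>{- \<epsilon><..<\<epsilon>}. immersion PA (cone (?c s))"
      unfolding immersion_def smooth_map_def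
    proof (intro ballI conjI; clarify)
      fix s V p assume s: "s \<in> {- \<epsilon><..<\<epsilon>}" and "(V, p) \<in> PA"
      then obtain a W q where Wq: "(W, q) \<in> M" and V: "V = {a<..<a + 2 * pi} \<times> W" and p: "p = map_prod cis q"
        by (metis PA_cases)
      show "smooth_on V (cone (?c s) \<circ> p)" unfolding V p cone_chart[OF cl] by (rule sm0[OF Wq])
      fix y assume "y \<in> V"
      then show "inj (diff (cone (?c s) \<circ> p) y)"
        using s nz[of s] unfolding V p by (auto intro!: inj_cone_chart[OF Wq _ cl dc])
    qed
    show "\<forall>p\<in>points PA. cone (?c 0) p = cone \<gamma> p" by simp
    \<comment> \<open>The product is compact, so it can itself be taken as the support.\<close>
    show "\<exists>K. compact K \<and> K \<subseteq> points PA \<and> (\<forall>s\<in>{- \<epsilon><..<\<epsilon>}. \<forall>p\<in>points PA - K. cone (?c s) p = cone \<gamma> p)"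
      using compact_points_PA by blast
    show "\<forall>(V, p)\<in>PA. \<forall>y\<in>V. vector_derivative (\<lambda>s. cone (?c s) (p y)) (at 0) \<in> orthogonal_comp (tangent_space (cone \<gamma> \<circ> p) y)"
    proof clarify
      fix V p t y assume "(V, p) \<in> PA" and ty: "(t, y) \<in> V"
      then obtain a W q where Wq: "(W, q) \<in> M" and V: "V = {a<..<a + 2 * pi} \<times> W" and p: "p = map_prod cis q"
        by (metis PA_cases)
      have y: "y \<in> W" using ty V by auto
      let ?u = "(\<psi> \<circ> q) y"
      have "(\<lambda>s. cone (?c s) (p (t, y))) = (\<lambda>s. \<gamma> (\<kappa> * t) *s ?u + s *\<^sub>R (v (\<kappa> * t) *s ?u))"
      proof
        fix s
        have "(\<gamma> (\<kappa> * t) + s *\<^sub>R v (\<kappa> * t)) *s ?u = \<gamma> (\<kappa> * t) *s ?u + s *\<^sub>R (v (\<kappa> * t) *s ?u)"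
          by (simp add: vec_eq_iff algebra_simps)
        then show "cone (?c s) (p (t, y)) = \<gamma> (\<kappa> * t) *s ?u + s *\<^sub>R (v (\<kappa> * t) *s ?u)"
          using fun_cong[OF cone_chart[OF cl[of s], of q], of "(t, y)"] by (simp add: p)
      qed
      then have vd: "vector_derivative (\<lambda>s. cone (?c s) (p (t, y))) (at 0) = v (\<kappa> * t) *s ?u"
        by (auto intro!: vector_derivative_at derivative_eq_intros)
      have "x \<bullet> (v (\<kappa> * t) *s ?u) = 0" if xT: "x \<in> tangent_space (cone \<gamma> \<circ> p) (t, y)" for x
      proof -
        obtain z where "x = diff (cone \<gamma> \<circ> p) (t, y) z" using xT unfolding tangent_space_def by blast
        then obtain \<tau> w where x: "x = diff (cone \<gamma> \<circ> p) (t, y) (\<tau>, w)" by (cases z) blast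
        have "Re (of_real (\<kappa> * \<tau>) * \<gamma>' (\<kappa> * t) * cnj (v (\<kappa> * t))) = \<kappa> * \<tau> * Re (\<gamma>' (\<kappa> * t) * cnj (v (\<kappa> * t)))"
          by (simp add: algebra_simps)
        then have "((of_real (\<kappa> * \<tau>) * \<gamma>' (\<kappa> * t)) *s ?u) \<bullet> (v (\<kappa> * t) *s ?u) = 0"
          unfolding inner_vector_scalar_mult \<omega>_self orth by simp
        moreover have "(\<gamma> (\<kappa> * t) *s diff (\<psi> \<circ> q) y w) \<bullet> (v (\<kappa> * t) *s ?u) = 0"
          using hermitian_zero[OF Wq y] by (simp add: inner_commute)
        ultimately show ?thesis
          unfolding x p cone_chart_diff[OF Wq y \<gamma>(2,3)] by (simp add: inner_add_left)
      qed
      then show "vector_derivative (\<lambda>s. cone (?c s) (p (t, y))) (at 0) \<in> orthogonal_comp (tangent_space (cone \<gamma> \<circ> p) (t, y))"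
        unfolding vd by (auto simp: orthogonal_comp_def orthogonal_def)
    qed
  qed (use \<epsilon> in simp)
qed

end

section \<open>The profile curve\<close>

text \<open>The identity behind \<open>jacobi_h\<close>, with \<open>S\<close> and \<open>C\<close>
  in place of the sine and the cosine.\<close>

lemma jacobi_operator_algebra:
  fixes r S C n :: real
  assumes r: "r \<noteq> 0" and SC: "C\<^sup>2 + S\<^sup>2 = 1"
  shows "((n - 1) / r - r / 2) * C * (S * C * (1 + r\<^sup>2 / 2 - n))
      + ((C\<^sup>2 - S\<^sup>2) * ((r / 2 - n / r) * S) * (1 + r\<^sup>2 / 2 - n) + S * C * (r * C))
    = r * S * (1 / 2 - ((r / 2 - (n - 1) / r) * S)\<^sup>2 + (n - 1) * (1 - 2 * S\<^sup>2) / r\<^sup>2)"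
proof -
  \<comment> \<open>In terms of \<open>a\<close> the derivative of \<theta> is
    \<open>a / r * S\<close> and r^2 is linear, so after multiplication by \<open>r\<close> a
    polynomial identity in \<open>a\<close>, \<open>S\<close> and \<open>n\<close> remains.\<close>
  define a where "a = r\<^sup>2 / 2 - n + 1"
  have a: "(n - 1) / r - r / 2 = - (a / r)" "r / 2 - n / r = (a - 1) / r" "r / 2 - (n - 1) / r = a / r" "1 + r\<^sup>2 / 2 - n = a"
    using r by (simp_all add: a_def field_simps power2_eq_square)
  have r2: "r\<^sup>2 = 2 * (a + n - 1)" by (simp add: a_def)
  have C2: "C\<^sup>2 = 1 - S\<^sup>2" using SC by simp
  have "r * (- (a / r) * C * (S * C * a) + ((C\<^sup>2 - S\<^sup>2) * ((a - 1) / r * S) * a + S * C * (r * C)))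
      = S * (- (a\<^sup>2 * C\<^sup>2) + (C\<^sup>2 - S\<^sup>2) * ((a - 1) * a) + r\<^sup>2 * C\<^sup>2)"
    using r by (simp add: field_simps power2_eq_square)
  also have "\<dots> = S * (r\<^sup>2 / 2 - a\<^sup>2 * S\<^sup>2 + (n - 1) * (1 - 2 * S\<^sup>2))"
    unfolding C2 r2 by (simp add: field_simps power2_eq_square[of a])
  also have "\<dots> = r * (r * S * (1 / 2 - (a / r * S)\<^sup>2 + (n - 1) * (1 - 2 * S\<^sup>2) / r\<^sup>2))"
    using r by (simp add: field_simps power2_eq_square)
  finally show ?thesis unfolding a mult_left_cancel[OF r] .
qed

lemma weight_derivative_algebra:
  fixes r S C n W :: real
  assumes r: "r \<noteq> 0"
  shows "W * (((n - 1) / r - r / 2) * C) * (r * C) + (C * C + - S * ((r / 2 - n / r) * S) * r) * W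
     = W * ((n - r\<^sup>2 / 2) * (S\<^sup>2 + C\<^sup>2))"
  using r by (simp add: field_simps power2_eq_square)

text \<open>On the right stands the integrand of the second variation; on the left stand the form in
  \<open>u\<close> and multiples of the exact derivatives \<open>?g1\<close>, \<open>?g2\<close>,
  \<open>?g3\<close> of \<open>second_variation_negative\<close>. There \<open>R\<close> is r^2,
  \<open>h\<close> is r sin \<alpha>, \<open>c\<close> is (r cos \<alpha>)^2, \<open>T\<close> is
  the squared curvature of \<gamma> and \<open>B\<close> the remaining part of the
  potential.\<close>

lemma second_variation_algebra:
  fixes W u u' h k R n c T B \<kappa>2 \<tau> Y :: real
  assumes R: "R = h\<^sup>2 + c" and n: "n \<noteq> 0"
  shows "(W * h\<^sup>2 * (u'\<^sup>2 - u\<^sup>2) - \<tau> * (W * h\<^sup>2 * u) - \<tau>\<^sup>2 / 4 * (W * h\<^sup>2))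
      + ((- (\<kappa>2 / 2) - Y / (2 * n) + \<tau>\<^sup>2 / 2) * (W * (n - R / 2)) - \<tau>\<^sup>2 / 4 * (- (W * (R / 2 - n)\<^sup>2) + W * c)
        + W * ((u' * h + u * k)\<^sup>2 - (u' * h)\<^sup>2 + (u * h)\<^sup>2 * (1 / 2 - T + B)))
    = W * (\<kappa>2 * (R / 4 - n / 2) + \<tau>\<^sup>2 * (n / 2 - R / 2) - \<tau> * (u * h\<^sup>2)
      + ((u' * h + u * k)\<^sup>2 - (u * h)\<^sup>2 * T - (u * h)\<^sup>2 / 2 + (u * h)\<^sup>2 * B)
      + Y * (R / (4 * n) - 1 / 2) + \<tau>\<^sup>2 * (R / 4 - n / 2)\<^sup>2)"
proof -
  have y: "Y / (2 * n) * (n - R / 2) = - (Y * (R / (4 * n) - 1 / 2))"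
    using n by (simp add: field_simps)
  have "(- (\<kappa>2 / 2) - Y / (2 * n) + \<tau>\<^sup>2 / 2) * (W * (n - R / 2))
      = W * ((- (\<kappa>2 / 2) + \<tau>\<^sup>2 / 2) * (n - R / 2) - Y / (2 * n) * (n - R / 2))"
  proof -
    have "(a - v + b) * (W * X) = W * ((a + b) * X - v * X)" for a b v X :: real by (simp add: algebra_simps)
    then show ?thesis .
  qed
  also have "\<dots> = W * ((- (\<kappa>2 / 2) + \<tau>\<^sup>2 / 2) * (n - R / 2) + Y * (R / (4 * n) - 1 / 2))" unfolding y by simp
  finally have e: "(- (\<kappa>2 / 2) - Y / (2 * n) + \<tau>\<^sup>2 / 2) * (W * (n - R / 2))
      = W * ((- (\<kappa>2 / 2) + \<tau>\<^sup>2 / 2) * (n - R / 2) + Y * (R / (4 * n) - 1 / 2))" .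
  define Z where "Z = Y * (R / (4 * n) - 1 / 2)"
  have c: "c = R - h\<^sup>2" using R by simp
  show ?thesis unfolding e Z_def[symmetric] c by (simp add: field_simps power2_eq_square)
qed

section \<open>The profile curve: conserved quantity and periodicity\<close>

locale anciaux_curve =
  fixes n :: nat and \<gamma> :: "real \<Rightarrow> complex" and r \<phi> \<theta> :: "real \<Rightarrow> real" and L :: real
  assumes n: "n \<ge> 2"
    and d\<phi>_ex: "\<And>s. \<phi> differentiable (at s)"
    and polar: "\<And>s. 0 < r s" "\<And>s. \<gamma> s = of_real (r s) * cis (\<phi> s)"
    and arclength: "\<And>s. (\<gamma> has_vector_derivative cis (\<theta> s)) (at s)"
    and ode_r: "\<And>s. (r has_real_derivative cos (\<theta> s - \<phi> s)) (at s)"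
    and ode_\<theta>: "\<And>s. ((\<lambda>s. \<theta> s - \<phi> s) has_real_derivative (r s / 2 - real n / r s) * sin (\<theta> s - \<phi> s)) (at s)"
    and closed: "closed_curve L \<gamma>"
begin

definition \<alpha> :: "real \<Rightarrow> real" where "\<alpha> s = \<theta> s - \<phi> s"

abbreviation S where "S s \<equiv> sin (\<alpha> s)"
abbreviation C where "C s \<equiv> cos (\<alpha> s)"

lemma L: "0 < L" and per_\<gamma>: "\<gamma> (s + L) = \<gamma> s"
  using closed by (auto simp: closed_curve_def)

lemma d_r: "(r has_real_derivative C s) (at s)"
  using ode_r by (simp add: \<alpha>_def)

lemma d_\<alpha>: "(\<alpha> has_real_derivative (r s / 2 - real n / r s) * S s) (at s)"
  using ode_\<theta> by (simp add: \<alpha>_def[abs_def])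

lemma r_nz: "r s \<noteq> 0" using polar(1)[of s] by simp

definition \<phi>' :: "real \<Rightarrow> real" where "\<phi>' s = S s / r s"

text \<open>The polar form of \<gamma> is differentiated and rotated back by \<phi>; comparing
  imaginary parts with those of exp (i \<alpha>) gives r \<phi>' = sin \<alpha>.\<close>

lemma d_\<phi>: "(\<phi> has_real_derivative \<phi>' s) (at s)"
proof -
  obtain D where D: "(\<phi> has_real_derivative D) (at s)"
    using d\<phi>_ex real_differentiable_def by blast
  have "((\<lambda>s. of_real (r s) * cis (\<phi> s)) has_vector_derivative
      of_real (r s) * (D *\<^sub>R (\<i> * cis (\<phi> s))) + of_real (C s) * cis (\<phi> s)) (at s)"
  proof (rule has_vector_derivative_mult)
    show "((\<lambda>s. complex_of_real (r s)) has_vector_derivative of_real (C s)) (at s)"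
      by (rule has_vector_derivative_of_real[OF d_r])
    have "(cis has_vector_derivative \<i> * cis (\<phi> s)) (at (\<phi> s))"
      unfolding has_vector_derivative_def
      by (rule has_derivative_eq_rhs[OF has_derivative_cis[OF has_derivative_ident]]) (simp add: scaleR_conv_of_real)
    from vector_diff_chain_at[OF D[unfolded has_real_derivative_iff_has_vector_derivative] this]
    show "((\<lambda>s. cis (\<phi> s)) has_vector_derivative D *\<^sub>R (\<i> * cis (\<phi> s))) (at s)" by (simp add: o_def)
  qed
  moreover have "\<gamma> = (\<lambda>s. of_real (r s) * cis (\<phi> s))" using polar(2) by (rule ext)
  ultimately have "(\<gamma> has_vector_derivative of_real (r s) * (D *\<^sub>R (\<i> * cis (\<phi> s))) + of_real (C s) * cis (\<phi> s)) (at s)"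
    by simp
  then have "cis (\<theta> s) = of_real (r s) * (D *\<^sub>R (\<i> * cis (\<phi> s))) + of_real (C s) * cis (\<phi> s)"
    using arclength vector_derivative_unique_at by blast
  then have "cis (\<theta> s) * cis (- \<phi> s) = (of_real (r s) * (D *\<^sub>R (\<i> * cis (\<phi> s))) + of_real (C s) * cis (\<phi> s)) * cis (- \<phi> s)"
    by simp
  also have "\<dots> = (of_real (r s * D) * \<i> + of_real (C s)) * (cis (\<phi> s) * cis (- \<phi> s))"
    by (simp add: scaleR_conv_of_real algebra_simps)
  finally have "cis (\<alpha> s) = of_real (r s * D) * \<i> + of_real (C s)"
    by (simp add: cis_mult \<alpha>_def)
  then have "S s = r s * D" by (simp add: complex_eq_iff)
  then show ?thesis using D r_nz[of s] by (simp add: \<phi>'_def)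
qed

lemma d_\<theta>: "(\<theta> has_real_derivative (r s / 2 - (real n - 1) / r s) * S s) (at s)"
proof -
  have "((\<lambda>s. \<alpha> s + \<phi> s) has_real_derivative (r s / 2 - real n / r s) * S s + \<phi>' s) (at s)"
    by (intro DERIV_add d_\<alpha> d_\<phi>)
  moreover have "(r s / 2 - real n / r s) * S s + \<phi>' s = (r s / 2 - (real n - 1) / r s) * S s"
    using r_nz[of s] by (simp add: \<phi>'_def field_simps)
  ultimately show ?thesis by (simp add: \<alpha>_def)
qed

text \<open>The factor r^(n-1) by which the cone scales the volume of the Legendrian factor, times
  the Gaussian weight of the functional.\<close>

definition W :: "real \<Rightarrow> real" where "W s = r s ^ (n - 1) * exp (- (r s)\<^sup>2 / 4)"

lemma W_pos: "W s > 0" using polar(1) by (simp add: W_def)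

lemma d_W: "(W has_real_derivative W s * (((real n - 1) / r s - r s / 2) * C s)) (at s)"
proof -
  have e: "((\<lambda>s. r s ^ (n - 1)) has_real_derivative (r s ^ (n - 1) * ((real n - 1) / r s)) * C s) (at s)"
  proof -
    have "((\<lambda>s. r s ^ (n - 1)) has_real_derivative real (n - 1) * (C s * r s ^ (n - 1 - Suc 0))) (at s)"
      by (rule DERIV_power[OF d_r])
    moreover have "real (n - 1) * (C s * r s ^ (n - 1 - Suc 0)) = (r s ^ (n - 1) * ((real n - 1) / r s)) * C s"
    proof -
      have "n - 1 = Suc (n - 2)" "n - 1 - Suc 0 = n - 2" using n by auto
      then have "r s ^ (n - 1) = r s * r s ^ (n - 1 - Suc 0)" by (metis power_Suc)
      then show ?thesis using n r_nz[of s] by (simp add: of_nat_diff field_simps)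
    qed
    ultimately show ?thesis by simp
  qed
  have x: "((\<lambda>s. exp (- (r s)\<^sup>2 / 4)) has_real_derivative exp (- (r s)\<^sup>2 / 4) * (- (r s / 2) * C s)) (at s)"
    by (auto intro!: derivative_eq_intros d_r simp: power2_eq_square)
  from DERIV_mult[OF e x] show ?thesis
    unfolding W_def[abs_def] by (rule DERIV_cong) (simp add: algebra_simps)
qed

definition E :: real where "E = W 0 * r 0 * S 0"

lemma E: "W s * r s * S s = E"
proof -
  have "((\<lambda>s. W s * r s * S s) has_real_derivative 0) (at s)" for s
  proof -
    have "((\<lambda>s. W s * r s * S s) has_real_derivative
        (W s * (((real n - 1) / r s - r s / 2) * C s) * r s + C s * W s) * S s + C s * ((r s / 2 - real n / r s) * S s) * (W s * r s)) (at s)"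
      by (intro DERIV_mult d_W d_r DERIV_chain2[OF DERIV_sin d_\<alpha>])
    moreover have "(W s * (((real n - 1) / r s - r s / 2) * C s) * r s + C s * W s) * S s + C s * ((r s / 2 - real n / r s) * S s) * (W s * r s) = 0"
      using r_nz[of s] by (simp add: field_simps)
    ultimately show ?thesis by simp
  qed
  then have "\<forall>s. ((\<lambda>s. W s * r s * S s) has_real_derivative 0) (at s)" by blast
  from DERIV_isconst_all[OF this, of s 0] show ?thesis unfolding E_def .
qed

lemma per_r: "r (s + L) = r s"
proof -
  have "r s = norm (\<gamma> s)" for s using polar(1)[of s] by (simp add: polar(2) norm_mult)
  then show ?thesis by (simp add: per_\<gamma>)
qed

lemma per_cis_\<phi>: "cis (\<phi> (s + L)) = cis (\<phi> s)"
  using per_\<gamma>[of s] r_nz[of s] by (simp add: polar(2) per_r)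

lemma per_cis_\<theta>: "cis (\<theta> (s + L)) = cis (\<theta> s)"
proof -
  have "((\<lambda>s. \<gamma> (s + L)) has_vector_derivative cis (\<theta> (s + L))) (at s)"
  proof -
    have "((\<lambda>s. s + L) has_vector_derivative 1) (at s)"
      by (auto intro!: derivative_eq_intros)
    from vector_diff_chain_at[OF this arclength] show ?thesis by (simp add: o_def)
  qed
  then show ?thesis using arclength[of s] vector_derivative_unique_at by (simp add: per_\<gamma>) blast
qed

lemma per_cis_\<alpha>: "cis (\<alpha> (s + L)) = cis (\<alpha> s)"
  by (simp add: \<alpha>_def cis_divide[symmetric] per_cis_\<phi> per_cis_\<theta>)

lemma per_SC: "S (s + L) = S s" "C (s + L) = C s"
  using per_cis_\<alpha>[of s] by (simp_all add: complex_eq_iff)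

text \<open>If E were 0, the sine would vanish everywhere; but r is periodic, so its derivative, the
  cosine, vanishes somewhere.\<close>

lemma E_nz: "E \<noteq> 0"
proof
  assume "E = 0"
  then have S0: "S s = 0" for s using E[of s] W_pos[of s] r_nz[of s] by simp
  have "\<exists>z>0. z < L \<and> r L - r 0 = (L - 0) * C z"
    by (rule MVT2[OF L]) (rule d_r)
  then obtain z where "C z = 0" using per_r[of 0] L by auto
  then show False using S0[of z] sin_cos_squared_add[of "\<alpha> z"] by simp
qed

lemma S_nz: "S s \<noteq> 0" using E[of s] E_nz by auto

lemma ES_pos: "E * S s > 0"
proof -
  have "E * S s = W s * r s * (S s)\<^sup>2" by (simp add: E[of s, symmetric] power2_eq_square)
  also have "\<dots> > 0" using W_pos[of s] polar(1)[of s] S_nz[of s] by simp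
  finally show ?thesis .
qed

text \<open>The midpoint between the consecutive multiples of \<pi> that enclose \<alpha> at
  0.\<close>

definition \<alpha>0 :: real where "\<alpha>0 = (of_int \<lfloor>\<alpha> 0 / pi\<rfloor> + 1 / 2) * pi"

text \<open>The sine of \<alpha> has no zero, so the connected range of \<alpha> stays in one gap
  between multiples of \<pi>.\<close>

lemma \<alpha>_range: "\<bar>\<alpha> s - \<alpha>0\<bar> < pi / 2"
proof -
  define k where "k = \<lfloor>\<alpha> 0 / pi\<rfloor>"
  have k: "of_int k * pi \<le> \<alpha> 0" "\<alpha> 0 < (of_int k + 1) * pi"
  proof -
    have "of_int k \<le> \<alpha> 0 / pi" "\<alpha> 0 / pi < of_int k + 1" unfolding k_def by linarith+
    then show "of_int k * pi \<le> \<alpha> 0" "\<alpha> 0 < (of_int k + 1) * pi"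
      using pi_gt_zero by (simp_all only: pos_le_divide_eq pos_divide_less_eq)
  qed
  have ne: "\<alpha> s \<noteq> of_int j * pi" for s j
  proof
    assume "\<alpha> s = of_int j * pi"
    then have "S s = 0" using sin_zero_iff_int2 by metis
    then show False using S_nz by simp
  qed
  have cont: "continuous_on UNIV \<alpha>"
    using DERIV_isCont[OF d_\<alpha>] continuous_at_imp_continuous_on by blast
  have "connected (range \<alpha>)" by (rule connected_continuous_image[OF cont connected_UNIV])
  then have iv: "x \<in> range \<alpha>" if "a \<in> range \<alpha>" "b \<in> range \<alpha>" "a \<le> x" "x \<le> b" for a b x
    using that connected_iff_interval by blast
  have "of_int k * pi < \<alpha> s"
  proof (rule ccontr)
    assume "\<not> of_int k * pi < \<alpha> s"
    then have "\<alpha> s \<le> of_int k * pi" by simp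
    from iv[OF rangeI rangeI this k(1)] have "of_int k * pi \<in> range \<alpha>" .
    then show False using ne by (metis rangeE)
  qed
  moreover have "\<alpha> s < (of_int k + 1) * pi"
  proof (rule ccontr)
    assume "\<not> \<alpha> s < (of_int k + 1) * pi"
    then have "(of_int k + 1) * pi \<le> \<alpha> s" by simp
    from iv[OF rangeI rangeI less_imp_le[OF k(2)] this] have "of_int (k + 1) * pi \<in> range \<alpha>" by simp
    then show False using ne by (metis rangeE)
  qed
  moreover have "(of_int k + 1) * pi = of_int k * pi + pi" by (simp add: algebra_simps)
  moreover have "\<alpha>0 = of_int k * pi + pi / 2" unfolding \<alpha>0_def k_def[symmetric] by (simp add: algebra_simps)
  ultimately show ?thesis by linarith
qed

text \<open>After a period \<alpha> can only have changed by a multiple of 2 \<pi>, and its range is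
  too short for a nonzero one. In contrast, \<phi> is periodic only modulo 2 \<pi>, as the curve may
  wind around the origin.\<close>

lemma per_\<alpha>: "\<alpha> (s + L) = \<alpha> s"
proof -
  have "cos (\<alpha> (s + L) - \<alpha> s) = 1" 
    unfolding cos_diff per_SC using sin_cos_squared_add[of "\<alpha> s"] by (simp add: power2_eq_square)
  moreover have "\<bar>\<alpha> (s + L) - \<alpha> s\<bar> < pi" using \<alpha>_range[of s] \<alpha>_range[of "s + L"] by linarith
  moreover obtain j :: int where j: "\<alpha> (s + L) - \<alpha> s = of_int j * 2 * pi"
    using \<open>cos (\<alpha> (s + L) - \<alpha> s) = 1\<close> cos_one_2pi_int by blast
  ultimately have "\<bar>of_int j :: real\<bar> * (2 * pi) < pi" by (simp add: abs_mult)
  then have "\<bar>of_int j :: real\<bar> * 2 < 1" by simp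
  then have "j = 0" by linarith
  then show ?thesis using j by simp
qed

lemma per_W: "W (s + L) = W s" by (simp add: W_def per_r)

lemma per_trig_\<phi>: "cos (\<phi> (s + L) - b) = cos (\<phi> s - b)" "sin (\<phi> (s + L) - b) = sin (\<phi> s - b)"
  using per_cis_\<phi>[of s] by (simp_all add: complex_eq_iff cos_diff sin_diff)

section \<open>Weighted integrals over one period\<close>

abbreviation I where "I g \<equiv> integral {0..L} g"

lemma I_derivative:
  assumes "\<And>s. (G has_real_derivative g s) (at s)" "G L = G 0"
  shows "(g has_integral 0) {0..L}"
  using fundamental_theorem_of_calculus[of 0 L G g] L assms
  by (auto simp: has_real_derivative_iff_has_vector_derivative intro: has_vector_derivative_at_within)

lemma cont:
  "continuous_on UNIV r" "continuous_on UNIV \<alpha>" "continuous_on UNIV \<phi>" "continuous_on UNIV \<theta>" "continuous_on UNIV W"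
  by (intro continuous_at_imp_continuous_on ballI DERIV_isCont[OF d_r] DERIV_isCont[OF d_\<alpha>] DERIV_isCont[OF d_\<phi>]
      DERIV_isCont[OF d_\<theta>] DERIV_isCont[OF d_W])+

lemma cont':
  "continuous_on {0..L} r" "continuous_on {0..L} \<alpha>" "continuous_on {0..L} \<phi>" "continuous_on {0..L} \<theta>" "continuous_on {0..L} W"
  using cont continuous_on_subset[OF _ subset_UNIV] by blast+

text \<open>The mean curvature of the cone is \<open>h / 2\<close> up to sign.\<close>

definition h where "h s = r s * S s"
definition k where "k s = S s * C s * (1 + (r s)\<^sup>2 / 2 - real n)"
definition k' where "k' s = ((C s)\<^sup>2 - (S s)\<^sup>2) * ((r s / 2 - real n / r s) * S s) * (1 + (r s)\<^sup>2 / 2 - real n) + S s * C s * (r s * C s)"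

lemma d_h: "(h has_real_derivative k s) (at s)"
proof -
  have "((\<lambda>s. r s * S s) has_real_derivative C s * S s + C s * ((r s / 2 - real n / r s) * S s) * r s) (at s)"
    by (intro DERIV_mult d_r DERIV_chain2[OF DERIV_sin d_\<alpha>])
  moreover have "C s * S s + C s * ((r s / 2 - real n / r s) * S s) * r s = k s"
    using r_nz[of s] by (simp add: k_def field_simps power2_eq_square)
  ultimately show ?thesis by (simp add: h_def[abs_def])
qed

lemma d_k: "(k has_real_derivative k' s) (at s)"
proof -
  have "((\<lambda>s. S s * C s * (1 + (r s)\<^sup>2 / 2 - real n)) has_real_derivative
      (C s * ((r s / 2 - real n / r s) * S s) * C s + - S s * ((r s / 2 - real n / r s) * S s) * S s) * (1 + (r s)\<^sup>2 / 2 - real n)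
      + (r s * C s) * (S s * C s)) (at s)"
    by (intro DERIV_mult DERIV_chain2[OF DERIV_sin d_\<alpha>] DERIV_chain2[OF DERIV_cos d_\<alpha>])
      (auto intro!: derivative_eq_intros d_r)
  then show ?thesis unfolding k_def[abs_def]
    by (rule DERIV_cong) (simp add: k'_def algebra_simps power2_eq_square)
qed

text \<open>Because the logarithmic derivative of W is ((n - 1) / r - r / 2) cos \<alpha>, the left
  side is (W h')' / W. Relative to the quadratic form with integrand W (f'^2 - \<theta>'^2 f^2 - f^2
  / 2 + (n - 1) (1 - 2 S^2) f^2 / r^2), this makes \<open>h\<close> an eigenfunction with eigenvalue
  -1, the origin of the term - u^2 once f = u h.\<close>

lemma jacobi_h:
  "((real n - 1) / r s - r s / 2) * C s * k s + k' s
   = h s * (1 / 2 - ((r s / 2 - (real n - 1) / r s) * S s)\<^sup>2 + (real n - 1) * (1 - 2 * (S s)\<^sup>2) / (r s)\<^sup>2)"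
  unfolding h_def k_def k'_def by (rule jacobi_operator_algebra[OF r_nz]) simp

lemma per_hk: "h (s + L) = h s" "k (s + L) = k s"
  by (simp_all add: h_def k_def per_r per_SC)

definition \<rho> where "\<rho> s = W s * (h s)\<^sup>2"

text \<open>One of the two factors \<open>h\<close> combines with \<open>W\<close> to the constant
  \<open>E\<close>.\<close>

lemma \<rho>_eq: "\<rho> s = E * (r s * S s)" 
  unfolding E[of s, symmetric] by (simp add: \<rho>_def h_def power2_eq_square)

lemma cont_\<rho>: "continuous_on {0..L} \<rho>"
  unfolding \<rho>_eq by (intro continuous_on_mult continuous_on_const continuous_on_sin cont')

text \<open>The angle swept by the curve in one period, times \<open>E\<close>, which makes it
  positive for either orientation.\<close>

definition \<Phi> where "\<Phi> = E * I (\<lambda>s. \<phi>' s)"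

lemma cont_d\<phi>: "continuous_on {0..L} \<phi>'"
  unfolding \<phi>'_def[abs_def] using r_nz by (intro continuous_on_divide continuous_on_sin cont') auto

lemma int_cont: "continuous_on {0..L} g \<Longrightarrow> (g :: real \<Rightarrow> real) integrable_on {0..L}"
  by (rule integrable_continuous_interval)

lemma \<Phi>_pos: "\<Phi> > 0"
proof -
  have "0 < I (\<lambda>s. E * \<phi>' s)"
  proof -
    have c: "continuous_on {0..L} (\<lambda>s. E * \<phi>' s)" by (intro continuous_on_mult continuous_on_const cont_d\<phi>)
    have p: "E * \<phi>' s > 0" for s using ES_pos[of s] polar(1)[of s] by (simp add: \<phi>'_def)
    have "0 \<le> I (\<lambda>s. E * \<phi>' s)" by (rule integral_nonneg[OF int_cont[OF c]]) (use p less_imp_le in blast)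
    moreover have "I (\<lambda>s. E * \<phi>' s) \<noteq> 0"
      using integral_eq_0_iff[OF c] L p p[of 0] less_imp_le by (metis atLeastAtMost_iff less_irrefl order_refl)
    ultimately show ?thesis by linarith
  qed
  then show ?thesis by (simp add: \<Phi>_def)
qed

text \<open>The equation for \<alpha> is \<alpha>' = h / 2 - n \<phi>', so \<rho> = E h differs from
  2 n E \<phi>' by the derivative of the periodic function 2 E \<alpha>.\<close>

lemma I_\<rho>: "I \<rho> = 2 * real n * \<Phi>"
proof -
  have "((\<lambda>s. \<rho> s - 2 * real n * E * \<phi>' s) has_integral 0) {0..L}"
  proof (rule I_derivative[where G = "\<lambda>s. 2 * E * \<alpha> s"])
    show "((\<lambda>s. 2 * E * \<alpha> s) has_real_derivative \<rho> s - 2 * real n * E * \<phi>' s) (at s)" for s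
      by (rule DERIV_cong[OF DERIV_cmult[OF d_\<alpha>]]) (use r_nz[of s] in \<open>simp add: \<rho>_eq \<phi>'_def field_simps\<close>)
  qed (use per_\<alpha>[of 0] in simp)
  then have "I (\<lambda>s. \<rho> s - 2 * real n * E * \<phi>' s) = 0" by (rule integral_unique)
  then show ?thesis
    by (subst (asm) integral_diff)
      (auto simp: \<Phi>_def mult.assoc intro!: int_cont cont_\<rho> continuous_on_mult continuous_on_const cont_d\<phi>)
qed

text \<open>In \<rho> = 2 E (\<alpha>' + n \<phi>') the second term times the cosine is exact, and
  in the first an integration by parts moves the derivative to the cosine. The constant \<alpha>0
  may be subtracted from \<alpha>; then the factor 2 |\<alpha> - \<alpha>0| is at most
  \<pi>.\<close>

lemma I_\<rho>_cos_le: "\<bar>I (\<lambda>s. \<rho> s * cos (\<phi> s - b))\<bar> \<le> pi * \<Phi>"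
proof -
  let ?g = "\<lambda>s. 2 * E * (\<alpha> s - \<alpha>0) * (sin (\<phi> s - b) * \<phi>' s)"
  have "((\<lambda>s. \<rho> s * cos (\<phi> s - b) - ?g s) has_integral 0) {0..L}"
  proof (rule I_derivative[where G = "\<lambda>s. 2 * E * (\<alpha> s - \<alpha>0) * cos (\<phi> s - b) + 2 * real n * E * sin (\<phi> s - b)"])
    fix s
    have "((\<lambda>s. 2 * E * (\<alpha> s - \<alpha>0) * cos (\<phi> s - b) + 2 * real n * E * sin (\<phi> s - b)) has_real_derivative
       (2 * E * ((r s / 2 - real n / r s) * S s) * cos (\<phi> s - b) + - sin (\<phi> s - b) * \<phi>' s * (2 * E * (\<alpha> s - \<alpha>0)))
       + 2 * real n * E * (cos (\<phi> s - b) * \<phi>' s)) (at s)"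
      by (intro DERIV_add DERIV_mult DERIV_cmult DERIV_chain2[OF DERIV_sin] DERIV_chain2[OF DERIV_cos])
        (auto intro!: derivative_eq_intros d_\<alpha> d_\<phi>)
    then show "((\<lambda>s. 2 * E * (\<alpha> s - \<alpha>0) * cos (\<phi> s - b) + 2 * real n * E * sin (\<phi> s - b)) has_real_derivative
       \<rho> s * cos (\<phi> s - b) - ?g s) (at s)"
      by (rule DERIV_cong) (use r_nz[of s] in \<open>simp add: \<rho>_eq \<phi>'_def field_simps\<close>)
  qed (use per_\<alpha>[of 0] per_trig_\<phi>[of 0] in simp)
  then have 0: "I (\<lambda>s. \<rho> s * cos (\<phi> s - b) - ?g s) = 0" by (rule integral_unique)
  have cg: "continuous_on {0..L} ?g"
    by (intro continuous_on_mult continuous_on_diff continuous_on_const continuous_on_sin cont' cont_d\<phi>)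
  have "I (\<lambda>s. \<rho> s * cos (\<phi> s - b)) = I ?g"
    using 0 by (subst (asm) integral_diff)
      (auto intro!: int_cont cg continuous_on_mult cont_\<rho> continuous_on_cos continuous_on_diff continuous_on_const cont')
  moreover have "norm (I ?g) \<le> I (\<lambda>s. pi * (E * \<phi>' s))"
  proof (rule integral_norm_bound_integral)
    fix s
    have p: "E * \<phi>' s > 0" using ES_pos[of s] polar(1)[of s] by (simp add: \<phi>'_def)
    have "norm (?g s) = (2 * \<bar>\<alpha> s - \<alpha>0\<bar>) * (\<bar>sin (\<phi> s - b)\<bar> * (E * \<phi>' s))"
    proof -
      have "?g s = (2 * (\<alpha> s - \<alpha>0)) * (sin (\<phi> s - b) * (E * \<phi>' s))" by simp
      moreover have "\<bar>E * \<phi>' s\<bar> = E * \<phi>' s" using p by simp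
      ultimately show ?thesis
        by (simp only: real_norm_def abs_mult[of "2 * (\<alpha> s - \<alpha>0)"] abs_mult[of "sin (\<phi> s - b)"] abs_mult[of 2] abs_numeral)
    qed
    also have "\<dots> \<le> pi * (1 * (E * \<phi>' s))"
    proof (rule mult_mono)
      show "2 * \<bar>\<alpha> s - \<alpha>0\<bar> \<le> pi" using \<alpha>_range[of s] by simp
      show "\<bar>sin (\<phi> s - b)\<bar> * (E * \<phi>' s) \<le> 1 * (E * \<phi>' s)"
        by (rule mult_right_mono[OF abs_sin_le_one less_imp_le[OF p]])
      show "0 \<le> \<bar>sin (\<phi> s - b)\<bar> * (E * \<phi>' s)"
        by (rule mult_nonneg_nonneg[OF abs_ge_zero less_imp_le[OF p]])
    qed simp
    finally show "norm (?g s) \<le> pi * (E * \<phi>' s)" by simp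
  qed (auto intro!: int_cont cg continuous_on_mult continuous_on_const cont_d\<phi>)
  ultimately show ?thesis by (simp add: \<Phi>_def)
qed

lemma ex_unstable_direction:
  "\<exists>\<beta> m. I (\<lambda>s. \<rho> s * (cos (\<phi> s - \<beta>) - m)) = 0 \<and>
     I (\<lambda>s. \<rho> s * ((sin (\<phi> s - \<beta>) * \<phi>' s)\<^sup>2 - (cos (\<phi> s - \<beta>) - m)\<^sup>2)) < 0"
proof -
  \<comment> \<open>The Fourier coefficient for the phase \<open>b\<close>;
    \<open>c b / I \<rho>\<close> below is the mean of the cosine with respect to \<rho>, hence the
    right value of \<open>m\<close>.\<close>
  define c where "c b = I (\<lambda>s. \<rho> s * cos (\<phi> s - b))" for b
  define q where "q b = I (\<lambda>s. \<rho> s * ((sin (\<phi> s - b) * \<phi>' s)\<^sup>2 - (cos (\<phi> s - b) - c b / I \<rho>)\<^sup>2))" for b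
  have R: "I \<rho> > 0" unfolding I_\<rho> using \<Phi>_pos n by simp
  have cc: "continuous_on {0..L} (\<lambda>s. cos (\<phi> s - b))" "continuous_on {0..L} (\<lambda>s. sin (\<phi> s - b))" for b
    by (intro continuous_on_cos continuous_on_sin continuous_on_diff continuous_on_const cont')+
  note ci = int_cont continuous_on_mult cont_\<rho> cc continuous_on_diff continuous_on_const continuous_on_power cont_d\<phi> continuous_on_add
  have z: "I (\<lambda>s. \<rho> s * (cos (\<phi> s - b) - c b / I \<rho>)) = 0" for b
  proof -
    have "I (\<lambda>s. \<rho> s * (cos (\<phi> s - b) - c b / I \<rho>)) = I (\<lambda>s. \<rho> s * cos (\<phi> s - b) - c b / I \<rho> * \<rho> s)"
      by (simp add: algebra_simps)
    also have "\<dots> = c b - c b / I \<rho> * I \<rho>"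
      by (subst integral_diff) (rule int_cont, intro ci, rule int_cont, intro ci, simp add: c_def)
    also have "\<dots> = 0" using R by simp
    finally show ?thesis .
  qed
  have qe: "q b = I (\<lambda>s. \<rho> s * (sin (\<phi> s - b) * \<phi>' s)\<^sup>2) - I (\<lambda>s. \<rho> s * (cos (\<phi> s - b))\<^sup>2) + (c b)\<^sup>2 / I \<rho>" for b
  proof -
    have "q b = I (\<lambda>s. (\<rho> s * (sin (\<phi> s - b) * \<phi>' s)\<^sup>2 - \<rho> s * (cos (\<phi> s - b))\<^sup>2)
        + ((2 * (c b / I \<rho>)) * (\<rho> s * cos (\<phi> s - b)) - (c b / I \<rho>)\<^sup>2 * \<rho> s))"
      unfolding q_def by (rule arg_cong[where f = I]) (auto simp: fun_eq_iff algebra_simps power2_eq_square)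
    also have "\<dots> = I (\<lambda>s. \<rho> s * (sin (\<phi> s - b) * \<phi>' s)\<^sup>2) - I (\<lambda>s. \<rho> s * (cos (\<phi> s - b))\<^sup>2)
        + ((2 * (c b / I \<rho>)) * c b - (c b / I \<rho>)\<^sup>2 * I \<rho>)"
      by (subst integral_add integral_diff; (intro ci)?)+ (simp add: c_def)
    also have "(2 * (c b / I \<rho>)) * c b - (c b / I \<rho>)\<^sup>2 * I \<rho> = (c b)\<^sup>2 / I \<rho>"
      using R by (simp add: power2_eq_square field_simps)
    finally show ?thesis .
  qed
  \<comment> \<open>\<open>c\<close> is a combination of cosine and sine with coefficients
    \<open>c 0\<close> and \<open>c (pi / 2)\<close>, so it vanishes a quarter turn after its
    maximum. With this phase only one coefficient has to be estimated; bounding both would leave 1 -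
    2 n + \<pi>^2 / n, which is positive for n = 2.\<close>
  obtain b where b: "(c 0)\<^sup>2 + (c (pi / 2))\<^sup>2 = (c b)\<^sup>2" "c (b + pi / 2) = 0"
  proof -
    define A B where "A = c 0" and "B = c (pi / 2)"
    have cb: "c b = cos b * A + sin b * B" for b
    proof -
      have "c b = I (\<lambda>s. cos b * (\<rho> s * cos (\<phi> s - 0)) + sin b * (\<rho> s * cos (\<phi> s - pi / 2)))"
        unfolding c_def by (rule arg_cong[where f = I]) (auto simp: fun_eq_iff cos_diff algebra_simps)
      also have "\<dots> = cos b * A + sin b * B"
        by (subst integral_add; (intro ci)?) (simp add: A_def B_def c_def)
      finally show ?thesis .
    qed
    define z where "z = Complex A B"
    have AB: "A = norm z * cos (Arg z)" "B = norm z * sin (Arg z)"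
      using arg_cong[OF rcis_cmod_Arg[of z], of Re] arg_cong[OF rcis_cmod_Arg[of z], of Im] by (simp_all add: z_def)
    have "norm z * ((cos (Arg z))\<^sup>2 + (sin (Arg z))\<^sup>2) = cos (Arg z) * (norm z * cos (Arg z)) + sin (Arg z) * (norm z * sin (Arg z))"
      by (simp only: power2_eq_square distrib_left mult.left_commute)
    also have "\<dots> = c (Arg z)" unfolding cb by (simp only: AB[symmetric])
    finally have 1: "c (Arg z) = norm z" by simp
    have 2: "c (Arg z + pi / 2) = 0"
    proof -
      have "c (Arg z + pi / 2) = - sin (Arg z) * A + cos (Arg z) * B" unfolding cb by (simp add: sin_add cos_add)
      also have "\<dots> = - sin (Arg z) * (norm z * cos (Arg z)) + cos (Arg z) * (norm z * sin (Arg z))"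
        by (simp only: AB[symmetric])
      also have "\<dots> = 0" by simp
      finally show ?thesis .
    qed
    have "A\<^sup>2 + B\<^sup>2 = (norm z)\<^sup>2" by (simp add: z_def cmod_power2)
    then show ?thesis using that[of "Arg z"] 1 2 by (simp add: A_def B_def)
  qed
  \<comment> \<open>For two phases a quarter turn apart the squares of sine and cosine add up to 1,
    in the derivative terms as well as in the others.\<close>
  have sum: "q b + q (b + pi / 2) < 0"
  proof -
    have sc: "sin (\<phi> s - (b + pi / 2)) = - cos (\<phi> s - b)" "cos (\<phi> s - (b + pi / 2)) = sin (\<phi> s - b)" for s
      by (simp_all add: sin_diff cos_diff sin_add cos_add algebra_simps)
    have "q b + q (b + pi / 2) = (I (\<lambda>s. \<rho> s * (sin (\<phi> s - b) * \<phi>' s)\<^sup>2) + I (\<lambda>s. \<rho> s * (cos (\<phi> s - b) * \<phi>' s)\<^sup>2))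
        - (I (\<lambda>s. \<rho> s * (cos (\<phi> s - b))\<^sup>2) + I (\<lambda>s. \<rho> s * (sin (\<phi> s - b))\<^sup>2)) + (c b)\<^sup>2 / I \<rho>"
      unfolding qe b(2) sc by simp
    also have "I (\<lambda>s. \<rho> s * (sin (\<phi> s - b) * \<phi>' s)\<^sup>2) + I (\<lambda>s. \<rho> s * (cos (\<phi> s - b) * \<phi>' s)\<^sup>2)
       = I (\<lambda>s. \<rho> s * (\<phi>' s)\<^sup>2)"
    proof -
      have "(\<lambda>s. \<rho> s * (\<phi>' s)\<^sup>2) = (\<lambda>s. \<rho> s * (sin (\<phi> s - b) * \<phi>' s)\<^sup>2 + \<rho> s * (cos (\<phi> s - b) * \<phi>' s)\<^sup>2)"
      proof
        fix s
        have "\<rho> s * (\<phi>' s)\<^sup>2 = \<rho> s * (((sin (\<phi> s - b))\<^sup>2 + (cos (\<phi> s - b))\<^sup>2) * (\<phi>' s)\<^sup>2)" by simp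
        also have "\<dots> = \<rho> s * (sin (\<phi> s - b) * \<phi>' s)\<^sup>2 + \<rho> s * (cos (\<phi> s - b) * \<phi>' s)\<^sup>2"
          by (simp only: power_mult_distrib distrib_left distrib_right)
        finally show "\<rho> s * (\<phi>' s)\<^sup>2 = \<rho> s * (sin (\<phi> s - b) * \<phi>' s)\<^sup>2 + \<rho> s * (cos (\<phi> s - b) * \<phi>' s)\<^sup>2" .
      qed
      moreover have "I (\<lambda>s. \<rho> s * (sin (\<phi> s - b) * \<phi>' s)\<^sup>2 + \<rho> s * (cos (\<phi> s - b) * \<phi>' s)\<^sup>2)
        = I (\<lambda>s. \<rho> s * (sin (\<phi> s - b) * \<phi>' s)\<^sup>2) + I (\<lambda>s. \<rho> s * (cos (\<phi> s - b) * \<phi>' s)\<^sup>2)"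
        by (rule integral_add) (intro ci)+
      ultimately show ?thesis by (simp only:)
    qed
    also have "I (\<lambda>s. \<rho> s * (cos (\<phi> s - b))\<^sup>2) + I (\<lambda>s. \<rho> s * (sin (\<phi> s - b))\<^sup>2) = I \<rho>"
    proof -
      have "(\<lambda>s. \<rho> s * (cos (\<phi> s - b))\<^sup>2 + \<rho> s * (sin (\<phi> s - b))\<^sup>2) = \<rho>"
        by (rule ext) (simp only: distrib_left[symmetric] sin_cos_squared_add2 mult_1_right)
      moreover have "I (\<lambda>s. \<rho> s * (cos (\<phi> s - b))\<^sup>2 + \<rho> s * (sin (\<phi> s - b))\<^sup>2)
        = I (\<lambda>s. \<rho> s * (cos (\<phi> s - b))\<^sup>2) + I (\<lambda>s. \<rho> s * (sin (\<phi> s - b))\<^sup>2)"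
        by (rule integral_add) (intro ci)+
      ultimately show ?thesis by (simp only:)
    qed
    finally have 1: "q b + q (b + pi / 2) = I (\<lambda>s. \<rho> s * (\<phi>' s)\<^sup>2) - I \<rho> + (c b)\<^sup>2 / I \<rho>" .
    \<comment> \<open>The integrand on the left is E \<phi>' times the square of the sine of
      \<alpha>.\<close>
    have 2: "I (\<lambda>s. \<rho> s * (\<phi>' s)\<^sup>2) \<le> I (\<lambda>s. E * \<phi>' s)"
    proof (rule integral_le)
      fix s
      have p: "E * \<phi>' s > 0" using ES_pos[of s] polar(1)[of s] by (simp add: \<phi>'_def)
      have "\<rho> s * (\<phi>' s)\<^sup>2 = (E * \<phi>' s) * (S s)\<^sup>2"
        using r_nz[of s] by (simp add: \<rho>_eq \<phi>'_def power2_eq_square)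
      also have "\<dots> \<le> (E * \<phi>' s) * 1"
        using p by (intro mult_left_mono) (auto simp: abs_square_le_1)
      finally show "\<rho> s * (\<phi>' s)\<^sup>2 \<le> E * \<phi>' s" by simp
    qed (intro ci)+
    have 3: "I (\<lambda>s. E * \<phi>' s) = \<Phi>" by (simp add: \<Phi>_def)
    have 4: "(c b)\<^sup>2 / I \<rho> \<le> (pi * \<Phi>)\<^sup>2 / I \<rho>"
    proof -
      have "\<bar>c b\<bar> \<le> pi * \<Phi>" unfolding c_def by (rule I_\<rho>_cos_le)
      then have "(c b)\<^sup>2 \<le> (pi * \<Phi>)\<^sup>2" by (metis abs_ge_zero power2_abs power_mono)
      then show ?thesis using R by (simp add: divide_right_mono)
    qed
    have "q b + q (b + pi / 2) \<le> \<Phi> - I \<rho> + (pi * \<Phi>)\<^sup>2 / I \<rho>" using 1 2 3 4 by linarith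
    also have "\<dots> = \<Phi> * (1 - 2 * real n + pi\<^sup>2 / (2 * real n))"
      unfolding I_\<rho> using \<Phi>_pos n by (simp add: field_simps power2_eq_square)
    \<comment> \<open>For n at least 2 the bound \<pi>^2 < 10 leaves less than 1 - 4 + 10 /
      4.\<close>
    also have "\<dots> < 0"
    proof -
      have "pi < 3.15" using pi_approx by simp
      then have "pi\<^sup>2 < 3.15\<^sup>2" using pi_gt_zero by (intro power_strict_mono) auto
      then have "pi\<^sup>2 < 10" by (simp add: power2_eq_square)
      moreover have "pi\<^sup>2 / (2 * real n) \<le> pi\<^sup>2 / 4" using n by (intro divide_left_mono) auto
      ultimately have "1 - 2 * real n + pi\<^sup>2 / (2 * real n) < 0" using n by linarith
      then show ?thesis using \<Phi>_pos by (simp add: mult_pos_neg)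
    qed
    finally show ?thesis .
  qed
  then have "q b < 0 \<or> q (b + pi / 2) < 0" by linarith
  then obtain b' where "q b' < 0" by blast
  then show ?thesis using z[of b'] unfolding q_def by blast
qed

text \<open>Here \<open>\<tau>\<close> and \<open>\<kappa>2\<close> are the first and second
  derivatives of t_s at 0, and \<open>Y\<close> is the squared length of the first derivative of
  x_s. Up to derivatives of periodic functions, the integrand is that of \<open>neg\<close>, minus
  \<tau> \<rho> u, which integrates to zero by \<open>z\<close>, minus \<tau>^2 \<rho> / 4.\<close>

lemma second_variation_negative:
  assumes z: "I (\<lambda>s. \<rho> s * (cos (\<phi> s - \<beta>) - m)) = 0"
    and neg: "I (\<lambda>s. \<rho> s * ((sin (\<phi> s - \<beta>) * \<phi>' s)\<^sup>2 - (cos (\<phi> s - \<beta>) - m)\<^sup>2)) < 0"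
  defines "u \<equiv> \<lambda>s. cos (\<phi> s - \<beta>) - m" and "u' \<equiv> \<lambda>s. - (sin (\<phi> s - \<beta>) * \<phi>' s)"
  shows "I (\<lambda>s. W s * (\<kappa>2 * ((r s)\<^sup>2 / 4 - real n / 2) + \<tau>\<^sup>2 * (real n / 2 - (r s)\<^sup>2 / 2) - \<tau> * (u s * (h s)\<^sup>2)
     + ((u' s * h s + u s * k s)\<^sup>2 - (u s * h s)\<^sup>2 * ((r s / 2 - (real n - 1) / r s) * S s)\<^sup>2 - (u s * h s)\<^sup>2 / 2
        + (u s * h s)\<^sup>2 * ((real n - 1) * (1 - 2 * (S s)\<^sup>2) / (r s)\<^sup>2))
     + Y * ((r s)\<^sup>2 / (4 * real n) - 1 / 2) + \<tau>\<^sup>2 * ((r s)\<^sup>2 / 4 - real n / 2)\<^sup>2)) < 0" (is "I ?f < 0")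
proof -
  \<comment> \<open>Periodic primitives of the terms to be discarded. \<open>?G1\<close>, built from
    the derivative of r^2 / 2, absorbs the terms with \<open>\<kappa>2\<close> and \<open>Y\<close>;
    together with \<open>?G2\<close> it turns the terms with \<tau>^2 into a multiple of \<rho>.
    \<open>?G3\<close> carries out the substitution f = u h, its derivative being simplified by
    \<open>jacobi_h\<close>.\<close>
  let ?G1 = "\<lambda>s. W s * (r s * C s)" and ?g1 = "\<lambda>s. W s * (real n - (r s)\<^sup>2 / 2)"
  let ?G2 = "\<lambda>s. W s * (r s * C s) * ((r s)\<^sup>2 / 2 - real n)"
  let ?g2 = "\<lambda>s. - (W s * ((r s)\<^sup>2 / 2 - real n)\<^sup>2) + W s * (r s * C s)\<^sup>2"
  let ?G3 = "\<lambda>s. W s * (u s)\<^sup>2 * (h s * k s)"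
  let ?g3 = "\<lambda>s. W s * ((u' s * h s + u s * k s)\<^sup>2 - (u' s * h s)\<^sup>2 + (u s * h s)\<^sup>2 * (1 / 2 - ((r s / 2 - (real n - 1) / r s) * S s)\<^sup>2 + (real n - 1) * (1 - 2 * (S s)\<^sup>2) / (r s)\<^sup>2))"
  have SC: "(S s)\<^sup>2 + (C s)\<^sup>2 = 1" for s by simp
  have d1: "(?G1 has_real_derivative ?g1 s) (at s)" for s
  proof -
    have "(?G1 has_real_derivative W s * (((real n - 1) / r s - r s / 2) * C s) * (r s * C s)
       + (C s * C s + - S s * ((r s / 2 - real n / r s) * S s) * r s) * W s) (at s)"
      by (intro DERIV_mult d_W d_r DERIV_chain2[OF DERIV_cos d_\<alpha>])
    moreover have "W s * (((real n - 1) / r s - r s / 2) * C s) * (r s * C s)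
       + (C s * C s + - S s * ((r s / 2 - real n / r s) * S s) * r s) * W s = W s * ((real n - (r s)\<^sup>2 / 2) * ((S s)\<^sup>2 + (C s)\<^sup>2))"
      by (rule weight_derivative_algebra[OF r_nz])
    ultimately show ?thesis unfolding SC by simp
  qed
  have d2: "(?G2 has_real_derivative ?g2 s) (at s)" for s
  proof -
    have "((\<lambda>s. (r s)\<^sup>2 / 2 - real n) has_real_derivative r s * C s) (at s)"
      by (auto intro!: derivative_eq_intros d_r)
    from DERIV_mult[OF d1 this] show ?thesis
      by (rule DERIV_cong) (simp add: field_simps power2_eq_square)
  qed
  have du: "(u has_real_derivative u' s) (at s)" for s
    unfolding u_def u'_def by (auto intro!: derivative_eq_intros d_\<phi>)
  have d3: "(?G3 has_real_derivative ?g3 s) (at s)" for s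
  proof -
    have "((\<lambda>s. (u s)\<^sup>2) has_real_derivative 2 * u s * u' s) (at s)"
      by (auto intro!: derivative_eq_intros du)
    then have "(?G3 has_real_derivative (W s * (((real n - 1) / r s - r s / 2) * C s) * (u s)\<^sup>2 + 2 * u s * u' s * W s) * (h s * k s)
        + (k s * k s + k' s * h s) * (W s * (u s)\<^sup>2)) (at s)"
      by (intro DERIV_mult d_W d_h d_k)
    then show ?thesis
    proof (rule DERIV_cong)
      have "(W s * (((real n - 1) / r s - r s / 2) * C s) * (u s)\<^sup>2 + 2 * u s * u' s * W s) * (h s * k s)
        + (k s * k s + k' s * h s) * (W s * (u s)\<^sup>2)
        = W s * ((u' s * h s + u s * k s)\<^sup>2 - (u' s * h s)\<^sup>2 + (u s)\<^sup>2 * h s * (((real n - 1) / r s - r s / 2) * C s * k s + k' s))"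
        by (simp add: power2_eq_square algebra_simps)
      then show "(W s * (((real n - 1) / r s - r s / 2) * C s) * (u s)\<^sup>2 + 2 * u s * u' s * W s) * (h s * k s)
        + (k s * k s + k' s * h s) * (W s * (u s)\<^sup>2) = ?g3 s"
        unfolding jacobi_h by (simp add: power_mult_distrib power2_eq_square[of "h s"] mult.assoc)
    qed
  qed
  have g1: "(?g1 has_integral 0) {0..L}"
    by (rule I_derivative[OF d1]) (use per_W[of 0] per_r[of 0] per_SC[of 0] in simp)
  have g2: "(?g2 has_integral 0) {0..L}"
    by (rule I_derivative[OF d2]) (use per_W[of 0] per_r[of 0] per_SC[of 0] in simp)
  have g3: "(?g3 has_integral 0) {0..L}"
    by (rule I_derivative[OF d3]) (use per_W[of 0] per_hk[of 0] per_trig_\<phi>[of 0] in \<open>simp add: u_def\<close>)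
  have cc: "continuous_on {0..L} (\<lambda>s. cos (\<phi> s - b))" "continuous_on {0..L} (\<lambda>s. sin (\<phi> s - b))" for b
    by (intro continuous_on_cos continuous_on_sin continuous_on_diff continuous_on_const cont')+
  note ci = int_cont continuous_on_mult cont_\<rho> cc continuous_on_diff continuous_on_const continuous_on_power cont_d\<phi> continuous_on_add
  define q where "q = I (\<lambda>s. \<rho> s * ((sin (\<phi> s - \<beta>) * \<phi>' s)\<^sup>2 - (cos (\<phi> s - \<beta>) - m)\<^sup>2))"
  have hq: "((\<lambda>s. \<rho> s * ((sin (\<phi> s - \<beta>) * \<phi>' s)\<^sup>2 - (cos (\<phi> s - \<beta>) - m)\<^sup>2)) has_integral q) {0..L}"
    unfolding q_def by (intro integrable_integral ci)
  have hz: "((\<lambda>s. \<rho> s * (cos (\<phi> s - \<beta>) - m)) has_integral 0) {0..L}"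
    using z unfolding has_integral_iff by (intro conjI) (intro ci)
  have h\<rho>: "(\<rho> has_integral I \<rho>) {0..L}" by (intro integrable_integral ci)
  let ?a = "- (\<kappa>2 / 2) - Y / (2 * real n) + \<tau>\<^sup>2 / 2"
  have A: "((\<lambda>s. (\<rho> s * ((sin (\<phi> s - \<beta>) * \<phi>' s)\<^sup>2 - (cos (\<phi> s - \<beta>) - m)\<^sup>2) - \<tau> * (\<rho> s * (cos (\<phi> s - \<beta>) - m)) - \<tau>\<^sup>2 / 4 * \<rho> s)
      + (?a * ?g1 s - \<tau>\<^sup>2 / 4 * ?g2 s + ?g3 s)) has_integral (q - \<tau> * 0 - \<tau>\<^sup>2 / 4 * I \<rho>) + (?a * 0 - \<tau>\<^sup>2 / 4 * 0 + 0)) {0..L}"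
    using has_integral_add[OF has_integral_diff[OF has_integral_diff[OF hq has_integral_mult_right[OF hz]] has_integral_mult_right[OF h\<rho>]]
      has_integral_add[OF has_integral_diff[OF has_integral_mult_right[OF g1] has_integral_mult_right[OF g2]] g3]] by blast
  have B: "(\<rho> s * ((sin (\<phi> s - \<beta>) * \<phi>' s)\<^sup>2 - (cos (\<phi> s - \<beta>) - m)\<^sup>2) - \<tau> * (\<rho> s * (cos (\<phi> s - \<beta>) - m)) - \<tau>\<^sup>2 / 4 * \<rho> s)
      + (?a * ?g1 s - \<tau>\<^sup>2 / 4 * ?g2 s + ?g3 s) = ?f s" for s
  proof -
    have u2: "(sin (\<phi> s - \<beta>) * \<phi>' s)\<^sup>2 = (u' s)\<^sup>2" "cos (\<phi> s - \<beta>) - m = u s" by (simp_all add: u_def u'_def)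
    have "(r s)\<^sup>2 = (r s)\<^sup>2 * ((S s)\<^sup>2 + (C s)\<^sup>2)" by simp
    also have "\<dots> = (h s)\<^sup>2 + (r s * C s)\<^sup>2" by (simp only: h_def power_mult_distrib distrib_left)
    finally have r2: "(r s)\<^sup>2 = (h s)\<^sup>2 + (r s * C s)\<^sup>2" .
    show ?thesis unfolding u2 \<rho>_def by (rule second_variation_algebra[OF r2]) (use n in simp)
  qed
  \<comment> \<open>What is left of the dilations has a favourable sign.\<close>
  have "I ?f = q - \<tau>\<^sup>2 / 4 * I \<rho>"
    by (rule trans[OF integral_unique[OF A[unfolded B]]]) simp
  moreover have "I \<rho> \<ge> 0" unfolding I_\<rho> using \<Phi>_pos by simp
  then have "0 \<le> \<tau>\<^sup>2 / 4 * I \<rho>" by simp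
  ultimately show ?thesis using neg unfolding q_def by linarith
qed

end

section \<open>The second variation of the functional\<close>

text \<open>The integrand depends on the integration variable only through \<zeta>, whose values lie
  in a compact set. Continuity on the product with a compact interval of parameters therefore bounds
  the integrand and both derivatives by constants, which are integrable for a finite
  measure.\<close>

lemma deriv2_integral_compact:
  fixes Ha Hb Hc :: "real \<Rightarrow> 'c::euclidean_space \<Rightarrow> real"
  assumes fin: "finite_measure M" and \<delta>: "0 < \<delta>" and K: "compact K"
    and \<zeta>: "\<zeta> \<in> borel_measurable M" "\<And>p. p \<in> space M \<Longrightarrow> \<zeta> p \<in> K"
    and c0: "continuous_on ({-\<delta>..\<delta>} \<times> K) (\<lambda>p. Ha (fst p) (snd p))"
    and c1: "continuous_on ({-\<delta>..\<delta>} \<times> K) (\<lambda>p. Hb (fst p) (snd p))"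
    and c2: "continuous_on ({-\<delta>..\<delta>} \<times> K) (\<lambda>p. Hc (fst p) (snd p))"
    and d0: "\<And>s x. s \<in> {-\<delta><..<\<delta>} \<Longrightarrow> x \<in> K \<Longrightarrow> ((\<lambda>s. Ha s x) has_real_derivative Hb s x) (at s)"
    and d1: "\<And>s x. s \<in> {-\<delta><..<\<delta>} \<Longrightarrow> x \<in> K \<Longrightarrow> ((\<lambda>s. Hb s x) has_real_derivative Hc s x) (at s)"
    and F: "\<And>s. s \<in> {-\<delta><..<\<delta>} \<Longrightarrow> F s = (\<integral>p. Ha s (\<zeta> p) \<partial>M)"
  shows "(deriv ^^ 2) F 0 = (\<integral>p. Hc 0 (\<zeta> p) \<partial>M)"
proof -
  interpret finite_measure M by (rule fin)
  have meas: "(\<lambda>p. H s (\<zeta> p)) \<in> borel_measurable M"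
    if c: "continuous_on ({-\<delta>..\<delta>} \<times> K) (\<lambda>p. H (fst p) (snd p))" and s: "s \<in> {-\<delta><..<\<delta>}" for H :: "real \<Rightarrow> 'c \<Rightarrow> real" and s
  proof -
    have "continuous_on K (\<lambda>x. H (fst (s, x)) (snd (s, x)))"
      by (rule continuous_on_compose2[OF c]) (use s in \<open>auto intro: continuous_on_Pair continuous_on_const continuous_on_id\<close>)
    then have "H s \<in> borel_measurable (restrict_space borel K)"
      by (intro borel_measurable_continuous_on_restrict) simp
    moreover have "\<zeta> \<in> measurable M (restrict_space borel K)"
      using \<zeta> by (intro measurable_restrict_space2) auto
    ultimately show ?thesis by (rule measurable_compose[rotated])
  qed
  have bnd: "\<exists>B. \<forall>s\<in>{-\<delta><..<\<delta>}. \<forall>p\<in>space M. \<bar>H s (\<zeta> p)\<bar> \<le> B"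
    if c: "continuous_on ({-\<delta>..\<delta>} \<times> K) (\<lambda>p. H (fst p) (snd p))" for H :: "real \<Rightarrow> 'c \<Rightarrow> real"
  proof -
    have "compact ((\<lambda>p. H (fst p) (snd p)) ` ({-\<delta>..\<delta>} \<times> K))"
      by (rule compact_continuous_image[OF c compact_Times[OF compact_Icc K]])
    then have "bounded ((\<lambda>p. H (fst p) (snd p)) ` ({-\<delta>..\<delta>} \<times> K))" by (rule compact_imp_bounded)
    then obtain B where B: "\<forall>p\<in>{-\<delta>..\<delta>} \<times> K. norm (H (fst p) (snd p)) \<le> B" unfolding bounded_iff by blast
    have "\<bar>H s (\<zeta> p)\<bar> \<le> B" if "s \<in> {-\<delta><..<\<delta>}" "p \<in> space M" for s p
      using bspec[OF B, of "(s, \<zeta> p)"] that \<zeta>(2) by simp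
    then show ?thesis by blast
  qed
  have int: "integrable M (\<lambda>p. H s (\<zeta> p))"
    if c: "continuous_on ({-\<delta>..\<delta>} \<times> K) (\<lambda>p. H (fst p) (snd p))" and s: "s \<in> {-\<delta><..<\<delta>}" for H :: "real \<Rightarrow> 'c \<Rightarrow> real" and s
  proof -
    obtain B where "\<forall>s\<in>{-\<delta><..<\<delta>}. \<forall>p\<in>space M. \<bar>H s (\<zeta> p)\<bar> \<le> B" using bnd[OF c] by blast
    then show ?thesis using meas[OF c s] s by (intro integrable_const_bound[of _ B] AE_I2) auto
  qed
  have D: "((\<lambda>s. \<integral>p. H s (\<zeta> p) \<partial>M) has_real_derivative (\<integral>p. G s0 (\<zeta> p) \<partial>M)) (at s0)"
    if c: "continuous_on ({-\<delta>..\<delta>} \<times> K) (\<lambda>p. H (fst p) (snd p))" "continuous_on ({-\<delta>..\<delta>} \<times> K) (\<lambda>p. G (fst p) (snd p))"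
      and d: "\<And>s x. s \<in> {-\<delta><..<\<delta>} \<Longrightarrow> x \<in> K \<Longrightarrow> ((\<lambda>s. H s x) has_real_derivative G s x) (at s)"
      and s0: "s0 \<in> {-\<delta><..<\<delta>}" for H G :: "real \<Rightarrow> 'c \<Rightarrow> real" and s0
  proof -
    obtain B where B: "\<forall>s\<in>{-\<delta><..<\<delta>}. \<forall>p\<in>space M. \<bar>G s (\<zeta> p)\<bar> \<le> B" using bnd[OF c(2)] by blast
    show ?thesis
      by (rule DERIV_integral_param[where w = "\<lambda>_. B", OF s0])
        (use int[OF c(1)] d \<zeta>(2) B meas[OF c(2) s0] in auto)
  qed
  have dF: "(F has_real_derivative (\<integral>p. Hb s (\<zeta> p) \<partial>M)) (at s)" if s: "s \<in> {-\<delta><..<\<delta>}" for s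
    by (rule has_field_derivative_transform_within_open[OF D[OF c0 c1 d0 s] open_greaterThanLessThan s]) (simp_all add: F)
  have 0: "0 \<in> {-\<delta><..<\<delta>}" using \<delta> by simp
  have "(deriv F has_real_derivative (\<integral>p. Hc 0 (\<zeta> p) \<partial>M)) (at 0)"
    by (rule has_field_derivative_transform_within_open[OF D[OF c1 c2 d1 0] open_greaterThanLessThan 0])
      (simp_all add: DERIV_imp_deriv[OF dF])
  then show ?thesis by (simp add: numeral_2_eq_2 DERIV_imp_deriv)
qed

text \<open>Logarithmic derivatives of the integrand of the functional, where \<open>P = |c|\<^sup>2\<close>, \<open>R = |c'|\<^sup>2\<close>,
  \<open>Q = |c \<psi> - x|\<^sup>2\<close> along the variation.\<close>

definition log_weight :: "real \<Rightarrow> real \<Rightarrow> real \<Rightarrow> real \<Rightarrow> real \<Rightarrow> real \<Rightarrow> real" where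
  "log_weight N d T R P Q = - (N / 2) * ln (4 * pi * T) + ln R / 2 + d / 2 * ln P - Q / (4 * T)"

definition log_weight1 where
  "log_weight1 N d T T1 R R1 P P1 Q Q1 =
     - (N / 2) * (T1 / T) + R1 / R / 2 + d / 2 * (P1 / P) - Q1 / (4 * T) + Q * T1 / (4 * T\<^sup>2 :: real)"

definition log_weight2 where
  "log_weight2 N d T T1 T2 R R1 R2 P P1 P2 Q Q1 Q2 =
     - (N / 2) * (T2 / T - (T1 / T)\<^sup>2) + (R2 / R - (R1 / R)\<^sup>2) / 2 + d / 2 * (P2 / P - (P1 / P)\<^sup>2)
     - Q2 / (4 * T) + Q1 * T1 / (2 * T\<^sup>2) + Q * T2 / (4 * T\<^sup>2) - Q * T1\<^sup>2 / (2 * T ^ 3 :: real)"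

lemma DERIV_log_weight:
  assumes "(T has_real_derivative T1) (at s)" "(R has_real_derivative R1) (at s)" "(P has_real_derivative P1) (at s)"
    "(Q has_real_derivative Q1) (at s)" "T s > 0" "R s > 0" "P s > 0"
  shows "((\<lambda>s. log_weight N d (T s) (R s) (P s) (Q s)) has_real_derivative
     log_weight1 N d (T s) T1 (R s) R1 (P s) P1 (Q s) Q1) (at s)"
proof -
  have l: "((\<lambda>s. ln (g s)) has_real_derivative g' / g s) (at s)" if "(g has_real_derivative g') (at s)" "g s > 0" for g g'
    using DERIV_chain2[OF DERIV_ln_divide[OF that(2)] that(1)] by simp
  have t: "((\<lambda>s. ln (4 * pi * T s)) has_real_derivative T1 / T s) (at s)"
    by (rule DERIV_cong[OF l[OF DERIV_cmult[OF assms(1)]]]) (use assms in auto)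
  have q: "((\<lambda>s. Q s / (4 * T s)) has_real_derivative Q1 / (4 * T s) - Q s * T1 / (4 * (T s)\<^sup>2)) (at s)"
    by (rule DERIV_cong[OF DERIV_divide[OF assms(4) DERIV_cmult[OF assms(1)]]])
      (use assms in \<open>auto simp: field_simps power2_eq_square\<close>)
  have "((\<lambda>s. - (N / 2) * ln (4 * pi * T s) + ln (R s) / 2 + d / 2 * ln (P s) - Q s / (4 * T s)) has_real_derivative
      - (N / 2) * (T1 / T s) + R1 / R s / 2 + d / 2 * (P1 / P s) - (Q1 / (4 * T s) - Q s * T1 / (4 * (T s)\<^sup>2))) (at s)"
    by (intro DERIV_diff DERIV_add DERIV_cmult DERIV_cdivide t q l assms)
  then show ?thesis unfolding log_weight_def by (rule DERIV_cong) (simp add: log_weight1_def)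
qed

lemma DERIV_log_weight1:
  assumes "(T has_real_derivative T1 s) (at s)" "(R has_real_derivative R1 s) (at s)" "(P has_real_derivative P1 s) (at s)"
    "(Q has_real_derivative Q1 s) (at s)"
    "(T1 has_real_derivative T2) (at s)" "(R1 has_real_derivative R2) (at s)" "(P1 has_real_derivative P2) (at s)"
    "(Q1 has_real_derivative Q2) (at s)" and pos: "T s > 0" "R s > 0" "P s > 0"
  shows "((\<lambda>s. log_weight1 N d (T s) (T1 s) (R s) (R1 s) (P s) (P1 s) (Q s) (Q1 s)) has_real_derivative
     log_weight2 N d (T s) (T1 s) T2 (R s) (R1 s) R2 (P s) (P1 s) P2 (Q s) (Q1 s) Q2) (at s)"
proof -
  have dv: "((\<lambda>s. g1 s / g s) has_real_derivative g2 / g s - (g1 s / g s)\<^sup>2) (at s)"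
    if "(g has_real_derivative g1 s) (at s)" "(g1 has_real_derivative g2) (at s)" "g s > 0" for g g1 g2
    by (rule DERIV_cong[OF DERIV_divide[OF that(2,1)]]) (use that in \<open>auto simp: field_simps power2_eq_square\<close>)
  have q: "((\<lambda>s. Q1 s / (4 * T s)) has_real_derivative Q2 / (4 * T s) - Q1 s * T1 s / (4 * (T s)\<^sup>2)) (at s)"
    by (rule DERIV_cong[OF DERIV_divide[OF assms(8) DERIV_cmult[OF assms(1)]]])
      (use pos in \<open>auto simp: field_simps power2_eq_square\<close>)
  have qt: "((\<lambda>s. Q s * T1 s / (4 * (T s)\<^sup>2)) has_real_derivative
      Q1 s * T1 s / (4 * (T s)\<^sup>2) + Q s * T2 / (4 * (T s)\<^sup>2) - Q s * (T1 s)\<^sup>2 / (2 * T s ^ 3)) (at s)"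
  proof -
    have "((\<lambda>s. 4 * (T s)\<^sup>2) has_real_derivative 4 * (2 * T s * T1 s)) (at s)"
      by (rule DERIV_cmult) (auto intro!: derivative_eq_intros assms)
    from DERIV_divide[OF DERIV_mult[OF assms(4,5)] this] show ?thesis
      by (rule DERIV_cong) (use pos in \<open>auto simp: field_simps power2_eq_square power3_eq_cube\<close>)
  qed
  have "((\<lambda>s. - (N / 2) * (T1 s / T s) + R1 s / R s / 2 + d / 2 * (P1 s / P s) - Q1 s / (4 * T s) + Q s * T1 s / (4 * (T s)\<^sup>2)) has_real_derivative
      - (N / 2) * (T2 / T s - (T1 s / T s)\<^sup>2) + (R2 / R s - (R1 s / R s)\<^sup>2) / 2 + d / 2 * (P2 / P s - (P1 s / P s)\<^sup>2)
     - (Q2 / (4 * T s) - Q1 s * T1 s / (4 * (T s)\<^sup>2)) + (Q1 s * T1 s / (4 * (T s)\<^sup>2) + Q s * T2 / (4 * (T s)\<^sup>2) - Q s * (T1 s)\<^sup>2 / (2 * T s ^ 3))) (at s)"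
    by (intro DERIV_diff DERIV_add DERIV_cmult DERIV_cdivide q qt dv assms)
  moreover have "x / (2 * y) = x / (4 * y) + x / (4 * y)" for x y :: real by (simp add: add_divide_distrib[symmetric])
  note this[of "Q1 s * T1 s" "(T s)\<^sup>2"]
  ultimately show ?thesis unfolding log_weight1_def log_weight2_def
    by (elim DERIV_cong) simp
qed

context legendrian_cone
begin

text \<open>The integrand, with the normalising power of 4 \<pi> t taken inside, is \<kappa> times
  the exponential of \<Lambda>, so two derivatives give the factor \<Lambda>'' + \<Lambda>'^2.
  \<open>N\<close> is the dimension of the product and \<open>d\<close> that of \<open>M\<close>;
  \<open>R\<close> and \<open>P\<close> are explicit quadratic polynomials in the variation
  parameter.\<close>

lemma deriv2_F_functional_cone:
  fixes X X1 X2 :: "real \<Rightarrow> complex ^ 'n" and T T1 T2 :: "real \<Rightarrow> real"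
  assumes \<gamma>: "closed_curve L \<gamma>" "\<And>l. (\<gamma> has_vector_derivative \<gamma>' l) (at l)" "continuous_on UNIV \<gamma>'" "\<And>l. \<gamma>' (l + L) = \<gamma>' l"
    and v: "\<And>l. v (l + L) = v l" "\<And>l. (v has_vector_derivative v' l) (at l)" "continuous_on UNIV v'" "\<And>l. v' (l + L) = v' l"
    and \<delta>: "0 < \<delta>"
    and nz: "\<And>s l. \<bar>s\<bar> \<le> \<delta> \<Longrightarrow> \<gamma> l + s *\<^sub>R v l \<noteq> 0" "\<And>s l. \<bar>s\<bar> \<le> \<delta> \<Longrightarrow> \<gamma>' l + s *\<^sub>R v' l \<noteq> 0"
    and T: "\<And>s. \<bar>s\<bar> \<le> \<delta> \<Longrightarrow> T s > 0" "\<And>s. \<bar>s\<bar> \<le> \<delta> \<Longrightarrow> (T has_real_derivative T1 s) (at s)"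
      "\<And>s. \<bar>s\<bar> \<le> \<delta> \<Longrightarrow> (T1 has_real_derivative T2 s) (at s)" "continuous_on {-\<delta>..\<delta>} T2"
    and X: "\<And>s. \<bar>s\<bar> \<le> \<delta> \<Longrightarrow> (X has_vector_derivative X1 s) (at s)"
      "\<And>s. \<bar>s\<bar> \<le> \<delta> \<Longrightarrow> (X1 has_vector_derivative X2 s) (at s)" "continuous_on {-\<delta>..\<delta>} X2"
  defines "N \<equiv> real DIM('e) + 1" and "d \<equiv> real DIM('e)"
  defines "P \<equiv> \<lambda>s l. \<gamma> l \<bullet> \<gamma> l + 2 * s * (\<gamma> l \<bullet> v l) + s\<^sup>2 * (v l \<bullet> v l)" and "P1 \<equiv> \<lambda>s l. 2 * (\<gamma> l \<bullet> v l) + 2 * s * (v l \<bullet> v l)"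
    and "R \<equiv> \<lambda>s l. \<gamma>' l \<bullet> \<gamma>' l + 2 * s * (\<gamma>' l \<bullet> v' l) + s\<^sup>2 * (v' l \<bullet> v' l)" and "R1 \<equiv> \<lambda>s l. 2 * (\<gamma>' l \<bullet> v' l) + 2 * s * (v' l \<bullet> v' l)"
  defines "Q \<equiv> \<lambda>s l z. P s l - 2 * ((\<gamma> l *s z) \<bullet> X s) - 2 * s * ((v l *s z) \<bullet> X s) + X s \<bullet> X s"
    and "Q1 \<equiv> \<lambda>s l z. P1 s l - 2 * ((\<gamma> l *s z) \<bullet> X1 s) - 2 * ((v l *s z) \<bullet> X s) - 2 * s * ((v l *s z) \<bullet> X1 s) + 2 * (X s \<bullet> X1 s)"
    and "Q2 \<equiv> \<lambda>s l z. 2 * (v l \<bullet> v l) - 2 * ((\<gamma> l *s z) \<bullet> X2 s) - 4 * ((v l *s z) \<bullet> X1 s) - 2 * s * ((v l *s z) \<bullet> X2 s) + 2 * (X1 s \<bullet> X1 s) + 2 * (X s \<bullet> X2 s)"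
  defines "\<Lambda> \<equiv> \<lambda>s l z. log_weight N d (T s) (R s l) (P s l) (Q s l z)"
    and "\<Lambda>1 \<equiv> \<lambda>s l z. log_weight1 N d (T s) (T1 s) (R s l) (R1 s l) (P s l) (P1 s l) (Q s l z) (Q1 s l z)"
    and "\<Lambda>2 \<equiv> \<lambda>s l z. log_weight2 N d (T s) (T1 s) (T2 s) (R s l) (R1 s l) (2 * (v' l \<bullet> v' l)) (P s l) (P1 s l) (2 * (v l \<bullet> v l)) (Q s l z) (Q1 s l z) (Q2 s l z)"
  shows "(deriv ^^ 2) (\<lambda>s. F_functional PA (cone (\<lambda>l. \<gamma> l + s *\<^sub>R v l)) (X s) (T s)) 0
     = (\<integral>p. \<kappa> * (exp (\<Lambda> 0 (\<kappa> * fst p) (\<psi> (snd p))) * (\<Lambda>2 0 (\<kappa> * fst p) (\<psi> (snd p)) + (\<Lambda>1 0 (\<kappa> * fst p) (\<psi> (snd p)))\<^sup>2)) \<partial>base_measure)"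
proof -
  \<comment> \<open>A point of \<open>M\<close> enters only through its image under \<psi>, which
    lies in the unit sphere; this is the compact set on which the integrand is continuous.\<close>
  define K :: "(real \<times> (complex ^ 'n)) set" where "K = {0..2 * pi} \<times> sphere 0 1"
  define \<zeta> where "\<zeta> p = (fst p, \<psi> (snd p))" for p :: "real \<times> 'a"
  define H0 where "H0 s x = \<kappa> * exp (\<Lambda> s (\<kappa> * fst x) (snd x))" for s x
  define H1 where "H1 s x = \<kappa> * (exp (\<Lambda> s (\<kappa> * fst x) (snd x)) * \<Lambda>1 s (\<kappa> * fst x) (snd x))" for s x
  define H2 where "H2 s x = \<kappa> * (exp (\<Lambda> s (\<kappa> * fst x) (snd x)) * (\<Lambda>2 s (\<kappa> * fst x) (snd x) + (\<Lambda>1 s (\<kappa> * fst x) (snd x))\<^sup>2))" for s x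
  have P: "P s l = (norm (\<gamma> l + s *\<^sub>R v l))\<^sup>2" for s l
    unfolding power2_norm_eq_inner P_def
    by (simp add: inner_add_left inner_add_right inner_commute power2_eq_square[of s] algebra_simps)
  have R: "R s l = (norm (\<gamma>' l + s *\<^sub>R v' l))\<^sup>2" for s l
    unfolding power2_norm_eq_inner R_def
    by (simp add: inner_add_left inner_add_right inner_commute power2_eq_square[of s] algebra_simps)
  have pos: "P s l > 0" "R s l > 0" if "\<bar>s\<bar> \<le> \<delta>" for s l
    using nz[OF that] by (simp_all add: P R)
  have cg: "continuous_on UNIV \<gamma>" "continuous_on UNIV v"
    using \<gamma>(2) v(2) by (auto intro!: continuous_at_imp_continuous_on has_vector_derivative_continuous)
  have dX: "((\<lambda>s. w \<bullet> X s) has_real_derivative w \<bullet> X1 s) (at s)" "((\<lambda>s. w \<bullet> X1 s) has_real_derivative w \<bullet> X2 s) (at s)"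
    if "\<bar>s\<bar> \<le> \<delta>" for s w
    using bounded_linear.has_vector_derivative[OF bounded_linear_inner_right X(1)[OF that], of w]
      bounded_linear.has_vector_derivative[OF bounded_linear_inner_right X(2)[OF that], of w]
    by (simp_all add: has_real_derivative_iff_has_vector_derivative)
  have dXX: "((\<lambda>s. X s \<bullet> X s) has_real_derivative 2 * (X s \<bullet> X1 s)) (at s)"
      "((\<lambda>s. X s \<bullet> X1 s) has_real_derivative X1 s \<bullet> X1 s + X s \<bullet> X2 s) (at s)" if "\<bar>s\<bar> \<le> \<delta>" for s
    using bounded_bilinear.has_vector_derivative[OF bounded_bilinear_inner X(1)[OF that] X(1)[OF that]]
      bounded_bilinear.has_vector_derivative[OF bounded_bilinear_inner X(1)[OF that] X(2)[OF that]]
    by (simp_all add: has_real_derivative_iff_has_vector_derivative inner_commute add.commute)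
  have dP: "((\<lambda>s. P s l) has_real_derivative P1 s l) (at s)" "((\<lambda>s. P1 s l) has_real_derivative 2 * (v l \<bullet> v l)) (at s)"
    "((\<lambda>s. R s l) has_real_derivative R1 s l) (at s)" "((\<lambda>s. R1 s l) has_real_derivative 2 * (v' l \<bullet> v' l)) (at s)" for s l
    unfolding P_def P1_def R_def R1_def by (auto intro!: derivative_eq_intros)
  have dQ: "((\<lambda>s. Q s l z) has_real_derivative Q1 s l z) (at s)" "((\<lambda>s. Q1 s l z) has_real_derivative Q2 s l z) (at s)"
    if s: "\<bar>s\<bar> \<le> \<delta>" for s l z
  proof -
    have i: "((\<lambda>s. 2 * s) has_real_derivative 2) (at s)" by (auto intro!: derivative_eq_intros)
    have "((\<lambda>s. Q s l z) has_real_derivative P1 s l - 2 * ((\<gamma> l *s z) \<bullet> X1 s) - (2 * ((v l *s z) \<bullet> X s) + ((v l *s z) \<bullet> X1 s) * (2 * s)) + 2 * (X s \<bullet> X1 s)) (at s)"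
      unfolding Q_def by (intro DERIV_add DERIV_diff DERIV_cmult DERIV_mult dP dX dXX s i)
    then show "((\<lambda>s. Q s l z) has_real_derivative Q1 s l z) (at s)"
      by (rule DERIV_cong) (simp add: Q1_def algebra_simps)
    have "((\<lambda>s. Q1 s l z) has_real_derivative 2 * (v l \<bullet> v l) - 2 * ((\<gamma> l *s z) \<bullet> X2 s) - 2 * ((v l *s z) \<bullet> X1 s) - (2 * ((v l *s z) \<bullet> X1 s) + ((v l *s z) \<bullet> X2 s) * (2 * s)) + 2 * (X1 s \<bullet> X1 s + X s \<bullet> X2 s)) (at s)"
      unfolding Q1_def by (intro DERIV_add DERIV_diff DERIV_cmult DERIV_mult dP dX dXX s i)
    then show "((\<lambda>s. Q1 s l z) has_real_derivative Q2 s l z) (at s)"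
      by (rule DERIV_cong) (simp add: Q2_def algebra_simps)
  qed
  have d\<Lambda>: "((\<lambda>s. \<Lambda> s l z) has_real_derivative \<Lambda>1 s l z) (at s)" if s: "\<bar>s\<bar> \<le> \<delta>" for s l z
    unfolding \<Lambda>_def \<Lambda>1_def by (intro DERIV_log_weight T dP dQ pos s)
  have d\<Lambda>1: "((\<lambda>s. \<Lambda>1 s l z) has_real_derivative \<Lambda>2 s l z) (at s)" if s: "\<bar>s\<bar> \<le> \<delta>" for s l z
    unfolding \<Lambda>1_def \<Lambda>2_def by (intro DERIV_log_weight1 T dP dQ pos s)
  let ?D = "{-\<delta>..\<delta>} \<times> K"
  have cT: "continuous_on {-\<delta>..\<delta>} T" "continuous_on {-\<delta>..\<delta>} T1"
    using DERIV_isCont[OF T(2)] DERIV_isCont[OF T(3)] by (auto intro!: continuous_at_imp_continuous_on)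
  have cX: "continuous_on {-\<delta>..\<delta>} X" "continuous_on {-\<delta>..\<delta>} X1"
    using has_vector_derivative_continuous[OF X(1)] has_vector_derivative_continuous[OF X(2)]
    by (auto intro!: continuous_at_imp_continuous_on)
  have fs: "continuous_on ?D fst" "continuous_on ?D (\<lambda>p. snd (snd p))" "continuous_on ?D (\<lambda>p. \<kappa> * fst (snd p))"
    by (intro continuous_on_mult continuous_on_const continuous_on_fst continuous_on_snd continuous_on_id)+
  have cs: "continuous_on ?D (\<lambda>p. g (fst p))" if "continuous_on {-\<delta>..\<delta>} g" for g :: "real \<Rightarrow> 'z::topological_space"
    by (rule continuous_on_compose2[OF that fs(1)]) auto
  have cl: "continuous_on ?D (\<lambda>p. g (\<kappa> * fst (snd p)))" if "continuous_on UNIV g" for g :: "real \<Rightarrow> complex"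
    by (rule continuous_on_compose2[OF that fs(3)]) auto
  note c = cs[OF cT(1)] cs[OF cT(2)] cs[OF T(4)] cs[OF cX(1)] cs[OF cX(2)] cs[OF X(3)]
    cl[OF cg(1)] cl[OF cg(2)] cl[OF \<gamma>(3)] cl[OF v(3)] fs
    continuous_on_mult continuous_on_add continuous_on_diff continuous_on_inner continuous_on_power continuous_on_const
    bounded_bilinear.continuous_on[OF bounded_bilinear_vector_scalar_mult]
  have cP: "continuous_on ?D (\<lambda>p. P (fst p) (\<kappa> * fst (snd p)))" "continuous_on ?D (\<lambda>p. P1 (fst p) (\<kappa> * fst (snd p)))"
    "continuous_on ?D (\<lambda>p. R (fst p) (\<kappa> * fst (snd p)))" "continuous_on ?D (\<lambda>p. R1 (fst p) (\<kappa> * fst (snd p)))"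
    unfolding P_def P1_def R_def R1_def by (intro c)+
  have cQ: "continuous_on ?D (\<lambda>p. Q (fst p) (\<kappa> * fst (snd p)) (snd (snd p)))"
    "continuous_on ?D (\<lambda>p. Q1 (fst p) (\<kappa> * fst (snd p)) (snd (snd p)))"
    "continuous_on ?D (\<lambda>p. Q2 (fst p) (\<kappa> * fst (snd p)) (snd (snd p)))"
    unfolding Q_def Q1_def Q2_def by (intro cP c)+
  have nzD: "\<forall>p\<in>?D. T (fst p) \<noteq> 0" "\<forall>p\<in>?D. P (fst p) (\<kappa> * fst (snd p)) \<noteq> 0" "\<forall>p\<in>?D. R (fst p) (\<kappa> * fst (snd p)) \<noteq> 0"
  proof -
    have "T (fst p) > 0 \<and> P (fst p) (\<kappa> * fst (snd p)) > 0 \<and> R (fst p) (\<kappa> * fst (snd p)) > 0" if "p \<in> ?D" for p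
      using that by (intro conjI T pos) auto
    then show "\<forall>p\<in>?D. T (fst p) \<noteq> 0" "\<forall>p\<in>?D. P (fst p) (\<kappa> * fst (snd p)) \<noteq> 0" "\<forall>p\<in>?D. R (fst p) (\<kappa> * fst (snd p)) \<noteq> 0"
      by force+
  qed
  have nzT: "\<forall>p\<in>?D. 4 * pi * T (fst p) \<noteq> 0" "\<forall>p\<in>?D. 4 * T (fst p) \<noteq> 0" "\<forall>p\<in>?D. 4 * (T (fst p))\<^sup>2 \<noteq> 0" "\<forall>p\<in>?D. 2 * (T (fst p))\<^sup>2 \<noteq> 0" "\<forall>p\<in>?D. 2 * T (fst p) ^ 3 \<noteq> 0"
    "\<forall>p\<in>?D. (2::real) \<noteq> 0"
    using nzD(1) by auto
  have c\<Lambda>: "continuous_on ?D (\<lambda>p. \<Lambda> (fst p) (\<kappa> * fst (snd p)) (snd (snd p)))"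
    unfolding \<Lambda>_def log_weight_def by (intro c cP cQ continuous_on_ln continuous_on_divide nzD nzT)
  have c\<Lambda>1: "continuous_on ?D (\<lambda>p. \<Lambda>1 (fst p) (\<kappa> * fst (snd p)) (snd (snd p)))"
    unfolding \<Lambda>1_def log_weight1_def by (intro c cP cQ continuous_on_divide nzD nzT)
  have c\<Lambda>2: "continuous_on ?D (\<lambda>p. \<Lambda>2 (fst p) (\<kappa> * fst (snd p)) (snd (snd p)))"
    unfolding \<Lambda>2_def log_weight2_def by (intro c cP cQ continuous_on_divide nzD nzT)
  have main: "(deriv ^^ 2) (\<lambda>s. F_functional PA (cone (\<lambda>l. \<gamma> l + s *\<^sub>R v l)) (X s) (T s)) 0 = (\<integral>p. H2 0 (\<zeta> p) \<partial>base_measure)"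
  proof (rule deriv2_integral_compact[OF finite_measure_base \<delta>, where K = K and Ha = H0 and Hb = H1])
    show "compact K" unfolding K_def by (intro compact_Times compact_Icc compact_sphere)
    have "(\<lambda>t. t) \<in> borel_measurable (restrict_space lborel {0..2 * pi})"
      by (intro measurable_restrict_space1) simp
    then have "(\<lambda>p. (fst p, \<psi> (snd p))) \<in> measurable base_measure (borel \<Otimes>\<^sub>M borel)"
      unfolding base_measure_def
      by (intro measurable_Pair measurable_compose[OF measurable_fst] measurable_compose[OF measurable_snd psi_measurable])
    then show "\<zeta> \<in> borel_measurable base_measure" by (simp add: \<zeta>_def[abs_def] borel_prod)
    show "\<zeta> p \<in> K" if "p \<in> space base_measure" for p
      using that sphere by (auto simp: \<zeta>_def K_def space_base)
    show "continuous_on ?D (\<lambda>p. H0 (fst p) (snd p))"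
      unfolding H0_def by (intro continuous_on_mult continuous_on_const continuous_on_exp c\<Lambda>)
    show "continuous_on ?D (\<lambda>p. H1 (fst p) (snd p))"
      unfolding H1_def by (intro continuous_on_mult continuous_on_const continuous_on_exp c\<Lambda> c\<Lambda>1)
    show "continuous_on ?D (\<lambda>p. H2 (fst p) (snd p))"
      unfolding H2_def by (intro continuous_on_mult continuous_on_add continuous_on_power continuous_on_const continuous_on_exp c\<Lambda> c\<Lambda>1 c\<Lambda>2)
    fix s :: real
    assume "s \<in> {-\<delta><..<\<delta>}"
    then have s: "\<bar>s\<bar> \<le> \<delta>" by auto
    show "((\<lambda>s. H0 s x) has_real_derivative H1 s x) (at s)" for x
      unfolding H0_def H1_def by (intro DERIV_cmult DERIV_chain2[OF DERIV_exp] d\<Lambda> s)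
    show "((\<lambda>s. H1 s x) has_real_derivative H2 s x) (at s)" for x
    proof -
      let ?l = "\<kappa> * fst x" and ?z = "snd x"
      have "((\<lambda>s. exp (\<Lambda> s ?l ?z) * \<Lambda>1 s ?l ?z) has_real_derivative
         exp (\<Lambda> s ?l ?z) * \<Lambda>1 s ?l ?z * \<Lambda>1 s ?l ?z + \<Lambda>2 s ?l ?z * exp (\<Lambda> s ?l ?z)) (at s)"
        by (intro DERIV_mult DERIV_chain2[OF DERIV_exp] d\<Lambda> d\<Lambda>1 s)
      from DERIV_cmult[OF this, of \<kappa>] show ?thesis
        unfolding H1_def H2_def by (rule DERIV_cong) (simp add: algebra_simps power2_eq_square)
    qed
    have cc: "closed_curve L (\<lambda>l. \<gamma> l + s *\<^sub>R v l)" using \<gamma>(1) v(1) by (simp add: closed_curve_def)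
    have dc: "((\<lambda>l. \<gamma> l + s *\<^sub>R v l) has_vector_derivative \<gamma>' l + s *\<^sub>R v' l) (at l)" for l
      by (intro has_vector_derivative_add \<gamma>(2) bounded_linear.has_vector_derivative[OF bounded_linear_scaleR_right v(2)])
    have cc': "continuous_on UNIV (\<lambda>l. \<gamma>' l + s *\<^sub>R v' l)"
      by (intro continuous_on_add continuous_on_scaleR continuous_on_const \<gamma>(3) v(3))
    have pc': "\<gamma>' (l + L) + s *\<^sub>R v' (l + L) = \<gamma>' l + s *\<^sub>R v' l" for l by (simp add: \<gamma>(4) v(4))
    show "F_functional PA (cone (\<lambda>l. \<gamma> l + s *\<^sub>R v l)) (X s) (T s) = (\<integral>p. H0 s (\<zeta> p) \<partial>base_measure)"
      unfolding F_functional_cone[OF cc dc cc' pc'] integral_mult_right_zero[symmetric]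
    proof (intro Bochner_Integration.integral_cong refl)
      fix p assume "p \<in> space base_measure"
      then have z: "norm (\<psi> (snd p)) = 1" using sphere by (auto simp: space_base)
      let ?l = "\<kappa> * fst p" and ?z = "\<psi> (snd p)"
      let ?c = "\<gamma> ?l + s *\<^sub>R v ?l" and ?c' = "\<gamma>' ?l + s *\<^sub>R v' ?l"
      have n0: "norm ?c > 0" "norm ?c' > 0" using nz[OF s] by simp_all
      have cz: "?c *s ?z = \<gamma> ?l *s ?z + s *\<^sub>R (v ?l *s ?z)" by (simp add: vec_eq_iff algebra_simps)
      have "(norm (?c *s ?z - X s))\<^sup>2 = (norm (?c *s ?z))\<^sup>2 - 2 * ((?c *s ?z) \<bullet> X s) + X s \<bullet> X s"
        by (simp add: power2_norm_eq_inner inner_diff_left inner_diff_right inner_commute)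
      also have "\<dots> = Q s ?l ?z"
        unfolding norm_vector_scalar_mult z unfolding cz inner_add_left inner_scaleR_left by (simp add: Q_def P)
      finally have q: "(norm (?c *s ?z - X s))\<^sup>2 = Q s ?l ?z" .
      have e1: "(4 * pi * T s) powr (- (real DIM('e) + 1) / 2) = exp (- (N / 2) * ln (4 * pi * T s))"
        unfolding N_def powr_def using T(1)[OF s] by (simp add: field_simps)
      have e2: "norm ?c' = exp (ln (R s ?l) / 2)"
        using n0(2) by (simp add: R ln_realpow)
      have e3: "norm ?c ^ DIM('e) = exp (d / 2 * ln (P s ?l))"
        using n0(1) by (simp add: P ln_realpow d_def exp_of_nat_mult)
      have "(4 * pi * T s) powr (- (real DIM('e) + 1) / 2) * (cone_density (\<lambda>l. \<gamma> l + s *\<^sub>R v l) (\<lambda>l. \<gamma>' l + s *\<^sub>R v' l) p * exp (- (norm (?c *s ?z - X s))\<^sup>2 / (4 * T s)))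
        = \<kappa> * (((4 * pi * T s) powr (- (real DIM('e) + 1) / 2)) * (norm ?c') * (norm ?c ^ DIM('e)) * exp (- (Q s ?l ?z / (4 * T s))))"
        unfolding q cone_density_def case_prod_beta' by simp
      also have "\<dots> = H0 s (\<zeta> p)"
        unfolding e1 e2 e3 H0_def \<Lambda>_def log_weight_def \<zeta>_def fst_conv snd_conv exp_add[symmetric] by simp
      finally show "(4 * pi * T s) powr (- (real DIM('e) + 1) / 2) * (cone_density (\<lambda>l. \<gamma> l + s *\<^sub>R v l) (\<lambda>l. \<gamma>' l + s *\<^sub>R v' l) p * exp (- (norm (?c *s ?z - X s))\<^sup>2 / (4 * T s)))
        = H0 s (\<zeta> p)" .
    qed
  qed
  show ?thesis unfolding main H2_def \<zeta>_def by simp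
qed

end

section \<open>Instability\<close>

lemma smooth_on_vector_derivative:
  fixes x :: "real \<Rightarrow> 'b::real_normed_vector"
  assumes "smooth_on U x"
  shows "s \<in> U \<Longrightarrow> (x has_vector_derivative frechet_derivative x (at s) 1) (at s)"
    and "smooth_on U (\<lambda>s. frechet_derivative x (at s) 1)"
proof -
  have "Ck_on (Suc k) U x" for k using assms by (rule smooth_onD)
  then show "smooth_on U (\<lambda>s. frechet_derivative x (at s) 1)" by (simp add: smooth_on_def)
  assume s: "s \<in> U"
  have d: "(x has_derivative frechet_derivative x (at s)) (at s)"
    by (rule Ck1_imp(2)[OF smooth_onD[OF assms] s])
  then have l: "linear (frechet_derivative x (at s))" by (rule has_derivative_linear)
  have "frechet_derivative x (at s) = (\<lambda>t. t *\<^sub>R frechet_derivative x (at s) 1)"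
  proof
    show "frechet_derivative x (at s) t = t *\<^sub>R frechet_derivative x (at s) 1" for t
      using linear_scale[OF l, of t 1] by simp
  qed
  then show "(x has_vector_derivative frechet_derivative x (at s) 1) (at s)"
    unfolding has_vector_derivative_def using d by metis
qed

lemma periodic_bounded:
  fixes g :: "real \<Rightarrow> real"
  assumes c: "continuous_on UNIV g" and P: "0 < P" and per: "\<And>t. g (t + P) = g t"
  shows "\<exists>B. \<forall>t. \<bar>g t\<bar> \<le> B"
proof -
  have "compact (g ` {0..P})"
    by (intro compact_continuous_image continuous_on_subset[OF c] compact_Icc) simp
  then have "bounded (g ` {0..P})" by (rule compact_imp_bounded)
  then obtain B where B: "\<forall>t\<in>{0..P}. norm (g t) \<le> B" unfolding bounded_iff by blast
  have "\<bar>g t\<bar> \<le> B" for t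
  proof -
    define k where "k = \<lfloor>t / P\<rfloor>"
    have "of_int k \<le> t / P" "t / P < of_int k + 1" unfolding k_def by linarith+
    then have "t - of_int k * P \<in> {0..P}" using P by (simp add: field_simps)
    then have "\<bar>g (t - of_int k * P)\<bar> \<le> B" using B by simp
    then show ?thesis using periodic_int[of g P "t - of_int k * P" k, OF per] by simp
  qed
  then show ?thesis by blast
qed

lemma inner_mult_cis: "(a * cis t) \<bullet> (b * cis t) = a \<bullet> b"
proof -
  have e: "x \<bullet> y = Re (x * cnj y)" for x y :: complex by (simp add: inner_complex_def)
  have "a * cis t * cnj (b * cis t) = a * cnj b * (cis t * cnj (cis t))" by (simp only: complex_cnj_mult mult_ac)
  also have "cis t * cnj (cis t) = 1" by (simp add: complex_mult_cnj)
  finally have "a * cis t * cnj (b * cis t) = a * cnj b" by simp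
  then show ?thesis unfolding e by (rule arg_cong)
qed

text \<open>Moves the scalar off \<open>z\<close>, so that terms of first order become linear forms
  in \<psi>, to which \<open>integral_linear_zero\<close> applies.\<close>

lemma inner_vector_scalar_mult_adjoint:
  fixes z w :: "complex ^ 'n"
  shows "(c *s z) \<bullet> w = (cnj c *s w) \<bullet> z"
  using inner_vector_scalar_mult[of c z 1 w] inner_vector_scalar_mult[of 1 z "cnj c" w] by (simp add: inner_commute)

context legendrian_cone
begin

text \<open>Fubini over the angle and \<open>M\<close>. The inner integral is only bounded from
  above because its quadratic term in \<psi> is estimated rather than computed.\<close>

lemma integral_base_le:
  fixes H :: "real \<times> (complex ^ 'n) \<Rightarrow> real" and B :: "real \<Rightarrow> real"
  assumes H: "continuous_on UNIV H" and B: "continuous_on UNIV B"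
    and le: "\<And>t. (\<integral>\<sigma>. H (t, \<psi> \<sigma>) \<partial>vol) \<le> B t"
  shows "(\<integral>p. H (fst p, \<psi> (snd p)) \<partial>base_measure) \<le> integral {0..2 * pi} B"
proof -
  let ?T = "restrict_space lborel {0..2 * pi}"
  interpret T: finite_measure ?T by (rule finite_measure_interval)
  interpret V: finite_measure vol by (rule finite_measure_vol)
  interpret P: pair_sigma_finite ?T vol by unfold_locales
  interpret base: finite_measure base_measure by (rule finite_measure_base)
  have "(\<lambda>t. t) \<in> borel_measurable ?T" by (intro measurable_restrict_space1) simp
  then have "(\<lambda>p. (fst p, \<psi> (snd p))) \<in> measurable base_measure (borel \<Otimes>\<^sub>M borel)"
    unfolding base_measure_def
    by (intro measurable_Pair measurable_compose[OF measurable_fst] measurable_compose[OF measurable_snd psi_measurable])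
  then have "(\<lambda>p. (fst p, \<psi> (snd p))) \<in> borel_measurable base_measure" by (simp add: borel_prod)
  then have m: "(\<lambda>p. H (fst p, \<psi> (snd p))) \<in> borel_measurable base_measure"
    using borel_measurable_continuous_onI[OF H] by (rule measurable_compose)
  have "compact (H ` ({0..2 * pi} \<times> sphere 0 1))"
    by (intro compact_continuous_image continuous_on_subset[OF H] compact_Times compact_Icc compact_sphere) simp
  then have "bounded (H ` ({0..2 * pi} \<times> sphere 0 1))" by (rule compact_imp_bounded)
  then obtain b where b: "\<forall>p\<in>{0..2 * pi} \<times> sphere 0 1. norm (H p) \<le> b" unfolding bounded_iff by blast
  have i: "integrable (?T \<Otimes>\<^sub>M vol) (\<lambda>p. H (fst p, \<psi> (snd p)))"
    unfolding base_measure_def[symmetric]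
  proof (rule base.integrable_const_bound[of _ b])
    show "AE p in base_measure. norm (H (fst p, \<psi> (snd p))) \<le> b"
      using sphere by (intro AE_I2 bspec[OF b]) (auto simp: space_base)
  qed (rule m)
  have si: "set_integrable lborel {0..2 * pi} B"
    by (rule borel_integrable_atLeastAtMost') (rule continuous_on_subset[OF B], simp)
  have iB: "integrable ?T B"
    using si by (subst integrable_restrict_space) (simp_all add: set_integrable_def)
  have "(\<integral>p. H (fst p, \<psi> (snd p)) \<partial>base_measure) = (\<integral>t. (\<integral>\<sigma>. H (t, \<psi> \<sigma>) \<partial>vol) \<partial>?T)"
    unfolding base_measure_def using P.integral_fst'[OF i] by simp
  also have "\<dots> \<le> (\<integral>t. B t \<partial>?T)"
    using P.integrable_fst'[OF i] by (intro integral_mono iB le) simp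
  also have "\<dots> = integral {0..2 * pi} B"
    using set_borel_integral_eq_integral(2)[OF si] by (subst integral_restrict_space) (simp_all add: set_lebesgue_integral_def)
  finally show ?thesis .
qed

text \<open>Returns from the angle on the circle to arclength along the curve.\<close>

lemma integral_rescale:
  assumes "continuous_on {0..L} g"
  shows "integral {0..2 * pi} (\<lambda>t. \<kappa> * g (\<kappa> * t)) = integral {0..L} (g :: real \<Rightarrow> real)"
proof -
  have k: "\<kappa> * (2 * pi) = L" by (simp add: \<kappa>_def)
  have "((\<lambda>x. \<kappa> *\<^sub>R g (\<kappa> * x)) has_integral (integral {\<kappa> * 0..\<kappa> * (2 * pi)} g)) {0..2 * pi}"
  proof (rule has_integral_substitution[where c = 0 and d = L])
    show "(\<lambda>x. \<kappa> * x) ` {0..2 * pi} \<subseteq> {0..L}"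
    proof
      fix z assume "z \<in> (\<lambda>x. \<kappa> * x) ` {0..2 * pi}"
      then obtain x where "x \<in> {0..2 * pi}" "z = \<kappa> * x" by blast
      then have x: "z = \<kappa> * x" "0 \<le> x" "x \<le> 2 * pi" by simp_all
      then have "z \<le> L" "0 \<le> z" using mult_left_mono[of x "2 * pi" \<kappa>] \<kappa> unfolding k by simp_all
      then show "z \<in> {0..L}" by simp
    qed
    show "\<kappa> * 0 \<le> \<kappa> * (2 * pi)" unfolding k using L by simp
    show "((\<lambda>x. \<kappa> * x) has_field_derivative \<kappa>) (at x within {0..2 * pi})" for x
      by (auto intro!: derivative_eq_intros)
  qed (use assms in simp_all)
  then have "((\<lambda>x. \<kappa> * g (\<kappa> * x)) has_integral (integral {0..L} g)) {0..2 * pi}" unfolding k by simp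
  then show ?thesis by (rule integral_unique)
qed

end

text \<open>The assumptions on \<beta> and m are the output of \<open>ex_unstable_direction\<close>;
  the locale fixes them so that the unstable field can be defined from them.\<close>

locale anciaux_cone = legendrian_cone M \<psi> L + cv: anciaux_curve "CARD('n)" \<gamma> r \<phi> \<theta> L
  for M :: "('a::{t2_space,second_countable_topology}, 'e::euclidean_space) atlas"
    and \<psi> :: "'a \<Rightarrow> complex ^ 'n" and \<gamma> r \<phi> \<theta> L +
  fixes \<beta> m :: real
  assumes dim: "DIM('e) = CARD('n) - 1"
    and smooth: "smooth_on UNIV \<gamma>" "smooth_on UNIV r" "smooth_on UNIV \<phi>" "smooth_on UNIV \<theta>"
    and \<beta>: "cv.I (\<lambda>s. cv.\<rho> s * (cos (\<phi> s - \<beta>) - m)) = 0"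
      "cv.I (\<lambda>s. cv.\<rho> s * ((sin (\<phi> s - \<beta>) * cv.\<phi>' s)\<^sup>2 - (cos (\<phi> s - \<beta>) - m)\<^sup>2)) < 0"
begin

lemma dim': "real DIM('e) = real CARD('n) - 1"
  using dim cv.n by simp

definition u where "u s = cos (\<phi> s - \<beta>) - m"
definition u' where "u' s = - (sin (\<phi> s - \<beta>) * cv.\<phi>' s)"
definition f where "f s = u s * cv.h s"
definition f' where "f' s = u' s * cv.h s + u s * cv.k s"
text \<open>The curvature of \<gamma>, as computed in \<open>cv.d_\<theta>\<close>.\<close>

definition \<theta>' where "\<theta>' s = (r s / 2 - (real CARD('n) - 1) / r s) * cv.S s"
definition v where "v s = (of_real (f s) * \<i>) * cis (\<theta> s)"
definition v' where "v' s = (of_real (f' s) * \<i> - of_real (f s * \<theta>' s)) * cis (\<theta> s)"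

lemma d_u: "(u has_real_derivative u' s) (at s)"
proof -
  have "((\<lambda>s. \<phi> s - \<beta>) has_real_derivative cv.\<phi>' s - 0) (at s)" by (intro DERIV_diff cv.d_\<phi> DERIV_const)
  from DERIV_diff[OF DERIV_chain2[OF DERIV_cos this] DERIV_const[of m]]
  show ?thesis unfolding u_def[abs_def] by (rule DERIV_cong) (simp add: u'_def)
qed

lemma d_f: "(f has_real_derivative f' s) (at s)"
  using DERIV_mult[OF d_u cv.d_h] unfolding f_def[abs_def] by (rule DERIV_cong) (simp add: f'_def mult.commute)

lemma d_v: "(v has_vector_derivative v' s) (at s)"
proof -
  have "((\<lambda>s. of_real (f s) * (\<i> * cis (\<theta> s))) has_vector_derivative
      of_real (f s) * (\<i> * (\<theta>' s *\<^sub>R (\<i> * cis (\<theta> s)))) + of_real (f' s) * (\<i> * cis (\<theta> s))) (at s)"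
  proof (rule has_vector_derivative_mult)
    show "((\<lambda>s. complex_of_real (f s)) has_vector_derivative of_real (f' s)) (at s)"
      by (rule has_vector_derivative_of_real[OF d_f])
    have "(cis has_vector_derivative \<i> * cis (\<theta> s)) (at (\<theta> s))"
      unfolding has_vector_derivative_def
      by (rule has_derivative_eq_rhs[OF has_derivative_cis[OF has_derivative_ident]]) (simp add: scaleR_conv_of_real)
    from vector_diff_chain_at[OF cv.d_\<theta>[unfolded has_real_derivative_iff_has_vector_derivative] this]
    have "((\<lambda>s. cis (\<theta> s)) has_vector_derivative \<theta>' s *\<^sub>R (\<i> * cis (\<theta> s))) (at s)" by (simp add: o_def \<theta>'_def)
    then show "((\<lambda>s. \<i> * cis (\<theta> s)) has_vector_derivative \<i> * (\<theta>' s *\<^sub>R (\<i> * cis (\<theta> s)))) (at s)"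
      by (rule has_vector_derivative_mult_right)
  qed
  moreover have "of_real (f s) * (\<i> * (\<theta>' s *\<^sub>R (\<i> * cis (\<theta> s)))) + of_real (f' s) * (\<i> * cis (\<theta> s)) = v' s"
    by (simp add: v'_def scaleR_conv_of_real algebra_simps)
  ultimately show ?thesis unfolding v_def[abs_def] by (simp add: mult.assoc)
qed

lemma continuous_on_data:
  "continuous_on UNIV cv.\<phi>'" "continuous_on UNIV cv.h" "continuous_on UNIV cv.k" "continuous_on UNIV u" "continuous_on UNIV u'"
  "continuous_on UNIV f" "continuous_on UNIV f'" "continuous_on UNIV \<theta>'" "continuous_on UNIV v" "continuous_on UNIV v'"
  "continuous_on UNIV \<gamma>"
proof -
  note I = continuous_on_mult continuous_on_add continuous_on_diff continuous_on_minus continuous_on_const continuous_on_sin continuous_on_cos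
    continuous_on_divide cv.cont continuous_on_of_real continuous_on_cis
  have nz: "\<forall>x\<in>UNIV. r x \<noteq> 0" using cv.r_nz by blast
  show 1: "continuous_on UNIV cv.\<phi>'" unfolding cv.\<phi>'_def[abs_def] by (intro I nz)
  show 2: "continuous_on UNIV cv.h" "continuous_on UNIV cv.k" "continuous_on UNIV u"
    by (intro continuous_at_imp_continuous_on ballI DERIV_isCont[OF cv.d_h] DERIV_isCont[OF cv.d_k] DERIV_isCont[OF d_u])+
  show 3: "continuous_on UNIV u'" unfolding u'_def[abs_def] by (intro I 1)
  show 4: "continuous_on UNIV f" unfolding f_def[abs_def] by (intro I 2)
  show 5: "continuous_on UNIV f'" unfolding f'_def[abs_def] by (intro I 2 3)
  show 6: "continuous_on UNIV \<theta>'" unfolding \<theta>'_def[abs_def] by (intro I nz) auto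
  show "continuous_on UNIV v" unfolding v_def[abs_def] by (intro I 4)
  show "continuous_on UNIV v'" unfolding v'_def[abs_def] by (intro I 4 5 6)
  show "continuous_on UNIV \<gamma>" unfolding cv.polar(2)[abs_def] by (intro I)
qed

lemma periodic_data:
  "f (s + L) = f s" "v (s + L) = v s" "v' (s + L) = v' s"
proof -
  show "f (s + L) = f s" by (simp add: f_def u_def cv.per_hk cv.per_trig_\<phi>)
  then show "v (s + L) = v s" "v' (s + L) = v' s"
    by (simp_all add: v_def v'_def f'_def u_def u'_def \<theta>'_def cv.\<phi>'_def cv.per_hk cv.per_trig_\<phi> cv.per_r cv.per_SC cv.per_cis_\<theta>)
qed

lemma smooth_v: "smooth_on UNIV v"
proof -
  have mult: "smooth_on UNIV (\<lambda>x. g x * g' x)" if "smooth_on UNIV g" "smooth_on UNIV g'"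
    for g g' :: "real \<Rightarrow> 'b::real_normed_algebra"
    by (rule smooth_on_bilinear[OF bounded_bilinear_mult open_UNIV that])
  have diff: "smooth_on UNIV (\<lambda>x. g x - g' x)" if "smooth_on UNIV g" "smooth_on UNIV g'" for g g' :: "real \<Rightarrow> real"
    using smooth_on_add[OF open_UNIV that(1) mult[OF smooth_on_const[OF open_UNIV, of "-1"] that(2)]] by simp
  have of_real: "smooth_on UNIV (\<lambda>x. complex_of_real (g x))" if "smooth_on UNIV g" for g :: "real \<Rightarrow> real"
    by (rule smooth_on_compose[OF open_UNIV open_UNIV that smooth_on_bounded_linear[OF bounded_linear_of_real open_UNIV]]) simp
  have trig: "smooth_on UNIV (\<lambda>x. cos (g x))" "smooth_on UNIV (\<lambda>x. sin (g x))" if "smooth_on UNIV g" for g :: "real \<Rightarrow> real"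
    by (rule smooth_on_compose[OF open_UNIV open_UNIV that smooth_on_cos], simp,
        rule smooth_on_compose[OF open_UNIV open_UNIV that smooth_on_sin], simp)
  have "smooth_on UNIV (\<lambda>s. complex_of_real ((cos (\<phi> s - \<beta>) - m) * (r s * sin (\<theta> s - \<phi> s))) * \<i> *
      (of_real (cos (\<theta> s)) + \<i> * of_real (sin (\<theta> s))))"
    by (intro mult of_real trig diff smooth smooth_on_const open_UNIV smooth_on_add)
  moreover have "v = (\<lambda>s. complex_of_real ((cos (\<phi> s - \<beta>) - m) * (r s * sin (\<theta> s - \<phi> s))) * \<i> *
      (of_real (cos (\<theta> s)) + \<i> * of_real (sin (\<theta> s))))"
    unfolding v_def[abs_def] f_def u_def cv.h_def cv.\<alpha>_def
    by (intro ext arg_cong2[of _ _ _ _ times] refl) (simp add: complex_eq_iff)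
  ultimately show ?thesis by simp
qed

lemma inner_data:
  "\<gamma> s \<bullet> \<gamma> s = (r s)\<^sup>2" "cis (\<theta> s) \<bullet> cis (\<theta> s) = 1" "v s \<bullet> v s = (f s)\<^sup>2" "\<gamma> s \<bullet> v s = - (f s * cv.h s)"
  "cis (\<theta> s) \<bullet> v' s = - (f s * \<theta>' s)" "v' s \<bullet> v' s = (f' s)\<^sup>2 + (f s * \<theta>' s)\<^sup>2" "Re (cis (\<theta> s) * cnj (v s)) = 0"
proof -
  \<comment> \<open>All vectors are expressed in the frame rotating with the tangent, where
    \<open>inner_mult_cis\<close> removes the common rotation.\<close>
  have g: "\<gamma> s = (of_real (r s) * cis (- cv.\<alpha> s)) * cis (\<theta> s)"
    by (simp add: cv.polar(2) cis_mult mult.assoc cv.\<alpha>_def)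
  have c: "cis (\<theta> s) = 1 * cis (\<theta> s)" by simp
  show "\<gamma> s \<bullet> \<gamma> s = (r s)\<^sup>2" unfolding cv.polar(2) inner_mult_cis by (simp add: inner_complex_def power2_eq_square)
  show c1: "cis (\<theta> s) \<bullet> cis (\<theta> s) = 1" by (subst (1 2) c, subst inner_mult_cis) simp
  show "v s \<bullet> v s = (f s)\<^sup>2" unfolding v_def inner_mult_cis by (simp add: inner_complex_def power2_eq_square)
  show "\<gamma> s \<bullet> v s = - (f s * cv.h s)" unfolding g v_def inner_mult_cis by (simp add: inner_complex_def cv.h_def)
  show "cis (\<theta> s) \<bullet> v' s = - (f s * \<theta>' s)"
    by (subst c, unfold v'_def inner_mult_cis) (simp add: inner_complex_def)
  show "v' s \<bullet> v' s = (f' s)\<^sup>2 + (f s * \<theta>' s)\<^sup>2"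
    unfolding v'_def inner_mult_cis by (simp add: inner_complex_def power2_eq_square)
  have "Re (cis (\<theta> s) * cnj (v s)) = cis (\<theta> s) \<bullet> v s" by (simp add: inner_complex_def)
  also have "\<dots> = 0" by (subst c, unfold v_def inner_mult_cis) (simp add: inner_complex_def)
  finally show "Re (cis (\<theta> s) * cnj (v s)) = 0" .
qed

text \<open>Periodicity bounds |v| / |\<gamma>| and |v'| / |\<gamma>'| along the whole curve, so for
  small parameters the perturbation cannot cancel the position or the velocity.\<close>

lemma ex_variation_radius:
  "\<exists>\<epsilon>>0. \<forall>s l. \<bar>s\<bar> \<le> \<epsilon> \<longrightarrow> \<gamma> l + s *\<^sub>R v l \<noteq> 0 \<and> cis (\<theta> l) + s *\<^sub>R v' l \<noteq> 0"
proof -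
  have "\<exists>B. \<forall>l. \<bar>norm (v l) / r l + norm (v' l)\<bar> \<le> B"
  proof (rule periodic_bounded[OF _ L])
    show "continuous_on UNIV (\<lambda>l. norm (v l) / r l + norm (v' l))"
      using cv.r_nz by (intro continuous_on_add continuous_on_divide continuous_on_norm continuous_on_data cv.cont) auto
  qed (simp add: periodic_data cv.per_r)
  then obtain B where B: "\<forall>l. \<bar>norm (v l) / r l + norm (v' l)\<bar> \<le> B" by blast
  \<comment> \<open>Makes \<open>?e * \<bar>B\<bar>\<close> less than 1 / 2.\<close>
  let ?e = "1 / (2 * (\<bar>B\<bar> + 1))"
  have ne: "c + s *\<^sub>R w \<noteq> 0" if "\<bar>s\<bar> \<le> ?e" "norm w \<le> \<bar>B\<bar> * norm c" "norm c > 0" for s and c w :: complex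
  proof
    assume "c + s *\<^sub>R w = 0"
    then have "c = - (s *\<^sub>R w)" by (simp add: eq_neg_iff_add_eq_0)
    then have "norm c = \<bar>s\<bar> * norm w" by simp
    also have "\<dots> \<le> ?e * (\<bar>B\<bar> * norm c)" using that by (intro mult_mono) auto
    also have "\<dots> = (?e * \<bar>B\<bar>) * norm c" by simp
    also have "\<dots> < 1 * norm c" by (rule mult_strict_right_mono[OF _ that(3)]) (simp add: field_simps)
    finally show False by simp
  qed
  have b: "norm (v l) \<le> \<bar>B\<bar> * r l" "norm (v' l) \<le> \<bar>B\<bar>" for l
  proof -
    have p: "norm (v l) / r l \<ge> 0" using cv.polar(1)[of l] by simp
    have q: "\<bar>norm (v l) / r l + norm (v' l)\<bar> \<le> B" using B by blast
    have "norm (v l) / r l \<le> \<bar>B\<bar>" using p q norm_ge_zero[of "v' l"] by linarith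
    then show "norm (v l) \<le> \<bar>B\<bar> * r l" using cv.polar(1)[of l] by (simp add: field_simps)
    show "norm (v' l) \<le> \<bar>B\<bar>" using p q by linarith
  qed
  have ng: "norm (\<gamma> l) = r l" for l using cv.polar(1)[of l] by (simp add: cv.polar(2) norm_mult)
  have "?e > 0" by (simp add: add_nonneg_pos)
  moreover have "\<gamma> l + s *\<^sub>R v l \<noteq> 0 \<and> cis (\<theta> l) + s *\<^sub>R v' l \<noteq> 0" if "\<bar>s\<bar> \<le> ?e" for s l
    using ne[OF that, of "v l" "\<gamma> l"] ne[OF that, of "v' l" "cis (\<theta> l)"] b[of l] cv.polar(1)[of l] by (simp add: ng)
  ultimately show ?thesis by blast
qed

text \<open>Here \<open>y\<close> and \<open>w\<close> are the first two derivatives of x_s at 0,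
  and \<open>\<tau>\<close> and \<open>\<kappa>2\<close> those of t_s. The vector \<open>q\<close>
  collects everything linear in \<psi>, including the interactions of translations with
  \<open>v\<close> and with dilations, and integrates to zero over \<open>M\<close>. The square from
  the translations is bounded by \<open>integral_quadratic_le\<close>, and what remains is the
  integrand of \<open>second_variation_negative\<close>.\<close>

lemma second_variation_integral_negative:
  fixes y w :: "complex ^ 'n" and \<tau> \<kappa>2 :: real
  defines "N \<equiv> real CARD('n)"
  defines "G \<equiv> \<lambda>l. \<kappa>2 * ((r l)\<^sup>2 / 4 - N / 2) + \<tau>\<^sup>2 * (N / 2 - (r l)\<^sup>2 / 2) - \<tau> * (u l * (cv.h l)\<^sup>2)
     + ((f' l)\<^sup>2 - (f l)\<^sup>2 * (\<theta>' l)\<^sup>2 - (f l)\<^sup>2 / 2 + (f l)\<^sup>2 * ((N - 1) * (1 - 2 * (cv.S l)\<^sup>2) / (r l)\<^sup>2))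
     + \<tau>\<^sup>2 * ((r l)\<^sup>2 / 4 - N / 2)\<^sup>2"
  defines "q \<equiv> \<lambda>l. cnj (\<gamma> l) *s ((1 / 2) *\<^sub>R w + (\<tau> * ((r l)\<^sup>2 / 4 - N / 2) - \<tau>) *\<^sub>R y) + cnj (v l) *s y"
  defines "H \<equiv> \<lambda>p. \<kappa> * (cv.W (\<kappa> * fst p) * (G (\<kappa> * fst p) - (y \<bullet> y) / 2 + q (\<kappa> * fst p) \<bullet> snd p
     + ((cnj (\<gamma> (\<kappa> * fst p)) *s y) \<bullet> snd p)\<^sup>2 / 4))"
  shows "(\<integral>p. H (fst p, \<psi> (snd p)) \<partial>base_measure) < 0"
proof -
  \<comment> \<open>The bound for the integral over \<open>M\<close>, per unit of volume; the
    fraction with 4 N arises from the factor 1 / 4 of the square and the factor 1 / n of its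
    estimate.\<close>
  define g where "g l = cv.W l * (G l + (y \<bullet> y) * ((r l)\<^sup>2 / (4 * N) - 1 / 2))" for l
  have N: "N = real DIM('e) + 1" "N > 0" using dim' by (simp_all add: N_def)
  let ?V = "measure vol (points M)"
  note I = continuous_on_mult continuous_on_add continuous_on_diff continuous_on_minus continuous_on_const continuous_on_sin
    continuous_on_divide continuous_on_power cv.cont continuous_on_data continuous_on_scaleR continuous_on_cnj continuous_on_inner
    bounded_bilinear.continuous_on[OF bounded_bilinear_vector_scalar_mult]
  have nz: "\<forall>x\<in>UNIV. (r x)\<^sup>2 \<noteq> 0" "\<forall>x\<in>UNIV. (2 :: real) \<noteq> 0" "\<forall>x\<in>UNIV. (4 :: real) \<noteq> 0" "\<forall>x\<in>UNIV. (4 * N) \<noteq> 0"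
    using cv.r_nz N by auto
  have cG: "continuous_on UNIV G" unfolding G_def by (intro I) (use cv.r_nz in auto)
  have cg: "continuous_on UNIV g" unfolding g_def[abs_def] by (intro I cG) (use N in auto)
  have cq: "continuous_on UNIV q" unfolding q_def by (intro I) auto
  have fs: "continuous_on UNIV (\<lambda>p :: real \<times> (complex ^ 'n). \<kappa> * fst p)" "continuous_on UNIV (\<lambda>p :: real \<times> (complex ^ 'n). snd p)"
    by (intro continuous_on_mult continuous_on_const continuous_on_fst continuous_on_snd continuous_on_id)+
  have cl: "continuous_on UNIV (\<lambda>p :: real \<times> (complex ^ 'n). k (\<kappa> * fst p))" if "continuous_on UNIV k" for k :: "real \<Rightarrow> 'z::topological_space"
    by (rule continuous_on_compose2[OF that fs(1)]) auto
  have cH: "continuous_on UNIV H"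
    unfolding H_def
    by (intro cl[OF cG] cl[OF cq] cl[OF cv.cont(5)] cl[OF continuous_on_data(11)] fs
        continuous_on_mult continuous_on_add continuous_on_diff continuous_on_const continuous_on_divide continuous_on_power
        continuous_on_cnj continuous_on_inner bounded_bilinear.continuous_on[OF bounded_bilinear_vector_scalar_mult]) auto
  have cB: "continuous_on UNIV (\<lambda>t. \<kappa> * (?V * g (\<kappa> * t)))"
    by (intro continuous_on_mult continuous_on_const continuous_on_compose2[OF cg]) (auto intro: continuous_on_mult continuous_on_id)
  have le: "(\<integral>\<sigma>. H (t, \<psi> \<sigma>) \<partial>vol) \<le> \<kappa> * (?V * g (\<kappa> * t))" for t
  proof -
    let ?l = "\<kappa> * t"
    let ?a = "cnj (\<gamma> ?l) *s y"
    have i: "integrable vol (\<lambda>\<sigma>. G ?l - (y \<bullet> y) / 2)" "integrable vol (\<lambda>\<sigma>. q ?l \<bullet> \<psi> \<sigma>)" "integrable vol (\<lambda>\<sigma>. (?a \<bullet> \<psi> \<sigma>)\<^sup>2 / 4)"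
      by (intro integrable_vol continuous_on_const continuous_on_inner continuous_on_f continuous_on_divide continuous_on_power; simp)+
    have aa: "?a \<bullet> ?a = (r ?l)\<^sup>2 * (y \<bullet> y)"
      unfolding inner_vector_scalar_mult using inner_data(1)[of ?l] by (simp add: inner_complex_def \<omega>_self)
    \<comment> \<open>The constant vector has squared length r^2 times that of \<open>y\<close>, and
      the dimension of the sphere immersion plus 1 is n.\<close>
    have Q: "(\<integral>\<sigma>. (?a \<bullet> \<psi> \<sigma>)\<^sup>2 \<partial>vol) \<le> (r ?l)\<^sup>2 * (y \<bullet> y) * ?V / N"
      using integral_quadratic_le[of ?a] N unfolding aa by (simp add: pos_le_divide_eq mult.commute)
    have "(\<integral>\<sigma>. H (t, \<psi> \<sigma>) \<partial>vol) = \<kappa> * (cv.W ?l * (\<integral>\<sigma>. G ?l - (y \<bullet> y) / 2 + q ?l \<bullet> \<psi> \<sigma> + (?a \<bullet> \<psi> \<sigma>)\<^sup>2 / 4 \<partial>vol))"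
      unfolding H_def fst_conv snd_conv by (simp only: integral_mult_right_zero)
    also have "(\<integral>\<sigma>. G ?l - (y \<bullet> y) / 2 + q ?l \<bullet> \<psi> \<sigma> + (?a \<bullet> \<psi> \<sigma>)\<^sup>2 / 4 \<partial>vol)
      = (\<integral>\<sigma>. G ?l - (y \<bullet> y) / 2 \<partial>vol) + (\<integral>\<sigma>. q ?l \<bullet> \<psi> \<sigma> \<partial>vol) + (\<integral>\<sigma>. (?a \<bullet> \<psi> \<sigma>)\<^sup>2 / 4 \<partial>vol)"
      using i by (simp only: Bochner_Integration.integral_add Bochner_Integration.integrable_add)
    also have "\<dots> = ?V * (G ?l - (y \<bullet> y) / 2) + (\<integral>\<sigma>. (?a \<bullet> \<psi> \<sigma>)\<^sup>2 \<partial>vol) / 4"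
      by (simp add: integral_linear_zero space_vol)
    finally have e: "(\<integral>\<sigma>. H (t, \<psi> \<sigma>) \<partial>vol) = \<kappa> * (cv.W ?l * (?V * (G ?l - (y \<bullet> y) / 2) + (\<integral>\<sigma>. (?a \<bullet> \<psi> \<sigma>)\<^sup>2 \<partial>vol) / 4))" .
    have "?V * (G ?l - (y \<bullet> y) / 2) + (\<integral>\<sigma>. (?a \<bullet> \<psi> \<sigma>)\<^sup>2 \<partial>vol) / 4
      \<le> ?V * (G ?l - (y \<bullet> y) / 2) + ((r ?l)\<^sup>2 * (y \<bullet> y) * ?V / N) / 4" using Q by simp
    also have "\<dots> = ?V * (G ?l + (y \<bullet> y) * ((r ?l)\<^sup>2 / (4 * N) - 1 / 2))" by (simp add: algebra_simps)
    finally have "(\<integral>\<sigma>. H (t, \<psi> \<sigma>) \<partial>vol) \<le> \<kappa> * (cv.W ?l * (?V * (G ?l + (y \<bullet> y) * ((r ?l)\<^sup>2 / (4 * N) - 1 / 2))))"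
      unfolding e using \<kappa> cv.W_pos[of ?l] by (intro mult_left_mono) auto
    then show ?thesis by (simp add: g_def mult.left_commute)
  qed
  have "(\<integral>p. H (fst p, \<psi> (snd p)) \<partial>base_measure) \<le> integral {0..2 * pi} (\<lambda>t. \<kappa> * (?V * g (\<kappa> * t)))"
    by (rule integral_base_le[OF cH cB le])
  also have "\<dots> = integral {0..L} (\<lambda>l. ?V * g l)"
    by (rule integral_rescale) (intro continuous_on_mult continuous_on_const continuous_on_subset[OF cg] subset_UNIV)
  also have "\<dots> = ?V * integral {0..L} g" by simp
  also have "\<dots> < 0"
  proof (rule mult_pos_neg[OF measure_vol_pos])
    have "cv.I g < 0"
      using cv.second_variation_negative[OF \<beta>, of \<kappa>2 \<tau> "y \<bullet> y"]
      unfolding g_def[abs_def] G_def f_def f'_def \<theta>'_def u_def u'_def N_def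
      by (rule back_subst[where P = "\<lambda>x. x < 0"]) (intro arg_cong[where f = cv.I] ext, simp add: algebra_simps)
    then show "integral {0..L} g < 0" .
  qed
  finally show ?thesis .
qed

text \<open>Values at the parameter 0, where T = R = 1 and P = Q = r^2. The letters
  \<open>a\<close>, \<open>b\<close>, \<open>c\<close> stand for the inner products of \<gamma>
  \<psi> with the first and second derivatives of x_s and of v \<psi> with the first, and
  \<open>y2\<close> for the squared length of the first derivative.\<close>

lemma weight_at_zero:
  fixes a b c y2 \<tau> \<kappa>2 :: real
  defines "d \<equiv> real DIM('e)"
  defines "N \<equiv> d + 1"
  shows "exp (log_weight N d 1 1 ((r l)\<^sup>2) ((r l)\<^sup>2)) = (4 * pi) powr (- N / 2) * cv.W l"
    and "log_weight1 N d 1 \<tau> 1 (2 * - (f l * \<theta>' l)) ((r l)\<^sup>2) (2 * - (f l * cv.h l)) ((r l)\<^sup>2) (2 * - (f l * cv.h l) - 2 * a)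
      = \<tau> * ((r l)\<^sup>2 / 4 - N / 2) + a / 2"
    and "log_weight2 N d 1 \<tau> \<kappa>2 1 (2 * - (f l * \<theta>' l)) (2 * ((f' l)\<^sup>2 + (f l * \<theta>' l)\<^sup>2)) ((r l)\<^sup>2) (2 * - (f l * cv.h l)) (2 * (f l)\<^sup>2)
         ((r l)\<^sup>2) (2 * - (f l * cv.h l) - 2 * a) (2 * (f l)\<^sup>2 - 2 * b - 4 * c + 2 * y2)
      = \<kappa>2 * ((r l)\<^sup>2 / 4 - N / 2) + \<tau>\<^sup>2 * (N / 2 - (r l)\<^sup>2 / 2) - \<tau> * (u l * (cv.h l)\<^sup>2)
     + ((f' l)\<^sup>2 - (f l)\<^sup>2 * (\<theta>' l)\<^sup>2 - (f l)\<^sup>2 / 2 + (f l)\<^sup>2 * (d * (1 - 2 * (cv.S l)\<^sup>2) / (r l)\<^sup>2))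
     - y2 / 2 + b / 2 + c - \<tau> * a"
proof -
  have r: "r l > 0" "r l \<noteq> 0" using cv.polar(1)[of l] by simp_all
  have d: "d = real CARD('n) - 1" using dim' by (simp add: d_def)
  have "d / 2 * ln ((r l)\<^sup>2) = d * ln (r l)" using r by (simp add: ln_realpow)
  then have "log_weight N d 1 1 ((r l)\<^sup>2) ((r l)\<^sup>2) = - (N / 2) * ln (4 * pi) + (d * ln (r l) + - (r l)\<^sup>2 / 4)"
    by (simp add: log_weight_def)
  moreover have "exp (- (N / 2) * ln (4 * pi)) = (4 * pi) powr (- N / 2)" by (simp add: powr_def)
  moreover have "exp (d * ln (r l)) = r l ^ (CARD('n) - 1)"
    unfolding dim[symmetric] d_def using r by (simp only: exp_of_nat_mult exp_ln)
  ultimately show "exp (log_weight N d 1 1 ((r l)\<^sup>2) ((r l)\<^sup>2)) = (4 * pi) powr (- N / 2) * cv.W l"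
    by (simp only: exp_add cv.W_def)
  have h: "f l * cv.h l / (r l)\<^sup>2 = f l * cv.S l / r l"
    using r by (simp add: cv.h_def power2_eq_square)
  \<comment> \<open>The self-shrinker equation: the change of length, the change of volume of the
    Legendrian factor and the change of the Gaussian weight under \<open>v\<close> cancel
    pointwise.\<close>
  have "- (f l * \<theta>' l) - d * (f l * cv.h l / (r l)\<^sup>2) + f l * cv.h l / 2 = 0"
    unfolding h using r by (simp add: \<theta>'_def cv.h_def d[symmetric] field_simps)
  moreover have "log_weight1 N d 1 \<tau> 1 (2 * - (f l * \<theta>' l)) ((r l)\<^sup>2) (2 * - (f l * cv.h l)) ((r l)\<^sup>2) (2 * - (f l * cv.h l) - 2 * a)
      = - (N / 2) * \<tau> - f l * \<theta>' l - d * (f l * cv.h l / (r l)\<^sup>2) + f l * cv.h l / 2 + a / 2 + (r l)\<^sup>2 * \<tau> / 4"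
    by (simp add: log_weight1_def diff_divide_distrib)
  moreover have "\<tau> * ((r l)\<^sup>2 / 4 - N / 2) = (r l)\<^sup>2 * \<tau> / 4 - N / 2 * \<tau>" by (simp add: algebra_simps)
  ultimately show "log_weight1 N d 1 \<tau> 1 (2 * - (f l * \<theta>' l)) ((r l)\<^sup>2) (2 * - (f l * cv.h l)) ((r l)\<^sup>2) (2 * - (f l * cv.h l) - 2 * a)
      = \<tau> * ((r l)\<^sup>2 / 4 - N / 2) + a / 2"
    by linarith
  have fh: "f l * cv.h l = u l * (cv.h l)\<^sup>2" by (simp add: f_def power2_eq_square)
  \<comment> \<open>This square and the term 2 f^2 / r^2 form the second derivative of ln |\<gamma>
    + s v|^2, from which the factor 1 - 2 S^2 of the potential arises.\<close>
  have h2: "(2 * - (f l * cv.h l) / (r l)\<^sup>2)\<^sup>2 = 4 * (f l)\<^sup>2 * (cv.S l)\<^sup>2 / (r l)\<^sup>2"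
  proof -
    have e: "2 * - (f l * cv.h l) / (r l)\<^sup>2 = - 2 * (f l * cv.h l / (r l)\<^sup>2)" by simp
    show ?thesis unfolding e h by (simp add: power_divide power_mult_distrib)
  qed
  have "log_weight2 N d 1 \<tau> \<kappa>2 1 (2 * - (f l * \<theta>' l)) (2 * ((f' l)\<^sup>2 + (f l * \<theta>' l)\<^sup>2)) ((r l)\<^sup>2) (2 * - (f l * cv.h l)) (2 * (f l)\<^sup>2)
         ((r l)\<^sup>2) (2 * - (f l * cv.h l) - 2 * a) (2 * (f l)\<^sup>2 - 2 * b - 4 * c + 2 * y2)
    = - (N / 2) * (\<kappa>2 - \<tau>\<^sup>2) + ((f' l)\<^sup>2 - (f l * \<theta>' l)\<^sup>2) + d / 2 * (2 * (f l)\<^sup>2 / (r l)\<^sup>2 - 4 * (f l)\<^sup>2 * (cv.S l)\<^sup>2 / (r l)\<^sup>2)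
      - (2 * (f l)\<^sup>2 - 2 * b - 4 * c + 2 * y2) / 4 + (- (f l * cv.h l) - a) * \<tau> + (r l)\<^sup>2 * \<kappa>2 / 4 - (r l)\<^sup>2 * \<tau>\<^sup>2 / 2"
    unfolding log_weight2_def h2 by (simp add: power_mult_distrib diff_divide_distrib add_divide_distrib algebra_simps)
  also have "d / 2 * (2 * (f l)\<^sup>2 / (r l)\<^sup>2 - 4 * (f l)\<^sup>2 * (cv.S l)\<^sup>2 / (r l)\<^sup>2) = (f l)\<^sup>2 * (d * (1 - 2 * (cv.S l)\<^sup>2) / (r l)\<^sup>2)"
    by (simp add: diff_divide_distrib algebra_simps)
  finally show "log_weight2 N d 1 \<tau> \<kappa>2 1 (2 * - (f l * \<theta>' l)) (2 * ((f' l)\<^sup>2 + (f l * \<theta>' l)\<^sup>2)) ((r l)\<^sup>2) (2 * - (f l * cv.h l)) (2 * (f l)\<^sup>2)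
         ((r l)\<^sup>2) (2 * - (f l * cv.h l) - 2 * a) (2 * (f l)\<^sup>2 - 2 * b - 4 * c + 2 * y2)
      = \<kappa>2 * ((r l)\<^sup>2 / 4 - N / 2) + \<tau>\<^sup>2 * (N / 2 - (r l)\<^sup>2 / 2) - \<tau> * (u l * (cv.h l)\<^sup>2)
     + ((f' l)\<^sup>2 - (f l)\<^sup>2 * (\<theta>' l)\<^sup>2 - (f l)\<^sup>2 / 2 + (f l)\<^sup>2 * (d * (1 - 2 * (cv.S l)\<^sup>2) / (r l)\<^sup>2))
     - y2 / 2 + b / 2 + c - \<tau> * a"
    by (rule trans, unfold fh) (simp add: power_mult_distrib add_divide_distrib diff_divide_distrib algebra_simps)
qed

text \<open>The smooth x_s and t_s granted by stability affect the second derivative only through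
  their first two derivatives at 0, and the integral is negative for all values of these.\<close>

lemma not_F_stable: "\<not> F_stable PA (cone \<gamma>)"
proof
  assume st: "F_stable PA (cone \<gamma>)"
  obtain \<epsilon> where \<epsilon>: "\<epsilon> > 0" "\<forall>s l. \<bar>s\<bar> \<le> \<epsilon> \<longrightarrow> \<gamma> l + s *\<^sub>R v l \<noteq> 0 \<and> cis (\<theta> l) + s *\<^sub>R v' l \<noteq> 0"
    using ex_variation_radius by blast
  have nz: "\<gamma> l + s *\<^sub>R v l \<noteq> 0" "cis (\<theta> l) + s *\<^sub>R v' l \<noteq> 0" if "\<bar>s\<bar> \<le> \<epsilon>" for s l
    using \<epsilon>(2) that by blast+
  have nv: "normal_variation PA (cone \<gamma>) \<epsilon> (\<lambda>s. cone (\<lambda>l. \<gamma> l + s *\<^sub>R v l))"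
    by (rule normal_variation_cone[where \<gamma>' = "\<lambda>l. cis (\<theta> l)", OF smooth(1) cv.closed cv.arclength smooth_v periodic_data(2) d_v \<epsilon>(1)
          nz(1)[OF less_imp_le] nz(2)[OF less_imp_le] inner_data(7)])
  obtain \<delta>0 X T where \<delta>0: "\<delta>0 > 0" and X: "smooth_on {-\<delta>0<..<\<delta>0} X" "X 0 = 0"
    and T: "smooth_on {-\<delta>0<..<\<delta>0} T" "T 0 = 1" "\<forall>s\<in>{-\<delta>0<..<\<delta>0}. 0 < T s"
    and nonneg: "0 \<le> (deriv ^^ 2) (\<lambda>s. F_functional PA (cone (\<lambda>l. \<gamma> l + s *\<^sub>R v l)) (X s) (T s)) 0"
    using st[unfolded F_stable_def, rule_format, OF nv] by (elim exE conjE) 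
  \<comment> \<open>Halving \<open>\<delta>0\<close> keeps the closed interval inside the open one
    where \<open>X\<close> and \<open>T\<close> are smooth.\<close>
  define \<delta> where "\<delta> = min (\<delta>0 / 2) \<epsilon>"
  have \<delta>: "0 < \<delta>" "\<delta> < \<delta>0" "\<delta> \<le> \<epsilon>" using \<delta>0 \<epsilon>(1) by (auto simp: \<delta>_def)
  have sub: "{-\<delta>..\<delta>} \<subseteq> {-\<delta>0<..<\<delta>0}" using \<delta> by auto
  have mem: "s \<in> {-\<delta>0<..<\<delta>0}" if "\<bar>s\<bar> \<le> \<delta>" for s using that \<delta> by auto
  define X1 where "X1 s = frechet_derivative X (at s) 1" for s
  define X2 where "X2 s = frechet_derivative X1 (at s) 1" for s
  define T1 where "T1 s = frechet_derivative T (at s) 1" for s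
  define T2 where "T2 s = frechet_derivative T1 (at s) 1" for s
  note sX1 = smooth_on_vector_derivative(2)[OF X(1), folded X1_def]
  note sX2 = smooth_on_vector_derivative(2)[OF sX1, folded X2_def]
  note sT1 = smooth_on_vector_derivative(2)[OF T(1), folded T1_def]
  note sT2 = smooth_on_vector_derivative(2)[OF sT1, folded T2_def]
  have dX: "(X has_vector_derivative X1 s) (at s)" "(X1 has_vector_derivative X2 s) (at s)"
    and dT: "(T has_real_derivative T1 s) (at s)" "(T1 has_real_derivative T2 s) (at s)" if s: "\<bar>s\<bar> \<le> \<delta>" for s
    unfolding has_real_derivative_iff_has_vector_derivative
    by (rule smooth_on_vector_derivative(1)[OF X(1) mem[OF s], folded X1_def] smooth_on_vector_derivative(1)[OF sX1 mem[OF s], folded X2_def]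
        smooth_on_vector_derivative(1)[OF T(1) mem[OF s], folded T1_def] smooth_on_vector_derivative(1)[OF sT1 mem[OF s], folded T2_def])+
  have c2: "continuous_on {-\<delta>..\<delta>} T2" "continuous_on {-\<delta>..\<delta>} X2"
    using smooth_onD[OF sT2, of 0] smooth_onD[OF sX2, of 0] sub by (auto intro: continuous_on_subset)
  have nz': "\<gamma> l + s *\<^sub>R v l \<noteq> 0" "cis (\<theta> l) + s *\<^sub>R v' l \<noteq> 0" if "\<bar>s\<bar> \<le> \<delta>" for s l
    using nz[of s l] that \<delta>(3) by auto
  have cc: "continuous_on UNIV (\<lambda>l. cis (\<theta> l))" by (intro continuous_on_cis cv.cont)
  have Tp: "T s > 0" if "\<bar>s\<bar> \<le> \<delta>" for s using T(3) mem[OF that] by blast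
  note D = deriv2_F_functional_cone[where \<gamma>' = "\<lambda>l. cis (\<theta> l)", OF cv.closed cv.arclength cc cv.per_cis_\<theta> periodic_data(2) d_v continuous_on_data(10) periodic_data(3)
      \<delta>(1) nz' Tp dT c2(1) dX c2(2)]
  \<comment> \<open>First and second derivatives of the centre and of the scale at 0.\<close>
  define y w \<tau> \<kappa>2 where "y = X1 0" and "w = X2 0" and "\<tau> = T1 0" and "\<kappa>2 = T2 0"
  let ?d = "real DIM('e)" and ?A = "(4 * pi) powr (- (real DIM('e) + 1) / 2)" and ?N = "real CARD('n)"
  let ?G = "\<lambda>l. \<kappa>2 * ((r l)\<^sup>2 / 4 - ?N / 2) + \<tau>\<^sup>2 * (?N / 2 - (r l)\<^sup>2 / 2) - \<tau> * (u l * (cv.h l)\<^sup>2)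
     + ((f' l)\<^sup>2 - (f l)\<^sup>2 * (\<theta>' l)\<^sup>2 - (f l)\<^sup>2 / 2 + (f l)\<^sup>2 * ((?N - 1) * (1 - 2 * (cv.S l)\<^sup>2) / (r l)\<^sup>2))
     + \<tau>\<^sup>2 * ((r l)\<^sup>2 / 4 - ?N / 2)\<^sup>2"
  let ?q = "\<lambda>l. cnj (\<gamma> l) *s ((1 / 2) *\<^sub>R w + (\<tau> * ((r l)\<^sup>2 / 4 - ?N / 2) - \<tau>) *\<^sub>R y) + cnj (v l) *s y"
  define H where "H p = \<kappa> * (cv.W (\<kappa> * fst p) * (?G (\<kappa> * fst p) - (y \<bullet> y) / 2 + ?q (\<kappa> * fst p) \<bullet> snd p
     + ((cnj (\<gamma> (\<kappa> * fst p)) *s y) \<bullet> snd p)\<^sup>2 / 4))" for p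
  have neg: "(\<integral>p. H (fst p, \<psi> (snd p)) \<partial>base_measure) < 0"
    unfolding H_def by (rule second_variation_integral_negative)
  \<comment> \<open>Splits the constant power of 4 \<pi> off the integrand at 0. Expanding the
    square of the logarithmic derivative yields the last square of \<open>?G\<close>, the part of
    \<open>?q\<close> with \<tau> (r^2 / 4 - n / 2), and the quadratic term in
    \<open>y\<close>.\<close>
  have pt: "\<kappa> * (exp (log_weight (?d + 1) ?d 1 1 ((r l)\<^sup>2) ((r l)\<^sup>2)) *
      (log_weight2 (?d + 1) ?d 1 \<tau> \<kappa>2 1 (2 * - (f l * \<theta>' l)) (2 * ((f' l)\<^sup>2 + (f l * \<theta>' l)\<^sup>2)) ((r l)\<^sup>2) (2 * - (f l * cv.h l)) (2 * (f l)\<^sup>2)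
         ((r l)\<^sup>2) (2 * - (f l * cv.h l) - 2 * ((\<gamma> l *s z) \<bullet> y)) (2 * (f l)\<^sup>2 - 2 * ((\<gamma> l *s z) \<bullet> w) - 4 * ((v l *s z) \<bullet> y) + 2 * (y \<bullet> y))
       + (log_weight1 (?d + 1) ?d 1 \<tau> 1 (2 * - (f l * \<theta>' l)) ((r l)\<^sup>2) (2 * - (f l * cv.h l)) ((r l)\<^sup>2) (2 * - (f l * cv.h l) - 2 * ((\<gamma> l *s z) \<bullet> y)))\<^sup>2))
    = ?A * (\<kappa> * (cv.W l * (?G l - (y \<bullet> y) / 2 + ?q l \<bullet> z + ((cnj (\<gamma> l) *s y) \<bullet> z)\<^sup>2 / 4)))" for l z
  proof -
    have N: "?d + 1 = ?N" "?d = ?N - 1" using dim' by simp_all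
    have s: "c *s (k *\<^sub>R x) = k *\<^sub>R (c *s x)" for c k and x :: "complex ^ 'n" by (simp add: vec_eq_iff)
    have q: "?q l \<bullet> z = ((\<gamma> l *s z) \<bullet> w) / 2 + (\<tau> * ((r l)\<^sup>2 / 4 - ?N / 2) - \<tau>) * ((\<gamma> l *s z) \<bullet> y) + (v l *s z) \<bullet> y"
      unfolding inner_vector_scalar_mult_adjoint[of _ z] vector_add_ldistrib s inner_add_left inner_scaleR_left by simp
    have g: "(cnj (\<gamma> l) *s y) \<bullet> z = (\<gamma> l *s z) \<bullet> y" by (rule inner_vector_scalar_mult_adjoint[symmetric])
    define a b c where "a = (\<gamma> l *s z) \<bullet> y" and "b = (\<gamma> l *s z) \<bullet> w" and "c = (v l *s z) \<bullet> y"
    define x where "x = (r l)\<^sup>2 / 4 - ?N / 2"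
    have "(\<tau> * x + a / 2)\<^sup>2 = \<tau>\<^sup>2 * x\<^sup>2 + \<tau> * x * a + a\<^sup>2 / 4"
      by (simp add: power2_eq_square algebra_simps)
    then show ?thesis
      unfolding q g weight_at_zero unfolding N(1) unfolding N(2) a_def[symmetric] b_def[symmetric] c_def[symmetric] x_def[symmetric]
      by (simp add: algebra_simps)
  qed
  have "(deriv ^^ 2) (\<lambda>s. F_functional PA (cone (\<lambda>l. \<gamma> l + s *\<^sub>R v l)) (X s) (T s)) 0
      = (\<integral>p. ?A * H (fst p, \<psi> (snd p)) \<partial>base_measure)"
    by (rule trans[OF D], assumption+, unfold H_def fst_conv snd_conv pt[symmetric])
      (simp only: X(2) T(2) inner_data mult_zero_left mult_zero_right add_0_right add_0_left diff_zero inner_zero_right inner_zero_left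
        zero_power2 y_def w_def \<tau>_def \<kappa>2_def)
  also have "\<dots> = ?A * (\<integral>p. H (fst p, \<psi> (snd p)) \<partial>base_measure)" by simp
  also have "\<dots> < 0" using neg by (intro mult_pos_neg) simp_all
  finally show False using nonneg by simp
qed

end

theorem theorem6:
  fixes M :: "('a::{t2_space,second_countable_topology}, 'e::euclidean_space) atlas"
    and \<psi> :: "'a \<Rightarrow> complex ^ 'n"
    and \<gamma> :: "real \<Rightarrow> complex"
    and r \<phi> \<theta> :: "real \<Rightarrow> real"
    and L :: real
  assumes n: "CARD('n) \<ge> 2"
    and dim: "DIM('e) = CARD('n) - 1"
    and M: "closed_manifold M"
    and \<psi>: "legendrian M \<psi>" "minimal_in_sphere M \<psi>"
    and smooth: "smooth_on UNIV \<gamma>" "smooth_on UNIV r" "smooth_on UNIV \<phi>" "smooth_on UNIV \<theta>"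
    and polar: "\<And>s. 0 < r s" "\<And>s. \<gamma> s = of_real (r s) * cis (\<phi> s)"
    and arclength: "\<And>s. (\<gamma> has_vector_derivative cis (\<theta> s)) (at s)"
    and ode_r: "\<And>s. (r has_real_derivative cos (\<theta> s - \<phi> s)) (at s)"
    and ode_\<theta>: "\<And>s. ((\<lambda>s. \<theta> s - \<phi> s) has_real_derivative
                    (r s / 2 - real CARD('n) / r s) * sin (\<theta> s - \<phi> s)) (at s)"
    and closed: "closed_curve L \<gamma>"
  shows "F_unstable (prod_atlas circle_atlas M) (curve_prod (on_circle L \<gamma>) \<psi>)"
proof -
  have "\<phi> differentiable (at s)" for s using Ck1_imp(1)[OF smooth_onD[OF smooth(3)]] by simp
  then have cv: "anciaux_curve CARD('n) \<gamma> r \<phi> \<theta> L"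
    by (rule anciaux_curve.intro[OF n _ polar arclength ode_r ode_\<theta> closed])
  interpret cv: anciaux_curve "CARD('n)" \<gamma> r \<phi> \<theta> L by (rule cv)
  obtain \<beta> m where \<beta>: "cv.I (\<lambda>s. cv.\<rho> s * (cos (\<phi> s - \<beta>) - m)) = 0"
      "cv.I (\<lambda>s. cv.\<rho> s * ((sin (\<phi> s - \<beta>) * cv.\<phi>' s)\<^sup>2 - (cos (\<phi> s - \<beta>) - m)\<^sup>2)) < 0"
    using cv.ex_unstable_direction by blast
  interpret legendrian_cone M \<psi> L
    using M \<psi> cv.L by unfold_locales (simp_all add: legendrian_def)
  interpret K: anciaux_cone M \<psi> \<gamma> r \<phi> \<theta> L \<beta> m
    by unfold_locales (fact dim smooth \<beta>)+
  show ?thesis unfolding F_unstable_def using K.not_F_stable unfolding cone_def .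
qed

end
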